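(* Let $(\mathcal V_1,\mathcal L_1)$ and $(\mathcal V_2,\mathcal L_2)$ be quantized metric spaces. If $\mathrm{dist}_{NC}(\mathcal V_1,\mathcal V_2)=0$, then there exists a complete isometry $\Phi$ from $(\mathcal V_1,\mathcal L_1)$ onto $(\mathcal V_2,\mathcal L_2)$.
   Context: A matrix order unit space $(\mathcal V,1)$: complex vector space with conjugate-linear involution, partial orders on each $M_n(\mathcal V)$ via cones with $\gamma^*M_n(\mathcal V)^+\gamma\subseteq M_m(\mathcal V)^+$ ($\gamma\in M_{n,m}$), $\mathcal V^+$ proper with order unit $1$, each $M_n(\mathcal V)^+$ Archimedean; matrix norm $\|v\|_n=\inf\{t:\left[\begin{smallmatrix} t1_n& v\\ v^*& t1_n\end{smallmatrix}\right]\ge0\}$ (not assumed complete). $CS_n(\mathcal V)$ = unital completely positive maps $\mathcal V\to M_n$ with BW (pointwise) topology; $\ll\varphi,a\gg=[\varphi(a_{ij})]$. A matrix Lipschitz seminorm is a sequence $\mathcal L=(L_n)$ of seminorms on $M_n(\mathcal V)$ with null space $M_n(\mathbb C1)$, $L_{m+n}(v\oplus w)=\max\{L_m(v),L_n(w)\}$, $L_n(\alpha v\beta)\le\|\alpha\|L_m(v)\|\beta\|$, $L_m(v^* )=L_m(v)$; $D_{L_n}(\varphi,\psi)=\sup\{\|\ll\varphi,a\gg-\ll\psi,a\gg\|:a\in M_r(\mathcal V),L_r(a)\le1,r\in\mathbb N\}$; matrix Lip-norm: each $D_{L_n}$ induces the BW-topology; quantized metric space: $(\mathcal V,\mathcal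 L)$ with $\mathcal L$ a matrix Lip-norm. $L_{D_{L_n}}(a)=\sup\{\|\ll\varphi,a\gg-\ll\psi,a\gg\|/D_{L_r}(\varphi,\psi):\varphi\ne\psi\in CS_r(\mathcal V),r\in\mathbb N\}$. With $\bar{\mathcal V}$ the completion of $\mathcal V$, $L^c_n(a)=\inf\{t>0:a\in t\,\overline{B_n}\}$ for $a\in M_n(\bar{\mathcal V})$, $\overline{B_n}$ the norm closure of $\{a\in M_n(\mathcal V):L_{D_{L_n}}(a)\le1\}$, and $\mathcal V^c=\{a\in\bar{\mathcal V}:L^c_1(a)<\infty\}$; $(\mathcal V^c,\mathcal L^c)$ is a quantized metric space. A complete isometry from $(\mathcal V_1,\mathcal L_1)$ onto $(\mathcal V_2,\mathcal L_2)$ is a unital complete order isomorphism $\Phi:\mathcal V_1^c\to\mathcal V_2^c$ with $L^c_{1,n}=L^c_{2,n}\circ\Phi_n$ for all $n$. $\mathcal V_1\oplus\mathcal V_2$: entrywise order, unit $(1,1)$, norms $\max\{\|a\|_n,\|b\|_n\}$, projections $\pi_1,\pi_2$; a matrix Lip-norm $\mathcal L$ on it induces $\mathcal L_j$ via $\pi_j$ if $L_{j,n}(b)=\inf\{L_n(a):(\pi_j)_n(a)=b\}$; $\mathcal M(\mathcal L_1,\mathcal L_2)$: those inducing both; $CS_n(\mathcal V_j)\cong\{\varphi\circ\pi_j\}$; $\mathrm{dist}_{NC}(\mathcal V_1,\mathcal V_2)=\inf_{\mathcal L\in\mathcal M(\mathcal L_1,\mathcal L_2)}\sup_n n^{-2}\mathrm{dist}_H^{D_{L_n}}(CS_n(\mathcal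 V_1),CS_n(\mathcal V_2))$. *)

theory Defs
  imports "HOL-Analysis.Analysis"
begin

type_synonym 'a mtx = "nat \<Rightarrow> nat \<Rightarrow> 'a"

definition mats :: "nat \<Rightarrow> nat \<Rightarrow> ('a::zero) mtx set" where
  "mats n m = {A. \<forall>i j. (n \<le> i \<or> m \<le> j) \<longrightarrow> A i j = 0}"

definition mmap :: "('a \<Rightarrow> 'b) \<Rightarrow> 'a mtx \<Rightarrow> 'b mtx" where
  "mmap f A = (\<lambda>i j. f (A i j))"

definition madd :: "('a::plus) mtx \<Rightarrow> 'a mtx \<Rightarrow> 'a mtx" where
  "madd A B = (\<lambda>i j. A i j + B i j)"

definition msub :: "('a::minus) mtx \<Rightarrow> 'a mtx \<Rightarrow> 'a mtx" where
  "msub A B = (\<lambda>i j. A i j - B i j)"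

definition mzero :: "('a::zero) mtx" where
  "mzero = (\<lambda>i j. 0)"

definition smat :: "nat \<Rightarrow> 'a \<Rightarrow> ('a::zero) mtx" where
  "smat n x = (\<lambda>i j. if i = j \<and> i < n then x else 0)"

definition one_one :: "'a \<Rightarrow> ('a::zero) mtx" where
  "one_one x = (\<lambda>i j. if i = 0 \<and> j = 0 then x else 0)"

definition blk :: "nat \<Rightarrow> 'a mtx \<Rightarrow> 'a mtx \<Rightarrow> 'a mtx \<Rightarrow> 'a mtx \<Rightarrow> ('a::zero) mtx" where
  "blk n A B C D = (\<lambda>i j.
     if i < n then (if j < n then A i j else if j < 2*n then B i (j-n) else 0)
     else if i < 2*n then (if j < n then C (i-n) j else if j < 2*n then D (i-n) (j-n) else 0)
     else 0)"

definition dsum :: "nat \<Rightarrow> 'a mtx \<Rightarrow> 'a mtx \<Rightarrow> ('a::zero) mtx" where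
  "dsum m A B = (\<lambda>i j. if i < m \<and> j < m then A i j
                       else if m \<le> i \<and> m \<le> j then B (i-m) (j-m) else 0)"

definition cadj :: "complex mtx \<Rightarrow> complex mtx" where
  "cadj g = (\<lambda>i j. cnj (g j i))"

definition cnorm :: "nat \<Rightarrow> nat \<Rightarrow> complex mtx \<Rightarrow> real" where
  "cnorm n m M = Sup {sqrt (\<Sum>i<n. (cmod (\<Sum>j<m. M i j * x j))^2) | x.
                        (\<Sum>j<m. (cmod (x j))^2) \<le> 1}"

definition cpsd :: "nat \<Rightarrow> complex mtx \<Rightarrow> bool" where
  "cpsd n M \<longleftrightarrow> M \<in> mats n n \<and>
     (\<forall>x. Im (\<Sum>i<n. \<Sum>j<n. cnj (x i) * M i j * x j) = 0 \<and>
          Re (\<Sum>i<n. \<Sum>j<n. cnj (x i) * M i j * x j) \<ge> 0)"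

record 'v mous =
  msmul :: "complex \<Rightarrow> 'v \<Rightarrow> 'v"
  mstar :: "'v \<Rightarrow> 'v"
  munit :: 'v
  mcone :: "nat \<Rightarrow> 'v mtx set"

definition lmul :: "('v::ab_group_add) mous \<Rightarrow> nat \<Rightarrow> complex mtx \<Rightarrow> 'v mtx \<Rightarrow> 'v mtx" where
  "lmul V k a A = (\<lambda>i j. \<Sum>l<k. msmul V (a i l) (A l j))"

definition rmul :: "('v::ab_group_add) mous \<Rightarrow> nat \<Rightarrow> 'v mtx \<Rightarrow> complex mtx \<Rightarrow> 'v mtx" where
  "rmul V k A b = (\<lambda>i j. \<Sum>l<k. msmul V (b l j) (A i l))"

definition vadj :: "('v::ab_group_add) mous \<Rightarrow> 'v mtx \<Rightarrow> 'v mtx" where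
  "vadj V A = (\<lambda>i j. mstar V (A j i))"

definition vpos :: "('v::ab_group_add) mous \<Rightarrow> 'v set" where
  "vpos V = {v. one_one v \<in> mcone V 1}"

definition mou_space :: "('v::ab_group_add) mous \<Rightarrow> bool" where
  "mou_space V \<longleftrightarrow>
    \<comment> \<open>complex vector space\<close>
    (\<forall>c x y. msmul V c (x + y) = msmul V c x + msmul V c y) \<and>
    (\<forall>c d x. msmul V (c + d) x = msmul V c x + msmul V d x) \<and>
    (\<forall>c d x. msmul V c (msmul V d x) = msmul V (c * d) x) \<and>
    (\<forall>x. msmul V 1 x = x) \<and>
    \<comment> \<open>conjugate-linear involution\<close>
    (\<forall>x y. mstar V (x + y) = mstar V x + mstar V y) \<and>
    (\<forall>c x. mstar V (msmul V c x) = msmul V (cnj c) (mstar V x)) \<and>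
    (\<forall>x. mstar V (mstar V x) = x) \<and>
    \<comment> \<open>cones of self-adjoint matrices defining partial orders\<close>
    (\<forall>n. mcone V n \<subseteq> mats n n) \<and>
    (\<forall>n A. A \<in> mcone V n \<longrightarrow> vadj V A = A) \<and>
    (\<forall>n A B. A \<in> mcone V n \<longrightarrow> B \<in> mcone V n \<longrightarrow> madd A B \<in> mcone V n) \<and>
    (\<forall>n A (r::real). A \<in> mcone V n \<longrightarrow> r \<ge> 0 \<longrightarrow>
        mmap (msmul V (complex_of_real r)) A \<in> mcone V n) \<and>
    (\<forall>n A. A \<in> mcone V n \<longrightarrow> mmap uminus A \<in> mcone V n \<longrightarrow> A = mzero) \<and>
    \<comment> \<open>gamma^* M_n(V)^+ gamma \<subseteq> M_m(V)^+\<close>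
    (\<forall>n m g A. g \<in> mats n m \<longrightarrow> A \<in> mcone V n \<longrightarrow>
        rmul V n (lmul V n (cadj g) A) g \<in> mcone V m) \<and>
    \<comment> \<open>order unit of V^+\<close>
    mstar V (munit V) = munit V \<and>
    (\<forall>v. mstar V v = v \<longrightarrow>
        (\<exists>r::real. r > 0 \<and> msmul V (complex_of_real r) (munit V) - v \<in> vpos V)) \<and>
    \<comment> \<open>Archimedean\<close>
    (\<forall>n A. A \<in> mats n n \<longrightarrow>
        (\<forall>r::real. r > 0 \<longrightarrow> madd A (smat n (msmul V (complex_of_real r) (munit V))) \<in> mcone V n)
        \<longrightarrow> A \<in> mcone V n)"

definition mnorm :: "('v::ab_group_add) mous \<Rightarrow> nat \<Rightarrow> 'v mtx \<Rightarrow> real" where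
  "mnorm V n A = Inf {t::real.
     blk n (smat n (msmul V (complex_of_real t) (munit V))) A (vadj V A)
           (smat n (msmul V (complex_of_real t) (munit V))) \<in> mcone V (2*n)}"

definition ampl :: "nat \<Rightarrow> ('v \<Rightarrow> complex mtx) \<Rightarrow> 'v mtx \<Rightarrow> nat \<Rightarrow> complex mtx" where
  "ampl n phi a r = (\<lambda>i j. if i < r*n \<and> j < r*n
       then phi (a (i div n) (j div n)) (i mod n) (j mod n) else 0)"

definition CS :: "('v::ab_group_add) mous \<Rightarrow> nat \<Rightarrow> ('v \<Rightarrow> complex mtx) set" where
  "CS V n = {phi.
     (\<forall>x y i j. phi (x + y) i j = phi x i j + phi y i j) \<and>
     (\<forall>c x i j. phi (msmul V c x) i j = c * phi x i j) \<and>
     (\<forall>x. phi x \<in> mats n n) \<and>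
     phi (munit V) = smat n 1 \<and>
     (\<forall>r a. a \<in> mcone V r \<longrightarrow> cpsd (r*n) (ampl n phi a r))}"

definition Dist :: "(nat \<Rightarrow> ('v::zero) mtx \<Rightarrow> real) \<Rightarrow> nat \<Rightarrow>
    ('v \<Rightarrow> complex mtx) \<Rightarrow> ('v \<Rightarrow> complex mtx) \<Rightarrow> ereal" where
  "Dist L n phi psi = Sup {ereal (cnorm (r*n) (r*n) (msub (ampl n phi a r) (ampl n psi a r))) | r a.
       r \<ge> 1 \<and> a \<in> mats r r \<and> L r a \<le> 1}"

definition mlip_seminorm :: "('v::ab_group_add) mous \<Rightarrow> (nat \<Rightarrow> 'v mtx \<Rightarrow> real) \<Rightarrow> bool" where
  "mlip_seminorm V L \<longleftrightarrow>
    (\<forall>n\<ge>1. \<forall>A\<in>mats n n. \<forall>B\<in>mats n n. L n (madd A B) \<le> L n A + L n B) \<and>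
    (\<forall>n\<ge>1. \<forall>A\<in>mats n n. \<forall>c. L n (mmap (msmul V c) A) = cmod c * L n A) \<and>
    (\<forall>n\<ge>1. \<forall>A\<in>mats n n. L n A = 0 \<longleftrightarrow>
        (\<exists>c\<in>mats n n. A = (\<lambda>i j. msmul V (c i j) (munit V)))) \<and>
    (\<forall>m\<ge>1. \<forall>n\<ge>1. \<forall>A\<in>mats m m. \<forall>B\<in>mats n n.
        L (m + n) (dsum m A B) = max (L m A) (L n B)) \<and>
    (\<forall>m\<ge>1. \<forall>n\<ge>1. \<forall>A\<in>mats m m. \<forall>a\<in>mats n m. \<forall>b\<in>mats m n.
        L n (rmul V m (lmul V m a A) b) \<le> cnorm n m a * L m A * cnorm m n b) \<and>
    (\<forall>m\<ge>1. \<forall>A\<in>mats m m. L m (vadj V A) = L m A)"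

text \<open>matrix Lip-norm: each D_{L_n} induces the BW (pointwise) topology on CS_n(V);
  the type of maps V \<Rightarrow> nat \<Rightarrow> nat \<Rightarrow> complex carries the product (pointwise) topology.\<close>
definition mlip_norm :: "('v::ab_group_add) mous \<Rightarrow> (nat \<Rightarrow> 'v mtx \<Rightarrow> real) \<Rightarrow> bool" where
  "mlip_norm V L \<longleftrightarrow> mlip_seminorm V L \<and>
    (\<forall>n\<ge>1. \<forall>U. openin (top_of_set (CS V n)) U \<longleftrightarrow>
        (U \<subseteq> CS V n \<and> (\<forall>phi\<in>U. \<exists>e::real. e > 0 \<and>
            (\<forall>psi\<in>CS V n. Dist L n phi psi < ereal e \<longrightarrow> psi \<in> U))))"

definition qms :: "('v::ab_group_add) mous \<Rightarrow> (nat \<Rightarrow> 'v mtx \<Rightarrow> real) \<Rightarrow> bool" where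
  "qms V L \<longleftrightarrow> mou_space V \<and> mlip_norm V L"

definition LD :: "('v::ab_group_add) mous \<Rightarrow> (nat \<Rightarrow> 'v mtx \<Rightarrow> real) \<Rightarrow> nat \<Rightarrow> 'v mtx \<Rightarrow> ereal" where
  "LD V L n a = Sup {ereal (cnorm (n*r) (n*r) (msub (ampl r phi a n) (ampl r psi a n))) / Dist L r phi psi
       | r phi psi. r \<ge> 1 \<and> phi \<in> CS V r \<and> psi \<in> CS V r \<and> phi \<noteq> psi}"

definition mou_completion :: "('v::ab_group_add) mous \<Rightarrow> ('w::ab_group_add) mous \<Rightarrow> ('v \<Rightarrow> 'w) \<Rightarrow> bool" where
  "mou_completion V W \<iota> \<longleftrightarrow> mou_space W \<and>
    (\<forall>x y. \<iota> (x + y) = \<iota> x + \<iota> y) \<and>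
    (\<forall>c x. \<iota> (msmul V c x) = msmul W c (\<iota> x)) \<and>
    \<iota> (munit V) = munit W \<and>
    (\<forall>x. \<iota> (mstar V x) = mstar W (\<iota> x)) \<and>
    inj \<iota> \<and>
    (\<forall>n A. A \<in> mats n n \<longrightarrow> (A \<in> mcone V n \<longleftrightarrow> mmap \<iota> A \<in> mcone W n)) \<and>
    (\<forall>w e. e > 0 \<longrightarrow> (\<exists>v. mnorm W 1 (one_one (w - \<iota> v)) < e)) \<and>
    (\<forall>f::nat \<Rightarrow> 'w. (\<forall>e>0. \<exists>N. \<forall>k\<ge>N. \<forall>l\<ge>N. mnorm W 1 (one_one (f k - f l)) < e) \<longrightarrow>
        (\<exists>w. \<forall>e>0. \<exists>N. \<forall>k\<ge>N. mnorm W 1 (one_one (f k - w)) < e))"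

definition Bbar :: "('v::ab_group_add) mous \<Rightarrow> (nat \<Rightarrow> 'v mtx \<Rightarrow> real) \<Rightarrow>
    ('w::ab_group_add) mous \<Rightarrow> ('v \<Rightarrow> 'w) \<Rightarrow> nat \<Rightarrow> 'w mtx set" where
  "Bbar V L W \<iota> n = {b \<in> mats n n. \<forall>e>0. \<exists>a\<in>mats n n.
       LD V L n a \<le> 1 \<and> mnorm W n (msub b (mmap \<iota> a)) < e}"

definition Lc :: "('v::ab_group_add) mous \<Rightarrow> (nat \<Rightarrow> 'v mtx \<Rightarrow> real) \<Rightarrow>
    ('w::ab_group_add) mous \<Rightarrow> ('v \<Rightarrow> 'w) \<Rightarrow> nat \<Rightarrow> 'w mtx \<Rightarrow> ereal" where
  "Lc V L W \<iota> n b = Inf {ereal t | t. t > 0 \<and>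
       (\<exists>c\<in>Bbar V L W \<iota> n. b = mmap (msmul W (complex_of_real t)) c)}"

definition Vc :: "('v::ab_group_add) mous \<Rightarrow> (nat \<Rightarrow> 'v mtx \<Rightarrow> real) \<Rightarrow>
    ('w::ab_group_add) mous \<Rightarrow> ('v \<Rightarrow> 'w) \<Rightarrow> 'w set" where
  "Vc V L W \<iota> = {w. Lc V L W \<iota> 1 (one_one w) < \<infinity>}"

definition complete_isometry ::
  "('a::ab_group_add) mous \<Rightarrow> (nat \<Rightarrow> 'a mtx \<Rightarrow> real) \<Rightarrow> ('c::ab_group_add) mous \<Rightarrow> ('a \<Rightarrow> 'c) \<Rightarrow>
   ('b::ab_group_add) mous \<Rightarrow> (nat \<Rightarrow> 'b mtx \<Rightarrow> real) \<Rightarrow> ('d::ab_group_add) mous \<Rightarrow> ('b \<Rightarrow> 'd) \<Rightarrow>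
   ('c \<Rightarrow> 'd) \<Rightarrow> bool" where
  "complete_isometry V1 L1 W1 \<iota>1 V2 L2 W2 \<iota>2 \<Phi> \<longleftrightarrow>
    bij_betw \<Phi> (Vc V1 L1 W1 \<iota>1) (Vc V2 L2 W2 \<iota>2) \<and>
    (\<forall>x\<in>Vc V1 L1 W1 \<iota>1. \<forall>y\<in>Vc V1 L1 W1 \<iota>1. \<Phi> (x + y) = \<Phi> x + \<Phi> y) \<and>
    (\<forall>c. \<forall>x\<in>Vc V1 L1 W1 \<iota>1. \<Phi> (msmul W1 c x) = msmul W2 c (\<Phi> x)) \<and>
    \<Phi> (munit W1) = munit W2 \<and>
    (\<forall>n\<ge>1. \<forall>A\<in>mats n n. (\<forall>i j. A i j \<in> Vc V1 L1 W1 \<iota>1) \<longrightarrow>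
        (A \<in> mcone W1 n \<longleftrightarrow> mmap \<Phi> A \<in> mcone W2 n)) \<and>
    (\<forall>n\<ge>1. \<forall>A\<in>mats n n. (\<forall>i j. A i j \<in> Vc V1 L1 W1 \<iota>1) \<longrightarrow>
        Lc V1 L1 W1 \<iota>1 n A = Lc V2 L2 W2 \<iota>2 n (mmap \<Phi> A))"

definition dsum_mous :: "('a::ab_group_add) mous \<Rightarrow> ('b::ab_group_add) mous \<Rightarrow> ('a \<times> 'b) mous" where
  "dsum_mous V W = \<lparr> msmul = (\<lambda>c (a, b). (msmul V c a, msmul W c b)),
                     mstar = (\<lambda>(a, b). (mstar V a, mstar W b)),
                     munit = (munit V, munit W),
                     mcone = (\<lambda>n. {A. mmap fst A \<in> mcone V n \<and> mmap snd A \<in> mcone W n}) \<rparr>"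

definition induces :: "(nat \<Rightarrow> (('a::zero) \<times> ('b::zero)) mtx \<Rightarrow> real) \<Rightarrow> ('a \<times> 'b \<Rightarrow> ('c::zero)) \<Rightarrow>
    (nat \<Rightarrow> 'c mtx \<Rightarrow> real) \<Rightarrow> bool" where
  "induces L proj Lj \<longleftrightarrow> (\<forall>n\<ge>1. \<forall>b\<in>mats n n.
       Lj n b = Inf {L n a | a. a \<in> mats n n \<and> mmap proj a = b})"

definition Mset :: "('a::ab_group_add) mous \<Rightarrow> (nat \<Rightarrow> 'a mtx \<Rightarrow> real) \<Rightarrow>
    ('b::ab_group_add) mous \<Rightarrow> (nat \<Rightarrow> 'b mtx \<Rightarrow> real) \<Rightarrow> (nat \<Rightarrow> ('a \<times> 'b) mtx \<Rightarrow> real) set" where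
  "Mset V1 L1 V2 L2 = {L. mlip_norm (dsum_mous V1 V2) L \<and> induces L fst L1 \<and> induces L snd L2}"

definition hausdorff :: "('x \<Rightarrow> 'x \<Rightarrow> ereal) \<Rightarrow> 'x set \<Rightarrow> 'x set \<Rightarrow> ereal" where
  "hausdorff d A B = max (SUP x\<in>A. INF y\<in>B. d x y) (SUP y\<in>B. INF x\<in>A. d x y)"

definition distNC :: "('a::ab_group_add) mous \<Rightarrow> (nat \<Rightarrow> 'a mtx \<Rightarrow> real) \<Rightarrow>
    ('b::ab_group_add) mous \<Rightarrow> (nat \<Rightarrow> 'b mtx \<Rightarrow> real) \<Rightarrow> ereal" where
  "distNC V1 L1 V2 L2 = (INF L\<in>Mset V1 L1 V2 L2. SUP n\<in>{1::nat..}.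
      ereal (1 / (real n)^2) *
      hausdorff (Dist L n) ((\<lambda>phi. phi \<circ> fst) ` CS V1 n) ((\<lambda>psi. psi \<circ> snd) ` CS V2 n))"

end

theory Submission
  imports Defs "HOL-Library.Function_Algebras"
begin

text \<open>
  Choose matrix Lip-norms \<open>N k\<close> on \<open>V1 \<oplus> V2\<close> for which the matrix state spaces have distance at most
  \<open>n\<^sup>2 / (k + 1)\<close> at level \<open>n\<close>, and fix a free ultrafilter \<open>U\<close>. Relate \<open>w\<close> to \<open>z\<close> in the completions if they are
  limits of elements \<open>a\<close>, \<open>b\<close> for which \<open>N k (a, b)\<close> stays bounded along \<open>U\<close>. Separating by matrix states shows
  that this relation preserves positivity, so it is single-valued in both directions. Because the Lip-norm balls
  are totally bounded and every element lifts to the sum with almost the same seminorm, it is total on the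
  spaces of Lipschitz elements. The Effros--Ruan argument and the bipolar theorem identify the closed
  unit balls of \<open>L\<close> and \<open>LD\<close>, hence the relation also preserves \<open>Lc\<close>.
\<close>

text \<open>The partners of one element depend on \<open>k\<close> and are far from unique. An
  ultrafilter picks all limits simultaneously, so sums, multiples and adjoints of related elements
  stay related without passing to subsequences. The weight n^(-2) in the distance does no harm,
  because every argument fixes a matrix level and lets \<open>k\<close> grow. The real obstacle is
  \<open>Lc\<close>: it is built from \<open>LD\<close>, a supremum over matrix states, whereas
  lifts to the sum are controlled by \<open>L\<close> itself. One inclusion between the unit balls
  is immediate from the definition of \<open>Dist\<close>; the other requires that an element far
  from the ball of \<open>L\<close> be detected by a pair of matrix states. Norms are replaced by
  numerical radius bounds \<open>nrad\<close>, order conditions at the same matrix level that agree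
  with \<open>mnorm\<close> up to a factor 2. All separations use one Hahn-Banach theorem for cones
  in a product with the real line, since the dominating functionals are infima over auxiliary
  data.\<close>

section \<open>A Hahn-Banach theorem for cones, and ultrafilters\<close>

text \<open>The cone plays the part of the epigraph of a sublinear functional given by an infimum;
  axioms on the cone spare a separate proof that this infimum is finite. Zorn's lemma enlarges the
  cone until its lower boundary is linear, so there is no extension from a subspace.\<close>

lemma hahn_banach_cone:
  fixes sc :: "real \<Rightarrow> 'x::ab_group_add \<Rightarrow> 'x" and \<Gamma> :: "('x \<times> real) set"
  assumes "vector_space sc"
    and zero_mem: "(0, 0) \<in> \<Gamma>"
    and add_mem: "\<And>x y t s. (x, t) \<in> \<Gamma> \<Longrightarrow> (y, s) \<in> \<Gamma> \<Longrightarrow> (x + y, t + s) \<in> \<Gamma>"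
    and scale_mem: "\<And>x t r. (x, t) \<in> \<Gamma> \<Longrightarrow> r > 0 \<Longrightarrow> (sc r x, r * t) \<in> \<Gamma>"
    and total: "\<And>x. \<exists>t. (x, t) \<in> \<Gamma>"
    and nonneg: "\<And>t. (0, t) \<in> \<Gamma> \<Longrightarrow> t \<ge> 0"
  obtains g where "\<And>x y. g (x + y) = g x + g y" "\<And>r x. g (sc r x) = r * g x"
    "\<And>x t. (x, t) \<in> \<Gamma> \<Longrightarrow> g x \<le> t"
proof -
  interpret vector_space sc by fact
  define adm where "adm M \<longleftrightarrow> \<Gamma> \<subseteq> M \<and>
     (\<forall>x y t s. (x, t) \<in> M \<longrightarrow> (y, s) \<in> M \<longrightarrow> (x + y, t + s) \<in> M) \<and>
     (\<forall>x t r. (x, t) \<in> M \<longrightarrow> r > 0 \<longrightarrow> (sc r x, r * t) \<in> M) \<and>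
     (\<forall>t. (0, t) \<in> M \<longrightarrow> t \<ge> 0)" for M
  have "\<exists>M\<in>Collect adm. \<forall>X\<in>Collect adm. M \<subseteq> X \<longrightarrow> X = M"
  proof (rule subset_Zorn_nonempty)
    show "Collect adm \<noteq> {}"
      using assms by (auto simp: adm_def intro!: exI[of _ \<Gamma>])
  next
    fix C assume C: "C \<noteq> {}" "subset.chain (Collect adm) C"
    have sub: "\<And>M. M \<in> C \<Longrightarrow> adm M" and
      lin: "\<And>M N. M \<in> C \<Longrightarrow> N \<in> C \<Longrightarrow> M \<subseteq> N \<or> N \<subseteq> M"
      using C(2) by (auto simp: subset_chain_def)
    have "(x + y, t + s) \<in> \<Union>C" if xy: "(x, t) \<in> \<Union>C" "(y, s) \<in> \<Union>C" for x y t s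
    proof -
      obtain M N where MN: "M \<in> C" "N \<in> C" "(x, t) \<in> M" "(y, s) \<in> N" using xy by blast
      obtain K where "K \<in> C" "(x, t) \<in> K" "(y, s) \<in> K"
        using lin[OF MN(1,2)] MN by blast
      then show ?thesis using sub[of K] unfolding adm_def by blast
    qed
    moreover have "\<Gamma> \<subseteq> \<Union>C"
      using C(1) sub unfolding adm_def by blast
    moreover have "(sc r x, r * t) \<in> \<Union>C" if "(x, t) \<in> \<Union>C" "r > 0" for x t r
      using that sub unfolding adm_def by blast
    moreover have "t \<ge> 0" if "(0, t) \<in> \<Union>C" for t
      using that sub unfolding adm_def by blast
    ultimately show "\<Union>C \<in> Collect adm" by (simp add: adm_def)
  qed
  then obtain M where M: "adm M" and max: "\<And>X. adm X \<Longrightarrow> M \<subseteq> X \<Longrightarrow> X = M" by blast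
  have M0: "(0, 0) \<in> M" and Mtot: "\<exists>t. (x, t) \<in> M" for x
    using M zero_mem total[of x] by (auto simp: adm_def)
  have Madd: "(x, t) \<in> M \<Longrightarrow> (y, s) \<in> M \<Longrightarrow> (x + y, t + s) \<in> M"
    and Mscale: "(x, t) \<in> M \<Longrightarrow> r > 0 \<Longrightarrow> (sc r x, r * t) \<in> M"
    and Mnn: "(0, t) \<in> M \<Longrightarrow> t \<ge> 0" for x y t s r
    using M by (auto simp: adm_def)
  define g where "g y = Inf {t. (y, t) \<in> M}" for y
  have bdd: "bdd_below {t. (y, t) \<in> M}" for y
  proof -
    obtain s where s: "(- y, s) \<in> M" using Mtot by blast
    have "- s \<le> t" if "(y, t) \<in> M" for t
      using Mnn[of "t + s"] Madd[OF that s] by simp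
    then show ?thesis by (auto simp: bdd_below_def)
  qed
  have g_le: "g x \<le> t" if "(x, t) \<in> M" for x t
    unfolding g_def using that bdd by (auto intro!: cInf_lower)
  \<comment> \<open>Adjoining the ray through \<open>(- y, - g y)\<close> to the maximal cone
    \<open>M\<close> keeps it admissible: a point \<open>(0, t)\<close> that uses the ray with
    weight \<open>l > 0\<close> gives \<open>(y, t' / l)\<close> in \<open>M\<close>, hence
    \<open>g y \<le> t' / l\<close>. Maximality puts the ray into \<open>M\<close>, and this is
    linearity of \<open>g\<close> in disguise.\<close>
  have neg: "(- y, - g y) \<in> M" for y
  proof -
    define N where "N = {(x - sc l y, t - l * g y) | x t l. (x, t) \<in> M \<and> l \<ge> 0}"
    have N_I: "(x - sc l y, t - l * g y) \<in> N" if "(x, t) \<in> M" "l \<ge> 0" for x t l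
      using that unfolding N_def by blast
    have MN: "M \<subseteq> N"
    proof
      fix p assume "p \<in> M"
      then show "p \<in> N" using N_I[of "fst p" "snd p" 0] by simp
    qed
    have "adm N" unfolding adm_def
    proof (intro conjI allI impI)
      show "\<Gamma> \<subseteq> N" using MN M by (auto simp: adm_def)
    next
      fix x z t s assume "(x, t) \<in> N" "(z, s) \<in> N"
      then obtain x' t' l z' s' k where
        *: "x = x' - sc l y" "t = t' - l * g y" "(x', t') \<in> M" "l \<ge> 0"
        "z = z' - sc k y" "s = s' - k * g y" "(z', s') \<in> M" "k \<ge> 0"
        unfolding N_def by blast
      have "x + z = (x' + z') - sc (l + k) y" "t + s = (t' + s') - (l + k) * g y"
        using *(1,2,5,6) by (simp_all add: scale_left_distrib ring_distribs)
      then show "(x + z, t + s) \<in> N"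
        using N_I[OF Madd[OF *(3,7)], of "l + k"] *(4,8) by simp
    next
      fix x t and r :: real assume "(x, t) \<in> N" "r > 0"
      then obtain x' t' l where *: "x = x' - sc l y" "t = t' - l * g y" "(x', t') \<in> M" "l \<ge> 0"
        unfolding N_def by blast
      have "sc r x = sc r x' - sc (r * l) y" "r * t = r * t' - (r * l) * g y"
        using *(1,2) by (simp_all add: scale_right_diff_distrib ring_distribs)
      then show "(sc r x, r * t) \<in> N"
        using N_I[OF Mscale[OF *(3) \<open>r > 0\<close>], of "r * l"] *(4) \<open>r > 0\<close> by simp
    next
      fix t assume "(0, t) \<in> N"
      then obtain x' t' l where *: "x' = sc l y" "t = t' - l * g y" "(x', t') \<in> M" "l \<ge> 0"
        unfolding N_def by auto
      show "t \<ge> 0"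
      proof (cases "l = 0")
        case True then show ?thesis using * Mnn by auto
      next
        case False
        then have "l > 0" using * by simp
        then have "(y, t' / l) \<in> M"
          using Mscale[OF *(3), of "1 / l"] * by simp
        then have "g y \<le> t' / l" by (rule g_le)
        then show ?thesis using * \<open>l > 0\<close> by (simp add: field_simps)
      qed
    qed
    then have "N = M" using MN max by blast
    moreover have "(- y, - g y) \<in> N" using N_I[OF M0, of 1] by simp
    ultimately show ?thesis by simp
  qed
  have g_minus: "g (- y) = - g y" for y
  proof (rule antisym)
    show "g (- y) \<le> - g y" by (rule g_le[OF neg])
    have "- s \<le> g y" if s: "(- y, s) \<in> M" for s
      unfolding g_def using Mtot Mnn Madd[OF s] by (intro cInf_greatest) fastforce+
    then show "- g y \<le> g (- y)"
      unfolding g_def[of "- y"] using Mtot by (intro cInf_greatest) fastforce+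
  qed
  have g_mem: "(y, g y) \<in> M" for y
    using neg[of "- y"] by (simp add: g_minus)
  have sub: "g (x + y) \<le> g x + g y" for x y
    using g_le[OF Madd[OF g_mem g_mem]] .
  have add: "g (x + y) = g x + g y" for x y
    using sub[of x y] sub[of "- x" "- y"] g_minus[of "x + y"] by (simp add: g_minus)
  have pos: "g (sc r x) \<le> r * g x" if "r > 0" for r x
    using g_le[OF Mscale[OF g_mem that]] .
  have pos': "g (sc r x) = r * g x" if "r > 0" for r x
    using pos[OF that, of x] pos[OF that, of "- x"] by (simp add: g_minus)
  have "g (sc r x) = r * g x" for r x
  proof (cases r "0 :: real" rule: linorder_cases)
    case less
    then show ?thesis using pos'[of "- r" x] by (simp add: g_minus)
  next
    case equal
    then show ?thesis using g_minus[of 0] by simp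
  qed (rule pos')
  with add g_le show thesis
    using M by (intro that[of g]) (auto simp: adm_def)
qed

definition ultra :: "'i filter \<Rightarrow> bool" where
  "ultra U \<longleftrightarrow> U \<noteq> bot \<and> (\<forall>P. eventually P U \<or> eventually (\<lambda>x. \<not> P x) U)"

text \<open>Finer filters are smaller, so an ultrafilter is a minimal proper filter. Zorn's lemma
  applies because a property holds eventually for the infimum of a nonempty chain iff it does so for
  some member, so the infimum is still proper.\<close>

lemma ultrafilter_below:
  fixes F :: "'i filter"
  assumes "F \<noteq> bot"
  obtains U where "U \<le> F" "ultra U"
proof -
  define A where "A = {G. G \<noteq> bot \<and> G \<le> F}"
  have "\<exists>M\<in>A. \<forall>G\<in>A. M \<ge> G \<longrightarrow> G = M"
  proof (rule predicate_Zorn)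
    show "partial_order_on A (relation_of (\<ge>) A)"
      by (intro partial_order_on_relation_ofI) auto
  next
    fix C assume C: "C \<in> Chains (relation_of (\<ge>) A)"
    have CA: "G \<in> A" if "G \<in> C" for G
      using C that by (auto simp: Chains_def relation_of_def)
    have lin: "G \<le> H \<or> H \<le> G" if "G \<in> C" "H \<in> C" for G H
      using C that by (auto simp: Chains_def relation_of_def)
    show "\<exists>u\<in>A. \<forall>a\<in>C. a \<ge> u"
    proof (cases "C = {}")
      case True
      then show ?thesis using assms by (auto simp: A_def)
    next
      case False
      have "\<exists>x\<in>C. x \<le> inf G H" if "G \<in> C" "H \<in> C" for G H
        using lin[OF that] that by (auto intro: bexI[of _ G] bexI[of _ H])
      then have "eventually P (Inf C) \<longleftrightarrow> (\<exists>b\<in>C. eventually P b)" for P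
        using False by (intro eventually_Inf_base) auto
      then have "Inf C \<noteq> bot"
        using CA unfolding trivial_limit_def A_def by blast
      moreover have "Inf C \<le> F"
        using False CA by (auto simp: A_def intro: Inf_lower2)
      ultimately show ?thesis
        by (intro bexI[of _ "Inf C"]) (auto simp: A_def intro: Inf_lower)
    qed
  qed
  then obtain M where M: "M \<noteq> bot" "M \<le> F"
    and min: "\<And>G. G \<noteq> bot \<Longrightarrow> G \<le> F \<Longrightarrow> G \<le> M \<Longrightarrow> G = M"
    by (auto simp: A_def)
  \<comment> \<open>By minimality, restricting \<open>M\<close> to the set where \<open>P\<close>
    holds gives either the improper filter or \<open>M\<close> again.\<close>
  have "eventually P M \<or> eventually (\<lambda>x. \<not> P x) M" for P
  proof (cases "inf M (principal {x. P x}) = bot")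
    case True
    then have "eventually (\<lambda>x. \<not> P x) M"
      by (simp add: trivial_limit_def eventually_inf_principal)
    then show ?thesis by simp
  next
    case False
    then have "inf M (principal {x. P x}) = M"
      using M by (intro min) (auto intro: le_infI1)
    then have "M \<le> principal {x. P x}" by (metis inf.cobounded2)
    then show ?thesis by (simp add: le_principal)
  qed
  then show thesis using M that[of M] by (auto simp: ultra_def)
qed

text \<open>Compactness only provides a cluster point of the image filter. For an ultrafilter it is
  a limit, since a neighbourhood that is not eventually entered is eventually avoided.\<close>

lemma ultra_bounded_tendsto:
  fixes f :: "'i \<Rightarrow> 'm::heine_borel"
  assumes "ultra U" "bounded S" "eventually (\<lambda>k. f k \<in> S) U"
  obtains l where "(f \<longlongrightarrow> l) U"
proof -
  have "compact (closure S)" using assms(2) by (simp add: compact_closure)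
  moreover have "filtermap f U \<noteq> bot" "filtermap f U \<le> principal (closure S)"
    using assms(1,3) closure_subset[of S]
    by (auto simp: ultra_def filtermap_bot_iff le_principal eventually_filtermap elim!: eventually_mono)
  ultimately obtain l where l: "inf (nhds l) (filtermap f U) \<noteq> bot"
    unfolding compact_filter le_principal by blast
  have "eventually (\<lambda>k. f k \<in> T) U" if "open T" "l \<in> T" for T
  proof (rule ccontr)
    assume "\<not> ?thesis"
    then have "eventually (\<lambda>k. f k \<notin> T) U" using assms(1) unfolding ultra_def by blast
    then have "eventually (\<lambda>z. z \<notin> T) (filtermap f U)" by (simp add: eventually_filtermap)
    then have "eventually (\<lambda>z. z \<notin> T) (inf (nhds l) (filtermap f U))"
      by (rule filter_leD[OF inf_le2])
    moreover have "eventually (\<lambda>z. z \<in> T) (inf (nhds l) (filtermap f U))"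
      by (rule filter_leD[OF inf_le1 eventually_nhds_in_open[OF that]])
    ultimately have "eventually (\<lambda>z. False) (inf (nhds l) (filtermap f U))"
      by eventually_elim simp
    then show False using l by (simp add: trivial_limit_def)
  qed
  then show thesis by (intro that[of l]) (simp add: topological_tendstoI)
qed

section \<open>Operator norms, block forms and Gram-Schmidt over the complex numbers\<close>

definition vnorm :: "nat \<Rightarrow> (nat \<Rightarrow> complex) \<Rightarrow> real" where
  "vnorm n x = L2_set (\<lambda>i. cmod (x i)) {..<n}"

lemma vnorm_nonneg [simp]: "vnorm n x \<ge> 0"
  by (simp add: vnorm_def L2_set_nonneg)

lemma vnorm_squared: "(vnorm n x)\<^sup>2 = (\<Sum>i<n. (cmod (x i))\<^sup>2)"
  by (simp add: vnorm_def L2_set_def sum_nonneg)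

lemma vnorm_scale: "vnorm n (\<lambda>i. c * x i) = cmod c * vnorm n x"
  by (simp add: vnorm_def norm_mult L2_set_right_distrib)

lemma vnorm_zero_iff: "vnorm n x = 0 \<longleftrightarrow> (\<forall>i<n. x i = 0)"
  by (auto simp: vnorm_def L2_set_eq_0_iff)

lemma vnorm_Cauchy_Schwarz: "cmod (\<Sum>i<n. x i * y i) \<le> vnorm n x * vnorm n y"
proof -
  have "cmod (\<Sum>i<n. x i * y i) \<le> (\<Sum>i<n. \<bar>cmod (x i)\<bar> * \<bar>cmod (y i)\<bar>)"
    by (rule sum_norm_le) (simp add: norm_mult)
  also have "\<dots> \<le> vnorm n x * vnorm n y"
    unfolding vnorm_def by (rule L2_set_mult_ineq)
  finally show ?thesis .
qed

definition mvec :: "nat \<Rightarrow> complex mtx \<Rightarrow> (nat \<Rightarrow> complex) \<Rightarrow> nat \<Rightarrow> complex" where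
  "mvec m M x i = (\<Sum>j<m. M i j * x j)"

lemma cnorm_alt: "cnorm n m M = Sup {vnorm n (mvec m M x) | x. vnorm m x \<le> 1}"
proof -
  have "vnorm m x \<le> 1 \<longleftrightarrow> (\<Sum>j<m. (cmod (x j))\<^sup>2) \<le> 1" for x
    by (simp add: vnorm_def L2_set_def)
  then show ?thesis
    by (simp add: cnorm_def vnorm_def L2_set_def mvec_def)
qed

lemma cnorm_bdd: "bdd_above {vnorm n (mvec m M x) | x. vnorm m x \<le> 1}"
proof -
  have "vnorm n (mvec m M x) \<le> (\<Sum>i<n. vnorm m (M i))" if "vnorm m x \<le> 1" for x
  proof -
    have "vnorm n (mvec m M x) \<le> (\<Sum>i<n. \<bar>cmod (mvec m M x i)\<bar>)"
      unfolding vnorm_def by (rule L2_set_le_sum_abs)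
    also have "\<dots> \<le> (\<Sum>i<n. vnorm m (M i))"
    proof (rule sum_mono)
      fix i
      have "cmod (mvec m M x i) \<le> vnorm m (M i) * vnorm m x"
        unfolding mvec_def by (rule vnorm_Cauchy_Schwarz)
      also have "\<dots> \<le> vnorm m (M i)"
        using that by (simp add: mult_left_le)
      finally show "\<bar>cmod (mvec m M x i)\<bar> \<le> vnorm m (M i)" by simp
    qed
    finally show ?thesis .
  qed
  then show ?thesis by (auto simp: bdd_above_def)
qed

lemma cnorm_nonneg [simp]: "0 \<le> cnorm n m M"
proof -
  have "vnorm n (mvec m M (\<lambda>_. 0)) \<le> cnorm n m M"
    unfolding cnorm_alt by (rule cSup_upper[OF _ cnorm_bdd]) (auto simp: vnorm_def L2_set_def)
  then show ?thesis using vnorm_nonneg order_trans by blast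
qed

lemma cnorm_mvec: "vnorm n (mvec m M x) \<le> cnorm n m M * vnorm m x"
proof (cases "vnorm m x = 0")
  case True
  then have "mvec m M x = (\<lambda>i. 0)"
    by (auto simp: mvec_def vnorm_zero_iff)
  then show ?thesis using True by (simp add: vnorm_def L2_set_def)
next
  case False
  then have pos: "vnorm m x > 0" using vnorm_nonneg[of m x] by linarith
  define c where "c = complex_of_real (1 / vnorm m x)"
  have "vnorm n (mvec m M (\<lambda>i. c * x i)) \<le> cnorm n m M"
    unfolding cnorm_alt
  proof (rule cSup_upper[OF _ cnorm_bdd], clarify)
    show "\<exists>y. vnorm n (mvec m M (\<lambda>i. c * x i)) = vnorm n (mvec m M y) \<and> vnorm m y \<le> 1"
      using pos by (intro exI[of _ "\<lambda>i. c * x i"] conjI refl, subst vnorm_scale) (simp add: c_def norm_divide)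
  qed
  moreover have "mvec m M (\<lambda>i. c * x i) = (\<lambda>i. c * mvec m M x i)"
    by (simp add: fun_eq_iff mvec_def sum_distrib_left mult.left_commute)
  ultimately have "cmod c * vnorm n (mvec m M x) \<le> cnorm n m M"
    by (simp add: vnorm_scale)
  then show ?thesis
    using pos by (simp add: c_def norm_divide field_simps)
qed

lemma cnorm_bilinear:
  "cmod (\<Sum>i<n. \<Sum>j<m. y i * M i j * x j) \<le> cnorm n m M * vnorm m x * vnorm n y"
proof -
  have "(\<Sum>i<n. \<Sum>j<m. y i * M i j * x j) = (\<Sum>i<n. y i * mvec m M x i)"
    by (simp add: mvec_def sum_distrib_left mult.assoc)
  also have "cmod \<dots> \<le> vnorm n y * vnorm n (mvec m M x)"
    by (rule vnorm_Cauchy_Schwarz)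
  also have "\<dots> \<le> vnorm n y * (cnorm n m M * vnorm m x)"
    by (intro mult_left_mono cnorm_mvec) simp
  finally show ?thesis by (simp add: algebra_simps)
qed

text \<open>The form is bilinear, so the extremal test vector is the conjugate of the image of
  \<open>x\<close>; it turns the hypothesis into \<open>t * t \<le> K * t\<close>.\<close>

lemma cnorm_leI:
  assumes "K \<ge> 0"
    and "\<And>x y. cmod (\<Sum>i<n. \<Sum>j<m. y i * M i j * x j) \<le> K * vnorm m x * vnorm n y"
  shows "cnorm n m M \<le> K"
  unfolding cnorm_alt
proof (rule cSup_least)
  show "{vnorm n (mvec m M x) |x. vnorm m x \<le> 1} \<noteq> {}"
    by (auto intro!: exI[of _ "\<lambda>_. 0"] simp: vnorm_def L2_set_def)
next
  fix t assume "t \<in> {vnorm n (mvec m M x) |x. vnorm m x \<le> 1}"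
  then obtain x where x: "t = vnorm n (mvec m M x)" "vnorm m x \<le> 1" by blast
  define y where "y i = cnj (mvec m M x i)" for i
  have "(\<Sum>i<n. \<Sum>j<m. y i * M i j * x j) = (\<Sum>i<n. y i * mvec m M x i)"
    by (simp add: mvec_def sum_distrib_left mult.assoc)
  also have "\<dots> = complex_of_real (t\<^sup>2)"
    unfolding x(1) vnorm_squared of_real_sum y_def
    by (intro sum.cong) (simp_all add: complex_norm_square mult.commute del: of_real_power)
  finally have "t\<^sup>2 \<le> K * vnorm m x * vnorm n y"
    using assms(2)[of y x] by (simp add: norm_power)
  also have "vnorm n y = t" by (simp add: y_def x(1) vnorm_def)
  also have "K * vnorm m x * t \<le> K * 1 * t"
    using assms(1) x by (intro mult_right_mono mult_left_mono) auto
  finally have "t * t \<le> K * t" by (simp add: power2_eq_square)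
  then show "t \<le> K"
    using assms(1) x(1) vnorm_nonneg[of n "mvec m M x"] by (cases "t = 0") auto
qed

text \<open>Vectors of the tensor product of C^r and C^n are indexed by pairs, which removes the
  \<open>div\<close> and \<open>mod\<close> of \<open>ampl\<close> from later computations.\<close>

definition vnorm2 :: "nat \<Rightarrow> nat \<Rightarrow> complex mtx \<Rightarrow> real" where
  "vnorm2 r n x = sqrt (\<Sum>i<r. \<Sum>p<n. (cmod (x i p))\<^sup>2)"

lemma vnorm2_nonneg [simp]: "0 \<le> vnorm2 r n x"
  by (simp add: vnorm2_def sum_nonneg)

lemma vnorm2_squared: "(vnorm2 r n x)\<^sup>2 = (\<Sum>i<r. \<Sum>p<n. (cmod (x i p))\<^sup>2)"
  by (simp add: vnorm2_def sum_nonneg)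

lemma vnorm2_scale: "vnorm2 r n (\<lambda>i p. c * x i p) = cmod c * vnorm2 r n x"
  by (simp add: vnorm2_def norm_mult power_mult_distrib real_sqrt_mult flip: sum_distrib_left)

lemma vnorm2_zero_iff: "vnorm2 r n x = 0 \<longleftrightarrow> (\<forall>i<r. \<forall>p<n. x i p = 0)"
  by (auto simp: vnorm2_def sum_nonneg_eq_0_iff sum_nonneg)

lemma sum_div_mod:
  fixes f :: "nat \<Rightarrow> nat \<Rightarrow> 'm::comm_monoid_add"
  shows "(\<Sum>i<r*n. f (i div n) (i mod n)) = (\<Sum>i<r. \<Sum>p<n. f i p)"
proof (induction r)
  case (Suc r)
  have "(\<Sum>i<Suc r * n. f (i div n) (i mod n)) =
        (\<Sum>i<r*n. f (i div n) (i mod n)) + (\<Sum>i\<in>{r*n..<r*n+n}. f (i div n) (i mod n))"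
    by (subst sum.union_disjoint[symmetric]) (auto intro!: sum.cong)
  also have "(\<Sum>i\<in>{r*n..<r*n+n}. f (i div n) (i mod n)) = (\<Sum>p<n. f r p)"
  proof (rule sum.reindex_bij_witness[of _ "\<lambda>p. r*n + p" "\<lambda>i. i - r*n"])
    fix i assume "i \<in> {r*n..<r*n+n}"
    then obtain p where "i = r * n + p" "p < n"
      by (metis add_less_cancel_left atLeastLessThan_iff le_iff_add)
    then show "f r (i - r * n) = f (i div n) (i mod n)" by simp
  qed auto
  finally show ?case using Suc by simp
qed simp

text \<open>The sesquilinear form of the amplification of \<phi> at \<open>a\<close>. Statements
  about \<open>cpsd\<close> and \<open>cnorm\<close> of \<open>ampl\<close> are translated into this
  form once, and \<open>ampl\<close> is not unfolded afterwards.\<close>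

definition sform :: "nat \<Rightarrow> nat \<Rightarrow> ('v \<Rightarrow> complex mtx) \<Rightarrow> 'v mtx \<Rightarrow> complex mtx \<Rightarrow> complex mtx \<Rightarrow> complex" where
  "sform r n \<phi> a y x = (\<Sum>i<r. \<Sum>j<r. \<Sum>p<n. \<Sum>q<n. cnj (y i p) * \<phi> (a i j) p q * x j q)"

lemma vnorm_div_mod: "vnorm (r*n) (\<lambda>k. x (k div n) (k mod n)) = vnorm2 r n x"
  unfolding vnorm_def vnorm2_def L2_set_def
  using sum_div_mod[where f = "\<lambda>i p. (cmod (x i p))\<^sup>2"] by simp

lemma vnorm_undiv: "vnorm2 r n (\<lambda>i p. x (i * n + p)) = vnorm (r*n) x"
proof -
  have "vnorm2 r n (\<lambda>i p. x (i * n + p)) = vnorm (r*n) (\<lambda>k. x (k div n * n + k mod n))"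
    by (rule vnorm_div_mod[symmetric])
  then show ?thesis by simp
qed

lemma ampl_form:
  "(\<Sum>k<r*n. \<Sum>l<r*n. cnj (y (k div n) (k mod n)) * ampl n \<phi> a r k l * x (l div n) (l mod n))
    = sform r n \<phi> a y x"
proof -
  have "(\<Sum>k<r*n. \<Sum>l<r*n. cnj (y (k div n) (k mod n)) * ampl n \<phi> a r k l * x (l div n) (l mod n))
    = (\<Sum>k<r*n. \<Sum>l<r*n. cnj (y (k div n) (k mod n)) *
         \<phi> (a (k div n) (l div n)) (k mod n) (l mod n) * x (l div n) (l mod n))"
    by (intro sum.cong refl) (auto simp: ampl_def)
  also have "\<dots> = (\<Sum>k<r*n. (\<lambda>i p. \<Sum>j<r. \<Sum>q<n. cnj (y i p) * \<phi> (a i j) p q * x j q) (k div n) (k mod n))"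
  proof (rule sum.cong[OF refl])
    fix k
    show "(\<Sum>l<r*n. cnj (y (k div n) (k mod n)) *
         \<phi> (a (k div n) (l div n)) (k mod n) (l mod n) * x (l div n) (l mod n)) =
        (\<Sum>j<r. \<Sum>q<n. cnj (y (k div n) (k mod n)) * \<phi> (a (k div n) j) (k mod n) q * x j q)"
      by (rule sum_div_mod[where f = "\<lambda>j q. cnj (y (k div n) (k mod n)) * \<phi> (a (k div n) j) (k mod n) q * x j q"])
  qed
  also have "\<dots> = (\<Sum>i<r. \<Sum>p<n. \<Sum>j<r. \<Sum>q<n. cnj (y i p) * \<phi> (a i j) p q * x j q)"
    by (rule sum_div_mod)
  also have "\<dots> = sform r n \<phi> a y x"
    unfolding sform_def by (intro sum.cong refl sum.swap)
  finally show ?thesis .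
qed

lemma ampl_form_diff:
  "(\<Sum>k<r*n. \<Sum>l<r*n. cnj (y (k div n) (k mod n)) * msub (ampl n \<phi> a r) (ampl n \<psi> a r) k l * x (l div n) (l mod n))
    = sform r n \<phi> a y x - sform r n \<psi> a y x"
  unfolding ampl_form[symmetric]
  by (simp add: msub_def ring_distribs sum_subtractf)

lemma cpsd_ampl_iff:
  "cpsd (r*n) (ampl n \<phi> a r) \<longleftrightarrow> (\<forall>x. Im (sform r n \<phi> a x x) = 0 \<and> 0 \<le> Re (sform r n \<phi> a x x))"
proof -
  have mats: "ampl n \<phi> a r \<in> mats (r*n) (r*n)" by (auto simp: mats_def ampl_def)
  define Z where "Z x = (\<Sum>k<r*n. \<Sum>l<r*n. cnj (x k) * ampl n \<phi> a r k l * x l)" for x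
  have 1: "Z x = sform r n \<phi> a (\<lambda>i p. x (i * n + p)) (\<lambda>i p. x (i * n + p))" for x
    unfolding ampl_form[symmetric] Z_def by simp
  have 2: "sform r n \<phi> a x x = Z (\<lambda>k. x (k div n) (k mod n))" for x
    unfolding ampl_form[symmetric] Z_def by simp
  have Z: "cpsd (r*n) (ampl n \<phi> a r) \<longleftrightarrow> (\<forall>x. Im (Z x) = 0 \<and> 0 \<le> Re (Z x))"
    using mats by (simp only: cpsd_def Z_def simp_thms)
  show ?thesis
  proof (intro iffI allI)
    fix x assume "cpsd (r*n) (ampl n \<phi> a r)"
    then show "Im (sform r n \<phi> a x x) = 0 \<and> 0 \<le> Re (sform r n \<phi> a x x)"
      unfolding Z 2 by simp
  next
    assume "\<forall>x. Im (sform r n \<phi> a x x) = 0 \<and> 0 \<le> Re (sform r n \<phi> a x x)"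
    then show "cpsd (r*n) (ampl n \<phi> a r)" unfolding Z 1 by simp
  qed
qed

lemma sform_diff_le:
  "cmod (sform r n \<phi> a y x - sform r n \<psi> a y x)
    \<le> cnorm (r*n) (r*n) (msub (ampl n \<phi> a r) (ampl n \<psi> a r)) * vnorm2 r n x * vnorm2 r n y"
proof -
  have "vnorm (r*n) (\<lambda>k. cnj (y (k div n) (k mod n))) = vnorm2 r n y"
    using vnorm_div_mod[of r n y] by (simp add: vnorm_def)
  then show ?thesis
    using cnorm_bilinear[of "\<lambda>k. cnj (y (k div n) (k mod n))"
        "msub (ampl n \<phi> a r) (ampl n \<psi> a r)" "\<lambda>l. x (l div n) (l mod n)" "r*n" "r*n"]
    by (simp add: ampl_form_diff vnorm_div_mod)
qed

lemma cnorm_ampl_leI: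
  assumes "K \<ge> 0"
    and "\<And>x y. cmod (sform r n \<phi> a y x - sform r n \<psi> a y x) \<le> K * vnorm2 r n x * vnorm2 r n y"
  shows "cnorm (r*n) (r*n) (msub (ampl n \<phi> a r) (ampl n \<psi> a r)) \<le> K"
proof (rule cnorm_leI[OF assms(1)])
  fix x y :: "nat \<Rightarrow> complex"
  let ?x = "\<lambda>i p. x (i * n + p)" and ?y = "\<lambda>i p. cnj (y (i * n + p))"
  have "(\<Sum>k<r*n. \<Sum>l<r*n. y k * msub (ampl n \<phi> a r) (ampl n \<psi> a r) k l * x l)
      = sform r n \<phi> a ?y ?x - sform r n \<psi> a ?y ?x"
    unfolding ampl_form_diff[symmetric] by simp
  moreover have "vnorm2 r n ?y = vnorm (r*n) y"
    by (subst vnorm_undiv) (simp add: vnorm_def)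
  ultimately show "cmod (\<Sum>k<r*n. \<Sum>l<r*n. y k * msub (ampl n \<phi> a r) (ampl n \<psi> a r) k l * x l)
      \<le> K * vnorm (r*n) x * vnorm (r*n) y"
    using assms(2)[of ?y ?x] by (simp add: vnorm_undiv)
qed

text \<open>Here the column index carries the conjugate, whereas in \<open>sform\<close> it is the
  row index; \<open>CPM_hform\<close> converts between the two conventions.\<close>

definition hform :: "complex mtx \<Rightarrow> nat \<Rightarrow> (nat \<Rightarrow> complex) \<Rightarrow> (nat \<Rightarrow> complex) \<Rightarrow> complex" where
  "hform P n x y = (\<Sum>i<n. \<Sum>j<n. P i j * x i * cnj (y j))"

lemma hform_add_left: "hform P n (\<lambda>i. x i + x' i) y = hform P n x y + hform P n x' y"
  by (simp add: hform_def ring_distribs sum.distrib)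

lemma hform_scale_left: "hform P n (\<lambda>i. c * x i) y = c * hform P n x y"
  by (simp add: hform_def sum_distrib_left algebra_simps)

lemma hform_sum_left: "hform P n (\<lambda>i. \<Sum>k\<in>K. f k i) y = (\<Sum>k\<in>K. hform P n (f k) y)"
  by (induction K rule: infinite_finite_induct)
    (simp_all add: hform_add_left, simp_all add: hform_def)

lemma hform_swap:
  assumes "\<And>i j. P j i = cnj (P i j)"
  shows "hform P n y x = cnj (hform P n x y)"
proof -
  have "cnj (hform P n x y) = (\<Sum>i<n. \<Sum>j<n. P j i * y j * cnj (x i))"
    by (simp add: hform_def assms[symmetric] mult.commute mult.left_commute)
  also have "\<dots> = hform P n y x" unfolding hform_def by (rule sum.swap)
  finally show ?thesis by simp
qed

lemma hform_unit:
  assumes "i < n" "j < n"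
  shows "hform P n (\<lambda>k. if k = i then 1 else 0) (\<lambda>k. if k = j then 1 else 0) = P i j"
proof -
  have "hform P n (\<lambda>k. if k = i then 1 else 0) (\<lambda>k. if k = j then 1 else 0)
      = (\<Sum>k<n. if k = i then (\<Sum>l<n. if l = j then P k l else 0) else 0)"
    unfolding hform_def
  proof (rule sum.cong[OF refl])
    fix k
    show "(\<Sum>l<n. P k l * (if k = i then 1 else 0) * cnj (if l = j then 1 else 0))
        = (if k = i then (\<Sum>l<n. if l = j then P k l else 0) else 0)"
      using assms by (cases "k = i") (simp_all add: if_distrib[of cnj] if_distrib[of "(*) _"] cong: if_cong)
  qed
  then show ?thesis using assms by simp
qed

lemma hform_orthonormal:
  fixes m :: nat
  assumes herm: "\<And>i j. P j i = cnj (P i j)"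
    and orth: "\<And>k l. k < m \<Longrightarrow> l < m \<Longrightarrow> hform P n (h k) (h l) = (if k = l then 1 else 0)"
  shows "hform P n (\<lambda>i. \<Sum>k<m. x k * h k i) (\<lambda>i. \<Sum>k<m. y k * h k i) = (\<Sum>k<m. x k * cnj (y k))"
proof -
  have 1: "hform P n (h k) (\<lambda>i. \<Sum>k<m. y k * h k i) = cnj (y k)" if "k < m" for k
  proof -
    have "hform P n (\<lambda>i. \<Sum>l<m. y l * h l i) (h k) = (\<Sum>l<m. y l * (if l = k then 1 else 0))"
      by (simp add: hform_sum_left hform_scale_left orth that)
    also have "\<dots> = (\<Sum>l<m. if l = k then y l else 0)" by (intro sum.cong) auto
    also have "\<dots> = y k" using that by simp
    finally show ?thesis
      using hform_swap[OF herm, where x = "\<lambda>i. \<Sum>l<m. y l * h l i" and y = "h k" and n = n] by simp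
  qed
  show ?thesis by (simp add: hform_sum_left hform_scale_left 1)
qed

text \<open>Orthonormalisation of the unit vectors for the form \<open>P\<close>. The triangular
  shape belongs to the induction because the new vector \<open>u\<close> must have coordinate 1 at
  \<open>m\<close>, which makes its norm positive; \<open>c\<close> expresses the unit vectors in
  the new basis.\<close>

lemma gram_schmidt_partial:
  assumes herm: "\<And>i j. P j i = cnj (P i j)"
    and pos: "\<And>x i. i < n \<Longrightarrow> x i \<noteq> 0 \<Longrightarrow> 0 < Re (hform P n x x)"
    and "m \<le> n"
  shows "\<exists>h c. (\<forall>k<m. \<forall>i>k. h k i = 0) \<and>
     (\<forall>k<m. \<forall>l<m. hform P n (h k) (h l) = (if k = l then 1 else 0)) \<and>
     (\<forall>i<m. \<forall>j. (\<Sum>k<m. c i k * h k j) = (if i = j then 1 else 0))"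
  using \<open>m \<le> n\<close>
proof (induction m)
  case 0
  show ?case by simp
next
  case (Suc m)
  then obtain h c where hc: "\<forall>k<m. \<forall>i>k. h k i = 0"
    "\<forall>k<m. \<forall>l<m. hform P n (h k) (h l) = (if k = l then 1 else 0)"
    "\<forall>i<m. \<forall>j. (\<Sum>k<m. c i k * h k j) = (if i = j then 1 else 0)"
    using Suc.IH[OF Suc_leD[OF Suc.prems]] by (elim exE conjE) (rule that)
  note supp = hc(1)[rule_format] and orth = hc(2)[rule_format] and gen = hc(3)[rule_format]
  define e where "e = (\<lambda>k. if k = m then 1 else 0 :: complex)"
  define b where "b k = hform P n e (h k)" for k
  define u where "u i = e i + (\<Sum>k<m. - b k * h k i)" for i
  have um: "u m = 1" by (simp add: u_def e_def supp)
  have u_supp: "u i = 0" if "i > m" for i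
    using that by (simp add: u_def e_def supp)
  have u_orth: "hform P n u (h l) = 0" if "l < m" for l
  proof -
    have "hform P n u (h l) = b l + (\<Sum>k<m. - b k * (if k = l then 1 else 0))"
      unfolding u_def hform_add_left hform_sum_left hform_scale_left
      by (simp add: orth that b_def)
    also have "(\<Sum>k<m. - b k * (if k = l then 1 else 0)) = - b l"
      using that by (subst sum.remove[of _ l]) auto
    finally show ?thesis by simp
  qed
  define N where "N = Re (hform P n u u)"
  have N: "N > 0" unfolding N_def using Suc.prems um by (intro pos[where i = m]) auto
  have uu: "hform P n u u = of_real N"
    using arg_cong[OF hform_swap[OF herm, where n = n and x = u and y = u], of Im]
    by (simp add: complex_eq_iff N_def)
  define s where "s = complex_of_real (sqrt N)"
  have s: "s \<noteq> 0" "s * s = of_real N" "cnj s = s"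
    using N by (simp_all add: s_def flip: of_real_mult)
  have s': "inverse s * (inverse s * of_real N) = 1"
    using s(1) unfolding s(2)[symmetric] by (simp flip: mult.assoc)
  define h' where "h' = h(m := (\<lambda>i. inverse s * u i))"
  define c' where "c' i k = (if i = m then if k = m then s else b k else if k = m then 0 else c i k)" for i k
  have right: "hform P n x (\<lambda>i. inverse s * u i) = inverse s * hform P n x u" for x
  proof -
    have "hform P n x (\<lambda>i. inverse s * u i) = cnj (hform P n (\<lambda>i. inverse s * u i) x)"
      by (rule hform_swap[OF herm])
    also have "\<dots> = inverse s * cnj (hform P n u x)" by (simp add: hform_scale_left s)
    also have "cnj (hform P n u x) = hform P n x u" by (rule hform_swap[OF herm, symmetric])
    finally show ?thesis .
  qed
  have hu: "hform P n (h k) u = 0" if "k < m" for k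
    using hform_swap[OF herm, where n = n and x = u and y = "h k"] u_orth[OF that] by simp
  have supp': "h' k i = 0" if "k < Suc m" "k < i" for k i
    using that by (auto simp: h'_def less_Suc_eq supp u_supp)
  have orth': "hform P n (h' k) (h' l) = (if k = l then 1 else 0)" if "k < Suc m" "l < Suc m" for k l
    using that s s' by (auto simp: h'_def less_Suc_eq orth right hform_scale_left u_orth hu uu)
  have gen': "(\<Sum>k<Suc m. c' i k * h' k j) = (if i = j then 1 else 0)" if "i < Suc m" for i j
  proof (cases "i = m")
    case True
    then have "(\<Sum>k<Suc m. c' i k * h' k j) = (\<Sum>k<m. b k * h k j) + u j"
      using s by (simp add: c'_def h'_def)
    then show ?thesis using True by (simp add: u_def e_def sum_negf)
  next
    case False
    then show ?thesis using that by (simp add: c'_def h'_def gen)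
  qed
  show ?case
    by (rule exI[of _ h'], rule exI[of _ c'], intro conjI allI impI)
      (assumption | rule supp' orth' gen')+
qed

text \<open>A substitute for the square root of a positive definite matrix: \<open>c\<close> is a
  factor of \<open>P\<close> and \<open>h\<close> its inverse, so \<open>h\<close> normalises the
  form and \<open>c\<close> undoes the normalisation.\<close>

lemma gram_schmidt:
  assumes herm: "\<And>i j. P j i = cnj (P i j)"
    and pos: "\<And>x i. i < n \<Longrightarrow> x i \<noteq> 0 \<Longrightarrow> 0 < Re (hform P n x x)"
  obtains h c where
    "\<And>x y. hform P n (\<lambda>i. \<Sum>k<n. x k * h k i) (\<lambda>i. \<Sum>k<n. y k * h k i) = (\<Sum>k<n. x k * cnj (y k))"
    "\<And>i j. i < n \<Longrightarrow> (\<Sum>k<n. c i k * h k j) = (if i = j then 1 else 0)"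
    "\<And>i j. i < n \<Longrightarrow> j < n \<Longrightarrow> P i j = (\<Sum>k<n. c i k * cnj (c j k))"
proof -
  obtain h c where hc: "\<forall>k<n. \<forall>l<n. hform P n (h k) (h l) = (if k = l then 1 else 0)"
    "\<forall>i<n. \<forall>j. (\<Sum>k<n. c i k * h k j) = (if i = j then 1 else 0)"
  proof -
    have "\<exists>h c. (\<forall>k<n. \<forall>i>k. h k i = 0) \<and>
       (\<forall>k<n. \<forall>l<n. hform P n (h k) (h l) = (if k = l then 1 else 0)) \<and>
       (\<forall>i<n. \<forall>j. (\<Sum>k<n. c i k * h k j) = (if i = j then 1 else 0))"
      by (rule gram_schmidt_partial[OF herm _ order_refl]) (rule pos)
    then show thesis by (elim exE conjE) (rule that)
  qed
  note orth = hc(1)[rule_format] and gen = hc(2)[rule_format]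
  have comb: "hform P n (\<lambda>i. \<Sum>k<n. x k * h k i) (\<lambda>i. \<Sum>k<n. y k * h k i) = (\<Sum>k<n. x k * cnj (y k))" for x y
    by (rule hform_orthonormal[OF herm]) (rule orth)
  have fac: "P i j = (\<Sum>k<n. c i k * cnj (c j k))" if "i < n" "j < n" for i j
  proof -
    have "P i j = hform P n (\<lambda>k. if i = k then 1 else 0) (\<lambda>k. if j = k then 1 else 0)"
      by (subst hform_unit[OF that, symmetric]) (intro arg_cong2[where f = "hform P n"] ext; auto)
    then show ?thesis
      using comb[of "c i" "c j"] that by (simp add: gen)
  qed
  show thesis
  proof (rule that)
    show "hform P n (\<lambda>i. \<Sum>k<n. x k * h k i) (\<lambda>i. \<Sum>k<n. y k * h k i) = (\<Sum>k<n. x k * cnj (y k))" for x y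
      by (rule comb)
    show "(\<Sum>k<n. c i k * h k j) = (if i = j then 1 else 0)" if "i < n" for i j
      using that by (rule gen)
    show "P i j = (\<Sum>k<n. c i k * cnj (c j k))" if "i < n" "j < n" for i j
      using that by (rule fac)
  qed
qed

section \<open>Matrix order unit spaces and the numerical radius\<close>

lemma sum_apply: "(\<Sum>i\<in>S. f i) x = (\<Sum>i\<in>S. f i x)"
  by (induction S rule: infinite_finite_induct) auto

lemma madd_eq: "madd A B = A + B"
  and msub_eq: "msub A B = A - B"
  and mzero_eq: "(mzero :: 'v mtx) = 0" for A B :: "'v::ab_group_add mtx"
  by (auto simp: fun_eq_iff madd_def msub_def mzero_def)

definition elm :: "nat \<Rightarrow> nat \<Rightarrow> 'v::zero \<Rightarrow> 'v mtx" where
  "elm i j x = (\<lambda>a b. if a = i \<and> b = j then x else 0)"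

definition mconj :: "('v::ab_group_add) mous \<Rightarrow> nat \<Rightarrow> complex mtx \<Rightarrow> 'v mtx \<Rightarrow> 'v mtx" where
  "mconj V n g A = (\<lambda>i j. \<Sum>k<n. \<Sum>l<n. msmul V (cnj (g k i) * g l j) (A k l))"

text \<open>The numerical radius of \<open>A\<close> is at most \<open>t\<close>: adding
  \<open>2 * t\<close> to twice the real part of \<open>u A\<close> gives a positive element for
  every unit scalar \<open>u\<close>. Unlike the definition of \<open>mnorm\<close>, the condition
  needs no block matrix of twice the size.\<close>

definition nrad :: "('v::ab_group_add) mous \<Rightarrow> nat \<Rightarrow> real \<Rightarrow> 'v mtx \<Rightarrow> bool" where
  "nrad V n t A \<longleftrightarrow> (\<forall>u. cmod u = 1 \<longrightarrow>
     smat n (msmul V (complex_of_real (2 * t)) (munit V)) + mmap (msmul V u) A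
       + mmap (msmul V (cnj u)) (vadj V A) \<in> mcone V n)"

lemma mats_add: "A \<in> mats n m \<Longrightarrow> B \<in> mats n m \<Longrightarrow> A + B \<in> mats n m"
  and mats_diff: "A \<in> mats n m \<Longrightarrow> B \<in> mats n m \<Longrightarrow> A - B \<in> mats n m"
  and mats_uminus: "A \<in> mats n m \<Longrightarrow> - A \<in> mats n m"
  and mats_0: "(0 :: 'v mtx) \<in> mats n m" for A B :: "'v::ab_group_add mtx"
  by (auto simp: mats_def)

lemma elm_mats: "i < n \<Longrightarrow> j < m \<Longrightarrow> elm i j x \<in> mats n m"
  by (auto simp: mats_def elm_def)

lemma smat_mats: "smat n x \<in> mats n n"
  by (auto simp: mats_def smat_def)

lemma one_one_mats: "one_one x \<in> mats 1 1"
  by (auto simp: mats_def one_one_def)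

lemma smat_add: "smat n (x + y) = smat n x + smat n (y :: 'v::ab_group_add)"
  by (auto simp: smat_def fun_eq_iff)

lemma one_one_add: "one_one (x + y) = one_one x + one_one y"
  and one_one_diff: "one_one (x - y) = one_one x - one_one y" for x y :: "'v::ab_group_add"
  by (auto simp: one_one_def fun_eq_iff)

lemma one_one_inject: "one_one x = one_one y \<longleftrightarrow> x = y"
  by (auto simp: one_one_def fun_eq_iff)

lemma sum_lessThan_double:
  "(\<Sum>k<2*n. f k) = (\<Sum>k<n. f k) + (\<Sum>k<n. f (n + k))" for f :: "nat \<Rightarrow> 'm::comm_monoid_add"
proof -
  have "(\<Sum>k\<in>{n..<2*n}. f k) = (\<Sum>k<n. f (n + k))"
    by (rule sum.reindex_bij_witness[of _ "\<lambda>k. n + k" "\<lambda>k. k - n"]) auto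
  moreover have "(\<Sum>k<2*n. f k) = (\<Sum>k<n. f k) + (\<Sum>k\<in>{n..<2*n}. f k)"
    by (subst sum.union_disjoint[symmetric]) (auto intro!: sum.cong)
  ultimately show ?thesis by simp
qed

locale mou =
  fixes V :: "('v::ab_group_add) mous"
  assumes mou_space: "mou_space V"
begin

abbreviation "sm \<equiv> msmul V"
abbreviation "mm c A \<equiv> mmap (msmul V c) A"
abbreviation "idm n t \<equiv> smat n (msmul V (complex_of_real t) (munit V))"

sublocale sm: vector_space sm
  by standard (use mou_space in \<open>simp_all add: mou_space_def\<close>)

sublocale mm: vector_space "\<lambda>c. mmap (msmul V c)"
  by standard (simp_all add: mmap_def fun_eq_iff sm.scale_right_distrib sm.scale_left_distrib)

sublocale mr: vector_space "\<lambda>r. mmap (msmul V (complex_of_real r))"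
  by standard (simp_all add: mmap_def fun_eq_iff sm.scale_right_distrib sm.scale_left_distrib)

lemma star_add: "mstar V (x + y) = mstar V x + mstar V y"
  and star_sm: "mstar V (sm c x) = sm (cnj c) (mstar V x)"
  and star_star: "mstar V (mstar V x) = x"
  and star_unit: "mstar V (munit V) = munit V"
  using mou_space by (simp_all add: mou_space_def)

lemma star_0: "mstar V 0 = 0"
  using star_add[of 0 0] by simp

lemma star_minus: "mstar V (- x) = - mstar V x"
  using star_add[of x "- x"] by (simp add: star_0 eq_neg_iff_add_eq_0 add.commute)

lemma star_sum: "mstar V (\<Sum>i\<in>S. f i) = (\<Sum>i\<in>S. mstar V (f i))"
  by (induction S rule: infinite_finite_induct) (auto simp: star_add star_0)

lemma cone_mats: "A \<in> mcone V n \<Longrightarrow> A \<in> mats n n"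
  and cone_sa: "A \<in> mcone V n \<Longrightarrow> vadj V A = A"
  and cone_add: "A \<in> mcone V n \<Longrightarrow> B \<in> mcone V n \<Longrightarrow> A + B \<in> mcone V n"
  and cone_scale: "A \<in> mcone V n \<Longrightarrow> r \<ge> 0 \<Longrightarrow> mm (complex_of_real r) A \<in> mcone V n"
  using mou_space by (auto simp: mou_space_def madd_eq)

lemma mmap_uminus: "mmap uminus A = - A" for A :: "'w::ab_group_add mtx"
  by (auto simp: mmap_def fun_eq_iff)

lemma cone_proper: "A \<in> mcone V n \<Longrightarrow> - A \<in> mcone V n \<Longrightarrow> A = 0"
  using mou_space by (simp add: mou_space_def mmap_uminus mzero_eq)

lemma cone_arch:
  assumes "A \<in> mats n n" "\<And>r. r > 0 \<Longrightarrow> A + idm n r \<in> mcone V n"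
  shows "A \<in> mcone V n"
proof -
  have "\<forall>n A. A \<in> mats n n \<longrightarrow> (\<forall>r>0. A + idm n r \<in> mcone V n) \<longrightarrow> A \<in> mcone V n"
    using mou_space by (simp add: mou_space_def madd_eq)
  then show ?thesis using assms by blast
qed

lemma order_unit:
  assumes "mstar V v = v"
  obtains r where "r > 0" "one_one (sm (complex_of_real r) (munit V) - v) \<in> mcone V 1"
proof -
  have "\<forall>v. mstar V v = v \<longrightarrow> (\<exists>r>0. one_one (sm (complex_of_real r) (munit V) - v) \<in> mcone V 1)"
    using mou_space by (simp add: mou_space_def vpos_def)
  then show ?thesis using assms that by blast
qed

text \<open>Rows of \<open>g\<close> from \<open>n\<close> on never enter \<open>mconj\<close>, so
  \<open>g\<close> may be arbitrary there; this spares the padding with zeros that membership in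
  \<open>mats\<close> would demand.\<close>

lemma cone_conj:
  assumes "A \<in> mcone V n" "\<And>k j. k < n \<Longrightarrow> m \<le> j \<Longrightarrow> g k j = 0"
  shows "mconj V n g A \<in> mcone V m"
proof -
  define g' where "g' = (\<lambda>k j. if k < n then g k j else 0)"
  have "g' \<in> mats n m" using assms(2) by (auto simp: g'_def mats_def)
  then have "rmul V n (lmul V n (cadj g') A) g' \<in> mcone V m"
    using mou_space assms(1) by (simp add: mou_space_def)
  moreover have "rmul V n (lmul V n (cadj g') A) g' = mconj V n g A"
  proof (intro ext)
    fix i j
    have "rmul V n (lmul V n (cadj g') A) g' i j
        = (\<Sum>l<n. \<Sum>k<n. sm (cnj (g k i) * g l j) (A k l))"
      by (simp add: rmul_def lmul_def cadj_def g'_def sm.scale_sum_right mult.commute)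
    also have "\<dots> = mconj V n g A i j"
      unfolding mconj_def by (rule sum.swap)
    finally show "rmul V n (lmul V n (cadj g') A) g' i j = mconj V n g A i j" .
  qed
  ultimately show ?thesis by simp
qed

lemma cone_embed:
  assumes "one_one x \<in> mcone V 1" "\<And>j. m \<le> j \<Longrightarrow> g j = 0"
  shows "(\<lambda>i j. sm (cnj (g i) * g j) x) \<in> mcone V m"
  using cone_conj[OF assms(1), of m "\<lambda>_. g"] assms(2) by (simp add: mconj_def one_one_def)

lemma cone_vec:
  assumes "A \<in> mcone V n"
  shows "one_one (\<Sum>k<n. \<Sum>l<n. sm (cnj (g k) * g l) (A k l)) \<in> mcone V 1"
proof -
  have "mconj V n (\<lambda>k j. if j = 0 then g k else 0) A \<in> mcone V 1"
    by (rule cone_conj[OF assms]) auto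
  also have "mconj V n (\<lambda>k j. if j = 0 then g k else 0) A
      = one_one (\<Sum>k<n. \<Sum>l<n. sm (cnj (g k) * g l) (A k l))"
    by (auto simp: mconj_def one_one_def fun_eq_iff)
  finally show ?thesis .
qed

lemma mm_one_one: "mm c (one_one x) = one_one (sm c x)"
  by (auto simp: mmap_def one_one_def fun_eq_iff)

lemma mm_smat: "mm c (smat n x) = smat n (sm c x)"
  by (auto simp: mmap_def smat_def fun_eq_iff)

lemma mm_elm: "mm c (elm i j x) = elm i j (sm c x)"
  by (auto simp: mmap_def elm_def fun_eq_iff)

lemma mm_mats: "A \<in> mats n m \<Longrightarrow> mm c A \<in> mats n m"
  by (auto simp: mats_def mmap_def)

lemma vadj_mats: "A \<in> mats n m \<Longrightarrow> vadj V A \<in> mats m n"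
  by (auto simp: mats_def vadj_def star_0)

lemma vadj_add: "vadj V (A + B) = vadj V A + vadj V B"
  by (simp add: vadj_def fun_eq_iff star_add)

lemma vadj_minus: "vadj V (- A) = - vadj V A"
  by (simp add: vadj_def fun_eq_iff star_minus)

lemma vadj_diff: "vadj V (A - B) = vadj V A - vadj V B"
  using vadj_add[of A "- B"] by (simp add: vadj_minus)

lemma vadj_mm: "vadj V (mm c A) = mm (cnj c) (vadj V A)"
  by (simp add: vadj_def mmap_def fun_eq_iff star_sm)

lemma vadj_vadj [simp]: "vadj V (vadj V A) = A"
  by (simp add: vadj_def star_star)

lemma vadj_elm: "vadj V (elm i j x) = elm j i (mstar V x)"
  by (auto simp: vadj_def elm_def fun_eq_iff star_0)

lemma vadj_one_one: "vadj V (one_one x) = one_one (mstar V x)"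
  unfolding vadj_def one_one_def by (intro ext) (simp add: star_0)

lemma vadj_idm: "vadj V (idm n t) = idm n t"
proof (intro ext)
  fix i j
  show "vadj V (idm n t) i j = idm n t i j"
    by (cases "i = j") (simp_all add: vadj_def smat_def star_0 star_sm star_unit)
qed

lemma idm_add: "idm n (s + t) = idm n s + idm n t"
  by (simp add: smat_add sm.scale_left_distrib)

lemma idm_0 [simp]: "smat n (0::'v) = 0"
  by (auto simp: smat_def fun_eq_iff)

lemma mm_idm: "mm (complex_of_real r) (idm n t) = idm n (r * t)"
  by (simp add: mm_smat)

lemma unit_pos: "one_one (munit V) \<in> mcone V 1"
proof -
  obtain r where r: "r > 0" "one_one (sm (complex_of_real r) (munit V) - 0) \<in> mcone V 1"
    using order_unit[OF star_0] by blast
  then show ?thesis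
    using cone_scale[OF r(2), of "1 / r"] by (simp add: mm_one_one)
qed

lemma cone_0: "0 \<in> mcone V n"
  using cone_embed[OF unit_pos, of n "\<lambda>_. 0"] by (simp add: zero_fun_def)

lemma cone_sum: "(\<And>i. i \<in> S \<Longrightarrow> f i \<in> mcone V n) \<Longrightarrow> (\<Sum>i\<in>S. f i) \<in> mcone V n"
  by (induction S rule: infinite_finite_induct) (auto simp: cone_0 cone_add)

lemma cone_elm:
  assumes "one_one x \<in> mcone V 1" "i < n"
  shows "elm i i x \<in> mcone V n"
proof -
  have "(\<lambda>a b. sm (cnj (if a = i then 1 else 0) * (if b = i then 1 else 0)) x) \<in> mcone V n"
    using assms(2) by (intro cone_embed[OF assms(1)]) auto
  also have "(\<lambda>a b. sm (cnj (if a = i then 1 else 0) * (if b = i then 1 else 0)) x) = elm i i x"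
    by (auto simp: elm_def fun_eq_iff)
  finally show ?thesis .
qed

lemma smat_elm: "smat n x = (\<Sum>i<n. elm i i x)" for x :: "'w::ab_group_add"
proof (intro ext)
  fix a b
  have "(\<Sum>i<n. elm i i x) a b = (\<Sum>i<n. if i = a then (if a = b then x else 0) else 0)"
    unfolding sum_apply by (intro sum.cong) (auto simp: elm_def)
  then show "smat n x a b = (\<Sum>i<n. elm i i x) a b"
    by (simp add: smat_def)
qed

lemma idm_cone:
  assumes "t \<ge> 0" shows "idm n t \<in> mcone V n"
proof -
  have "one_one (sm (complex_of_real t) (munit V)) \<in> mcone V 1"
    using cone_scale[OF unit_pos assms] by (simp add: mm_one_one)
  then show ?thesis unfolding smat_elm by (intro cone_sum cone_elm) auto
qed

lemma idm_cone_nonneg: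
  assumes "munit V \<noteq> 0" "n \<ge> 1" "idm n t \<in> mcone V n"
  shows "t \<ge> 0"
proof (rule ccontr)
  assume "\<not> t \<ge> 0"
  then have "idm n (-t) \<in> mcone V n" using idm_cone[of "-t" n] by simp
  moreover have "idm n (-t) = - idm n t" by (auto simp: smat_def fun_eq_iff)
  ultimately have "idm n t = 0" using cone_proper[OF assms(3)] by simp
  then have "idm n t 0 0 = 0" by simp
  then show False using assms \<open>\<not> t \<ge> 0\<close> by (simp add: smat_def)
qed

lemma nradD:
  assumes "nrad V n t A" "cmod u = 1"
  shows "idm n (2 * t) + mm u A + mm (cnj u) (vadj V A) \<in> mcone V n"
  using assms unfolding nrad_def by blast

lemma nrad_add:
  assumes "nrad V n s A" "nrad V n t B"
  shows "nrad V n (s + t) (A + B)"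
  unfolding nrad_def
proof (intro allI impI)
  fix u assume "cmod u = 1"
  then have "(idm n (2 * s) + mm u A + mm (cnj u) (vadj V A)) +
     (idm n (2 * t) + mm u B + mm (cnj u) (vadj V B)) \<in> mcone V n"
    using assms by (intro cone_add[OF nradD nradD])
  then show "idm n (2 * (s+t)) + mm u (A + B) + mm (cnj u) (vadj V (A + B)) \<in> mcone V n"
    by (simp only: idm_add vadj_add mm.scale_right_distrib distrib_left add_ac)
qed

lemma nrad_mono:
  assumes "nrad V n s A" "s \<le> t" shows "nrad V n t A"
  unfolding nrad_def
proof (intro allI impI)
  fix u assume "cmod u = 1"
  then have "(idm n (2 * s) + mm u A + mm (cnj u) (vadj V A)) + idm n (2 * (t - s)) \<in> mcone V n"
    using assms by (intro cone_add[OF nradD idm_cone]) auto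
  moreover have "idm n (2 * t) = idm n (2 * s) + idm n (2 * (t - s))"
    by (subst idm_add[symmetric]) (simp add: algebra_simps)
  ultimately show "idm n (2 * t) + mm u A + mm (cnj u) (vadj V A) \<in> mcone V n"
    by (simp only: add_ac)
qed

lemma vadj_0 [simp]: "vadj V 0 = 0"
  by (auto simp: vadj_def fun_eq_iff star_0)

lemma nrad_0: "t \<ge> 0 \<Longrightarrow> nrad V n t 0"
  using idm_cone[of "2 * t" n] by (simp add: nrad_def)

lemma nrad_mm:
  assumes "nrad V n t A" shows "nrad V n (cmod c * t) (mm c A)"
proof (cases "c = 0")
  case False
  show ?thesis unfolding nrad_def
  proof (intro allI impI)
    fix u assume u: "cmod u = 1"
    define w where "w = u * c / cmod c"
    have "cmod w = 1" using u False by (simp add: w_def norm_divide norm_mult)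
    then have "mm (complex_of_real (cmod c)) (idm n (2 * t) + mm w A + mm (cnj w) (vadj V A)) \<in> mcone V n"
      by (intro cone_scale[OF nradD[OF assms]]) auto
    moreover have "complex_of_real (cmod c) * w = u * c"
      "complex_of_real (cmod c) * cnj w = cnj u * cnj c"
      using False by (simp_all add: w_def)
    ultimately show "idm n (2 * (cmod c * t)) + mm u (mm c A) + mm (cnj u) (vadj V (mm c A)) \<in> mcone V n"
      by (simp add: mm.scale_right_distrib vadj_mm mm_smat algebra_simps)
  qed
qed (simp add: nrad_0)

lemma nrad_minus: "nrad V n t A \<Longrightarrow> nrad V n t (- A)"
  using nrad_mm[of n t A "-1"] by simp

lemma nrad_vadj:
  assumes "nrad V n t A" shows "nrad V n t (vadj V A)"
  unfolding nrad_def
proof (intro allI impI)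
  fix u assume "cmod u = 1"
  then have "idm n (2 * t) + mm (cnj u) A + mm (cnj (cnj u)) (vadj V A) \<in> mcone V n"
    by (intro nradD[OF assms]) simp
  then show "idm n (2 * t) + mm u (vadj V A) + mm (cnj u) (vadj V (vadj V A)) \<in> mcone V n"
    by (simp add: add_ac)
qed

lemma nrad_sum:
  assumes "\<And>i. i \<in> S \<Longrightarrow> nrad V n (t i) (f i)"
  shows "nrad V n (\<Sum>i\<in>S. t i) (\<Sum>i\<in>S. f i)"
  using assms by (induction S rule: infinite_finite_induct) (auto simp: nrad_0 nrad_add)

text \<open>For self-adjoint \<open>A\<close> only the real part of \<open>u\<close> matters, and
  \<open>2 t + 2 (Re u) A\<close> is the combination of \<open>t + A\<close> and
  \<open>t - A\<close> with the nonnegative weights \<open>1 + Re u\<close> and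
  \<open>1 - Re u\<close>.\<close>

lemma nrad_saI:
  assumes "vadj V A = A" "idm n t + A \<in> mcone V n" "idm n t - A \<in> mcone V n"
  shows "nrad V n t A"
  unfolding nrad_def
proof (intro allI impI)
  fix u assume "cmod u = 1"
  then have "\<bar>Re u\<bar> \<le> 1" using abs_Re_le_cmod[of u] by simp
  then have "mm (complex_of_real (1 + Re u)) (idm n t + A) + mm (complex_of_real (1 - Re u)) (idm n t - A) \<in> mcone V n"
    by (intro cone_add[OF cone_scale[OF assms(2)] cone_scale[OF assms(3)]]) auto
  also have "mm (complex_of_real (1 + Re u)) (idm n t + A) + mm (complex_of_real (1 - Re u)) (idm n t - A)
      = (mm (complex_of_real (1 + Re u) + complex_of_real (1 - Re u)) (idm n t))
        + mm (complex_of_real (1 + Re u) - complex_of_real (1 - Re u)) A"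
    by (simp only: mm.scale_right_distrib mm.scale_right_diff_distrib mm.scale_left_distrib
        mm.scale_left_diff_distrib) (simp add: algebra_simps)
  also have "complex_of_real (1 + Re u) + complex_of_real (1 - Re u) = complex_of_real 2"
    by (simp add: complex_eq_iff)
  also have "complex_of_real (1 + Re u) - complex_of_real (1 - Re u) = u + cnj u"
    by (simp add: complex_eq_iff)
  finally show "idm n (2 * t) + mm u A + mm (cnj u) (vadj V A) \<in> mcone V n"
    by (simp only: mm_idm mm.scale_left_distrib assms(1) add_ac)
qed

end

lemma smat_1: "smat 1 x = one_one x" "smat (Suc 0) x = one_one x"
  by (auto simp: smat_def one_one_def fun_eq_iff)

context mou
begin

definition vcomp :: "nat \<Rightarrow> (nat \<Rightarrow> complex) \<Rightarrow> 'v mtx \<Rightarrow> 'v" where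
  "vcomp n g A = (\<Sum>k<n. \<Sum>l<n. sm (cnj (g k) * g l) (A k l))"

lemma vcomp_add: "vcomp n g (A + B) = vcomp n g A + vcomp n g B"
  by (simp add: vcomp_def sm.scale_right_distrib sum.distrib)

lemma vcomp_mm: "vcomp n g (mm c A) = sm c (vcomp n g A)"
  by (simp add: vcomp_def mmap_def sm.scale_sum_right mult.commute)

lemma vcomp_vadj: "vcomp n g (vadj V A) = mstar V (vcomp n g A)"
proof -
  have "mstar V (vcomp n g A) = (\<Sum>k<n. \<Sum>l<n. sm (cnj (g l) * g k) (mstar V (A k l)))"
    by (simp add: vcomp_def star_sum star_sm mult.commute)
  also have "\<dots> = vcomp n g (vadj V A)"
    unfolding vcomp_def vadj_def by (rule sum.swap)
  finally show ?thesis by simp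
qed

lemma vcomp_idm: "vcomp n g (idm n t) = sm (complex_of_real (t * (\<Sum>k<n. (cmod (g k))\<^sup>2))) (munit V)"
proof -
  have "vcomp n g (idm n t) = (\<Sum>k<n. sm (complex_of_real (t * (cmod (g k))\<^sup>2)) (munit V))"
    unfolding vcomp_def
  proof (rule sum.cong[OF refl])
    fix k assume k: "k \<in> {..<n}"
    have "(\<Sum>l<n. sm (cnj (g k) * g l) (idm n t k l))
        = (\<Sum>l<n. if l = k then sm (cnj (g k) * g k) (sm (complex_of_real t) (munit V)) else 0)"
      using k by (intro sum.cong) (auto simp: smat_def)
    also have "\<dots> = sm (complex_of_real (t * (cmod (g k))\<^sup>2)) (munit V)"
      using k by (simp add: complex_norm_square mult.commute del: of_real_power)
    finally show "(\<Sum>l<n. sm (cnj (g k) * g l) (idm n t k l))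
      = sm (complex_of_real (t * (cmod (g k))\<^sup>2)) (munit V)" .
  qed
  then show ?thesis by (simp only: sum_distrib_left of_real_sum sm.scale_sum_left)
qed

lemma nrad_vcomp:
  assumes "nrad V n t A"
  shows "nrad V 1 (t * (\<Sum>k<n. (cmod (g k))\<^sup>2)) (one_one (vcomp n g A))"
  unfolding nrad_def
proof (intro allI impI)
  fix u assume u: "cmod u = 1"
  show "idm 1 (2 * (t * (\<Sum>k<n. (cmod (g k))\<^sup>2))) + mm u (one_one (vcomp n g A))
      + mm (cnj u) (vadj V (one_one (vcomp n g A))) \<in> mcone V 1"
    using cone_vec[OF nradD[OF assms u], of g]
    unfolding vcomp_def[symmetric] vcomp_add vcomp_mm vcomp_vadj vcomp_idm
    by (simp only: mm_one_one vadj_one_one one_one_add mult.assoc smat_1)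
qed

text \<open>The common shape of all averages over the unit scalars 1, -1, i, -i: the four vectors
  are the values of \<open>m + u x + (cnj u) y\<close>, and suitable weights select one of the three
  coefficients.\<close>

lemma polarization:
  "sm c1 (m + x + y) + sm c2 (m - x - y) + sm c3 (m + sm \<i> x - sm \<i> y) + sm c4 (m - sm \<i> x + sm \<i> y)
   = sm (c1 + c2 + c3 + c4) m + sm (c1 - c2 + \<i> * c3 - \<i> * c4) x + sm (c1 - c2 - \<i> * c3 + \<i> * c4) y"
  by (simp add: sm.scale_right_distrib sm.scale_right_diff_distrib sm.scale_left_distrib
      sm.scale_left_diff_distrib mult.commute)

text \<open>Polarization recovers \<open>A i j\<close> from four compressions of \<open>A\<close> to
  vectors \<open>e_i + w e_j\<close>. Their squared length is at most 4, the extreme case being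
  \<open>i = j\<close>; four terms with weight 1/4 give the constant 4.\<close>

lemma nrad_entry:
  assumes A: "nrad V n t A" "t \<ge> 0" and ij: "i < n" "j < n"
  shows "nrad V 1 (4 * t) (one_one (A i j))"
proof -
  define y where "y w = vcomp n (\<lambda>k. (if k = i then 1 else 0) + w * (if k = j then 1 else 0)) A" for w
  have y: "y w = A i i + sm w (A i j) + sm (cnj w) (A j i) + sm (cnj w * w) (A j j)" for w
  proof -
    have "y w = (\<Sum>k<n. \<Sum>l<n.
          (if k = i then (if l = i then A i i else 0) + (if l = j then sm w (A i j) else 0) else 0)
        + (if k = j then (if l = i then sm (cnj w) (A j i) else 0) + (if l = j then sm (cnj w * w) (A j j) else 0) else 0))"
      unfolding y_def vcomp_def
      by (intro sum.cong refl)
        (auto simp: sm.scale_left_distrib ring_distribs)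
    also have "\<dots> = (\<Sum>k<n. (if k = i then A i i + sm w (A i j) else 0)
        + (if k = j then sm (cnj w) (A j i) + sm (cnj w * w) (A j j) else 0))"
      using ij by (intro sum.cong refl) (simp add: sum.distrib)
    also have "\<dots> = A i i + sm w (A i j) + sm (cnj w) (A j i) + sm (cnj w * w) (A j j)"
      using ij by (simp add: sum.distrib add_ac)
    finally show ?thesis .
  qed
  have le4: "nrad V 1 (4 * t) (one_one (y w))" if w: "cmod w = 1" for w
  proof -
    define g where "g = (\<lambda>k. (if k = i then 1 else 0) + w * (if k = j then 1 else 0))"
    have "(\<Sum>k<n. (cmod (g k))\<^sup>2) \<le> (\<Sum>k<n. (if k = i then 2 else 0) + (if k = j then 2 else 0))"
    proof (rule sum_mono)
      fix k
      have "cmod (1 + w) \<le> 2" using norm_triangle_ineq[of 1 w] w by simp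
      then have "(cmod (1 + w))\<^sup>2 \<le> 2\<^sup>2" by (intro power_mono) auto
      then show "(cmod (g k))\<^sup>2 \<le> (if k = i then 2 else 0) + (if k = j then 2 else 0)"
        by (auto simp: g_def w)
    qed
    also have "\<dots> = 4" using ij by (simp add: sum.distrib)
    finally have "t * (\<Sum>k<n. (cmod (g k))\<^sup>2) \<le> 4 * t"
      using A(2) by (simp add: mult.commute mult_left_mono)
    then show ?thesis
      unfolding y_def g_def[symmetric] by (rule nrad_mono[OF nrad_vcomp[OF A(1)]])
  qed
  have q: "nrad V 1 (1/4 * (4 * t)) (one_one (sm c (y w)))" if "cmod w = 1" "cmod c = 1/4" for w c
    using nrad_mm[OF le4[OF that(1)], of c] that(2) by (simp add: mm_one_one)
  have "A i j = sm (1/4) (y 1) + sm (-1/4) (y (-1)) + sm (-\<i>/4) (y \<i>) + sm (\<i>/4) (y (-\<i>))"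
    using polarization[of "1/4" "A i i + A j j" "A i j" "A j i" "-1/4" "-\<i>/4" "\<i>/4"]
    by (simp add: y algebra_simps)
  moreover have "nrad V 1 (1/4 * (4 * t) + 1/4 * (4 * t) + 1/4 * (4 * t) + 1/4 * (4 * t))
    (one_one (sm (1/4) (y 1)) + one_one (sm (-1/4) (y (-1))) + one_one (sm (-\<i>/4) (y \<i>)) + one_one (sm (\<i>/4) (y (-\<i>))))"
    by (intro nrad_add q) (simp_all add: norm_divide)
  ultimately show ?thesis by (simp flip: one_one_add)
qed

text \<open>The radius condition for \<open>x\<close> at \<open>u\<close>, conjugated by the vector
  \<open>e_i + (cnj u) e_j\<close>, is positive. Averaging over four unit scalars leaves
  \<open>2 * t\<close> at the two diagonal places and \<open>x\<close> with its adjoint off the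
  diagonal. Filling up the diagonal turns this into \<open>4 * t\<close> times the identity, that
  is, radius \<open>2 * t\<close>.\<close>

lemma nrad_elm:
  assumes x: "nrad V 1 t (one_one x)" "t \<ge> 0" and ij: "i < n" "j < n"
  shows "nrad V n (2 * t) (elm i j x)"
proof -
  have key: "idm n (4 * t) + elm i j x + elm j i (mstar V x) \<in> mcone V n"
    if x: "nrad V 1 t (one_one x)" for x
  proof -
    define X where "X u = sm (2 * complex_of_real t) (munit V) + sm u x + sm (cnj u) (mstar V x)" for u
    define g where "g u a = (if a = i then 1 else 0) + cnj u * (if a = j then 1 else 0)" for u :: complex and a
    have "one_one (X u) \<in> mcone V 1" if "cmod u = 1" for u
      using nradD[OF x that] by (simp add: X_def mm_one_one vadj_one_one one_one_add smat_1)
    then have E: "(\<lambda>a b. sm (cnj (g u a) * g u b) (X u)) \<in> mcone V n" if "cmod u = 1" for u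
      using that ij by (intro cone_embed) (auto simp: g_def)
    define S where "S = (\<lambda>a b. sm (cnj (g 1 a) * g 1 b) (X 1)) + (\<lambda>a b. sm (cnj (g (-1) a) * g (-1) b) (X (-1)))
       + (\<lambda>a b. sm (cnj (g \<i> a) * g \<i> b) (X \<i>)) + (\<lambda>a b. sm (cnj (g (-\<i>) a) * g (-\<i>) b) (X (-\<i>)))"
    have "S \<in> mcone V n" unfolding S_def by (intro cone_add E) auto
    then have "mm (complex_of_real (1/4)) S \<in> mcone V n" by (rule cone_scale) simp
    moreover have "mm (complex_of_real (1/4)) S =
       elm i i (sm (complex_of_real (2 * t)) (munit V)) + elm j j (sm (complex_of_real (2 * t)) (munit V))
       + elm i j x + elm j i (mstar V x)"
    proof (intro ext)
      fix a b
      define p q r :: complex where "p = (if a = i \<and> b = i then 1 else 0) + (if a = j \<and> b = j then 1 else 0)"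
        and "q = (if a = i \<and> b = j then 1 else 0)" and "r = (if a = j \<and> b = i then 1 else 0)"
      have g: "cnj (g u a) * g u b = p + cnj u * q + u * r" if "cmod u = 1" for u
      proof -
        have "u * cnj u = 1" using that by (metis complex_norm_square of_real_1 one_power2)
        then show ?thesis by (auto simp: g_def p_def q_def r_def algebra_simps)
      qed
      have "S a b = sm (p + q + r) (X 1) + sm (p - q - r) (X (-1)) + sm (p - \<i> * q + \<i> * r) (X \<i>)
          + sm (p + \<i> * q - \<i> * r) (X (-\<i>))"
        by (simp add: S_def g)
      also have "\<dots> = sm (4 * p) (sm (2 * complex_of_real t) (munit V)) + sm (4 * q) x + sm (4 * r) (mstar V x)"
        using polarization[of "p + q + r" "sm (2 * complex_of_real t) (munit V)" x "mstar V x" "p - q - r"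
            "p - \<i> * q + \<i> * r" "p + \<i> * q - \<i> * r"]
        by (simp add: X_def algebra_simps)
      finally have "mm (complex_of_real (1/4)) S a b
          = sm p (sm (2 * complex_of_real t) (munit V)) + sm q x + sm r (mstar V x)"
        by (simp add: mmap_def sm.scale_right_distrib)
      also have "\<dots> = (elm i i (sm (complex_of_real (2 * t)) (munit V)) + elm j j (sm (complex_of_real (2 * t)) (munit V))
       + elm i j x + elm j i (mstar V x)) a b"
      proof -
        have "sm p y = elm i i y a b + elm j j y a b" for y
          unfolding p_def elm_def sm.scale_left_distrib by simp
        moreover have "sm q y = elm i j y a b" "sm r y = elm j i y a b" for y
          unfolding q_def r_def elm_def by simp_all
        ultimately show ?thesis by (simp del: sm.scale_scale)
      qed
      finally show "mm (complex_of_real (1/4)) S a b = (elm i i (sm (complex_of_real (2 * t)) (munit V))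
        + elm j j (sm (complex_of_real (2 * t)) (munit V)) + elm i j x + elm j i (mstar V x)) a b" .
    qed
    moreover have "idm n (2 * t) - elm k k (sm (complex_of_real (2 * t)) (munit V)) \<in> mcone V n" if "k < n" for k
    proof -
      have "one_one (sm (complex_of_real (2 * t)) (munit V)) \<in> mcone V 1"
        using cone_scale[OF unit_pos, of "2 * t"] \<open>t \<ge> 0\<close> by (simp add: mm_one_one)
      then have "(\<Sum>l\<in>{..<n} - {k}. elm l l (sm (complex_of_real (2 * t)) (munit V))) \<in> mcone V n"
        by (intro cone_sum cone_elm) auto
      then show ?thesis using that by (simp add: smat_elm sum_diff1)
    qed
    ultimately have "(elm i i (sm (complex_of_real (2 * t)) (munit V)) + elm j j (sm (complex_of_real (2 * t)) (munit V))
       + elm i j x + elm j i (mstar V x)) + (idm n (2 * t) - elm i i (sm (complex_of_real (2 * t)) (munit V)))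
       + (idm n (2 * t) - elm j j (sm (complex_of_real (2 * t)) (munit V))) \<in> mcone V n"
      using ij by (metis cone_add)
    moreover have "idm n (4 * t) = idm n (2 * t) + idm n (2 * t)"
      by (subst idm_add[symmetric]) simp
    ultimately show ?thesis by (simp add: algebra_simps)
  qed
  show ?thesis unfolding nrad_def
  proof (intro allI impI)
    fix u assume "cmod u = 1"
    then have "nrad V 1 t (one_one (sm u x))"
      using nrad_mm[OF x(1), of u] by (simp add: mm_one_one)
    from key[OF this] show "idm n (2 * (2 * t)) + mm u (elm i j x) + mm (cnj u) (vadj V (elm i j x)) \<in> mcone V n"
      by (simp add: mm_elm vadj_elm star_sm)
  qed
qed

lemma mtx_elm_sum:
  assumes "A \<in> mats n n"
  shows "A = (\<Sum>i<n. \<Sum>j<n. elm i j (A i j))"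
proof (intro ext)
  fix a b
  have "(\<Sum>i<n. \<Sum>j<n. elm i j (A i j)) a b = (\<Sum>i<n. \<Sum>j<n. if i = a then (if j = b then A a b else 0) else 0)"
    unfolding sum_apply by (intro sum.cong) (auto simp: elm_def)
  also have "\<dots> = (\<Sum>i<n. if i = a then (\<Sum>j<n. if j = b then A a b else 0) else 0)"
    by (intro sum.cong) auto
  finally show "A a b = (\<Sum>i<n. \<Sum>j<n. elm i j (A i j)) a b"
    using assms by (auto simp: mats_def)
qed

lemma nrad_entriesI:
  assumes "A \<in> mats n n" "t \<ge> 0" "\<And>i j. i < n \<Longrightarrow> j < n \<Longrightarrow> nrad V 1 t (one_one (A i j))"
  shows "nrad V n (2 * (real n)\<^sup>2 * t) A"
proof -
  have "nrad V n (\<Sum>i<n. \<Sum>j<n. 2 * t) (\<Sum>i<n. \<Sum>j<n. elm i j (A i j))"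
    using assms by (intro nrad_sum nrad_elm) auto
  then show ?thesis
    by (simp add: power2_eq_square mult.commute mult.left_commute flip: mtx_elm_sum[OF assms(1)])
qed

text \<open>The order unit bounds the real and the imaginary part, each from both sides.\<close>

lemma nrad_exists1: "\<exists>t\<ge>0. nrad V 1 t (one_one x)"
proof -
  have sa: "\<exists>t\<ge>0. nrad V 1 t (one_one x)" if x: "mstar V x = x" for x
  proof -
    obtain r where r: "r > 0" "one_one (sm (complex_of_real r) (munit V) - x) \<in> mcone V 1"
      using order_unit[OF x] by blast
    obtain s where s: "s > 0" "one_one (sm (complex_of_real s) (munit V) - (- x)) \<in> mcone V 1"
      using order_unit[of "- x"] x by (auto simp: star_minus)
    have "idm 1 (r + s) + one_one x \<in> mcone V 1"
      using cone_add[OF idm_cone[of r 1] s(2)] r(1)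
      by (simp add: smat_1 sm.scale_left_distrib add.assoc flip: one_one_add)
    moreover have "idm 1 (r + s) - one_one x \<in> mcone V 1"
      using cone_add[OF r(2) idm_cone[of s 1]] s(1)
      by (simp add: smat_1 sm.scale_left_distrib algebra_simps flip: one_one_add one_one_diff)
    ultimately have "nrad V 1 (r + s) (one_one x)"
      using x by (intro nrad_saI) (auto simp: vadj_one_one)
    then show ?thesis using r s by (intro exI[of _ "r + s"]) auto
  qed
  define h k where "h = x + mstar V x" and "k = sm \<i> (mstar V x - x)"
  have "mstar V h = h" by (simp add: h_def star_add star_star add.commute)
  moreover have "mstar V (mstar V x - x) = x - mstar V x"
    using star_add[of "mstar V x" "- x"] by (simp add: star_star star_minus)
  then have "mstar V k = k"
    unfolding k_def star_sm by (simp add: sm.scale_right_diff_distrib)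
  ultimately obtain s t where st: "s \<ge> 0" "nrad V 1 s (one_one h)" "t \<ge> 0" "nrad V 1 t (one_one k)"
    using sa by meson
  have "x = sm (1/2) h + sm (\<i>/2) k"
  proof -
    have "sm (1/2) h + sm (\<i>/2) k = sm (1/2) x + sm (1/2) x"
      by (simp add: h_def k_def sm.scale_right_distrib sm.scale_right_diff_distrib)
    also have "\<dots> = x" by (simp flip: sm.scale_left_distrib)
    finally show ?thesis by simp
  qed
  then have "one_one x = mm (1/2) (one_one h) + mm (\<i>/2) (one_one k)"
    by (simp add: mm_one_one one_one_add)
  moreover have "nrad V 1 (cmod (1/2) * s + cmod (\<i>/2) * t) (mm (1/2) (one_one h) + mm (\<i>/2) (one_one k))"
    by (intro nrad_add nrad_mm st)
  ultimately show ?thesis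
    using st by (intro exI[of _ "cmod (1/2) * s + cmod (\<i>/2) * t"]) auto
qed

lemma nrad_exists:
  assumes "A \<in> mats n n" shows "\<exists>t\<ge>0. nrad V n t A"
proof -
  define f where "f i j = (SOME t. t \<ge> 0 \<and> nrad V 1 t (one_one (A i j)))" for i j
  have f: "f i j \<ge> 0 \<and> nrad V 1 (f i j) (one_one (A i j))" for i j
    unfolding f_def using nrad_exists1 by (rule someI_ex)
  have "nrad V n (\<Sum>i<n. \<Sum>j<n. 2 * f i j) (\<Sum>i<n. \<Sum>j<n. elm i j (A i j))"
    using f by (intro nrad_sum nrad_elm) auto
  then have "nrad V n (\<Sum>i<n. \<Sum>j<n. 2 * f i j) A"
    by (simp flip: mtx_elm_sum[OF assms])
  moreover have "(\<Sum>i<n. \<Sum>j<n. 2 * f i j) \<ge> 0" using f by (intro sum_nonneg) auto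
  ultimately show ?thesis by blast
qed

lemma nrad_nonneg:
  assumes "munit V \<noteq> 0" "n \<ge> 1" "nrad V n t A"
  shows "t \<ge> 0"
proof -
  have "(idm n (2 * t) + mm 1 A + mm (cnj 1) (vadj V A)) + (idm n (2 * t) + mm (-1) A + mm (cnj (-1)) (vadj V A)) \<in> mcone V n"
    by (intro cone_add nradD[OF assms(3)]) auto
  then have "idm n (2 * t) + idm n (2 * t) \<in> mcone V n" by (simp add: algebra_simps)
  then have "2 * t + 2 * t \<ge> 0"
    by (intro idm_cone_nonneg[OF assms(1,2)]) (simp only: idm_add)
  then show ?thesis by simp
qed

text \<open>The Archimedean axiom lets \<open>t\<close> tend to 0. The resulting positive elements
  for \<open>u\<close> and \<open>- u\<close> are negatives of each other, hence zero because the
  cone is proper; \<open>u = 1\<close> and \<open>u = \<i>\<close> then annihilate the real and the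
  imaginary part.\<close>

lemma nrad_arch:
  assumes A: "A \<in> mats n n" and "\<And>t. t > 0 \<Longrightarrow> nrad V n t A"
  shows "A = 0"
proof -
  have c: "mm u A + mm (cnj u) (vadj V A) \<in> mcone V n" if "cmod u = 1" for u
  proof (rule cone_arch)
    show "mm u A + mm (cnj u) (vadj V A) \<in> mats n n"
      using A by (intro mats_add mm_mats vadj_mats)
    fix r :: real assume "r > 0"
    then show "mm u A + mm (cnj u) (vadj V A) + idm n r \<in> mcone V n"
      using nradD[OF assms(2)[of "r / 2"] that] by (simp add: add_ac)
  qed
  have z: "mm u A + mm (cnj u) (vadj V A) = 0" if "cmod u = 1" for u
    using c[OF that] c[of "- u"] that by (intro cone_proper[of _ n]) (auto simp: algebra_simps)
  have "A + vadj V A = 0" using z[of 1] by simp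
  moreover have "mm \<i> (A - vadj V A) = 0" using z[of \<i>] by (simp add: mm.scale_right_diff_distrib)
  then have "A - vadj V A = 0" by (simp only: mm.scale_eq_0_iff) simp
  ultimately have "A + A = 0" by (metis add_diff_cancel_left' diff_add_cancel eq_iff_diff_eq_0)
  then have "mm (1 + 1) A = 0" by (simp only: mm.scale_left_distrib mm.scale_one)
  then show ?thesis by (simp only: mm.scale_eq_0_iff) simp
qed

end

section \<open>Completely positive maps and separation by matrix states\<close>

text \<open>Unital maps are not closed under sums and compressions, so the constructions work with
  arbitrary completely positive maps and normalise at the end.\<close>

definition CPM :: "('v::ab_group_add) mous \<Rightarrow> nat \<Rightarrow> ('v \<Rightarrow> complex mtx) set" where
  "CPM V n = {\<phi>. (\<forall>x y i j. \<phi> (x + y) i j = \<phi> x i j + \<phi> y i j) \<and>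
     (\<forall>c x i j. \<phi> (msmul V c x) i j = c * \<phi> x i j) \<and> (\<forall>x. \<phi> x \<in> mats n n) \<and>
     (\<forall>r a x. a \<in> mcone V r \<longrightarrow> Im (sform r n \<phi> a x x) = 0 \<and> 0 \<le> Re (sform r n \<phi> a x x))}"

lemma CS_iff: "\<phi> \<in> CS V n \<longleftrightarrow> \<phi> \<in> CPM V n \<and> \<phi> (munit V) = smat n 1"
  by (simp add: CS_def CPM_def cpsd_ampl_iff) blast

definition cconj :: "nat \<Rightarrow> nat \<Rightarrow> complex mtx \<Rightarrow> ('v \<Rightarrow> complex mtx) \<Rightarrow> 'v \<Rightarrow> complex mtx" where
  "cconj n m g \<phi> v = (\<lambda>k l. if k < m \<and> l < m
     then \<Sum>p<n. \<Sum>q<n. cnj (g p k) * \<phi> v p q * g q l else 0)"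

lemma sform_cconj:
  "sform r m (cconj n m g \<phi>) A y x
    = sform r n \<phi> A (\<lambda>i p. \<Sum>k<m. g p k * y i k) (\<lambda>i p. \<Sum>k<m. g p k * x i k)"
proof -
  have "(\<Sum>k<m. \<Sum>l<m. cnj (y i k) * cconj n m g \<phi> v k l * x j l)
     = (\<Sum>p<n. \<Sum>q<n. cnj (\<Sum>k<m. g p k * y i k) * \<phi> v p q * (\<Sum>l<m. g q l * x j l))" for i j v
  proof -
    have "(\<Sum>k<m. \<Sum>l<m. cnj (y i k) * cconj n m g \<phi> v k l * x j l)
      = (\<Sum>k<m. \<Sum>l<m. \<Sum>p<n. \<Sum>q<n. cnj (y i k) * cnj (g p k) * \<phi> v p q * (g q l * x j l))"
      by (intro sum.cong refl) (simp add: cconj_def sum_distrib_left sum_distrib_right mult_ac)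
    also have "\<dots> = (\<Sum>k<m. \<Sum>p<n. \<Sum>l<m. \<Sum>q<n. cnj (y i k) * cnj (g p k) * \<phi> v p q * (g q l * x j l))"
      by (intro sum.cong refl sum.swap)
    also have "\<dots> = (\<Sum>p<n. \<Sum>k<m. \<Sum>l<m. \<Sum>q<n. cnj (y i k) * cnj (g p k) * \<phi> v p q * (g q l * x j l))"
      by (rule sum.swap)
    also have "\<dots> = (\<Sum>p<n. \<Sum>k<m. \<Sum>q<n. \<Sum>l<m. cnj (y i k) * cnj (g p k) * \<phi> v p q * (g q l * x j l))"
      by (intro sum.cong refl sum.swap)
    also have "\<dots> = (\<Sum>p<n. \<Sum>q<n. \<Sum>k<m. \<Sum>l<m. cnj (y i k) * cnj (g p k) * \<phi> v p q * (g q l * x j l))"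
      by (intro sum.cong refl sum.swap)
    also have "\<dots> = (\<Sum>p<n. \<Sum>q<n. cnj (\<Sum>k<m. g p k * y i k) * \<phi> v p q * (\<Sum>l<m. g q l * x j l))"
      by (intro sum.cong refl) (simp add: sum_distrib_left sum_distrib_right mult_ac)
    finally show ?thesis .
  qed
  then show ?thesis by (simp add: sform_def)
qed

context mou
begin

lemma CPM_add: "\<phi> \<in> CPM V n \<Longrightarrow> \<phi> (x + y) i j = \<phi> x i j + \<phi> y i j"
  and CPM_sm: "\<phi> \<in> CPM V n \<Longrightarrow> \<phi> (sm c x) i j = c * \<phi> x i j"
  and CPM_mats: "\<phi> \<in> CPM V n \<Longrightarrow> \<phi> x \<in> mats n n"
  and CPM_pos: "\<phi> \<in> CPM V n \<Longrightarrow> A \<in> mcone V r \<Longrightarrow> 0 \<le> Re (sform r n \<phi> A z z)"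
  and CPM_real: "\<phi> \<in> CPM V n \<Longrightarrow> A \<in> mcone V r \<Longrightarrow> Im (sform r n \<phi> A z z) = 0"
  by (simp_all add: CPM_def)

lemma CS_CPM: "\<phi> \<in> CS V n \<Longrightarrow> \<phi> \<in> CPM V n"
  by (simp add: CS_iff)

lemma CPM_0: "\<phi> \<in> CPM V n \<Longrightarrow> \<phi> 0 i j = 0"
  using CPM_sm[of \<phi> n 0 0] by simp

lemma CPM_uminus: "\<phi> \<in> CPM V n \<Longrightarrow> \<phi> (- x) i j = - \<phi> x i j"
  using CPM_sm[of \<phi> n "-1" x] by simp

lemma CPM_diff: "\<phi> \<in> CPM V n \<Longrightarrow> \<phi> (x - y) i j = \<phi> x i j - \<phi> y i j"
  using CPM_add[of \<phi> n x "- y"] by (simp add: CPM_uminus)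

lemma sform_add: "\<phi> \<in> CPM V n \<Longrightarrow> sform r n \<phi> (A + B) y x = sform r n \<phi> A y x + sform r n \<phi> B y x"
  by (simp add: sform_def CPM_add ring_distribs sum.distrib)

lemma sform_mm: "\<phi> \<in> CPM V n \<Longrightarrow> sform r n \<phi> (mm c A) y x = c * sform r n \<phi> A y x"
  by (simp add: sform_def mmap_def CPM_sm sum_distrib_left mult_ac)

lemma sform_one_one: "sform 1 n \<phi> (one_one v) y x = (\<Sum>p<n. \<Sum>q<n. cnj (y 0 p) * \<phi> v p q * x 0 q)"
  by (simp add: sform_def one_one_def)

text \<open>Positivity is stated through diagonal values of the form only, so the symmetry of the
  entries is recovered by polarization with \<open>w = 1\<close> and
  \<open>w = \<i>\<close>.\<close>

lemma CPM_pos_entry_hermitian: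
  assumes "\<phi> \<in> CPM V n" "one_one v \<in> mcone V 1" "p < n" "q < n"
  shows "\<phi> v p q = cnj (\<phi> v q p)"
proof (cases "p = q")
  case True
  define x :: "complex mtx" where "x = (\<lambda>i k. if k = p then 1 else 0)"
  have "sform 1 n \<phi> (one_one v) x x = \<phi> v p p"
  proof -
    have "sform 1 n \<phi> (one_one v) x x = (\<Sum>k<n. if k = p then (\<Sum>l<n. if l = p then \<phi> v p p else 0) else 0)"
      unfolding sform_one_one x_def
      by (intro sum.cong refl) (simp add: if_distrib[of "(*) _"] if_distrib[of cnj] cong: if_cong)
    then show ?thesis using assms by simp
  qed
  then show ?thesis
    using CPM_real[OF assms(1,2), of x] True by (simp add: complex_eq_iff)
next
  case False
  define x :: "complex \<Rightarrow> complex mtx" where "x w = (\<lambda>i k. if k = p then 1 else if k = q then w else 0)" for w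
  have f: "sform 1 n \<phi> (one_one v) (x w) (x w)
      = \<phi> v p p + w * \<phi> v p q + cnj w * \<phi> v q p + cnj w * w * \<phi> v q q" for w
  proof -
    have "sform 1 n \<phi> (one_one v) (x w) (x w) = (\<Sum>k<n.
        (if k = p then (\<Sum>l<n. (if l = p then \<phi> v p p else 0) + (if l = q then w * \<phi> v p q else 0)) else 0)
      + (if k = q then (\<Sum>l<n. (if l = p then cnj w * \<phi> v q p else 0) + (if l = q then cnj w * w * \<phi> v q q else 0)) else 0))"
    proof -
      have "(\<Sum>l<n. cnj (x w 0 k) * \<phi> v k l * x w 0 l) =
        (if k = p then (\<Sum>l<n. (if l = p then \<phi> v p p else 0) + (if l = q then w * \<phi> v p q else 0)) else 0)
      + (if k = q then (\<Sum>l<n. (if l = p then cnj w * \<phi> v q p else 0) + (if l = q then cnj w * w * \<phi> v q q else 0)) else 0)" for k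
      proof -
        have *: "cnj (x w 0 k) * \<phi> v k l * x w 0 l
          = (if k = p then (if l = p then \<phi> v p p else 0) + (if l = q then w * \<phi> v p q else 0) else 0)
          + (if k = q then (if l = p then cnj w * \<phi> v q p else 0) + (if l = q then cnj w * w * \<phi> v q q else 0) else 0)" for l
          using False by (simp add: x_def)
        show ?thesis unfolding * using False by (cases "k = p"; cases "k = q") (simp_all add: sum.distrib)
      qed
      then show ?thesis unfolding sform_one_one by (rule sum.cong[OF refl])
    qed
    then show ?thesis using assms by (simp add: sum.distrib)
  qed
  have d: "Im (\<phi> v k k) = 0" if "k < n" for k
  proof -
    have "sform 1 n \<phi> (one_one v) (\<lambda>i l. if l = k then 1 else 0) (\<lambda>i l. if l = k then 1 else 0)
        = (\<Sum>a<n. if a = k then (\<Sum>l<n. if l = k then \<phi> v k k else 0) else 0)"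
      unfolding sform_one_one
      by (intro sum.cong refl) (simp add: if_distrib[of "(*) _"] if_distrib[of cnj] cong: if_cong)
    then show ?thesis
      using CPM_real[OF assms(1,2), of "\<lambda>i l. if l = k then 1 else 0"] that by simp
  qed
  show ?thesis
    using CPM_real[OF assms(1,2), of "x 1"] CPM_real[OF assms(1,2), of "x \<i>"] d[OF assms(3)] d[OF assms(4)]
    unfolding f by (simp add: complex_eq_iff)
qed

lemma sa_decomp:
  obtains h k where "mstar V h = h" "mstar V k = k" "v = h + sm \<i> k"
proof
  define h k where "h = sm (1/2) (v + mstar V v)" and "k = sm (\<i>/2) (mstar V v - v)"
  show "mstar V h = h" by (simp add: h_def star_sm star_add star_star add.commute)
  have "mstar V (mstar V v - v) = v - mstar V v"
    using star_add[of "mstar V v" "- v"] by (simp add: star_star star_minus)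
  then show "mstar V k = k"
    unfolding k_def star_sm by (simp add: sm.scale_right_diff_distrib)
  have "h + sm \<i> k = sm (1/2) v + sm (1/2) v"
    by (simp add: h_def k_def sm.scale_right_distrib sm.scale_right_diff_distrib)
  then show "v = h + sm \<i> k" by (simp flip: sm.scale_left_distrib)
qed

text \<open>A self-adjoint element is a multiple of the unit minus a positive element, so the
  symmetry known for positive elements carries over; the general case follows by splitting into real
  and imaginary part.\<close>

lemma CPM_star:
  assumes \<phi>: "\<phi> \<in> CPM V n"
  shows "\<phi> (mstar V v) p q = cnj (\<phi> v q p)"
proof (cases "p < n \<and> q < n")
  case True
  have sa: "\<phi> h p q = cnj (\<phi> h q p)" if h: "mstar V h = h" for h
  proof -
    obtain r where r: "r > 0" "one_one (sm (complex_of_real r) (munit V) - h) \<in> mcone V 1"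
      using order_unit[OF h] by blast
    have "h = sm (complex_of_real r) (munit V) + - (sm (complex_of_real r) (munit V) - h)" by simp
    then have *: "\<phi> h a b = complex_of_real r * \<phi> (munit V) a b - \<phi> (sm (complex_of_real r) (munit V) - h) a b" for a b
      by (metis CPM_add[OF \<phi>] CPM_sm[OF \<phi>] CPM_uminus[OF \<phi>] diff_conv_add_uminus)
    show ?thesis
      using True CPM_pos_entry_hermitian[OF \<phi> unit_pos, of p q] CPM_pos_entry_hermitian[OF \<phi> r(2), of p q]
      by (simp add: *)
  qed
  obtain h k where hk: "mstar V h = h" "mstar V k = k" "v = h + sm \<i> k" using sa_decomp .
  show ?thesis
    using sa[OF hk(1)] sa[OF hk(2)]
    by (simp add: hk star_add star_sm CPM_add[OF \<phi>] CPM_sm[OF \<phi>] CPM_diff[OF \<phi>])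
next
  case False
  then show ?thesis using CPM_mats[OF \<phi>] by (auto simp: mats_def)
qed

lemma sform_vadj:
  assumes "\<phi> \<in> CPM V n"
  shows "sform r n \<phi> (vadj V A) y x = cnj (sform r n \<phi> A x y)"
proof -
  have "cnj (sform r n \<phi> A x y) = (\<Sum>i<r. \<Sum>j<r. \<Sum>p<n. \<Sum>q<n. x i p * cnj (\<phi> (A i j) p q) * cnj (y j q))"
    by (simp add: sform_def)
  also have "\<dots> = (\<Sum>j<r. \<Sum>i<r. \<Sum>p<n. \<Sum>q<n. x i p * cnj (\<phi> (A i j) p q) * cnj (y j q))"
    by (rule sum.swap)
  also have "\<dots> = (\<Sum>j<r. \<Sum>i<r. \<Sum>q<n. \<Sum>p<n. x i p * cnj (\<phi> (A i j) p q) * cnj (y j q))"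
    by (intro sum.cong refl sum.swap)
  also have "\<dots> = sform r n \<phi> (vadj V A) y x"
    unfolding sform_def vadj_def CPM_star[OF assms]
    by (intro sum.cong refl) (simp add: mult_ac)
  finally show ?thesis by simp
qed

lemma sform_idm:
  assumes "\<phi> \<in> CS V n"
  shows "sform r n \<phi> (idm r t) x x = complex_of_real (t * (vnorm2 r n x)\<^sup>2)"
proof -
  have \<phi>: "\<phi> \<in> CPM V n" and u: "\<phi> (munit V) = smat n 1" using assms by (auto simp: CS_iff)
  have "sform r n \<phi> (idm r t) x x = (\<Sum>i<r. \<Sum>j<r. if j = i then
      (\<Sum>p<n. \<Sum>q<n. if q = p then cnj (x i p) * complex_of_real t * x i p else 0) else 0)"
    unfolding sform_def
  proof (intro sum.cong refl)
    fix i j assume ij: "i \<in> {..<r}" "j \<in> {..<r}"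
    show "(\<Sum>p<n. \<Sum>q<n. cnj (x i p) * \<phi> (idm r t i j) p q * x j q) = (if j = i then
      (\<Sum>p<n. \<Sum>q<n. if q = p then cnj (x i p) * complex_of_real t * x i p else 0) else 0)"
    proof (cases "i = j")
      case True
      then show ?thesis using ij
        by (auto simp: smat_def CPM_sm[OF \<phi>] u if_distrib[of "(*) _"] if_distrib[of "\<lambda>z. z * _"]
            intro!: sum.cong cong: if_cong)
    next
      case False
      then show ?thesis by (simp add: smat_def CPM_0[OF \<phi>])
    qed
  qed
  also have "\<dots> = complex_of_real (t * (vnorm2 r n x)\<^sup>2)"
    by (simp add: vnorm2_squared sum_distrib_left complex_norm_square mult_ac del: of_real_power)
  finally show ?thesis .
qed

text \<open>If \<open>u\<close> rotates the value \<open>z\<close> of the form onto the negative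
  real axis, then positivity of the radius condition bounds twice the modulus of \<open>z\<close> by
  \<open>2 * t\<close> times the squared length of \<open>x\<close>.\<close>

lemma nrad_sform_le:
  assumes "\<phi> \<in> CS V n" "nrad V r t A"
  shows "cmod (sform r n \<phi> A x x) \<le> t * (vnorm2 r n x)\<^sup>2"
proof -
  define z where "z = sform r n \<phi> A x x"
  obtain u where u: "cmod u = 1" "u * z = - complex_of_real (cmod z)"
  proof (cases "z = 0")
    case True then show ?thesis using that[of 1] by simp
  next
    case False
    moreover have "cnj z * z = complex_of_real (cmod z) * complex_of_real (cmod z)"
      using complex_norm_square[of z] by (simp add: power2_eq_square mult.commute)
    ultimately have "- cnj z / complex_of_real (cmod z) * z = - complex_of_real (cmod z)"
      by (simp add: field_simps)
    then show ?thesis using that[of "- cnj z / complex_of_real (cmod z)"] False by (simp add: norm_divide)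
  qed
  have "0 \<le> Re (sform r n \<phi> (idm r (2 * t) + mm u A + mm (cnj u) (vadj V A)) x x)"
    by (rule CPM_pos[OF CS_CPM[OF assms(1)] nradD[OF assms(2) u(1)]])
  also have "sform r n \<phi> (idm r (2 * t) + mm u A + mm (cnj u) (vadj V A)) x x
      = complex_of_real (2 * t * (vnorm2 r n x)\<^sup>2) + u * z + cnj (u * z)"
    by (simp only: sform_add[OF CS_CPM[OF assms(1)]] sform_mm[OF CS_CPM[OF assms(1)]]
        sform_vadj[OF CS_CPM[OF assms(1)]] sform_idm[OF assms(1)] z_def complex_cnj_mult)
  finally show ?thesis unfolding u(2) z_def[symmetric] by simp
qed

lemma CPM_cconj:
  assumes \<phi>: "\<phi> \<in> CPM V n"
  shows "cconj n m g \<phi> \<in> CPM V m"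
  unfolding CPM_def
proof (intro CollectI conjI allI impI)
  show "cconj n m g \<phi> (x + y) i j = cconj n m g \<phi> x i j + cconj n m g \<phi> y i j" for x y i j
    by (simp add: cconj_def CPM_add[OF \<phi>] ring_distribs sum.distrib)
  show "cconj n m g \<phi> (sm c x) i j = c * cconj n m g \<phi> x i j" for c x i j
    by (simp add: cconj_def CPM_sm[OF \<phi>] sum_distrib_left mult_ac)
  show "cconj n m g \<phi> x \<in> mats m m" for x
    by (auto simp: mats_def cconj_def)
qed (use CPM_real[OF \<phi>] CPM_pos[OF \<phi>] in \<open>auto simp: sform_cconj\<close>)

lemma CPM_plus:
  assumes \<phi>: "\<phi> \<in> CPM V n" and \<psi>: "\<psi> \<in> CPM V n"
  shows "(\<lambda>v i j. \<phi> v i j + \<psi> v i j) \<in> CPM V n"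
proof -
  have "sform r n (\<lambda>v i j. \<phi> v i j + \<psi> v i j) A x x = sform r n \<phi> A x x + sform r n \<psi> A x x" for r A x
    by (simp add: sform_def ring_distribs sum.distrib)
  then show ?thesis
    using CPM_mats[OF \<phi>] CPM_mats[OF \<psi>]
    by (auto simp: CPM_def mats_def CPM_add[OF \<phi>] CPM_add[OF \<psi>] CPM_sm[OF \<phi>] CPM_sm[OF \<psi>]
        CPM_real[OF \<phi>] CPM_real[OF \<psi>] CPM_pos[OF \<phi>] CPM_pos[OF \<psi>] ring_distribs)
qed

lemma CPM_scale:
  assumes \<phi>: "\<phi> \<in> CPM V n" and "c \<ge> 0"
  shows "(\<lambda>v i j. complex_of_real c * \<phi> v i j) \<in> CPM V n"
proof -
  have "sform r n (\<lambda>v i j. complex_of_real c * \<phi> v i j) A x x = complex_of_real c * sform r n \<phi> A x x" for r A x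
    by (simp add: sform_def sum_distrib_left mult_ac)
  then show ?thesis
    using CPM_mats[OF \<phi>] assms(2)
    by (auto simp: CPM_def mats_def CPM_add[OF \<phi>] CPM_sm[OF \<phi>] CPM_real[OF \<phi>] CPM_pos[OF \<phi>] ring_distribs)
qed

lemma CPM_sum:
  assumes "\<And>k. k < (m::nat) \<Longrightarrow> f k \<in> CPM V n"
  shows "(\<lambda>v i j. \<Sum>k<m. f k v i j) \<in> CPM V n"
  using assms
proof (induction m)
  case 0
  show ?case by (auto simp: CPM_def mats_def sform_def)
next
  case (Suc m)
  then show ?case using CPM_plus[of "\<lambda>v i j. \<Sum>k<m. f k v i j" n "f m"] by simp
qed

text \<open>These are real parts of positive functionals on n-by-n matrices, defined on the whole
  type \<open>'v mtx\<close> because Hahn-Banach is applied there; \<open>cpx\<close> restores the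
  complex functional, and invariance under \<open>vadj\<close> makes it hermitian.\<close>

definition posf :: "nat \<Rightarrow> ('v mtx \<Rightarrow> real) \<Rightarrow> bool" where
  "posf n G \<longleftrightarrow> (\<forall>A B. G (A + B) = G A + G B) \<and> (\<forall>r A. G (mm (complex_of_real r) A) = r * G A) \<and>
     (\<forall>A\<in>mcone V n. G A \<ge> 0) \<and> (\<forall>A\<in>mats n n. G (vadj V A) = G A)"

definition cpx :: "('v mtx \<Rightarrow> real) \<Rightarrow> 'v mtx \<Rightarrow> complex" where
  "cpx G X = Complex (G X) (- G (mm \<i> X))"

text \<open>The correspondence between positive functionals on M_n(V) and completely positive maps
  from V into M_n, without normalisation.\<close>

definition cpmap :: "nat \<Rightarrow> ('v mtx \<Rightarrow> real) \<Rightarrow> 'v \<Rightarrow> complex mtx" where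
  "cpmap n G v = (\<lambda>p q. if p < n \<and> q < n then cpx G (elm p q v) else 0)"

lemma cpx_linear:
  assumes "\<And>A B. G (A + B) = G A + G B" "\<And>r A. G (mm (complex_of_real r) A) = r * G A"
  shows "cpx G (A + B) = cpx G A + cpx G B" "cpx G (mm c A) = c * cpx G A"
    "cpx G (\<Sum>i\<in>S. f i) = (\<Sum>i\<in>S. cpx G (f i))"
proof -
  show add: "cpx G (A + B) = cpx G A + cpx G B" for A B
    by (simp add: cpx_def assms(1) mm.scale_right_distrib complex_eq_iff)
  have *: "G (mm c A) = Re c * G A + Im c * G (mm \<i> A)" for c A
  proof -
    have "mm c A = mm (complex_of_real (Re c)) A + mm (complex_of_real (Im c)) (mm \<i> A)"
      by (simp add: complex_eq mult.commute flip: mm.scale_left_distrib)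
    then show ?thesis by (simp only: assms)
  qed
  show "cpx G (mm c A) = c * cpx G A"
    by (simp add: cpx_def *[of c] *[of "\<i> * c"] complex_eq_iff)
  have "G 0 = 0" using assms(2)[of 0 0] by simp
  then have "cpx G 0 = 0" by (simp add: cpx_def complex_eq_iff)
  then show "cpx G (\<Sum>i\<in>S. f i) = (\<Sum>i\<in>S. cpx G (f i))"
    by (induction S rule: infinite_finite_induct) (simp_all add: add)
qed

lemma elm_add: "elm i j (x + y) = elm i j x + elm i j y" for x y :: 'v
  by (auto simp: elm_def fun_eq_iff)

lemma elm_sum: "elm i j (\<Sum>k\<in>S. f k) = (\<Sum>k\<in>S. elm i j (f k))" for f :: "_ \<Rightarrow> 'v"
proof -
  have "elm i j (0::'v) = 0" by (auto simp: elm_def fun_eq_iff)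
  then show ?thesis by (induction S rule: infinite_finite_induct) (auto simp: elm_add)
qed

lemma sform_cpmap:
  assumes lin: "\<And>A B. G (A + B) = G A + G B" "\<And>r A. G (mm (complex_of_real r) A) = r * G A"
  shows "sform r n (cpmap n G) C y x
    = cpx G (\<Sum>p<n. \<Sum>q<n. elm p q (\<Sum>k<r. \<Sum>l<r. sm (cnj (y k p) * x l q) (C k l)))"
proof -
  have "cpx G (\<Sum>p<n. \<Sum>q<n. elm p q (\<Sum>k<r. \<Sum>l<r. sm (cnj (y k p) * x l q) (C k l)))
     = (\<Sum>p<n. \<Sum>q<n. \<Sum>k<r. \<Sum>l<r. cnj (y k p) * x l q * cpx G (elm p q (C k l)))"
    by (simp add: elm_sum cpx_linear[OF lin] flip: mm_elm)
  also have "\<dots> = (\<Sum>p<n. \<Sum>k<r. \<Sum>q<n. \<Sum>l<r. cnj (y k p) * x l q * cpx G (elm p q (C k l)))"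
    by (intro sum.cong refl sum.swap)
  also have "\<dots> = (\<Sum>k<r. \<Sum>p<n. \<Sum>q<n. \<Sum>l<r. cnj (y k p) * x l q * cpx G (elm p q (C k l)))"
    by (rule sum.swap)
  also have "\<dots> = (\<Sum>k<r. \<Sum>p<n. \<Sum>l<r. \<Sum>q<n. cnj (y k p) * x l q * cpx G (elm p q (C k l)))"
    by (intro sum.cong refl sum.swap)
  also have "\<dots> = (\<Sum>k<r. \<Sum>l<r. \<Sum>p<n. \<Sum>q<n. cnj (y k p) * x l q * cpx G (elm p q (C k l)))"
    by (intro sum.cong refl sum.swap)
  also have "\<dots> = sform r n (cpmap n G) C y x"
    unfolding sform_def by (intro sum.cong refl) (auto simp: cpmap_def)
  finally show ?thesis by simp
qed

lemma posf_linear: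
  assumes "posf n G"
  shows "G (A + B) = G A + G B" "G (mm (complex_of_real r) A) = r * G A"
    "A \<in> mcone V n \<Longrightarrow> G A \<ge> 0" "A \<in> mats n n \<Longrightarrow> G (vadj V A) = G A"
  using assms by (auto simp: posf_def)

lemma cpx_vadj:
  assumes "posf n G" "A \<in> mats n n"
  shows "cpx G (vadj V A) = cnj (cpx G A)"
proof -
  have "vadj V (mm (-\<i>) A) = mm \<i> (vadj V A)" by (subst vadj_mm) simp
  then have "G (mm \<i> (vadj V A)) = G (vadj V (mm (-\<i>) A))" by simp
  also have "\<dots> = G (mm (complex_of_real (-1)) (mm \<i> A))"
    using assms by (subst posf_linear(4)) (auto intro: mm_mats mats_uminus)
  also have "\<dots> = - G (mm \<i> A)" by (subst posf_linear(2)[OF assms(1)]) simp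
  finally show ?thesis using assms by (simp add: cpx_def posf_linear complex_eq_iff)
qed

text \<open>The form over \<open>A\<close> at \<open>x\<close> is the functional at the conjugate of
  \<open>A\<close> by \<open>x\<close>, and this conjugate lies in the cone of size \<open>n\<close>
  whatever the size of \<open>A\<close>. Positivity at one level thus becomes complete
  positivity.\<close>

lemma cpmap_CPM:
  assumes G: "posf n G"
  shows "cpmap n G \<in> CPM V n"
  unfolding CPM_def
proof (intro CollectI conjI allI impI)
  note lin = cpx_linear[OF posf_linear(1,2)[OF G]]
  show "cpmap n G (x + y) i j = cpmap n G x i j + cpmap n G y i j" for x y i j
    by (simp add: cpmap_def elm_add lin)
  show "cpmap n G (sm c x) i j = c * cpmap n G x i j" for c x i j
    by (simp add: cpmap_def lin flip: mm_elm)
  show "cpmap n G x \<in> mats n n" for x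
    by (auto simp: mats_def cpmap_def)
next
  fix r A x assume A: "A \<in> mcone V r"
  define X where "X = mconj V r (\<lambda>k p. if p < n then x k p else 0) A"
  have X: "X \<in> mcone V n" unfolding X_def by (rule cone_conj[OF A]) auto
  have "(\<Sum>p<n. \<Sum>q<n. elm p q (\<Sum>k<r. \<Sum>l<r. sm (cnj (x k p) * x l q) (A k l)))
     = (\<Sum>p<n. \<Sum>q<n. elm p q (X p q))"
    by (intro sum.cong refl) (auto simp: X_def mconj_def)
  also have "\<dots> = X" using mtx_elm_sum[OF cone_mats[OF X]] by simp
  finally have eq: "sform r n (cpmap n G) A x x = cpx G X"
    by (simp add: sform_cpmap[OF posf_linear(1,2)[OF G]])
  have "cpx G X = cnj (cpx G X)"
    using cpx_vadj[OF G cone_mats[OF X]] cone_sa[OF X] by simp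
  then show "Im (sform r n (cpmap n G) A x x) = 0"
    unfolding eq by (metis Im_complex_of_real Reals_cnj_iff complex_is_Real_iff)
  show "Re (sform r n (cpmap n G) A x x) \<ge> 0"
    using posf_linear(3)[OF G X] by (simp add: eq cpx_def)
qed

end

text \<open>Hahn-Banach works on the whole type of infinite matrices; truncation extends conditions
  on n-by-n matrices to it.\<close>

definition trunc :: "nat \<Rightarrow> 'v::zero mtx \<Rightarrow> 'v mtx" where
  "trunc n A = (\<lambda>i j. if i < n \<and> j < n then A i j else 0)"

lemma trunc_mats: "trunc n A \<in> mats n n"
  by (auto simp: trunc_def mats_def)

lemma trunc_id: "A \<in> mats n n \<Longrightarrow> trunc n A = A"
  by (auto simp: trunc_def mats_def fun_eq_iff)

lemma trunc_add: "trunc n (A + B) = trunc n A + trunc n (B :: 'v::ab_group_add mtx)"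
  by (auto simp: trunc_def fun_eq_iff)

lemma trunc_0 [simp]: "trunc n (0 :: 'v::ab_group_add mtx) = 0"
  by (auto simp: trunc_def fun_eq_iff)

lemma cone_trivial:
  fixes V :: "('v::ab_group_add) mous" and v :: 'v
  assumes "mou V" "munit V = 0" shows "v = 0"
proof -
  interpret mou V by fact
  obtain t where "nrad V 1 t (one_one v)" using nrad_exists1 by blast
  then have "nrad V 1 s (one_one v)" for s
    unfolding nrad_def assms(2) by simp
  then have "one_one v = 0"
    by (intro nrad_arch[of _ 1] one_one_mats)
  then show ?thesis using one_one_inject[of v 0] by (simp add: one_one_def zero_fun_def)
qed

lemma hform_diag: "hform (\<lambda>p q. if p = q \<and> p < n then c else 0) n x x = c * complex_of_real ((vnorm n x)\<^sup>2)"
proof -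
  have "hform (\<lambda>p q. if p = q \<and> p < n then c else 0) n x x
      = (\<Sum>p<n. \<Sum>q<n. if q = p then c * x p * cnj (x p) else 0)"
    unfolding hform_def by (intro sum.cong refl) auto
  also have "\<dots> = (\<Sum>p<n. c * x p * cnj (x p))" by simp
  finally show ?thesis
    by (simp add: vnorm_squared sum_distrib_left complex_norm_square mult_ac del: of_real_power)
qed

context mou
begin

lemma trunc_mm: "trunc n (mm c A) = mm c (trunc n A)"
  by (auto simp: trunc_def mmap_def fun_eq_iff)

text \<open>The functional is dominated by the infimum of all \<open>t\<close> for which
  \<open>t + s C\<close> lies above the real part of \<open>x\<close> for some
  \<open>s \<ge> 0\<close>. The Archimedean axiom provides \<open>C = B + \<delta>\<close> still
  outside the cone, and the margin \<delta> turns \<open>G C \<le> 0\<close> into the strict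
  \<open>G B < 0\<close>.\<close>

lemma posf_separation:
  assumes B: "B \<in> mats n n" "vadj V B = B" "B \<notin> mcone V n" and n: "n \<ge> 1"
  obtains G where "posf n G" "G B < 0" "G (idm n 1) \<ge> 1"
proof -
  have e: "munit V \<noteq> 0"
  proof
    assume "munit V = 0"
    then have "B = 0" using cone_trivial[OF mou_axioms] by (auto simp: fun_eq_iff)
    then show False using B(3) cone_0 by simp
  qed
  obtain \<delta> where \<delta>: "\<delta> > 0" "B + idm n \<delta> \<notin> mcone V n"
    using cone_arch[OF B(1)] B(3) by blast
  define C where "C = B + idm n \<delta>"
  have C: "vadj V C = C" "C \<in> mats n n"
    using B by (auto simp: C_def vadj_add vadj_idm intro: mats_add smat_mats)
  define H where "H x = trunc n x + vadj V (trunc n x)" for x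
  have H_add: "H (x + y) = H x + H y" for x y
    by (simp add: H_def trunc_add vadj_add add_ac)
  have H_mm: "H (mm (complex_of_real r) x) = mm (complex_of_real r) (H x)" for r x
    by (simp add: H_def trunc_mm vadj_mm mm.scale_right_distrib)
  \<comment> \<open>Everything is doubled because \<open>H x\<close> is twice the real part of
    \<open>x\<close>.\<close>
  define \<Gamma> where "\<Gamma> = {(x, t). \<exists>s\<ge>0. idm n (2 * t) + mm (complex_of_real (2 * s)) C - H x \<in> mcone V n}"
  have \<Gamma>I: "(x, t) \<in> \<Gamma>" if "s \<ge> 0" "idm n (2 * t) + mm (complex_of_real (2 * s)) C - H x \<in> mcone V n" for x t s
    unfolding \<Gamma>_def using that by blast
  have dbl: "mm 2 A = A + A" for A
    using mm.scale_left_distrib[of 1 1 A] by simp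
  obtain G where G: "\<And>x y. G (x + y) = G x + G y" "\<And>r x. G (mm (complex_of_real r) x) = r * G x"
    "\<And>x t. (x, t) \<in> \<Gamma> \<Longrightarrow> G x \<le> t"
  proof (rule hahn_banach_cone[OF mr.vector_space_axioms, of \<Gamma>])
    show "(0, 0) \<in> \<Gamma>" by (rule \<Gamma>I[of 0]) (simp_all add: cone_0 H_def)
  next
    fix x y t s assume "(x, t) \<in> \<Gamma>" "(y, s) \<in> \<Gamma>"
    then obtain a b where ab: "a \<ge> 0" "b \<ge> 0" "idm n (2 * t) + mm (complex_of_real (2 * a)) C - H x \<in> mcone V n"
      "idm n (2 * s) + mm (complex_of_real (2 * b)) C - H y \<in> mcone V n"
      unfolding \<Gamma>_def by blast
    have "idm n (2 * (t + s)) + mm (complex_of_real (2 * (a + b))) C - H (x + y)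
       = (idm n (2 * t) + mm (complex_of_real (2 * a)) C - H x) + (idm n (2 * s) + mm (complex_of_real (2 * b)) C - H y)"
    proof -
      have "idm n (2 * (t + s)) = idm n (2 * t) + idm n (2 * s)"
        by (simp only: distrib_left idm_add)
      moreover have "mm (complex_of_real (2 * (a + b))) C = mm (complex_of_real (2 * a)) C + mm (complex_of_real (2 * b)) C"
        by (simp only: distrib_left of_real_add mm.scale_left_distrib)
      ultimately show ?thesis
        by (simp only: H_add diff_conv_add_uminus minus_add_distrib add_ac)
    qed
    then show "(x + y, t + s) \<in> \<Gamma>"
      using cone_add[OF ab(3,4)] ab(1,2) by (intro \<Gamma>I[of "a + b"]) auto
  next
    fix x t and r :: real assume "(x, t) \<in> \<Gamma>" "r > 0"
    then obtain a where a: "a \<ge> 0" "idm n (2 * t) + mm (complex_of_real (2 * a)) C - H x \<in> mcone V n"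
      unfolding \<Gamma>_def by blast
    have "mm (complex_of_real r) (idm n (2 * t) + mm (complex_of_real (2 * a)) C - H x)
       = idm n (2 * (r * t)) + mm (complex_of_real (2 * (r * a))) C - H (mm (complex_of_real r) x)"
      by (simp add: mm.scale_right_distrib mm.scale_right_diff_distrib mm_smat H_mm mult_ac)
    then show "(mm (complex_of_real r) x, r * t) \<in> \<Gamma>"
      using cone_scale[OF a(2), of r] a(1) \<open>r > 0\<close> by (intro \<Gamma>I[of "r * a"]) auto
  next
    fix x
    obtain t where "t \<ge> 0" "nrad V n t (- trunc n x)"
      using nrad_exists[OF mats_uminus[OF trunc_mats]] by blast
    then have "idm n (2 * t) + mm (complex_of_real (2 * 0)) C - H x \<in> mcone V n"
      using nradD[of n t "- trunc n x" 1] by (simp add: H_def vadj_minus diff_diff_eq)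
    then show "\<exists>t. (x, t) \<in> \<Gamma>" using \<Gamma>I[of 0] by blast
  next
    \<comment> \<open>A negative \<open>t\<close> would make \<open>s C\<close> positive and hence
      \<open>C\<close> itself if \<open>s > 0\<close>; for \<open>s = 0\<close> it would make a
      negative multiple of the unit positive.\<close>
    fix t assume "(0, t) \<in> \<Gamma>"
    then obtain s where s: "s \<ge> 0" "idm n (2 * t) + mm (complex_of_real (2 * s)) C \<in> mcone V n"
      unfolding \<Gamma>_def by (auto simp: H_def)
    show "t \<ge> 0"
    proof (rule ccontr)
      assume t: "\<not> t \<ge> 0"
      have "idm n (2 * t) + idm n (2 * - t) = 0" by (subst idm_add[symmetric]) simp
      then have *: "mm (complex_of_real (2 * s)) C \<in> mcone V n"
        using cone_add[OF s(2) idm_cone[of "2 * - t" n]] t by (simp add: algebra_simps)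
      show False
      proof (cases "s = 0")
        case True
        then show False using s(2) t idm_cone_nonneg[OF e n, of "2 * t"] by simp
      next
        case False
        then have "C \<in> mcone V n" using cone_scale[OF *, of "1 / (2 * s)"] s(1) by simp
        then show False using \<delta>(2) C_def by simp
      qed
    qed
  qed blast
  have G_minus: "G (- x) = - G x" for x using G(2)[of "-1" x] by simp
  have "G A \<ge> 0" if "A \<in> mcone V n" for A
  proof -
    have "H (- A) = - mm (complex_of_real 2) A"
      using cone_mats[OF that] cone_sa[OF that]
      by (simp add: dbl H_def trunc_id mats_uminus vadj_minus)
    then have "(- A, 0) \<in> \<Gamma>"
      using cone_scale[OF that, of 2] by (intro \<Gamma>I[of 0]) auto
    then show ?thesis using G(3) G_minus by force
  qed
  moreover have "G (vadj V A) = G A" if "A \<in> mats n n" for A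
  proof -
    have "H (vadj V A) = H A"
      using that vadj_mats[OF that] by (simp add: H_def trunc_id add.commute)
    then have "H (vadj V A - A) = 0" "H (A - vadj V A) = 0"
      using H_add[of "vadj V A - A" A] H_add[of "A - vadj V A" "vadj V A"] by simp_all
    then have "(vadj V A - A, 0) \<in> \<Gamma>" "(A - vadj V A, 0) \<in> \<Gamma>"
      by (auto intro!: \<Gamma>I[of 0] simp: cone_0)
    then show ?thesis
      using G(3)[of "vadj V A - A" 0] G(3)[of "A - vadj V A" 0]
        G(1)[of "vadj V A - A" A] G(1)[of "A - vadj V A" "vadj V A"] by simp
  qed
  ultimately have posf: "posf n G" using G(1,2) by (auto simp: posf_def)
  have "(C, 0) \<in> \<Gamma>"
    using C dbl[of C] by (intro \<Gamma>I[of 1]) (simp_all add: H_def trunc_id cone_0)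
  then have "G C \<le> 0" by (rule G(3))
  have "(idm n (-1), -1) \<in> \<Gamma>"
  proof (rule \<Gamma>I[of 0])
    have "H (idm n (-1)) = idm n (-1) + idm n (-1)"
      by (simp only: H_def trunc_id[OF smat_mats] vadj_idm)
    also have "\<dots> = idm n (2 * -1)" by (subst idm_add[symmetric]) simp
    finally show "idm n (2 * -1) + mm (complex_of_real (2 * 0)) C - H (idm n (-1)) \<in> mcone V n"
      by (simp add: cone_0)
  qed simp
  then have "G (idm n (-1)) \<le> -1" by (rule G(3))
  then have unit: "G (idm n 1) \<ge> 1"
    using G(2)[of "-1" "idm n 1"] by (simp add: mm_smat)
  have "G (idm n \<delta>) = \<delta> * G (idm n 1)"
    using G(2)[of \<delta> "idm n 1"] by (simp add: mm_smat)
  moreover have "\<delta> * G (idm n 1) > 0" using \<delta>(1) unit by simp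
  ultimately have "G B < 0" using \<open>G C \<le> 0\<close> G(1)[of B "idm n \<delta>"] by (simp add: C_def)
  then show thesis using posf unit that by blast
qed

lemma cpx_posf_real:
  assumes "posf n G" "A \<in> mats n n" "vadj V A = A"
  shows "cpx G A = complex_of_real (G A)"
proof -
  have "cpx G A = cnj (cpx G A)" using cpx_vadj[OF assms(1,2)] assms(3) by simp
  then have "Im (cpx G A) = Im (cnj (cpx G A))" by (rule arg_cong)
  then show ?thesis by (simp add: complex_eq_iff) (simp add: cpx_def)
qed

text \<open>The negative of a nonzero unit is not positive; a functional separating it from the
  cone, divided by its value at the unit, is a state.\<close>

lemma state_exists:
  assumes "munit V \<noteq> 0"
  obtains \<phi> where "\<phi> \<in> CS V 1"
proof -
  have "idm 1 (-1) \<notin> mcone V 1" using idm_cone_nonneg[OF assms, of 1 "-1"] by auto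
  then obtain G where G: "posf 1 G" "G (idm 1 1) \<ge> 1"
    using posf_separation[of "idm 1 (-1)" 1] vadj_idm[of 1 "-1"] smat_mats by (metis order_refl)
  have "(\<lambda>v i j. complex_of_real (1 / G (idm 1 1)) * cpmap 1 G v i j) \<in> CPM V 1"
    using G by (intro CPM_scale cpmap_CPM) auto
  moreover have "cpmap 1 G (munit V) 0 0 = complex_of_real (G (idm 1 1))"
    using cpx_posf_real[OF G(1) smat_mats vadj_idm, of 1]
    by (simp add: cpmap_def smat_elm)
  then have "(\<lambda>i j. complex_of_real (1 / G (idm 1 1)) * cpmap 1 G (munit V) i j) = smat 1 1"
    using G(2) by (auto simp: fun_eq_iff smat_def) (auto simp: cpmap_def)
  ultimately show thesis using that by (auto simp: CS_iff)
qed

lemma CPM_diag: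
  assumes "\<sigma> \<in> CPM V 1" "\<epsilon> \<ge> 0"
  shows "(\<lambda>v p q. if p = q \<and> p < n then complex_of_real \<epsilon> * \<sigma> v 0 0 else 0) \<in> CPM V n"
proof -
  have "(\<lambda>v i j. complex_of_real \<epsilon> * (\<Sum>k<n. cconj 1 n (\<lambda>_ q. if q = k then 1 else 0) \<sigma> v i j)) \<in> CPM V n"
    using assms by (intro CPM_scale CPM_sum CPM_cconj) auto
  also have "(\<lambda>v i j. complex_of_real \<epsilon> * (\<Sum>k<n. cconj 1 n (\<lambda>_ q. if q = k then 1 else 0) \<sigma> v i j))
    = (\<lambda>v p q. if p = q \<and> p < n then complex_of_real \<epsilon> * \<sigma> v 0 0 else 0)"
  proof (intro ext)
    fix v i j
    have "(\<Sum>k<n. cconj 1 n (\<lambda>_ q. if q = k then 1 else 0) \<sigma> v i j)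
       = (\<Sum>k<n. if k = i then (if i = j \<and> i < n then \<sigma> v 0 0 else 0) else 0)"
      by (intro sum.cong refl) (auto simp: cconj_def)
    then show "complex_of_real \<epsilon> * (\<Sum>k<n. cconj 1 n (\<lambda>_ q. if q = k then 1 else 0) \<sigma> v i j)
      = (if i = j \<and> i < n then complex_of_real \<epsilon> * \<sigma> v 0 0 else 0)"
      by auto
  qed
  finally show ?thesis .
qed

lemma CPM_hform:
  assumes "\<phi> \<in> CPM V n"
  shows "hform (\<phi> v) n x y = sform 1 n \<phi> (one_one v) (\<lambda>_ p. cnj (x p)) (\<lambda>_ p. cnj (y p))"
  unfolding hform_def sform_one_one by (simp add: mult_ac)

text \<open>A separating functional gives a completely positive map that still has to be made
  unital. Its value at the unit may be singular, so a small multiple of a state times the identity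
  is added before Gram-Schmidt normalises it.\<close>

lemma matrix_state_separation:
  assumes B: "B \<in> mats n n" "vadj V B = B" "B \<notin> mcone V n" and n: "n \<ge> 1"
  obtains \<psi> x where "\<psi> \<in> CS V n" "Re (sform n n \<psi> B x x) < 0"
proof -
  obtain G where G: "posf n G" "G B < 0" "G (idm n 1) \<ge> 1"
    using posf_separation[OF assms] by blast
  have e: "munit V \<noteq> 0"
  proof
    assume "munit V = 0"
    then have "B = 0" using cone_trivial[OF mou_axioms] by (auto simp: fun_eq_iff)
    then show False using B(3) cone_0 by simp
  qed
  obtain \<sigma> where \<sigma>: "\<sigma> \<in> CS V 1" using state_exists[OF e] .
  have \<sigma>1: "\<sigma> (munit V) 0 0 = 1" using \<sigma> by (simp add: CS_iff smat_def)
  define \<tau> where "\<tau> = (\<Sum>i<n. \<sigma> (B i i) 0 0)"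
  \<comment> \<open>The perturbation changes the value at \<open>B\<close> by
    \<open>\<epsilon> * Re \<tau>\<close>, which this choice keeps at or below half of
    \<open>- G B\<close>; the summand 1 protects against \<open>\<tau> = 0\<close>.\<close>
  define \<epsilon> where "\<epsilon> = - G B / (2 * (cmod \<tau> + 1))"
  have \<epsilon>: "\<epsilon> > 0" 
  proof -
    have "2 * (cmod \<tau> + 1) > 0" by (simp add: add_nonneg_pos)
    then show ?thesis unfolding \<epsilon>_def using G(2) by (intro divide_pos_pos) auto
  qed
  define \<theta> where "\<theta> v p q = cpmap n G v p q + (if p = q \<and> p < n then complex_of_real \<epsilon> * \<sigma> v 0 0 else 0)" for v p q
  have \<theta>: "\<theta> \<in> CPM V n"
    unfolding \<theta>_def using \<epsilon> by (intro CPM_plus cpmap_CPM[OF G(1)] CPM_diag[OF CS_CPM[OF \<sigma>]]) auto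
  define P where "P = \<theta> (munit V)"
  have herm: "P j i = cnj (P i j)" for i j
    unfolding P_def using CPM_star[OF \<theta>, of "munit V" j i] by (simp add: star_unit)
  have pos: "0 < Re (hform P n x x)" if "i < n" "x i \<noteq> 0" for x i
  proof -
    have "hform P n x x = hform (cpmap n G (munit V)) n x x
        + hform (\<lambda>p q. if p = q \<and> p < n then complex_of_real \<epsilon> else 0) n x x"
      unfolding P_def \<theta>_def \<sigma>1 mult_1_right by (simp add: hform_def ring_distribs sum.distrib)
    moreover have "Re (hform (cpmap n G (munit V)) n x x) \<ge> 0"
      unfolding CPM_hform[OF cpmap_CPM[OF G(1)]]
      by (rule CPM_pos[OF cpmap_CPM[OF G(1)] unit_pos])
    moreover have "vnorm n x \<noteq> 0" using that by (auto simp: vnorm_zero_iff)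
    then have "\<epsilon> * (vnorm n x)\<^sup>2 > 0" using \<epsilon> by simp
    ultimately show ?thesis by (simp add: hform_diag)
  qed
  obtain h c where
    orth: "\<And>x y. hform P n (\<lambda>i. \<Sum>k<n. x k * h k i) (\<lambda>i. \<Sum>k<n. y k * h k i) = (\<Sum>k<n. x k * cnj (y k))"
    and gen: "\<And>i j. i < n \<Longrightarrow> (\<Sum>k<n. c i k * h k j) = (if i = j then 1 else 0)"
  proof (rule gram_schmidt[where P = P and n = n])
    show "P j i = cnj (P i j)" for i j by (rule herm)
    show "0 < Re (hform P n x x)" if "i < n" "x i \<noteq> 0" for x i using that by (rule pos)
  qed (rule that)
  define \<psi> where "\<psi> = cconj n n (\<lambda>p k. cnj (h k p)) \<theta>"
  have "\<psi> \<in> CPM V n" unfolding \<psi>_def by (rule CPM_cconj[OF \<theta>])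
  moreover have "\<psi> (munit V) = smat n 1"
  proof (intro ext)
    fix k l
    have "(\<Sum>p<n. \<Sum>q<n. cnj (cnj (h k p)) * P p q * cnj (h l q)) = (if k = l then 1 else 0)"
      if "k < n" "l < n"
    proof -
      have d: "(\<Sum>k'<n. (if k' = k then 1 else 0) * f k') = f k" if "k < n" for k and f :: "nat \<Rightarrow> complex"
      proof -
        have "(\<Sum>k'<n. (if k' = k then 1 else 0) * f k') = (\<Sum>k'<n. if k' = k then f k' else 0)"
          by (intro sum.cong) auto
        then show ?thesis using that by simp
      qed
      have "(\<Sum>p<n. \<Sum>q<n. cnj (cnj (h k p)) * P p q * cnj (h l q)) = hform P n (h k) (h l)"
        by (simp add: hform_def mult_ac)
      also have "\<dots> = (\<Sum>k'<n. (if k' = k then 1 else 0) * cnj (if k' = l then 1 else 0))"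
        using orth[of "\<lambda>k'. if k' = k then 1 else 0" "\<lambda>l'. if l' = l then 1 else 0"]
        unfolding d[OF that(1)] d[OF that(2)] .
      also have "\<dots> = (if k = l then 1 else 0)" unfolding d[OF that(1)] by simp
      finally show ?thesis .
    qed
    then show "\<psi> (munit V) k l = smat n 1 k l"
      by (cases "k < n \<and> l < n") (auto simp: \<psi>_def cconj_def smat_def P_def[symmetric])
  qed
  ultimately have \<psi>: "\<psi> \<in> CS V n" by (simp add: CS_iff)
  \<comment> \<open>The vector built from \<open>c\<close> cancels \<open>h\<close> and leaves the
    sum of all \<open>e_i\<close> tensored with \<open>e_i\<close>. There the form of \<theta> is
    the functional at \<open>B\<close> plus the perturbation.\<close>
  have "sform n n \<psi> B (\<lambda>i k. cnj (c i k)) (\<lambda>i k. cnj (c i k))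
      = sform n n \<theta> B (\<lambda>i p. cnj (\<Sum>k<n. c i k * h k p)) (\<lambda>i p. cnj (\<Sum>k<n. c i k * h k p))"
    by (simp add: \<psi>_def sform_cconj mult.commute)
  also have "\<dots> = (\<Sum>i<n. \<Sum>j<n. \<theta> (B i j) i j)"
    unfolding sform_def
  proof (intro sum.cong refl)
    fix i j assume ij: "i \<in> {..<n}" "j \<in> {..<n}"
    have "(\<Sum>p<n. \<Sum>q<n. cnj (cnj (\<Sum>k<n. c i k * h k p)) * \<theta> (B i j) p q * cnj (\<Sum>k<n. c j k * h k q))
       = (\<Sum>p<n. if p = i then (\<Sum>q<n. if q = j then \<theta> (B i j) i j else 0) else 0)"
      using ij by (intro sum.cong refl) (simp add: gen if_distrib[of "(*) _"] if_distrib[of cnj] eq_commute[of j] cong: if_cong)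
    then show "(\<Sum>p<n. \<Sum>q<n. cnj (cnj (\<Sum>k<n. c i k * h k p)) * \<theta> (B i j) p q * cnj (\<Sum>k<n. c j k * h k q))
      = \<theta> (B i j) i j" using ij by simp
  qed
  also have "\<dots> = (\<Sum>i<n. \<Sum>j<n. cpmap n G (B i j) i j) + (\<Sum>i<n. \<Sum>j<n. if j = i then complex_of_real \<epsilon> * \<sigma> (B i i) 0 0 else 0)"
    unfolding \<theta>_def sum.distrib by (intro arg_cong2[where f = "(+)"] refl sum.cong) auto
  also have "(\<Sum>i<n. \<Sum>j<n. cpmap n G (B i j) i j) = cpx G B"
  proof -
    have "cpx G B = (\<Sum>i<n. \<Sum>j<n. cpx G (elm i j (B i j)))"
      by (subst mtx_elm_sum[OF B(1)]) (simp only: cpx_linear[OF posf_linear(1,2)[OF G(1)]])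
    then show ?thesis by (simp add: cpmap_def)
  qed
  also have "(\<Sum>i<n. \<Sum>j<n. if j = i then complex_of_real \<epsilon> * \<sigma> (B i i) 0 0 else 0) = complex_of_real \<epsilon> * \<tau>"
    by (simp add: \<tau>_def sum_distrib_left)
  finally have "Re (sform n n \<psi> B (\<lambda>i k. cnj (c i k)) (\<lambda>i k. cnj (c i k))) = G B + \<epsilon> * Re \<tau>"
    by (simp add: cpx_def)
  also have "\<dots> < 0"
  proof -
    have "\<epsilon> * Re \<tau> \<le> \<epsilon> * (cmod \<tau> + 1)"
      using \<epsilon> complex_Re_le_cmod[of \<tau>] by (intro mult_left_mono) auto
    also have "\<dots> = - G B / 2"
      using norm_ge_zero[of \<tau>] unfolding \<epsilon>_def by (simp add: divide_simps add_nonneg_eq_0_iff)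
    finally show ?thesis using G(2) by simp
  qed
  finally show thesis using \<psi> that by blast
qed

end

section \<open>Lipschitz seminorms: separating functionals and their factorisation\<close>

locale lip_space = mou V for V :: "('v::ab_group_add) mous" +
  fixes L :: "nat \<Rightarrow> 'v mtx \<Rightarrow> real"
  assumes lip: "mlip_seminorm V L"
begin

lemma L_add: "n \<ge> 1 \<Longrightarrow> A \<in> mats n n \<Longrightarrow> B \<in> mats n n \<Longrightarrow> L n (A + B) \<le> L n A + L n B"
  and L_mm: "n \<ge> 1 \<Longrightarrow> A \<in> mats n n \<Longrightarrow> L n (mm z A) = cmod z * L n A"
  and L_scalar: "n \<ge> 1 \<Longrightarrow> c \<in> mats n n \<Longrightarrow> L n (\<lambda>i j. sm (c i j) (munit V)) = 0"
  and L_dsum: "m \<ge> 1 \<Longrightarrow> n \<ge> 1 \<Longrightarrow> A' \<in> mats m m \<Longrightarrow> B \<in> mats n n \<Longrightarrow> L (m + n) (dsum m A' B) = max (L m A') (L n B)"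
  and L_vadj: "n \<ge> 1 \<Longrightarrow> A \<in> mats n n \<Longrightarrow> L n (vadj V A) = L n A"
proof -
  have c: "(\<lambda>i j. sm (c i j) (munit V)) \<in> mats n n" if "c \<in> mats n n" for c n
    using that by (auto simp: mats_def)
  note l = lip[unfolded mlip_seminorm_def]
  show "n \<ge> 1 \<Longrightarrow> A \<in> mats n n \<Longrightarrow> B \<in> mats n n \<Longrightarrow> L n (A + B) \<le> L n A + L n B"
    using l by (simp add: madd_eq)
  show "n \<ge> 1 \<Longrightarrow> A \<in> mats n n \<Longrightarrow> L n (mm z A) = cmod z * L n A"
    using l by simp
  show "n \<ge> 1 \<Longrightarrow> c \<in> mats n n \<Longrightarrow> L n (\<lambda>i j. sm (c i j) (munit V)) = 0"
    using l c[of c n] by fast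
  show "m \<ge> 1 \<Longrightarrow> n \<ge> 1 \<Longrightarrow> A' \<in> mats m m \<Longrightarrow> B \<in> mats n n \<Longrightarrow> L (m + n) (dsum m A' B) = max (L m A') (L n B)"
    using l by simp
  show "n \<ge> 1 \<Longrightarrow> A \<in> mats n n \<Longrightarrow> L n (vadj V A) = L n A"
    using l by simp
qed

lemma L_mult:
  assumes "m \<ge> 1" "n \<ge> 1" "A \<in> mats m m" "a \<in> mats n m" "b \<in> mats m n"
  shows "L n (rmul V m (lmul V m a A) b) \<le> cnorm n m a * L m A * cnorm m n b"
  using lip assms unfolding mlip_seminorm_def by simp

lemma L_0: "n \<ge> 1 \<Longrightarrow> L n 0 = 0"
  using L_mm[of n 0 0] by (simp add: mats_0)

lemma L_nonneg:
  assumes "n \<ge> 1" "A \<in> mats n n" shows "0 \<le> L n A"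
proof -
  have "L n (A + mm (-1) A) \<le> L n A + L n (mm (-1) A)"
    using assms by (intro L_add mm_mats) auto
  then show ?thesis using assms L_mm[of n A "-1"] by (simp add: L_0)
qed

text \<open>The product of \<alpha>, \<open>v\<close> and the transpose of \<beta>. Giving \<beta>
  the same shape as \<alpha> lets both be concatenated in the same way.\<close>

definition bil :: "nat \<Rightarrow> complex mtx \<Rightarrow> 'v mtx \<Rightarrow> complex mtx \<Rightarrow> 'v mtx" where
  "bil r \<alpha> v \<beta> = (\<lambda>i j. \<Sum>k<r. \<Sum>l<r. sm (\<alpha> i k * \<beta> j l) (v k l))"

lemma bil_mats: "\<alpha> \<in> mats n r \<Longrightarrow> \<beta> \<in> mats n r \<Longrightarrow> bil r \<alpha> v \<beta> \<in> mats n n"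
  by (auto simp: bil_def mats_def)

lemma bil_eq:
  "bil r \<alpha> v \<beta> = rmul V r (lmul V r \<alpha> v) (\<lambda>l j. \<beta> j l)"
proof (intro ext)
  fix i j
  have "rmul V r (lmul V r \<alpha> v) (\<lambda>l j. \<beta> j l) i j = (\<Sum>l<r. \<Sum>k<r. sm (\<alpha> i k * \<beta> j l) (v k l))"
    by (simp add: rmul_def lmul_def sm.scale_sum_right mult.commute)
  also have "\<dots> = bil r \<alpha> v \<beta> i j" unfolding bil_def by (rule sum.swap)
  finally show "bil r \<alpha> v \<beta> i j = rmul V r (lmul V r \<alpha> v) (\<lambda>l j. \<beta> j l) i j" by simp
qed

text \<open>The norm bounds on \<alpha> and \<beta> are stated through quadratic forms because
  \<open>effros_ruan\<close> supplies them as domination of a Gram matrix by a scalar.\<close>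

lemma L_bil:
  assumes "r \<ge> 1" "n \<ge> 1" "v \<in> mats r r" "\<alpha> \<in> mats n r" "\<beta> \<in> mats n r"
    and \<alpha>: "\<And>\<xi>. (\<Sum>l<r. (cmod (\<Sum>i<n. \<alpha> i l * \<xi> i))\<^sup>2) \<le> s * (vnorm n \<xi>)\<^sup>2"
    and \<beta>: "\<And>\<xi>. (\<Sum>l<r. (cmod (\<Sum>i<n. \<beta> i l * \<xi> i))\<^sup>2) \<le> t * (vnorm n \<xi>)\<^sup>2"
    and "s \<ge> 0" "t \<ge> 0"
  shows "L n (bil r \<alpha> v \<beta>) \<le> sqrt s * L r v * sqrt t"
proof -
  have *: "cmod (\<Sum>l<r. (\<Sum>i<n. \<gamma> i l * y i) * x l) \<le> sqrt s * vnorm r x * vnorm n y"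
    if "\<And>\<xi>. (\<Sum>l<r. (cmod (\<Sum>i<n. \<gamma> i l * \<xi> i))\<^sup>2) \<le> s * (vnorm n \<xi>)\<^sup>2" "s \<ge> 0" for \<gamma> x y s
  proof -
    have "cmod (\<Sum>l<r. (\<Sum>i<n. \<gamma> i l * y i) * x l) \<le> vnorm r (\<lambda>l. \<Sum>i<n. \<gamma> i l * y i) * vnorm r x"
      by (rule vnorm_Cauchy_Schwarz)
    also have "vnorm r (\<lambda>l. \<Sum>i<n. \<gamma> i l * y i) \<le> sqrt s * vnorm n y"
    proof (rule power2_le_imp_le)
      show "(vnorm r (\<lambda>l. \<Sum>i<n. \<gamma> i l * y i))\<^sup>2 \<le> (sqrt s * vnorm n y)\<^sup>2"
        using that by (simp add: vnorm_squared[of r] power_mult_distrib)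
    qed (use that in simp)
    finally show ?thesis by (simp add: mult_ac mult_left_mono mult_right_mono)
  qed
  have "cnorm n r \<alpha> \<le> sqrt s"
  proof (rule cnorm_leI)
    fix x y
    have "(\<Sum>i<n. \<Sum>l<r. y i * \<alpha> i l * x l) = (\<Sum>l<r. \<Sum>i<n. y i * \<alpha> i l * x l)"
      by (rule sum.swap)
    also have "\<dots> = (\<Sum>l<r. (\<Sum>i<n. \<alpha> i l * y i) * x l)"
      by (simp add: sum_distrib_left sum_distrib_right mult_ac)
    finally show "cmod (\<Sum>i<n. \<Sum>l<r. y i * \<alpha> i l * x l) \<le> sqrt s * vnorm r x * vnorm n y"
      using *[OF \<alpha>] assms by simp
  qed (use assms in simp)
  moreover have "cnorm r n (\<lambda>l j. \<beta> j l) \<le> sqrt t"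
  proof (rule cnorm_leI)
    fix x y
    have "(\<Sum>l<r. \<Sum>i<n. y l * \<beta> i l * x i) = (\<Sum>l<r. (\<Sum>i<n. \<beta> i l * x i) * y l)"
      by (simp add: sum_distrib_left sum_distrib_right mult_ac)
    then show "cmod (\<Sum>l<r. \<Sum>i<n. y l * \<beta> i l * x i) \<le> sqrt t * vnorm n x * vnorm r y"
      using *[OF \<beta> \<open>t \<ge> 0\<close>, where x = y and y = x] by (simp only: mult_ac)
  qed (use assms in simp)
  moreover have "L n (bil r \<alpha> v \<beta>) \<le> cnorm n r \<alpha> * L r v * cnorm r n (\<lambda>l j. \<beta> j l)"
    unfolding bil_eq using assms by (intro L_mult) (auto simp: mats_def)
  ultimately show ?thesis
    using L_nonneg[of r v] assms
    by (smt (verit) cnorm_nonneg mult_mono mult_nonneg_nonneg)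
qed

text \<open>Besides separating \<open>b\<close> from a ball of \<open>L\<close>, the functional has
  to be bounded for the order structure too. It is dominated by the infimum of
  \<open>L n y + K * \<tau> - (1 + \<eta>) * s\<close> over all ways to write \<open>x + s b\<close>
  as \<open>y\<close> up to an error of radius \<tau>.\<close>

lemma lip_separation:
  assumes n: "n \<ge> 1" and b: "b \<in> mats n n" and pos: "\<delta> > 0" "\<eta> \<ge> 0"
    and far: "\<And>y. y \<in> mats n n \<Longrightarrow> L n y \<le> 1 + \<eta> \<Longrightarrow> \<not> nrad V n \<delta> (b - y)"
  obtains G K where "\<And>A B. G (A + B) = G A + G B" "\<And>r A. G (mm (complex_of_real r) A) = r * G A"
    "\<And>y. y \<in> mats n n \<Longrightarrow> G y \<le> L n y"
    "\<And>x \<tau>. x \<in> mats n n \<Longrightarrow> \<tau> \<ge> 0 \<Longrightarrow> nrad V n \<tau> x \<Longrightarrow> G x \<le> K * \<tau>"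
    "G b \<ge> 1 + \<eta>" "K \<ge> 0"
proof -
  \<comment> \<open>With this slope an error of radius \<delta> costs exactly
    \<open>1 + \<eta>\<close>, as much as reaching the boundary of the ball.\<close>
  define K where "K = (1 + \<eta>) / \<delta>"
  have K: "K \<ge> 0" using pos by (simp add: K_def)
  define \<Gamma> where "\<Gamma> = {(x, t). \<exists>y\<in>mats n n. \<exists>s\<ge>0. \<exists>\<tau>\<ge>0.
     nrad V n \<tau> (trunc n x + mm (complex_of_real s) b - y) \<and> L n y + K * \<tau> - (1 + \<eta>) * s \<le> t}"
  have \<Gamma>I: "(x, t) \<in> \<Gamma>" if "y \<in> mats n n" "s \<ge> 0" "\<tau> \<ge> 0"
    "nrad V n \<tau> (trunc n x + mm (complex_of_real s) b - y)" "L n y + K * \<tau> - (1 + \<eta>) * s \<le> t" for x t y s \<tau>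
    unfolding \<Gamma>_def using that by blast
  obtain G where G: "\<And>x y. G (x + y) = G x + G y" "\<And>r x. G (mm (complex_of_real r) x) = r * G x"
    "\<And>x t. (x, t) \<in> \<Gamma> \<Longrightarrow> G x \<le> t"
  proof (rule hahn_banach_cone[OF mr.vector_space_axioms, of \<Gamma>])
    show "(0, 0) \<in> \<Gamma>"
      by (rule \<Gamma>I[of 0 0 0]) (use n in \<open>simp_all add: mats_0 nrad_0 L_0\<close>)
  next
    fix x x' t t' assume "(x, t) \<in> \<Gamma>" "(x', t') \<in> \<Gamma>"
    then obtain y s \<tau> y' s' \<tau>' where 1: "y \<in> mats n n" "s \<ge> 0" "\<tau> \<ge> 0"
      "nrad V n \<tau> (trunc n x + mm (complex_of_real s) b - y)" "L n y + K * \<tau> - (1 + \<eta>) * s \<le> t"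
      and 2: "y' \<in> mats n n" "s' \<ge> 0" "\<tau>' \<ge> 0"
      "nrad V n \<tau>' (trunc n x' + mm (complex_of_real s') b - y')" "L n y' + K * \<tau>' - (1 + \<eta>) * s' \<le> t'"
      unfolding \<Gamma>_def by blast
    show "(x + x', t + t') \<in> \<Gamma>"
    proof (rule \<Gamma>I[of "y + y'" "s + s'" "\<tau> + \<tau>'"])
      show "y + y' \<in> mats n n" using 1 2 by (intro mats_add)
      have eq: "trunc n (x + x') + mm (complex_of_real (s + s')) b - (y + y')
         = (trunc n x + mm (complex_of_real s) b - y) + (trunc n x' + mm (complex_of_real s') b - y')"
        unfolding trunc_add of_real_add mm.scale_left_distrib by (simp add: algebra_simps)
      show "nrad V n (\<tau> + \<tau>') (trunc n (x + x') + mm (complex_of_real (s + s')) b - (y + y'))"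
        unfolding eq by (rule nrad_add[OF 1(4) 2(4)])
      show "L n (y + y') + K * (\<tau> + \<tau>') - (1 + \<eta>) * (s + s') \<le> t + t'"
        using L_add[OF n 1(1) 2(1)] 1(5) 2(5) by (simp add: ring_distribs)
    qed (use 1 2 in auto)
  next
    fix x t and r :: real assume "(x, t) \<in> \<Gamma>" and r: "r > 0"
    then obtain y s \<tau> where 1: "y \<in> mats n n" "s \<ge> 0" "\<tau> \<ge> 0"
      "nrad V n \<tau> (trunc n x + mm (complex_of_real s) b - y)" "L n y + K * \<tau> - (1 + \<eta>) * s \<le> t"
      unfolding \<Gamma>_def by blast
    show "(mm (complex_of_real r) x, r * t) \<in> \<Gamma>"
    proof (rule \<Gamma>I[of "mm (complex_of_real r) y" "r * s" "r * \<tau>"])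
      show "nrad V n (r * \<tau>) (trunc n (mm (complex_of_real r) x) + mm (complex_of_real (r * s)) b - mm (complex_of_real r) y)"
        using nrad_mm[OF 1(4), of "complex_of_real r"] r
        by (simp add: trunc_mm mm.scale_right_distrib mm.scale_right_diff_distrib)
      have "r * (L n y + K * \<tau> - (1 + \<eta>) * s) \<le> r * t" using 1(5) r by simp
      then show "L n (mm (complex_of_real r) y) + K * (r * \<tau>) - (1 + \<eta>) * (r * s) \<le> r * t"
        using r by (simp add: L_mm[OF n 1(1)] algebra_simps)
    qed (use 1 r in \<open>auto intro: mm_mats\<close>)
  next
    fix x
    obtain \<tau> where "\<tau> \<ge> 0" "nrad V n \<tau> (trunc n x)" using nrad_exists[OF trunc_mats] by blast
    then have "(x, K * \<tau>) \<in> \<Gamma>"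
      by (intro \<Gamma>I[of 0 0 \<tau>]) (use n in \<open>simp_all add: mats_0 L_0\<close>)
    then show "\<exists>t. (x, t) \<in> \<Gamma>" by blast
  next
    fix t assume "(0, t) \<in> \<Gamma>"
    then obtain y s \<tau> where 1: "y \<in> mats n n" "s \<ge> 0" "\<tau> \<ge> 0"
      "nrad V n \<tau> (mm (complex_of_real s) b - y)" "L n y + K * \<tau> - (1 + \<eta>) * s \<le> t"
      unfolding \<Gamma>_def by auto
    show "t \<ge> 0"
    proof (cases "s = 0")
      case True
      moreover have "K * \<tau> \<ge> 0" using K 1(3) by simp
      ultimately show ?thesis using 1(5) L_nonneg[OF n 1(1)] by simp
    next
      case False
      then have s: "s > 0" using 1 by simp
      define y' where "y' = mm (complex_of_real (1 / s)) y"
      have y': "y' \<in> mats n n" "L n y' = L n y / s"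
        using 1(1) s L_mm[OF n 1(1), of "complex_of_real (1 / s)"] by (auto simp: y'_def norm_divide intro: mm_mats)
      have "nrad V n (\<tau> / s) (b - y')"
        using nrad_mm[OF 1(4), of "complex_of_real (1 / s)"] s
        by (simp add: mm.scale_right_diff_distrib y'_def norm_divide)
      then have "L n y' > 1 + \<eta> \<or> \<tau> / s > \<delta>"
        using far[OF y'(1)] nrad_mono by (meson not_le)
      then have "L n y' + K * (\<tau> / s) \<ge> 1 + \<eta>"
      proof
        assume "L n y' > 1 + \<eta>"
        moreover have "K * (\<tau> / s) \<ge> 0" using K 1(3) s by simp
        ultimately show ?thesis by linarith
      next
        assume "\<tau> / s > \<delta>"
        then have "K * (\<tau> / s) \<ge> K * \<delta>" using K by (intro mult_left_mono) auto
        also have "K * \<delta> = 1 + \<eta>" using pos by (simp add: K_def)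
        finally show ?thesis using L_nonneg[OF n y'(1)] by linarith
      qed
      then have "s * (L n y / s + K * (\<tau> / s)) \<ge> s * (1 + \<eta>)"
        using s y'(2) by (intro mult_left_mono) auto
      then show ?thesis using 1(5) s by (simp add: algebra_simps)
    qed
  qed blast
  show thesis
  proof (rule that[of G K])
    show "G y \<le> L n y" if "y \<in> mats n n" for y
      using that by (intro G(3) \<Gamma>I[of y 0 0]) (simp_all add: trunc_id nrad_0)
    show "G x \<le> K * \<tau>" if "x \<in> mats n n" "\<tau> \<ge> 0" "nrad V n \<tau> x" for x \<tau>
      using that n by (intro G(3) \<Gamma>I[of 0 0 \<tau>]) (simp_all add: trunc_id mats_0 L_0)
    have "(- b, - (1 + \<eta>)) \<in> \<Gamma>"
      using n b by (intro \<Gamma>I[of 0 1 0]) (simp_all add: trunc_id mats_uminus mats_0 L_0 nrad_0)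
    then have "G (- b) \<le> - (1 + \<eta>)" by (rule G(3))
    then show "G b \<ge> 1 + \<eta>" using G(2)[of "-1" b] by simp
  qed (use G K in auto)
qed

end

definition gram :: "nat \<Rightarrow> complex mtx \<Rightarrow> complex mtx" where
  "gram r \<alpha> = (\<lambda>i j. \<Sum>l<r. \<alpha> i l * cnj (\<alpha> j l))"

lemma hform_gram: "hform (gram r \<alpha>) n \<xi> \<xi> = complex_of_real (\<Sum>l<r. (cmod (\<Sum>i<n. \<alpha> i l * \<xi> i))\<^sup>2)"
proof -
  have "hform (gram r \<alpha>) n \<xi> \<xi> = (\<Sum>i<n. \<Sum>j<n. \<Sum>l<r. (\<alpha> i l * \<xi> i) * cnj (\<alpha> j l * \<xi> j))"
    by (simp add: hform_def gram_def sum_distrib_left sum_distrib_right mult_ac)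
  also have "\<dots> = (\<Sum>i<n. \<Sum>l<r. \<Sum>j<n. (\<alpha> i l * \<xi> i) * cnj (\<alpha> j l * \<xi> j))"
    by (intro sum.cong refl sum.swap)
  also have "\<dots> = (\<Sum>l<r. \<Sum>i<n. \<Sum>j<n. (\<alpha> i l * \<xi> i) * cnj (\<alpha> j l * \<xi> j))"
    by (rule sum.swap)
  also have "\<dots> = (\<Sum>l<r. (\<Sum>i<n. \<alpha> i l * \<xi> i) * cnj (\<Sum>i<n. \<alpha> i l * \<xi> i))"
    by (simp add: sum_product)
  also have "\<dots> = complex_of_real (\<Sum>l<r. (cmod (\<Sum>i<n. \<alpha> i l * \<xi> i))\<^sup>2)"
    unfolding of_real_sum by (intro sum.cong refl) (simp only: complex_norm_square)
  finally show ?thesis .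
qed

lemma hform_minus: "hform (- x) n \<xi> \<xi> = - hform x n \<xi> \<xi>"
  and hform_plus: "hform (x + y) n \<xi> \<xi> = hform x n \<xi> \<xi> + hform y n \<xi> \<xi>"
  and hform_mult: "hform (\<lambda>i j. c * x i j) n \<xi> \<xi> = c * hform x n \<xi> \<xi>"
  by (simp_all add: hform_def sum_negf ring_distribs sum.distrib sum_distrib_left mult_ac)

lemma hform_zero: "hform (0 :: complex mtx) n \<xi> \<xi> = 0"
  by (simp add: hform_def)

lemma hform_le_cnorm: "cmod (hform x n \<xi> \<xi>) \<le> cnorm n n x * (vnorm n \<xi>)\<^sup>2"
proof -
  have "hform x n \<xi> \<xi> = (\<Sum>i<n. \<Sum>j<n. \<xi> i * x i j * cnj (\<xi> j))"
    by (simp add: hform_def mult_ac)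
  also have "cmod \<dots> \<le> cnorm n n x * vnorm n (\<lambda>j. cnj (\<xi> j)) * vnorm n \<xi>"
    by (rule cnorm_bilinear)
  finally show ?thesis by (simp add: vnorm_def power2_eq_square mult_ac)
qed

text \<open>A real-linear functional on complex matrices is the real part of a trace pairing.
  Symmetrising the representing matrix makes it hermitian and does not change the values on Gram
  matrices.\<close>

lemma functional_hform:
  assumes add: "\<And>x y. p (x + y) = p x + p y"
    and scale: "\<And>r x. p (\<lambda>i j. complex_of_real r * x i j) = r * p x"
  obtains P where "\<And>i j. P j i = cnj (P i j)" "\<And>r \<alpha>. \<alpha> \<in> mats n r \<Longrightarrow> p (gram r \<alpha>) = (\<Sum>l<r. Re (hform P n (\<lambda>i. \<alpha> i l) (\<lambda>i. \<alpha> i l)))"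
    "\<And>i. i < n \<Longrightarrow> p (elm i i 1) = Re (P i i)"
proof -
  have sum: "p (\<Sum>i\<in>S. f i) = (\<Sum>i\<in>S. p (f i))" for S and f :: "nat \<Rightarrow> complex mtx"
  proof -
    have "p 0 = 0" using add[of 0 0] by simp
    then show ?thesis by (induction S rule: infinite_finite_induct) (simp_all add: add)
  qed
  define P0 where "P0 i j = Complex (p (elm i j 1)) (- p (elm i j \<i>))" for i j
  have elm: "p (elm i j z) = Re (P0 i j * z)" for i j z
  proof -
    have "elm i j z = (\<lambda>a b. complex_of_real (Re z) * elm i j 1 a b) + (\<lambda>a b. complex_of_real (Im z) * elm i j \<i> a b)"
      by (auto simp: elm_def fun_eq_iff complex_eq_iff)
    then have "p (elm i j z) = Re z * p (elm i j 1) + Im z * p (elm i j \<i>)"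
      by (simp only: add scale)
    then show ?thesis by (simp add: P0_def mult_ac)
  qed
  define P where "P i j = (P0 i j + cnj (P0 j i)) / 2" for i j
  have herm: "P j i = cnj (P i j)" for i j by (simp add: P_def add.commute)
  have re: "Re (hform P n x x) = Re (hform P0 n x x)" for x
  proof -
    have 1: "hform P n x x = (hform P0 n x x + hform (\<lambda>i j. cnj (P0 j i)) n x x) / 2"
      by (simp add: hform_def P_def ring_distribs sum.distrib add_divide_distrib sum_divide_distrib)
    have 2: "hform (\<lambda>i j. cnj (P0 j i)) n x x = cnj (hform P0 n x x)"
    proof -
      have "hform (\<lambda>i j. cnj (P0 j i)) n x x = (\<Sum>j<n. \<Sum>i<n. cnj (P0 j i) * x i * cnj (x j))"
        unfolding hform_def by (rule sum.swap)
      then show ?thesis by (simp add: hform_def mult_ac)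
    qed
    show ?thesis unfolding 1 2 by simp
  qed
  have main: "p (gram r \<alpha>) = (\<Sum>l<r. Re (hform P n (\<lambda>i. \<alpha> i l) (\<lambda>i. \<alpha> i l)))" if "\<alpha> \<in> mats n r" for r \<alpha>
  proof -
    have "gram r \<alpha> = (\<Sum>l<r. \<Sum>i<n. \<Sum>j<n. elm i j (\<alpha> i l * cnj (\<alpha> j l)))"
    proof (intro ext)
      fix a b
      have "(\<Sum>i<n. \<Sum>j<n. elm i j (\<alpha> i l * cnj (\<alpha> j l)) a b) = \<alpha> a l * cnj (\<alpha> b l)" for l
      proof -
        have "(\<Sum>i<n. \<Sum>j<n. elm i j (\<alpha> i l * cnj (\<alpha> j l)) a b)
          = (\<Sum>i<n. if i = a then (\<Sum>j<n. if j = b then \<alpha> a l * cnj (\<alpha> b l) else 0) else 0)"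
        proof (rule sum.cong[OF refl])
          fix i
          show "(\<Sum>j<n. elm i j (\<alpha> i l * cnj (\<alpha> j l)) a b) = (if i = a then (\<Sum>j<n. if j = b then \<alpha> a l * cnj (\<alpha> b l) else 0) else 0)"
            by (cases "i = a") (auto simp: elm_def intro!: sum.cong sum.neutral)
        qed
        then show ?thesis using that by (auto simp: mats_def not_less)
      qed
      then show "gram r \<alpha> a b = (\<Sum>l<r. \<Sum>i<n. \<Sum>j<n. elm i j (\<alpha> i l * cnj (\<alpha> j l))) a b"
        by (simp add: gram_def sum_apply)
    qed
    then have "p (gram r \<alpha>) = (\<Sum>l<r. Re (hform P0 n (\<lambda>i. \<alpha> i l) (\<lambda>i. \<alpha> i l)))"
      by (simp add: sum elm hform_def Re_sum mult_ac)
    then show ?thesis by (simp add: re)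
  qed
  have diag: "p (elm i i 1) = Re (P i i)" for i by (simp add: elm P_def)
  show thesis by (rule that[of P], rule herm, rule main, assumption, rule diag)
qed

lemma sum_lessThan_plus:
  "(\<Sum>k<m+n. f k) = (\<Sum>k<m. f k) + (\<Sum>k<n. f (m + k))" for f :: "nat \<Rightarrow> 'm::comm_monoid_add"
proof -
  have "(\<Sum>k\<in>{m..<m+n}. f k) = (\<Sum>k<n. f (m + k))"
    by (rule sum.reindex_bij_witness[of _ "\<lambda>k. m + k" "\<lambda>k. k - m"]) auto
  moreover have "(\<Sum>k<m+n. f k) = (\<Sum>k<m. f k) + (\<Sum>k\<in>{m..<m+n}. f k)"
    by (subst sum.union_disjoint[symmetric]) (auto intro!: sum.cong)
  ultimately show ?thesis by simp
qed

text \<open>Blocks side by side turn a sum of two expressions \<open>bil\<close> into a single one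
  over a direct sum, which makes the cone in \<open>effros_ruan\<close> closed under
  addition.\<close>

definition hcat :: "nat \<Rightarrow> complex mtx \<Rightarrow> complex mtx \<Rightarrow> complex mtx" where
  "hcat r \<alpha> \<beta> = (\<lambda>i l. if l < r then \<alpha> i l else \<beta> i (l - r))"

lemma hcat_mats: "\<alpha> \<in> mats n r \<Longrightarrow> \<beta> \<in> mats n s \<Longrightarrow> hcat r \<alpha> \<beta> \<in> mats n (r + s)"
  by (auto simp: hcat_def mats_def)

lemma gram_hcat: "gram (r + s) (hcat r \<alpha> \<beta>) = gram r \<alpha> + gram s \<beta>"
  by (intro ext) (simp add: gram_def sum_lessThan_plus hcat_def)

lemma dsum_mats: "A \<in> mats r r \<Longrightarrow> B \<in> mats s s \<Longrightarrow> dsum r A B \<in> mats (r + s) (r + s)"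
  by (auto simp: dsum_def mats_def)

lemma gram_scale:
  assumes "t \<ge> 0"
  shows "gram r (\<lambda>i l. complex_of_real (sqrt t) * \<alpha> i l) = (\<lambda>i j. complex_of_real t * gram r \<alpha> i j)"
proof (intro ext)
  fix i j
  have "complex_of_real (sqrt t) * a * cnj (complex_of_real (sqrt t) * b) = complex_of_real t * (a * cnj b)" for a b
  proof -
    have "complex_of_real (sqrt t) * a * cnj (complex_of_real (sqrt t) * b) = complex_of_real (sqrt t * sqrt t) * (a * cnj b)"
      unfolding of_real_mult by (simp add: mult_ac)
    then show ?thesis using assms by simp
  qed
  then show "gram r (\<lambda>i l. complex_of_real (sqrt t) * \<alpha> i l) i j = complex_of_real t * gram r \<alpha> i j"
    unfolding gram_def sum_distrib_left by (intro sum.cong refl)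
qed

lemma gram_zero: "gram r (\<lambda>i l. 0) = 0"
  by (simp add: gram_def fun_eq_iff)

lemma sform_scale:
  "sform r n \<phi> a (\<lambda>i p. d * y i p) (\<lambda>i p. c * x i p) = cnj d * c * sform r n \<phi> a y x"
  by (simp add: sform_def sum_distrib_left mult_ac)

text \<open>Scale both vectors to length one and rotate the phase of one of them; the bound by an
  arithmetic mean then becomes one by a product.\<close>

lemma sform_bound_of_quadratic:
  assumes le: "\<And>x y. 2 * Re (sform r n \<phi> a y x) \<le> (vnorm2 r n x)\<^sup>2 + (vnorm2 r n y)\<^sup>2"
  shows "cmod (sform r n \<phi> a y x) \<le> vnorm2 r n x * vnorm2 r n y"
proof (cases "vnorm2 r n x = 0 \<or> vnorm2 r n y = 0")
  case True
  then have "sform r n \<phi> a y x = 0"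
    unfolding vnorm2_zero_iff sform_def by (auto intro!: sum.neutral)
  then show ?thesis by simp
next
  case False
  define a' b' where "a' = vnorm2 r n x" and "b' = vnorm2 r n y"
  have pos: "a' > 0" "b' > 0"
    using False vnorm2_nonneg[of r n x] vnorm2_nonneg[of r n y] by (auto simp: a'_def b'_def less_le)
  define z where "z = sform r n \<phi> a y x"
  obtain w where w: "cmod w = 1" "w * z = complex_of_real (cmod z)"
  proof (cases "z = 0")
    case True then show ?thesis using that[of 1] by simp
  next
    case False
    moreover have "cnj z * z = complex_of_real (cmod z) * complex_of_real (cmod z)"
      using complex_norm_square[of z] by (simp add: power2_eq_square mult.commute)
    ultimately have "cnj z / complex_of_real (cmod z) * z = complex_of_real (cmod z)"
      by (simp add: field_simps)
    then show ?thesis using that[of "cnj z / complex_of_real (cmod z)"] False by (simp add: norm_divide)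
  qed
  have "2 * Re (sform r n \<phi> a (\<lambda>i p. complex_of_real (1 / b') * y i p) (\<lambda>i p. (w / complex_of_real a') * x i p))
     \<le> (vnorm2 r n (\<lambda>i p. (w / complex_of_real a') * x i p))\<^sup>2 + (vnorm2 r n (\<lambda>i p. complex_of_real (1 / b') * y i p))\<^sup>2"
    by (rule le)
  also have "vnorm2 r n (\<lambda>i p. (w / complex_of_real a') * x i p) = 1"
    using pos w by (subst vnorm2_scale) (simp add: norm_divide flip: a'_def)
  also have "vnorm2 r n (\<lambda>i p. complex_of_real (1 / b') * y i p) = 1"
    using pos by (subst vnorm2_scale) (simp add: norm_divide flip: b'_def)
  also have "sform r n \<phi> a (\<lambda>i p. complex_of_real (1 / b') * y i p) (\<lambda>i p. (w / complex_of_real a') * x i p)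
      = complex_of_real (1 / b') / complex_of_real a' * (w * z)"
    by (subst sform_scale) (simp add: z_def)
  also have "Re \<dots> = cmod z / (a' * b')"
    unfolding w(2) by (simp flip: of_real_mult of_real_divide)
  finally have "cmod z / (a' * b') \<le> 1" by simp
  then show ?thesis using pos by (simp add: z_def a'_def b'_def)
qed

context lip_space
begin

lemma bil_hcat:
  "bil (r + s) (hcat r \<alpha> \<alpha>') (dsum r v v') (hcat r \<beta> \<beta>') = bil r \<alpha> v \<beta> + bil s \<alpha>' v' \<beta>'"
  by (intro ext) (simp add: bil_def sum_lessThan_plus hcat_def dsum_def sum.distrib)

lemma bil_scale: "bil r (\<lambda>i l. c * \<alpha> i l) v (\<lambda>i l. d * \<beta> i l) = mm (c * d) (bil r \<alpha> v \<beta>)"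
  by (simp add: bil_def mmap_def sm.scale_sum_right mult_ac)

lemma bil_zero: "bil r (\<lambda>i l. 0) v \<beta> = 0" "bil r \<alpha> v (\<lambda>i l. 0) = 0"
  by (simp_all add: bil_def fun_eq_iff)

text \<open>The Effros--Ruan argument: a functional dominated by \<open>L n\<close> is dominated through a pair of
  positive functionals on the scalar matrices.\<close>

lemma effros_ruan:
  assumes n: "n \<ge> 1"
    and G: "\<And>A B. G (A + B) = G A + G B" "\<And>r A. G (mm (complex_of_real r) A) = r * G A"
    "\<And>y. y \<in> mats n n \<Longrightarrow> G y \<le> L n y"
  obtains P Q where "\<And>i j. P j i = cnj (P i j)" "\<And>x. 0 \<le> Re (hform P n x x)" "(\<Sum>i<n. Re (P i i)) \<le> 1"
    "\<And>i j. Q j i = cnj (Q i j)" "\<And>x. 0 \<le> Re (hform Q n x x)" "(\<Sum>i<n. Re (Q i i)) \<le> 1"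
    "\<And>r v \<alpha> \<beta>. r \<ge> 1 \<Longrightarrow> v \<in> mats r r \<Longrightarrow> L r v \<le> 1 \<Longrightarrow> \<alpha> \<in> mats n r \<Longrightarrow> \<beta> \<in> mats n r \<Longrightarrow>
      2 * G (bil r \<alpha> v \<beta>) \<le> (\<Sum>l<r. Re (hform P n (\<lambda>i. \<alpha> i l) (\<lambda>i. \<alpha> i l)))
        + (\<Sum>l<r. Re (hform Q n (\<lambda>i. \<beta> i l) (\<lambda>i. \<beta> i l)))"
proof -
  define sc :: "real \<Rightarrow> complex mtx \<times> complex mtx \<Rightarrow> complex mtx \<times> complex mtx" where
    "sc r z = ((\<lambda>i j. complex_of_real r * fst z i j), (\<lambda>i j. complex_of_real r * snd z i j))" for r z
  have vs: "vector_space sc"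
    by standard (simp_all add: sc_def fun_eq_iff prod_eq_iff ring_distribs)
  have G0: "G 0 = 0" using G(2)[of 0 0] by simp
  \<comment> \<open>This says that \<open>x\<close> plus the Gram matrix of \<alpha> is at most
    \<open>s\<close> times the identity. The dominating functional is the infimum of the two upper
    bounds minus \<open>2 * G (bil r \<alpha> v \<beta>)\<close>; evaluated at the negative Gram
    matrices it gives the desired estimate.\<close>
  define dom where "dom x s r \<alpha> \<longleftrightarrow> (\<forall>\<xi>. Re (hform (x + gram r \<alpha>) n \<xi> \<xi>) \<le> s * (vnorm n \<xi>)\<^sup>2)" for x s r \<alpha>
  define \<Gamma> where "\<Gamma> = {(z, t). \<exists>r\<ge>1. \<exists>\<alpha>\<in>mats n r. \<exists>\<beta>\<in>mats n r. \<exists>v\<in>mats r r. \<exists>s1\<ge>0. \<exists>s2\<ge>0.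
     L r v \<le> 1 \<and> s1 + s2 - 2 * G (bil r \<alpha> v \<beta>) \<le> t \<and> dom (fst z) s1 r \<alpha> \<and> dom (snd z) s2 r \<beta>}"
  have \<Gamma>I: "(z, t) \<in> \<Gamma>" if "r \<ge> 1" "\<alpha> \<in> mats n r" "\<beta> \<in> mats n r" "v \<in> mats r r" "s1 \<ge> 0" "s2 \<ge> 0"
    "L r v \<le> 1" "s1 + s2 - 2 * G (bil r \<alpha> v \<beta>) \<le> t" "dom (fst z) s1 r \<alpha>" "dom (snd z) s2 r \<beta>"
    for z t r \<alpha> \<beta> v s1 s2
    unfolding \<Gamma>_def using that by blast
  have Z: "(\<lambda>i l. 0) \<in> mats n r" for r by (auto simp: mats_def)
  have simple: "((x, y), s1 + s2) \<in> \<Gamma>" if "s1 \<ge> 0" "s2 \<ge> 0"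
    "\<And>\<xi>. Re (hform x n \<xi> \<xi>) \<le> s1 * (vnorm n \<xi>)\<^sup>2" "\<And>\<xi>. Re (hform y n \<xi> \<xi>) \<le> s2 * (vnorm n \<xi>)\<^sup>2" for x y s1 s2
    using that by (intro \<Gamma>I[of 1 "\<lambda>i l. 0" "\<lambda>i l. 0" 0 s1 s2])
      (simp_all add: Z mats_0 L_0 bil_zero G0 dom_def gram_zero)
  obtain R where R: "\<And>x y. R (x + y) = R x + R y" "\<And>r x. R (sc r x) = r * R x"
    "\<And>x t. (x, t) \<in> \<Gamma> \<Longrightarrow> R x \<le> t"
  proof (rule hahn_banach_cone[OF vs, of \<Gamma>])
    show "(0, 0) \<in> \<Gamma>"
      using simple[of 0 0 0 0] by (simp add: hform_zero zero_prod_def)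
  next
    fix z z' t t' assume "(z, t) \<in> \<Gamma>" "(z', t') \<in> \<Gamma>"
    then obtain r \<alpha> \<beta> v s1 s2 r' \<alpha>' \<beta>' v' s1' s2' where
      1: "r \<ge> 1" "\<alpha> \<in> mats n r" "\<beta> \<in> mats n r" "v \<in> mats r r" "s1 \<ge> 0" "s2 \<ge> 0"
      "L r v \<le> 1" "s1 + s2 - 2 * G (bil r \<alpha> v \<beta>) \<le> t" "dom (fst z) s1 r \<alpha>" "dom (snd z) s2 r \<beta>" and
      2: "r' \<ge> 1" "\<alpha>' \<in> mats n r'" "\<beta>' \<in> mats n r'" "v' \<in> mats r' r'" "s1' \<ge> 0" "s2' \<ge> 0"
      "L r' v' \<le> 1" "s1' + s2' - 2 * G (bil r' \<alpha>' v' \<beta>') \<le> t'" "dom (fst z') s1' r' \<alpha>'" "dom (snd z') s2' r' \<beta>'"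
      unfolding \<Gamma>_def by blast
    have dom_add: "dom (x + x') (s + s') (r + r') (hcat r \<gamma> \<gamma>')" if "dom x s r \<gamma>" "dom x' s' r' \<gamma>'" for x x' s s' \<gamma> \<gamma>'
      using that unfolding dom_def gram_hcat hform_plus by (simp add: ring_distribs) (smt (verit))
    show "(z + z', t + t') \<in> \<Gamma>"
    proof (rule \<Gamma>I[of "r + r'" "hcat r \<alpha> \<alpha>'" "hcat r \<beta> \<beta>'" "dsum r v v'" "s1 + s1'" "s2 + s2'"])
      show "L (r + r') (dsum r v v') \<le> 1" using 1 2 by (subst L_dsum) auto
      show "s1 + s1' + (s2 + s2') - 2 * G (bil (r + r') (hcat r \<alpha> \<alpha>') (dsum r v v') (hcat r \<beta> \<beta>')) \<le> t + t'"
        unfolding bil_hcat G(1) using 1(8) 2(8) by simp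
    qed (use 1 2 in \<open>auto intro: hcat_mats dsum_mats dom_add\<close>)
  next
    fix z t and q :: real assume "(z, t) \<in> \<Gamma>" and q: "q > 0"
    then obtain r \<alpha> \<beta> v s1 s2 where
      1: "r \<ge> 1" "\<alpha> \<in> mats n r" "\<beta> \<in> mats n r" "v \<in> mats r r" "s1 \<ge> 0" "s2 \<ge> 0"
      "L r v \<le> 1" "s1 + s2 - 2 * G (bil r \<alpha> v \<beta>) \<le> t" "dom (fst z) s1 r \<alpha>" "dom (snd z) s2 r \<beta>"
      unfolding \<Gamma>_def by blast
    \<comment> \<open>Gram matrices are quadratic and \<open>bil\<close> is bilinear, so both scale
      by \<open>q\<close> when \<alpha> and \<beta> scale by its square root.\<close>
    define c where "c = complex_of_real (sqrt q)"
    have cc: "c * c = complex_of_real q" using q by (simp add: c_def flip: of_real_mult)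
    have dom_scale: "dom (\<lambda>i j. complex_of_real q * x i j) (q * s) r (\<lambda>i l. c * \<gamma> i l)" if "dom x s r \<gamma>" for x s \<gamma>
      unfolding dom_def
    proof
      fix \<xi>
      have "Re (hform ((\<lambda>i j. complex_of_real q * x i j) + gram r (\<lambda>i l. c * \<gamma> i l)) n \<xi> \<xi>)
         = q * Re (hform (x + gram r \<gamma>) n \<xi> \<xi>)"
        unfolding hform_plus c_def gram_scale[OF less_imp_le[OF q]] hform_mult by (simp add: algebra_simps)
      also have "\<dots> \<le> q * (s * (vnorm n \<xi>)\<^sup>2)"
        using that q unfolding dom_def by (intro mult_left_mono) auto
      finally show "Re (hform ((\<lambda>i j. complex_of_real q * x i j) + gram r (\<lambda>i l. c * \<gamma> i l)) n \<xi> \<xi>) \<le> q * s * (vnorm n \<xi>)\<^sup>2"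
        by (simp add: mult_ac)
    qed
    show "(sc q z, q * t) \<in> \<Gamma>"
    proof (rule \<Gamma>I[of r "\<lambda>i l. c * \<alpha> i l" "\<lambda>i l. c * \<beta> i l" v "q * s1" "q * s2"])
      have "q * (s1 + s2 - 2 * G (bil r \<alpha> v \<beta>)) \<le> q * t" using 1(8) q by simp
      then show "q * s1 + q * s2 - 2 * G (bil r (\<lambda>i l. c * \<alpha> i l) v (\<lambda>i l. c * \<beta> i l)) \<le> q * t"
        unfolding bil_scale cc G(2) by (simp add: algebra_simps)
    qed (use 1 q in \<open>auto simp: sc_def mats_def intro: dom_scale\<close>)
  next
    fix z :: "complex mtx \<times> complex mtx"
    have "((fst z, snd z), cnorm n n (fst z) + cnorm n n (snd z)) \<in> \<Gamma>"
      by (intro simple cnorm_nonneg order_trans[OF complex_Re_le_cmod hform_le_cnorm])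
    then show "\<exists>t. (z, t) \<in> \<Gamma>" by auto
  next
    \<comment> \<open>Now \<alpha> and \<beta> have norms at most \<open>sqrt s1\<close> and
      \<open>sqrt s2\<close>. Domination of \<open>G\<close> by \<open>L\<close> and the product
      axiom for \<open>L\<close> bound \<open>G (bil r \<alpha> v \<beta>)\<close> by the geometric
      mean of \<open>s1\<close> and \<open>s2\<close>, hence by the arithmetic one.\<close>
    fix t assume "(0, t) \<in> \<Gamma>"
    then obtain r \<alpha> \<beta> v s1 s2 where
      1: "r \<ge> 1" "\<alpha> \<in> mats n r" "\<beta> \<in> mats n r" "v \<in> mats r r" "s1 \<ge> 0" "s2 \<ge> 0"
      "L r v \<le> 1" "s1 + s2 - 2 * G (bil r \<alpha> v \<beta>) \<le> t" "dom 0 s1 r \<alpha>" "dom 0 s2 r \<beta>"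
      unfolding \<Gamma>_def by auto
    have d: "(\<Sum>l<r. (cmod (\<Sum>i<n. \<gamma> i l * \<xi> i))\<^sup>2) \<le> s * (vnorm n \<xi>)\<^sup>2" if "dom 0 s r \<gamma>" for s \<gamma> \<xi>
      using that unfolding dom_def by (simp add: hform_gram)
    have "G (bil r \<alpha> v \<beta>) \<le> L n (bil r \<alpha> v \<beta>)" by (intro G(3) bil_mats 1)
    also have "\<dots> \<le> sqrt s1 * L r v * sqrt s2"
      by (rule L_bil[OF 1(1) n 1(4,2,3) d[OF 1(9)] d[OF 1(10)] 1(5,6)])
    also have "\<dots> \<le> sqrt s1 * 1 * sqrt s2"
      using 1 by (intro mult_right_mono mult_left_mono) auto
    finally have "G (bil r \<alpha> v \<beta>) \<le> sqrt s1 * sqrt s2" by simp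
    moreover have "2 * (sqrt s1 * sqrt s2) \<le> s1 + s2"
      using sum_squares_bound[of "sqrt s1" "sqrt s2"] 1 by (simp add: mult.assoc)
    ultimately have "2 * G (bil r \<alpha> v \<beta>) \<le> s1 + s2" by linarith
    then show "t \<ge> 0" using 1(8) by simp
  qed blast
  have R_minus: "R (- z) = - R z" for z
  proof -
    have "sc (-1) z = - z" by (simp add: sc_def fun_eq_iff prod_eq_iff)
    then show ?thesis using R(2)[of "-1" z] by simp
  qed
  define p q where "p x = R (x, 0)" and "q x = R (0, x)" for x
  have pq: "p (x + y) = p x + p y" "q (x + y) = q x + q y"
    "p (\<lambda>i j. complex_of_real r * x i j) = r * p x" "q (\<lambda>i j. complex_of_real r * x i j) = r * q x" for x y r
  proof -
    show "p (x + y) = p x + p y" "q (x + y) = q x + q y"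
      using R(1)[of "(x, 0)" "(y, 0)"] R(1)[of "(0, x)" "(0, y)"] by (simp_all add: p_def q_def)
    have "sc r (x, 0) = ((\<lambda>i j. complex_of_real r * x i j), 0)" "sc r (0, x) = (0, (\<lambda>i j. complex_of_real r * x i j))"
      by (auto simp: sc_def fun_eq_iff)
    then show "p (\<lambda>i j. complex_of_real r * x i j) = r * p x" "q (\<lambda>i j. complex_of_real r * x i j) = r * q x"
      using R(2)[of r "(x, 0)"] R(2)[of r "(0, x)"] by (simp_all add: p_def q_def)
  qed
  obtain P where P: "\<And>i j. P j i = cnj (P i j)"
    "\<And>r \<alpha>. \<alpha> \<in> mats n r \<Longrightarrow> p (gram r \<alpha>) = (\<Sum>l<r. Re (hform P n (\<lambda>i. \<alpha> i l) (\<lambda>i. \<alpha> i l)))"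
    "\<And>i. i < n \<Longrightarrow> p (elm i i 1) = Re (P i i)"
    by (rule functional_hform[of p n, OF pq(1,3)]) (rule that)
  obtain Q where Q: "\<And>i j. Q j i = cnj (Q i j)"
    "\<And>r \<alpha>. \<alpha> \<in> mats n r \<Longrightarrow> q (gram r \<alpha>) = (\<Sum>l<r. Re (hform Q n (\<lambda>i. \<alpha> i l) (\<lambda>i. \<alpha> i l)))"
    "\<And>i. i < n \<Longrightarrow> q (elm i i 1) = Re (Q i i)"
    by (rule functional_hform[of q n, OF pq(2,4)]) (rule that)
  have main: "2 * G (bil r \<alpha> v \<beta>) \<le> p (gram r \<alpha>) + q (gram r \<beta>)"
    if "r \<ge> 1" "v \<in> mats r r" "L r v \<le> 1" "\<alpha> \<in> mats n r" "\<beta> \<in> mats n r" for r v \<alpha> \<beta>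
  proof -
    have "((- gram r \<alpha>, - gram r \<beta>), - 2 * G (bil r \<alpha> v \<beta>)) \<in> \<Gamma>"
      using that by (intro \<Gamma>I[of r \<alpha> \<beta> v 0 0]) (simp_all add: dom_def hform_zero)
    then have "R (- gram r \<alpha>, - gram r \<beta>) \<le> - 2 * G (bil r \<alpha> v \<beta>)" by (rule R(3))
    moreover have "R (- gram r \<alpha>, - gram r \<beta>) = - (p (gram r \<alpha>) + q (gram r \<beta>))"
      using R_minus[of "(gram r \<alpha>, gram r \<beta>)"] R(1)[of "(gram r \<alpha>, 0)" "(0, gram r \<beta>)"]
      by (simp add: p_def q_def)
    ultimately show ?thesis by simp
  qed
  have nn: "0 \<le> p (gram 1 (\<lambda>i l. if i < n \<and> l = 0 then x i else 0))" "0 \<le> q (gram 1 (\<lambda>i l. if i < n \<and> l = 0 then x i else 0))" for x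
  proof -
    let ?g = "gram 1 (\<lambda>i l. if i < n \<and> l = 0 then x i else 0)"
    have "Re (hform (- ?g) n \<xi> \<xi>) \<le> 0 * (vnorm n \<xi>)\<^sup>2" for \<xi>
      by (simp add: hform_minus hform_gram del: One_nat_def)
    then have "((- ?g, 0), 0 + 0) \<in> \<Gamma>" "((0, - ?g), 0 + 0) \<in> \<Gamma>"
      by (intro simple; simp add: hform_zero)+
    then show "0 \<le> p ?g" "0 \<le> q ?g"
      using R(3) R_minus[of "(?g, 0)"] R_minus[of "(0, ?g)"] by (fastforce simp: p_def q_def)+
  qed
  have col: "hform H n (\<lambda>i. if i < n \<and> (0::nat) = 0 then x i else 0) (\<lambda>i. if i < n \<and> (0::nat) = 0 then x i else 0) = hform H n x x" for H x
    by (simp add: hform_def)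
  have M1: "(\<lambda>i l. if i < n \<and> l = 0 then x i else 0) \<in> mats n 1" for x :: "nat \<Rightarrow> complex"
    by (auto simp: mats_def)
  have posP: "0 \<le> Re (hform P n x x)" and posQ: "0 \<le> Re (hform Q n x x)" for x
    using nn[of x] by (simp_all add: P(2)[OF M1] Q(2)[OF M1] col del: One_nat_def) (simp_all add: hform_def)
  have Id: "hform (\<Sum>i<n. elm i i 1) n \<xi> \<xi> = complex_of_real ((vnorm n \<xi>)\<^sup>2)" for \<xi>
    using hform_diag[of n 1 \<xi>] by (simp add: smat_elm[symmetric] smat_def)
  have pI: "p (\<Sum>i<n. elm i i 1) = (\<Sum>i<n. Re (P i i))" and qI: "q (\<Sum>i<n. elm i i 1) = (\<Sum>i<n. Re (Q i i))"
  proof -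
    have s: "f (\<Sum>i\<in>S. h i) = (\<Sum>i\<in>S. f (h i))" if "\<And>x y. f (x + y) = f x + f y" for f :: "complex mtx \<Rightarrow> real" and h S
    proof -
      have "f 0 = 0" using that[of 0 0] by simp
      then show ?thesis by (induction S rule: infinite_finite_induct) (simp_all add: that)
    qed
    show "p (\<Sum>i<n. elm i i 1) = (\<Sum>i<n. Re (P i i))" by (simp add: s[OF pq(1)] P(3))
    show "q (\<Sum>i<n. elm i i 1) = (\<Sum>i<n. Re (Q i i))" by (simp add: s[OF pq(2)] Q(3))
  qed
  \<comment> \<open>The identity is bounded by 1; this limits the traces of \<open>P\<close> and
    \<open>Q\<close>.\<close>
  have I: "(((\<Sum>i<n. elm i i 1), 0), 1 + 0) \<in> \<Gamma>" "((0, (\<Sum>i<n. elm i i 1)), 0 + 1) \<in> \<Gamma>"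
    by (intro simple; simp add: Id hform_zero)+
  have trP: "(\<Sum>i<n. Re (P i i)) \<le> 1"
    using R(3)[OF I(1)] unfolding pI[symmetric] p_def by simp
  have trQ: "(\<Sum>i<n. Re (Q i i)) \<le> 1"
    using R(3)[OF I(2)] unfolding qI[symmetric] q_def by simp
  show thesis
  proof (rule that[of P Q])
    show "2 * G (bil r \<alpha> v \<beta>) \<le> (\<Sum>l<r. Re (hform P n (\<lambda>i. \<alpha> i l) (\<lambda>i. \<alpha> i l)))
        + (\<Sum>l<r. Re (hform Q n (\<lambda>i. \<beta> i l) (\<lambda>i. \<beta> i l)))"
      if "r \<ge> 1" "v \<in> mats r r" "L r v \<le> 1" "\<alpha> \<in> mats n r" "\<beta> \<in> mats n r" for r v \<alpha> \<beta>
      using main[OF that] unfolding P(2)[OF that(4)] Q(2)[OF that(5)] .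
  qed (rule P(1) Q(1) posP posQ trP trQ)+
qed

end

lemma sum4_swap:
  "(\<Sum>a\<in>A. \<Sum>b\<in>B. \<Sum>c\<in>C. \<Sum>d\<in>D. f a b c d) = (\<Sum>c\<in>C. \<Sum>d\<in>D. \<Sum>a\<in>A. \<Sum>b\<in>B. f a b c d)"
  for f :: "_ \<Rightarrow> _ \<Rightarrow> _ \<Rightarrow> _ \<Rightarrow> 'm::comm_monoid_add"
proof -
  have "(\<Sum>a\<in>A. \<Sum>b\<in>B. \<Sum>c\<in>C. \<Sum>d\<in>D. f a b c d) = (\<Sum>a\<in>A. \<Sum>c\<in>C. \<Sum>b\<in>B. \<Sum>d\<in>D. f a b c d)"
    by (rule sum.cong[OF refl], rule sum.swap)
  also have "\<dots> = (\<Sum>c\<in>C. \<Sum>a\<in>A. \<Sum>b\<in>B. \<Sum>d\<in>D. f a b c d)"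
    by (rule sum.swap)
  also have "\<dots> = (\<Sum>c\<in>C. \<Sum>a\<in>A. \<Sum>d\<in>D. \<Sum>b\<in>B. f a b c d)"
    by (rule sum.cong[OF refl], rule sum.cong[OF refl], rule sum.swap)
  also have "\<dots> = (\<Sum>c\<in>C. \<Sum>d\<in>D. \<Sum>a\<in>A. \<Sum>b\<in>B. f a b c d)"
    by (rule sum.cong[OF refl], rule sum.swap)
  finally show ?thesis .
qed

lemma hform_diag_add:
  "hform (\<lambda>i j. P i j + (if i = j \<and> i < n then complex_of_real \<epsilon> else 0)) n x x
    = hform P n x x + complex_of_real (\<epsilon> * (vnorm n x)\<^sup>2)"
  using hform_plus[of P "\<lambda>i j. if i = j \<and> i < n then complex_of_real \<epsilon> else 0" n x]
  by (simp add: hform_diag plus_fun_def)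

text \<open>The matrices from \<open>effros_ruan\<close> are only semidefinite, so \<epsilon> is
  added on the diagonal. The squared Hilbert-Schmidt norm of the factor \<open>c\<close> is the
  trace of the perturbed matrix, which explains \<open>1 + n * \<epsilon>\<close>.\<close>

lemma gram_schmidt_perturbed:
  fixes \<epsilon> :: real
  assumes herm: "\<And>i j. P j i = cnj (P i j)" and nn: "\<And>x. 0 \<le> Re (hform P n x x)" and \<epsilon>: "\<epsilon> > 0"
    and tr: "(\<Sum>i<n. Re (P i i)) \<le> 1"
  obtains h c where "\<And>x. Re (hform P n (\<lambda>i. \<Sum>k<n. x k * h k i) (\<lambda>i. \<Sum>k<n. x k * h k i)) \<le> (\<Sum>k<n. (cmod (x k))\<^sup>2)"
    "\<And>i j. i < n \<Longrightarrow> (\<Sum>k<n. c i k * h k j) = (if i = j then 1 else 0)"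
    "(vnorm2 n n c)\<^sup>2 \<le> 1 + n * \<epsilon>"
proof -
  define P' where "P' i j = P i j + (if i = j \<and> i < n then complex_of_real \<epsilon> else 0)" for i j
  have eq: "hform P' n x x = hform P n x x + complex_of_real (\<epsilon> * (vnorm n x)\<^sup>2)" for x
    unfolding P'_def by (rule hform_diag_add)
  obtain h c where orth: "\<And>x y. hform P' n (\<lambda>i. \<Sum>k<n. x k * h k i) (\<lambda>i. \<Sum>k<n. y k * h k i) = (\<Sum>k<n. x k * cnj (y k))"
    and gen: "\<And>i j. i < n \<Longrightarrow> (\<Sum>k<n. c i k * h k j) = (if i = j then 1 else 0)"
    and fac: "\<And>i j. i < n \<Longrightarrow> j < n \<Longrightarrow> P' i j = (\<Sum>k<n. c i k * cnj (c j k))"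
  proof (rule gram_schmidt[where P = P' and n = n])
    show "P' j i = cnj (P' i j)" for i j using herm[of i j] by (simp add: P'_def)
    show "0 < Re (hform P' n x x)" if "i < n" "x i \<noteq> 0" for x i
    proof -
      have "vnorm n x \<noteq> 0" using that by (auto simp: vnorm_zero_iff)
      then have "\<epsilon> * (vnorm n x)\<^sup>2 > 0" using \<epsilon> by simp
      then show ?thesis using nn[of x] by (simp add: eq)
    qed
  qed (rule that)
  have le: "Re (hform P n x x) \<le> Re (hform P' n x x)" for x
    using \<epsilon> by (simp add: eq)
  show thesis
  proof (rule that[of h c])
    fix x
    have "(\<Sum>k<n. x k * cnj (x k)) = complex_of_real (\<Sum>k<n. (cmod (x k))\<^sup>2)"
      unfolding of_real_sum by (intro sum.cong refl) (simp only: complex_norm_square)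
    then show "Re (hform P n (\<lambda>i. \<Sum>k<n. x k * h k i) (\<lambda>i. \<Sum>k<n. x k * h k i)) \<le> (\<Sum>k<n. (cmod (x k))\<^sup>2)"
      using le[of "\<lambda>i. \<Sum>k<n. x k * h k i"] unfolding orth by simp
  next
    have "complex_of_real ((vnorm2 n n c)\<^sup>2) = (\<Sum>i<n. P' i i)"
      unfolding vnorm2_squared of_real_sum
      by (intro sum.cong refl) (simp add: fac complex_norm_square del: of_real_power)
    also have "\<dots> = (\<Sum>i<n. P i i) + n * \<epsilon>" by (simp add: P'_def sum.distrib)
    finally have "(vnorm2 n n c)\<^sup>2 = Re ((\<Sum>i<n. P i i) + n * \<epsilon>)" by (metis Re_complex_of_real)
    then show "(vnorm2 n n c)\<^sup>2 \<le> 1 + n * \<epsilon>" using tr by simp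
  qed (rule gen)
qed

lemma unit_phase:
  obtains w where "cmod w = 1" "w * z = complex_of_real (cmod z)"
proof (cases "z = 0")
  case True then show ?thesis using that[of 1] by simp
next
  case False
  moreover have "cnj z * z = complex_of_real (cmod z) * complex_of_real (cmod z)"
    using complex_norm_square[of z] by (simp add: power2_eq_square mult.commute)
  ultimately have "cnj z / complex_of_real (cmod z) * z = complex_of_real (cmod z)"
    by (simp add: field_simps)
  then show ?thesis using that[of "cnj z / complex_of_real (cmod z)"] False by (simp add: norm_divide)
qed

context lip_space
begin

text \<open>The functional \<open>G\<close> becomes a matrix-valued map once \<open>P\<close> and
  \<open>Q\<close> are normalised from the left and from the right. All amplified forms of
  \<open>g\<close> are then contractive on the unit balls of \<open>L\<close>, and the two
  coefficient matrices from Gram-Schmidt serve as vectors at which \<open>g\<close> returns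
  \<open>G\<close>.\<close>

lemma contraction:
  fixes \<epsilon> :: real
  assumes n: "n \<ge> 1" and \<epsilon>: "\<epsilon> > 0"
    and G: "\<And>A B. G (A + B) = G A + G B" "\<And>r A. G (mm (complex_of_real r) A) = r * G A"
    "\<And>y. y \<in> mats n n \<Longrightarrow> G y \<le> L n y"
    and K: "\<And>x \<tau>. x \<in> mats n n \<Longrightarrow> \<tau> \<ge> 0 \<Longrightarrow> nrad V n \<tau> x \<Longrightarrow> G x \<le> K * \<tau>" "K \<ge> 0"
  obtains g x y K' where "\<And>v w p q. g (v + w) p q = g v p q + g w p q"
    "\<And>c v p q. g (sm c v) p q = c * g v p q" "\<And>p q. g (munit V) p q = (0 :: complex)"
    "\<And>r v x y. r \<ge> 1 \<Longrightarrow> v \<in> mats r r \<Longrightarrow> L r v \<le> 1 \<Longrightarrow> cmod (sform r n g v y x) \<le> vnorm2 r n x * vnorm2 r n y"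
    "(vnorm2 n n x)\<^sup>2 \<le> 1 + n * \<epsilon>" "(vnorm2 n n y)\<^sup>2 \<le> 1 + n * \<epsilon>"
    "\<And>b. b \<in> mats n n \<Longrightarrow> Re (sform n n g b y x) = G b"
    "K' \<ge> 0" "\<And>v \<tau> p q. \<tau> \<ge> 0 \<Longrightarrow> nrad V 1 \<tau> (one_one v) \<Longrightarrow> p < n \<Longrightarrow> q < n \<Longrightarrow> cmod (g v p q) \<le> K' * \<tau>"
proof -
  obtain P Q where P: "\<And>i j. P j i = cnj (P i j)" "\<And>x. 0 \<le> Re (hform P n x x)" "(\<Sum>i<n. Re (P i i)) \<le> 1"
    and Q: "\<And>i j. Q j i = cnj (Q i j)" "\<And>x. 0 \<le> Re (hform Q n x x)" "(\<Sum>i<n. Re (Q i i)) \<le> 1"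
    and PQ: "\<And>r v \<alpha> \<beta>. r \<ge> 1 \<Longrightarrow> v \<in> mats r r \<Longrightarrow> L r v \<le> 1 \<Longrightarrow> \<alpha> \<in> mats n r \<Longrightarrow> \<beta> \<in> mats n r \<Longrightarrow>
      2 * G (bil r \<alpha> v \<beta>) \<le> (\<Sum>l<r. Re (hform P n (\<lambda>i. \<alpha> i l) (\<lambda>i. \<alpha> i l)))
        + (\<Sum>l<r. Re (hform Q n (\<lambda>i. \<beta> i l) (\<lambda>i. \<beta> i l)))"
    by (rule effros_ruan[OF n, of G]; (rule G)?) (assumption | rule that)+
  obtain h c where h: "\<And>x. Re (hform P n (\<lambda>i. \<Sum>k<n. x k * h k i) (\<lambda>i. \<Sum>k<n. x k * h k i)) \<le> (\<Sum>k<n. (cmod (x k))\<^sup>2)"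
    "\<And>i j. i < n \<Longrightarrow> (\<Sum>k<n. c i k * h k j) = (if i = j then 1 else 0)" "(vnorm2 n n c)\<^sup>2 \<le> 1 + n * \<epsilon>"
    by (rule gram_schmidt_perturbed[OF P(1,2) \<epsilon> P(3)]) (rule that)
  obtain k d where k: "\<And>x. Re (hform Q n (\<lambda>i. \<Sum>j<n. x j * k j i) (\<lambda>i. \<Sum>j<n. x j * k j i)) \<le> (\<Sum>j<n. (cmod (x j))\<^sup>2)"
    "\<And>i j. i < n \<Longrightarrow> (\<Sum>l<n. d i l * k l j) = (if i = j then 1 else 0)" "(vnorm2 n n d)\<^sup>2 \<le> 1 + n * \<epsilon>"
    by (rule gram_schmidt_perturbed[OF Q(1,2) \<epsilon> Q(3)]) (rule that)
  define F where "F = cpx G"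
  note F = cpx_linear[OF G(1,2), folded F_def]
  have F_re: "Re (F X) = G X" for X by (simp add: F_def cpx_def)
  define g where "g v p q = (\<Sum>i<n. \<Sum>j<n. h p i * k q j * F (elm i j v))" for v p q
  define col where "col f r i l = (if i < n \<and> l < (r::nat) then f l i else 0)" for f :: "nat \<Rightarrow> nat \<Rightarrow> complex" and r i l
  have col_mats: "col f r \<in> mats n r" for f r by (auto simp: col_def mats_def)
  \<comment> \<open>Evaluating the form of \<open>g\<close> moves \<open>h\<close> and
    \<open>k\<close> into the vectors and leaves the functional at a product \<open>bil\<close>, to
    which the estimate by \<open>P\<close> and \<open>Q\<close> applies.\<close>
  have key: "sform r n g v y x = F (bil r (col (\<lambda>l i. \<Sum>p<n. cnj (y l p) * h p i) r) v (col (\<lambda>l j. \<Sum>q<n. x l q * k q j) r))"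
    (is "_ = F (bil r ?\<alpha> v ?\<beta>)") for r v x y
  proof -
    have "sform r n g v y x = (\<Sum>a<r. \<Sum>b<r. \<Sum>i<n. \<Sum>j<n. (?\<alpha> i a * ?\<beta> j b) * F (elm i j (v a b)))"
      unfolding sform_def
    proof (rule sum.cong[OF refl], rule sum.cong[OF refl])
      fix a b assume ab: "a \<in> {..<r}" "b \<in> {..<r}"
      have "(\<Sum>p<n. \<Sum>q<n. cnj (y a p) * g (v a b) p q * x b q)
          = (\<Sum>p<n. \<Sum>q<n. \<Sum>i<n. \<Sum>j<n. (cnj (y a p) * h p i) * (x b q * k q j) * F (elm i j (v a b)))"
        unfolding g_def by (intro sum.cong refl) (simp add: sum_distrib_left sum_distrib_right mult_ac)
      also have "\<dots> = (\<Sum>i<n. \<Sum>j<n. \<Sum>p<n. \<Sum>q<n. (cnj (y a p) * h p i) * (x b q * k q j) * F (elm i j (v a b)))"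
        by (rule sum4_swap)
      also have "\<dots> = (\<Sum>i<n. \<Sum>j<n. (?\<alpha> i a * ?\<beta> j b) * F (elm i j (v a b)))"
      proof -
        have "(\<Sum>p<n. \<Sum>q<n. A p * B q * E) = (\<Sum>p<n. A p) * (\<Sum>q<n. B q) * E" for A B :: "nat \<Rightarrow> complex" and E
          unfolding sum_product by (simp only: sum_distrib_right)
        then show ?thesis using ab by (intro sum.cong refl) (simp only: col_def, simp)
      qed
      finally show "(\<Sum>p<n. \<Sum>q<n. cnj (y a p) * g (v a b) p q * x b q)
          = (\<Sum>i<n. \<Sum>j<n. (?\<alpha> i a * ?\<beta> j b) * F (elm i j (v a b)))" .
    qed
    also have "\<dots> = (\<Sum>i<n. \<Sum>j<n. \<Sum>a<r. \<Sum>b<r. (?\<alpha> i a * ?\<beta> j b) * F (elm i j (v a b)))"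
      by (rule sum4_swap)
    also have "\<dots> = (\<Sum>i<n. \<Sum>j<n. F (elm i j (bil r ?\<alpha> v ?\<beta> i j)))"
      by (intro sum.cong refl) (simp add: bil_def elm_sum F flip: mm_elm)
    also have "\<dots> = F (bil r ?\<alpha> v ?\<beta>)"
      by (subst (2) mtx_elm_sum[OF bil_mats[OF col_mats col_mats]]) (simp add: F)
    finally show ?thesis .
  qed
  have quad: "2 * Re (sform r n g v y x) \<le> (vnorm2 r n x)\<^sup>2 + (vnorm2 r n y)\<^sup>2"
    if r: "r \<ge> 1" "v \<in> mats r r" "L r v \<le> 1" for r v x y
  proof -
    let ?\<alpha> = "col (\<lambda>l i. \<Sum>p<n. cnj (y l p) * h p i) r" and ?\<beta> = "col (\<lambda>l j. \<Sum>q<n. x l q * k q j) r"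
    have hc: "hform H n (\<lambda>i. col f r i l) (\<lambda>i. col f r i l) = hform H n (f l) (f l)" if "l < r" for H f l
      unfolding hform_def using that by (intro sum.cong refl) (simp add: col_def)
    have "2 * Re (sform r n g v y x) = 2 * G (bil r ?\<alpha> v ?\<beta>)" by (simp add: key F_re)
    also have "\<dots> \<le> (\<Sum>l<r. Re (hform P n (\<lambda>i. ?\<alpha> i l) (\<lambda>i. ?\<alpha> i l)))
        + (\<Sum>l<r. Re (hform Q n (\<lambda>i. ?\<beta> i l) (\<lambda>i. ?\<beta> i l)))"
      by (intro PQ r col_mats)
    also have "\<dots> \<le> (\<Sum>l<r. \<Sum>p<n. (cmod (y l p))\<^sup>2) + (\<Sum>l<r. \<Sum>q<n. (cmod (x l q))\<^sup>2)"
    proof (intro add_mono sum_mono)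
      fix l assume "l \<in> {..<r}"
      then have l: "l < r" by simp
      show "Re (hform P n (\<lambda>i. ?\<alpha> i l) (\<lambda>i. ?\<alpha> i l)) \<le> (\<Sum>p<n. (cmod (y l p))\<^sup>2)"
        unfolding hc[OF l] using h(1)[of "\<lambda>p. cnj (y l p)"] by simp
      show "Re (hform Q n (\<lambda>i. ?\<beta> i l) (\<lambda>i. ?\<beta> i l)) \<le> (\<Sum>q<n. (cmod (x l q))\<^sup>2)"
        unfolding hc[OF l] by (rule k(1))
    qed
    finally show ?thesis by (simp add: vnorm2_squared)
  qed
  have evalb: "Re (sform n n g b (\<lambda>a p. cnj (c a p)) d) = G b" if b: "b \<in> mats n n" for b
  proof -
    have "bil n (col (\<lambda>l i. \<Sum>p<n. cnj (cnj (c l p)) * h p i) n) b (col (\<lambda>l j. \<Sum>q<n. d l q * k q j) n) = b"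
    proof (intro ext)
      fix i j
      have "bil n (col (\<lambda>l i. \<Sum>p<n. cnj (cnj (c l p)) * h p i) n) b (col (\<lambda>l j. \<Sum>q<n. d l q * k q j) n) i j
        = (\<Sum>a<n. if a = i then (\<Sum>l<n. if l = j then b i j else 0) else 0)"
        unfolding bil_def
      proof (rule sum.cong[OF refl])
        fix a assume a: "a \<in> {..<n}"
        show "(\<Sum>l<n. sm (col (\<lambda>l i. \<Sum>p<n. cnj (cnj (c l p)) * h p i) n i a * col (\<lambda>l j. \<Sum>q<n. d l q * k q j) n j l) (b a l))
          = (if a = i then (\<Sum>l<n. if l = j then b i j else 0) else 0)"
        proof -
          have d: "sm (if B then 1 else 0) y = (if B then y else 0)" for B y by simp
          show ?thesis using a
            by (cases "a = i"; cases "i < n"; cases "j < n")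
              (simp_all add: col_def h(2) k(2) eq_commute[of j] eq_commute[of i] d cong: if_cong)
        qed
      qed
      also have "\<dots> = b i j" using b by (auto simp: mats_def not_less)
      finally show "bil n (col (\<lambda>l i. \<Sum>p<n. cnj (cnj (c l p)) * h p i) n) b (col (\<lambda>l j. \<Sum>q<n. d l q * k q j) n) i j = b i j" .
    qed
    then show ?thesis by (simp add: key F_re)
  qed
  have F_bound: "cmod (F X) \<le> K * \<tau>" if "X \<in> mats n n" "\<tau> \<ge> 0" "nrad V n \<tau> X" for X \<tau>
  proof -
    obtain w where w: "cmod w = 1" "w * F X = complex_of_real (cmod (F X))" by (rule unit_phase)
    have "cmod (F X) = Re (F (mm w X))" by (simp add: F w)
    also have "\<dots> \<le> K * \<tau>"
      unfolding F_re using that nrad_mm[OF that(3), of w] w(1) by (intro K(1) mm_mats) auto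
    finally show ?thesis .
  qed
  define K' where "K' = (\<Sum>p<n. \<Sum>q<n. \<Sum>i<n. \<Sum>j<n. cmod (h p i) * cmod (k q j) * (2 * K))"
  show thesis
  proof (rule that[of g d "\<lambda>a p. cnj (c a p)" K'])
    show "g (v + w) p q = g v p q + g w p q" for v w p q
      by (simp add: g_def elm_add F ring_distribs sum.distrib)
    show "g (sm z v) p q = z * g v p q" for z v p q
      by (simp add: g_def F sum_distrib_left mult_ac flip: mm_elm)
    \<comment> \<open>\<open>L\<close> vanishes on scalar matrices and dominates \<open>G\<close>.
      As multiples of scalar matrices are again scalar, the complex functional vanishes on
      them.\<close>
    show "g (munit V) p q = 0" for p q
    proof -
      define C where "C i j = (if i < n \<and> j < n then h p i * k q j else 0)" for i j
      have Cm: "C \<in> mats n n" by (auto simp: C_def mats_def)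
      define X where "X = (\<lambda>i j. sm (C i j) (munit V))"
      have X: "X \<in> mats n n" using Cm by (auto simp: X_def mats_def)
      have z: "G (mm w X) \<le> 0" for w
        using G(3)[OF mm_mats[OF X], of w] L_mm[OF n X, of w] L_scalar[OF n Cm] by (simp add: X_def)
      obtain w where w: "cmod w = 1" "w * F X = complex_of_real (cmod (F X))" by (rule unit_phase)
      have "cmod (F X) = Re (F (mm w X))" by (simp add: F w)
      then have "cmod (F X) \<le> 0" using z[of w] by (simp only: F_re)
      then have "F X = 0" by simp
      moreover have "F X = (\<Sum>i<n. \<Sum>j<n. F (elm i j (X i j)))"
        by (subst mtx_elm_sum[OF X]) (simp add: F)
      moreover have "\<dots> = g (munit V) p q"
        unfolding g_def X_def C_def by (intro sum.cong refl) (simp add: F flip: mm_elm)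
      ultimately show ?thesis by simp
    qed
    show "cmod (sform r n g v y x) \<le> vnorm2 r n x * vnorm2 r n y" if "r \<ge> 1" "v \<in> mats r r" "L r v \<le> 1" for r v x y
      by (rule sform_bound_of_quadratic) (rule quad[OF that])
    show "(vnorm2 n n d)\<^sup>2 \<le> 1 + n * \<epsilon>" by (rule k(3))
    show "(vnorm2 n n (\<lambda>a p. cnj (c a p)))\<^sup>2 \<le> 1 + n * \<epsilon>" using h(3) by (simp add: vnorm2_def)
    show "Re (sform n n g b (\<lambda>a p. cnj (c a p)) d) = G b" if "b \<in> mats n n" for b by (rule evalb[OF that])
    show "K' \<ge> 0" unfolding K'_def using K(2) by (intro sum_nonneg) auto
    show "cmod (g v p q) \<le> K' * \<tau>" if \<tau>: "\<tau> \<ge> 0" "nrad V 1 \<tau> (one_one v)" and pq: "p < n" "q < n" for v \<tau> p q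
    proof -
      have "cmod (g v p q) \<le> (\<Sum>i<n. \<Sum>j<n. cmod (h p i) * cmod (k q j) * (2 * K) * \<tau>)"
        unfolding g_def
      proof (intro sum_norm_le)
        fix i j assume "i \<in> {..<n}" "j \<in> {..<n}"
        then have "cmod (F (elm i j v)) \<le> K * (2 * \<tau>)"
          using \<tau> by (intro F_bound elm_mats nrad_elm) auto
        then have "cmod (h p i * k q j) * cmod (F (elm i j v)) \<le> cmod (h p i * k q j) * (K * (2 * \<tau>))"
          by (intro mult_left_mono) auto
        then show "cmod (h p i * k q j * F (elm i j v)) \<le> cmod (h p i) * cmod (k q j) * (2 * K) * \<tau>"
          by (simp add: norm_mult mult_ac)
      qed
      also have "\<dots> = (\<Sum>i<n. \<Sum>j<n. cmod (h p i) * cmod (k q j) * (2 * K)) * \<tau>"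
        by (simp add: sum_distrib_right)
      also have "\<dots> \<le> K' * \<tau>"
      proof (rule mult_right_mono[OF _ \<tau>(1)])
        have "(\<Sum>i<n. \<Sum>j<n. cmod (h p i) * cmod (k q j) * (2 * K))
          \<le> (\<Sum>q<n. \<Sum>i<n. \<Sum>j<n. cmod (h p i) * cmod (k q j) * (2 * K))"
          using pq K(2) by (intro member_le_sum[of q "{..<n}" "\<lambda>q. \<Sum>i<n. \<Sum>j<n. cmod (h p i) * cmod (k q j) * (2 * K)"]) (auto intro!: sum_nonneg)
        also have "\<dots> \<le> K'"
          unfolding K'_def
          using pq K(2) by (intro member_le_sum[of p "{..<n}" "\<lambda>p. \<Sum>q<n. \<Sum>i<n. \<Sum>j<n. cmod (h p i) * cmod (k q j) * (2 * K)"]) (auto intro!: sum_nonneg)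
        finally show "(\<Sum>i<n. \<Sum>j<n. cmod (h p i) * cmod (k q j) * (2 * K)) \<le> K'" .
      qed
      finally show ?thesis .
    qed
  qed
qed

end

section \<open>Differences of matrix states and the bipolar theorem\<close>

context mou
begin

text \<open>A Jordan decomposition. On the level of functionals, the real part of \<open>T\<close>
  is the difference of the positive functionals \<open>G\<close> and \<open>G'\<close>. The two
  corresponding maps agree at the unit because \<open>gt\<close> vanishes there, so one common
  correction and one common factor make both unital.\<close>

lemma difference_of_states:
  fixes gt :: "'v \<Rightarrow> complex mtx"
  assumes e: "munit V \<noteq> 0"
    and gt: "\<And>v w p q. gt (v + w) p q = gt v p q + gt w p q" "\<And>c v p q. gt (sm c v) p q = c * gt v p q"
    "\<And>v. gt v \<in> mats N N" "\<And>v p q. gt (mstar V v) p q = cnj (gt v q p)" "\<And>p q. gt (munit V) p q = 0"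
    and K: "K \<ge> 0" "\<And>v \<tau> p q. \<tau> \<ge> 0 \<Longrightarrow> nrad V 1 \<tau> (one_one v) \<Longrightarrow> p < N \<Longrightarrow> q < N \<Longrightarrow> cmod (gt v p q) \<le> K * \<tau>"
  obtains \<phi> \<psi> c where "\<phi> \<in> CS V N" "\<psi> \<in> CS V N" "c > 0" "\<And>v p q. \<phi> v p q - \<psi> v p q = gt v p q / complex_of_real c"
proof -
  define T where "T X = (\<Sum>p<N. \<Sum>q<N. gt (X p q) p q)" for X
  have T_add: "T (X + Y) = T X + T Y" for X Y by (simp add: T_def gt(1) sum.distrib)
  have T_mm: "T (mm c X) = c * T X" for c X by (simp add: T_def mmap_def gt(2) sum_distrib_left)
  have T_vadj: "T (vadj V X) = cnj (T X)" for X
  proof -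
    have "T (vadj V X) = (\<Sum>p<N. \<Sum>q<N. cnj (gt (X q p) q p))" by (simp add: T_def vadj_def gt(4))
    also have "\<dots> = (\<Sum>q<N. \<Sum>p<N. cnj (gt (X q p) q p))" by (rule sum.swap)
    finally show ?thesis by (simp add: T_def)
  qed
  have gt0: "gt 0 p q = 0" for p q using gt(2)[of 0 0] by simp
  have T_elm: "T (elm p q v) = gt v p q" if "p < N" "q < N" for p q v
  proof -
    have "T (elm p q v) = (\<Sum>a<N. if a = p then (\<Sum>b<N. if b = q then gt v p q else 0) else 0)"
      unfolding T_def
    proof (rule sum.cong[OF refl])
      fix a
      show "(\<Sum>b<N. gt (elm p q v a b) a b) = (if a = p then (\<Sum>b<N. if b = q then gt v p q else 0) else 0)"
        using that by (cases "a = p") (auto simp: elm_def gt0 if_distrib[of gt] if_distribR cong: if_cong intro!: sum.neutral)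
    qed
    then show ?thesis using that by simp
  qed
  \<comment> \<open>Elements between 0 and \<open>s\<close> have radius at most \<open>s\<close> and
    entries of radius at most \<open>4 * s\<close>; summing over the \<open>N * N\<close> entries
    gives this constant.\<close>
  define M where "M = (real N)\<^sup>2 * (4 * K)"
  have T_bound: "Re (T A) \<le> M * s" if A: "A \<in> mcone V N" "idm N s - A \<in> mcone V N" "s \<ge> 0" for A s
  proof -
    have "nrad V N s A"
      using A cone_add[OF idm_cone[of s N] A(1)] by (intro nrad_saI cone_sa) auto
    then have "cmod (gt (A p q) p q) \<le> K * (4 * s)" if "p < N" "q < N" for p q
      using that A(3) by (intro K(2) nrad_entry) auto
    then have "cmod (T A) \<le> (\<Sum>p<N. \<Sum>q<N. K * (4 * s))"
      unfolding T_def by (intro sum_norm_le) auto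
    then show ?thesis
      using complex_Re_le_cmod[of "T A"] by (simp add: M_def power2_eq_square mult_ac)
  qed
  define H where "H x = trunc N x + vadj V (trunc N x)" for x
  have H_add: "H (x + y) = H x + H y" for x y
    by (simp add: H_def trunc_add vadj_add add_ac)
  have H_mm: "H (mm (complex_of_real r) x) = mm (complex_of_real r) (H x)" for r x
    by (simp add: H_def trunc_mm vadj_mm mm.scale_right_distrib)
  \<comment> \<open>The infimum of \<open>M * s - Re (T c)\<close> over positive \<open>c\<close>
    for which \<open>c\<close> plus the real part of \<open>x\<close> is at most \<open>s\<close>.
    At \<open>x = - A\<close>, the choice \<open>c = A\<close> and \<open>s = 0\<close> gives
    \<open>Re (T A) \<le> G A\<close>, and \<open>c = 0\<close> gives
    \<open>0 \<le> G A\<close>.\<close>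
  define \<Gamma> where "\<Gamma> = {(x, t). \<exists>c\<in>mcone V N. \<exists>s\<ge>0. idm N (2 * s) - mm 2 c - H x \<in> mcone V N \<and> M * s - Re (T c) \<le> t}"
  have \<Gamma>I: "(x, t) \<in> \<Gamma>" if "c \<in> mcone V N" "s \<ge> 0" "idm N (2 * s) - mm 2 c - H x \<in> mcone V N" "M * s - Re (T c) \<le> t" for x t c s
    unfolding \<Gamma>_def using that by blast
  have dbl: "mm 2 A = A + A" for A
    using mm.scale_left_distrib[of 1 1 A] by simp
  have T0: "T 0 = 0" using T_mm[of 0 0] by simp
  obtain G where G: "\<And>x y. G (x + y) = G x + G y" "\<And>r x. G (mm (complex_of_real r) x) = r * G x"
    "\<And>x t. (x, t) \<in> \<Gamma> \<Longrightarrow> G x \<le> t"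
  proof (rule hahn_banach_cone[OF mr.vector_space_axioms, of \<Gamma>])
    show "(0, 0) \<in> \<Gamma>" by (rule \<Gamma>I[of 0 0]) (simp_all add: cone_0 H_def T0)
  next
    fix x y t t' assume "(x, t) \<in> \<Gamma>" "(y, t') \<in> \<Gamma>"
    then obtain c s c' s' where 1: "c \<in> mcone V N" "s \<ge> 0" "idm N (2 * s) - mm 2 c - H x \<in> mcone V N" "M * s - Re (T c) \<le> t"
      and 2: "c' \<in> mcone V N" "s' \<ge> 0" "idm N (2 * s') - mm 2 c' - H y \<in> mcone V N" "M * s' - Re (T c') \<le> t'"
      unfolding \<Gamma>_def by blast
    have eq: "idm N (2 * (s + s')) - mm 2 (c + c') - H (x + y) = (idm N (2 * s) - mm 2 c - H x) + (idm N (2 * s') - mm 2 c' - H y)"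
      unfolding distrib_left idm_add mm.scale_right_distrib H_add
      by (simp only: diff_conv_add_uminus minus_add_distrib add_ac)
    show "(x + y, t + t') \<in> \<Gamma>"
    proof (rule \<Gamma>I[of "c + c'" "s + s'"])
      show "idm N (2 * (s + s')) - mm 2 (c + c') - H (x + y) \<in> mcone V N"
        unfolding eq by (rule cone_add[OF 1(3) 2(3)])
      show "M * (s + s') - Re (T (c + c')) \<le> t + t'" using 1(4) 2(4) by (simp add: T_add ring_distribs)
    qed (use 1 2 in \<open>auto intro: cone_add\<close>)
  next
    fix x t and r :: real assume "(x, t) \<in> \<Gamma>" "r > 0"
    then obtain c s where 1: "c \<in> mcone V N" "s \<ge> 0" "idm N (2 * s) - mm 2 c - H x \<in> mcone V N" "M * s - Re (T c) \<le> t"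
      unfolding \<Gamma>_def by blast
    show "(mm (complex_of_real r) x, r * t) \<in> \<Gamma>"
    proof (rule \<Gamma>I[of "mm (complex_of_real r) c" "r * s"])
      have "mm (complex_of_real r) (idm N (2 * s) - mm 2 c - H x)
         = idm N (2 * (r * s)) - mm 2 (mm (complex_of_real r) c) - H (mm (complex_of_real r) x)"
        by (simp add: mm.scale_right_diff_distrib mm_smat H_mm mult_ac)
      then show "idm N (2 * (r * s)) - mm 2 (mm (complex_of_real r) c) - H (mm (complex_of_real r) x) \<in> mcone V N"
        using cone_scale[OF 1(3), of r] \<open>r > 0\<close> by simp
      have "r * (M * s - Re (T c)) \<le> r * t" using 1(4) \<open>r > 0\<close> by simp
      then show "M * (r * s) - Re (T (mm (complex_of_real r) c)) \<le> r * t" by (simp add: T_mm algebra_simps)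
    qed (use 1 \<open>r > 0\<close> in \<open>auto intro: cone_scale\<close>)
  next
    fix x
    obtain t where t: "t \<ge> 0" "nrad V N t (- trunc N x)"
      using nrad_exists[OF mats_uminus[OF trunc_mats]] by blast
    then have "idm N (2 * t) - mm 2 0 - H x \<in> mcone V N"
      using nradD[of N t "- trunc N x" 1] by (simp add: H_def vadj_minus diff_diff_eq)
    then show "\<exists>t. (x, t) \<in> \<Gamma>" using \<Gamma>I[OF cone_0 t(1)] by blast
  next
    fix t assume "(0, t) \<in> \<Gamma>"
    then obtain c s where 1: "c \<in> mcone V N" "s \<ge> 0" "idm N (2 * s) - mm 2 c \<in> mcone V N" "M * s - Re (T c) \<le> t"
      unfolding \<Gamma>_def by (auto simp: H_def)
    have "mm (complex_of_real (1/2)) (idm N (2 * s) - mm 2 c) = idm N s - c"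
      by (simp add: mm.scale_right_diff_distrib mm_smat)
    then have "idm N s - c \<in> mcone V N" using cone_scale[OF 1(3), of "1/2"] by simp
    from T_bound[OF 1(1) this 1(2)] show "t \<ge> 0" using 1(4) by simp
  qed blast
  have G_minus: "G (- x) = - G x" for x using G(2)[of "-1" x] by simp
  have Hm: "H (- A) = - mm 2 A" if "A \<in> mcone V N" for A
    using cone_mats[OF that] cone_sa[OF that]
    by (simp add: dbl H_def trunc_id mats_uminus vadj_minus)
  have Gpos: "G A \<ge> 0" and Gdom: "G A \<ge> Re (T A)" if A: "A \<in> mcone V N" for A
  proof -
    have "(- A, 0) \<in> \<Gamma>"
      using cone_scale[OF A, of 2] by (intro \<Gamma>I[of 0 0]) (auto simp: Hm[OF A] cone_0 T0)
    then show "G A \<ge> 0" using G(3)[of "- A" 0] G_minus by simp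
    have "(- A, - Re (T A)) \<in> \<Gamma>"
      by (intro \<Gamma>I[of A 0]) (auto simp: Hm[OF A] cone_0 A)
    then show "G A \<ge> Re (T A)" using G(3)[of "- A" "- Re (T A)"] G_minus by simp
  qed
  have Gvadj: "G (vadj V A) = G A" if "A \<in> mats N N" for A
  proof -
    have "H (vadj V A) = H A"
      using that vadj_mats[OF that] by (simp add: H_def trunc_id add.commute)
    then have "H (vadj V A - A) = 0" "H (A - vadj V A) = 0"
      using H_add[of "vadj V A - A" A] H_add[of "A - vadj V A" "vadj V A"] by simp_all
    then have "(vadj V A - A, 0) \<in> \<Gamma>" "(A - vadj V A, 0) \<in> \<Gamma>"
      by (auto intro!: \<Gamma>I[of 0 0] simp: cone_0 T0)
    then show ?thesis
      using G(3)[of "vadj V A - A" 0] G(3)[of "A - vadj V A" 0]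
        G(1)[of "vadj V A - A" A] G(1)[of "A - vadj V A" "vadj V A"] by simp
  qed
  define G' where "G' X = G X - Re (T X)" for X
  have posG: "posf N G" using G(1,2) Gpos Gvadj by (auto simp: posf_def)
  have posG': "posf N G'"
    using G(1,2) Gdom Gvadj by (auto simp: posf_def G'_def T_add T_mm T_vadj algebra_simps)
  have diff: "cpmap N G v p q - cpmap N G' v p q = gt v p q" for v p q
  proof (cases "p < N \<and> q < N")
    case True
    have "cpx G' X = cpx G X - T X" for X
      by (simp add: cpx_def G'_def T_mm complex_eq_iff)
    then show ?thesis using True by (simp add: cpmap_def T_elm)
  next
    case False
    then show ?thesis using gt(3)[of v] by (auto simp: cpmap_def mats_def)
  qed
  define R where "R = cpmap N G (munit V)"
  have R': "cpmap N G' (munit V) = R"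
    using diff[of "munit V"] gt(5) by (simp add: R_def fun_eq_iff)
  \<comment> \<open>The summand 1 makes \<open>c0\<close> times the identity minus \<open>R\<close>
    strictly positive, so that Gram-Schmidt can factor it.\<close>
  define c0 where "c0 = cnorm N N R + 1"
  have c0: "c0 > 0" using cnorm_nonneg[of N N R] by (simp add: c0_def add_nonneg_pos)
  obtain \<sigma> where \<sigma>: "\<sigma> \<in> CS V 1" using state_exists[OF e] .
  have \<sigma>1: "\<sigma> (munit V) 0 0 = 1" using \<sigma> by (simp add: CS_iff smat_def)
  define D where "D i j = - R i j + (if i = j \<and> i < N then complex_of_real c0 else 0)" for i j
  have D_hform: "hform D N x x = - hform R N x x + complex_of_real (c0 * (vnorm N x)\<^sup>2)" for x
    using hform_diag_add[of "- R" N c0 x] by (simp add: D_def[abs_def] hform_minus)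
  obtain h cc where "\<And>x y. hform D N (\<lambda>i. \<Sum>k<N. x k * h k i) (\<lambda>i. \<Sum>k<N. y k * h k i) = (\<Sum>k<N. x k * cnj (y k))"
    and "\<And>i j. i < N \<Longrightarrow> (\<Sum>k<N. cc i k * h k j) = (if i = j then 1 else 0)"
    and fac: "\<And>i j. i < N \<Longrightarrow> j < N \<Longrightarrow> D i j = (\<Sum>k<N. cc i k * cnj (cc j k))"
  proof (rule gram_schmidt[where P = D and n = N])
    have R_herm: "R j i = cnj (R i j)" for i j
      using CPM_star[OF cpmap_CPM[OF posG], of "munit V" j i] by (simp add: R_def star_unit)
    show "D j i = cnj (D i j)" for i j using R_herm[of i j] by (simp add: D_def)
    show "0 < Re (hform D N x x)" if "i < N" "x i \<noteq> 0" for x i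
    proof -
      have "vnorm N x \<noteq> 0" using that by (auto simp: vnorm_zero_iff)
      then have "(vnorm N x)\<^sup>2 > 0" by simp
      moreover have "Re (hform R N x x) \<le> cnorm N N R * (vnorm N x)\<^sup>2"
        using hform_le_cnorm[of R N x] complex_Re_le_cmod order_trans by blast
      ultimately have "Re (hform R N x x) < c0 * (vnorm N x)\<^sup>2"
        unfolding c0_def distrib_right mult_1 by linarith
      then show ?thesis unfolding D_hform by simp
    qed
  qed (rule that)
  \<comment> \<open>Compressing a single state by the columns of a factor of \<open>D\<close> and
    summing gives a completely positive map whose value at the unit is \<open>D\<close>, the amount
    that \<open>R\<close> lacks.\<close>
  define \<rho> where "\<rho> v i j = (\<Sum>k<N. cconj 1 N (\<lambda>_ p. cnj (cc p k)) \<sigma> v i j)" for v i j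
  have \<rho>: "\<rho> \<in> CPM V N"
    unfolding \<rho>_def using CS_CPM[OF \<sigma>] by (intro CPM_sum CPM_cconj)
  have \<rho>1: "\<rho> (munit V) i j = (if i < N \<and> j < N then D i j else 0)" for i j
    by (auto simp: \<rho>_def cconj_def \<sigma>1 fac)
  have CS: "(\<lambda>v i j. complex_of_real (1 / c0) * (cpmap N G0 v i j + \<rho> v i j)) \<in> CS V N"
    if "posf N G0" "cpmap N G0 (munit V) = R" for G0
    unfolding CS_iff
  proof
    show "(\<lambda>v i j. complex_of_real (1 / c0) * (cpmap N G0 v i j + \<rho> v i j)) \<in> CPM V N"
      using c0 that by (intro CPM_scale CPM_plus cpmap_CPM \<rho>) auto
    have "R i j = 0" if "\<not> (i < N \<and> j < N)" for i j
      using that by (auto simp: R_def cpmap_def)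
    then show "(\<lambda>i j. complex_of_real (1 / c0) * (cpmap N G0 (munit V) i j + \<rho> (munit V) i j)) = smat N 1"
      using c0 by (auto simp: that(2) fun_eq_iff \<rho>1 D_def smat_def)
  qed
  show thesis
  proof (rule that[OF CS[OF posG R_def[symmetric]] CS[OF posG' R'] c0])
    fix v p q
    have "complex_of_real (1 / c0) * (cpmap N G v p q + \<rho> v p q) - complex_of_real (1 / c0) * (cpmap N G' v p q + \<rho> v p q)
      = complex_of_real (1 / c0) * (cpmap N G v p q - cpmap N G' v p q)" by (simp add: algebra_simps)
    then show "complex_of_real (1 / c0) * (cpmap N G v p q + \<rho> v p q) - complex_of_real (1 / c0) * (cpmap N G' v p q + \<rho> v p q)
      = gt v p q / complex_of_real c0" by (simp add: diff)
  qed
qed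

text \<open>The off-diagonal dilation with \<open>g\<close> and its adjoint map as corners. It is
  hermitian although \<open>g\<close> need not be, and it satisfies the same contraction bound, at
  the price of doubling the matrix size.\<close>

definition dil :: "nat \<Rightarrow> ('v \<Rightarrow> complex mtx) \<Rightarrow> 'v \<Rightarrow> complex mtx" where
  "dil n g v = (\<lambda>p q. if p < n \<and> n \<le> q \<and> q < 2 * n then g v p (q - n)
     else if n \<le> p \<and> p < 2 * n \<and> q < n then cnj (g (mstar V v) q (p - n)) else 0)"

lemma sform_dil:
  "sform r (2 * n) (dil n g) a y x = sform r n g a y (\<lambda>i p. x i (n + p))
     + cnj (sform r n g (vadj V a) x (\<lambda>i p. y i (n + p)))"
proof -
  have "sform r (2 * n) (dil n g) a y x = (\<Sum>i<r. \<Sum>j<r. (\<Sum>p<n. \<Sum>q<n. cnj (y i p) * g (a i j) p q * x j (n + q))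
     + (\<Sum>p<n. \<Sum>q<n. cnj (y i (n + p)) * cnj (g (mstar V (a i j)) q p) * x j q))"
    unfolding sform_def sum_lessThan_double
    by (intro sum.cong refl) (simp add: dil_def sum.distrib)
  also have "\<dots> = sform r n g a y (\<lambda>i p. x i (n + p))
     + (\<Sum>i<r. \<Sum>j<r. \<Sum>p<n. \<Sum>q<n. cnj (y i (n + p)) * cnj (g (mstar V (a i j)) q p) * x j q)"
    by (simp add: sform_def sum.distrib)
  also have "(\<Sum>i<r. \<Sum>j<r. \<Sum>p<n. \<Sum>q<n. cnj (y i (n + p)) * cnj (g (mstar V (a i j)) q p) * x j q)
     = (\<Sum>j<r. \<Sum>i<r. \<Sum>p<n. \<Sum>q<n. cnj (y i (n + p)) * cnj (g (mstar V (a i j)) q p) * x j q)"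
    by (rule sum.swap)
  also have "\<dots> = (\<Sum>j<r. \<Sum>i<r. \<Sum>q<n. \<Sum>p<n. cnj (y i (n + p)) * cnj (g (mstar V (a i j)) q p) * x j q)"
    by (rule sum.cong[OF refl], rule sum.cong[OF refl], rule sum.swap)
  also have "\<dots> = cnj (sform r n g (vadj V a) x (\<lambda>i p. y i (n + p)))"
    by (simp add: sform_def vadj_def mult_ac)
  finally show ?thesis .
qed

lemma vnorm2_double: "(vnorm2 r (2 * n) x)\<^sup>2 = (vnorm2 r n x)\<^sup>2 + (vnorm2 r n (\<lambda>i p. x i (n + p)))\<^sup>2"
  by (simp add: vnorm2_squared sum_lessThan_double sum.distrib)

end

context lip_space
begin

lemma Dist_upper:
  assumes "r \<ge> 1" "a \<in> mats r r" "L r a \<le> 1"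
  shows "ereal (cnorm (r*n) (r*n) (msub (ampl n \<phi> a r) (ampl n \<psi> a r))) \<le> Dist L n \<phi> \<psi>"
  unfolding Dist_def using assms by (intro Sup_upper) blast

lemma Dist_nonneg: "0 \<le> Dist L n \<phi> \<psi>"
proof -
  have "0 \<le> ereal (cnorm (1*n) (1*n) (msub (ampl n \<phi> 0 1) (ampl n \<psi> 0 1)))"
    using cnorm_nonneg by simp
  also have "\<dots> \<le> Dist L n \<phi> \<psi>" by (rule Dist_upper) (simp_all add: mats_0 L_0)
  finally show ?thesis .
qed

text \<open>The bipolar theorem for the unit ball of \<open>L n\<close>. Separate \<open>b\<close> from the ball by a functional,
  factor it through a matrix-valued map \<open>g\<close> that is completely contractive for \<open>L\<close>, and write the
  self-adjoint dilation of \<open>g\<close> as a multiple of a difference of two matrix states, whose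
  \<open>Dist L\<close>-distance is then known.\<close>

theorem bipolar:
  assumes e: "munit V \<noteq> 0" and n: "n \<ge> 1" and b: "b \<in> mats n n" and LD: "LD V L n b \<le> 1"
    and pos: "\<delta> > 0" "\<eta> > 0"
  obtains y where "y \<in> mats n n" "L n y \<le> 1 + \<eta>" "nrad V n \<delta> (b - y)"
proof (rule ccontr)
  assume "\<not> thesis"
  then have far: "\<And>y. y \<in> mats n n \<Longrightarrow> L n y \<le> 1 + \<eta> \<Longrightarrow> \<not> nrad V n \<delta> (b - y)" using that by blast
  obtain G K where G: "\<And>A B. G (A + B) = G A + G B" "\<And>r A. G (mm (complex_of_real r) A) = r * G A"
    "\<And>y. y \<in> mats n n \<Longrightarrow> G y \<le> L n y"
    "\<And>x \<tau>. x \<in> mats n n \<Longrightarrow> \<tau> \<ge> 0 \<Longrightarrow> nrad V n \<tau> x \<Longrightarrow> G x \<le> K * \<tau>"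
    "G b \<ge> 1 + \<eta>" "K \<ge> 0"
    by (rule lip_separation[OF n b pos(1) less_imp_le[OF pos(2)] far]) (assumption | rule that)+
  \<comment> \<open>Then \<open>n * \<epsilon> = \<eta> / 2\<close>, and the loss in Gram-Schmidt
    stays below \<eta>.\<close>
  define \<epsilon> where "\<epsilon> = \<eta> / (2 * n)"
  have \<epsilon>: "\<epsilon> > 0" "n * \<epsilon> < \<eta>" using pos n by (simp_all add: \<epsilon>_def)
  obtain g x y K' where g: "\<And>v w p q. g (v + w) p q = g v p q + g w p q"
    "\<And>c v p q. g (sm c v) p q = c * g v p q" "\<And>p q. g (munit V) p q = (0 :: complex)"
    "\<And>r v x y. r \<ge> 1 \<Longrightarrow> v \<in> mats r r \<Longrightarrow> L r v \<le> 1 \<Longrightarrow> cmod (sform r n g v y x) \<le> vnorm2 r n x * vnorm2 r n y"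
    "(vnorm2 n n x)\<^sup>2 \<le> 1 + n * \<epsilon>" "(vnorm2 n n y)\<^sup>2 \<le> 1 + n * \<epsilon>"
    "\<And>b. b \<in> mats n n \<Longrightarrow> Re (sform n n g b y x) = G b"
    "K' \<ge> 0" "\<And>v \<tau> p q. \<tau> \<ge> 0 \<Longrightarrow> nrad V 1 \<tau> (one_one v) \<Longrightarrow> p < n \<Longrightarrow> q < n \<Longrightarrow> cmod (g v p q) \<le> K' * \<tau>"
    by (rule contraction[OF n \<epsilon>(1) G(1,2,3,4,6)]) (assumption | rule that)+
  obtain \<phi> \<psi> c where st: "\<phi> \<in> CS V (2 * n)" "\<psi> \<in> CS V (2 * n)" "c > 0"
    "\<And>v p q. \<phi> v p q - \<psi> v p q = dil n g v p q / complex_of_real c"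
  proof (rule difference_of_states[OF e, of "dil n g" "2 * n" K'])
    show "dil n g (v + w) p q = dil n g v p q + dil n g w p q" for v w p q
      by (simp add: dil_def g(1) star_add)
    show "dil n g (sm z v) p q = z * dil n g v p q" for z v p q
      by (simp add: dil_def g(2) star_sm)
    show "dil n g v \<in> mats (2 * n) (2 * n)" for v by (auto simp: dil_def mats_def)
    show "dil n g (mstar V v) p q = cnj (dil n g v q p)" for v p q
      by (auto simp: dil_def star_star)
    show "dil n g (munit V) p q = 0" for p q by (simp add: dil_def star_unit g(3))
    show "cmod (dil n g v p q) \<le> K' * \<tau>" if "\<tau> \<ge> 0" "nrad V 1 \<tau> (one_one v)" "p < 2 * n" "q < 2 * n" for v \<tau> p q
      using that g(8) g(9)[of \<tau> v p "q - n"] g(9)[of \<tau> "mstar V v" q "p - n"] nrad_vadj[OF that(2)]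
      by (auto simp: dil_def vadj_one_one)
  qed (use g(8) that in auto)
  have diff: "sform r (2 * n) \<phi> a y x - sform r (2 * n) \<psi> a y x = sform r (2 * n) (dil n g) a y x / complex_of_real c" for r a y x
  proof -
    have "sform r (2 * n) \<phi> a y x - sform r (2 * n) \<psi> a y x
       = (\<Sum>i<r. \<Sum>j<r. \<Sum>p<2*n. \<Sum>q<2*n. cnj (y i p) * (\<phi> (a i j) p q - \<psi> (a i j) p q) * x j q)"
      by (simp add: sform_def sum_subtractf ring_distribs)
    then show ?thesis unfolding st(4) by (simp add: sform_def sum_divide_distrib)
  qed
  \<comment> \<open>\<open>Dist\<close> is a supremum over all matrix sizes, so the contraction
    bound for \<open>g\<close> is used at every size \<open>r\<close>.\<close>
  have Dist_le: "Dist L (2 * n) \<phi> \<psi> \<le> ereal (1 / c)"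
    unfolding Dist_def
  proof (rule Sup_least, clarify)
    fix r a assume r: "r \<ge> 1" "a \<in> mats r r" "L r a \<le> 1"
    have "cnorm (r*(2*n)) (r*(2*n)) (msub (ampl (2*n) \<phi> a r) (ampl (2*n) \<psi> a r)) \<le> 1 / c"
    proof (rule cnorm_ampl_leI)
      fix x y
      define a1 a2 b1 b2 where "a1 = vnorm2 r n x" and "a2 = vnorm2 r n (\<lambda>i p. x i (n + p))"
        and "b1 = vnorm2 r n y" and "b2 = vnorm2 r n (\<lambda>i p. y i (n + p))"
      have "cmod (sform r (2 * n) (dil n g) a y x) \<le> a2 * b1 + b2 * a1"
      proof -
        have "cmod (sform r n g a y (\<lambda>i p. x i (n + p))) \<le> a2 * b1"
          unfolding a2_def b1_def by (rule g(4)[OF r])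
        moreover have "cmod (sform r n g (vadj V a) x (\<lambda>i p. y i (n + p))) \<le> b2 * a1"
          unfolding b2_def a1_def using r by (intro g(4)) (auto simp: L_vadj intro: vadj_mats)
        ultimately show ?thesis unfolding sform_dil
          by (intro order_trans[OF norm_triangle_ineq] add_mono) auto
      qed
      also have "\<dots> \<le> vnorm2 r (2 * n) x * vnorm2 r (2 * n) y"
      proof (rule power2_le_imp_le)
        have "(a2 * b1 + b2 * a1)\<^sup>2 + (a1 * b1 - a2 * b2)\<^sup>2 = (a1\<^sup>2 + a2\<^sup>2) * (b1\<^sup>2 + b2\<^sup>2)"
          by (simp add: power2_eq_square algebra_simps)
        then have "(a2 * b1 + b2 * a1)\<^sup>2 \<le> (a1\<^sup>2 + a2\<^sup>2) * (b1\<^sup>2 + b2\<^sup>2)"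
          using zero_le_power2[of "a1 * b1 - a2 * b2"] by linarith
        then show "(a2 * b1 + b2 * a1)\<^sup>2 \<le> (vnorm2 r (2 * n) x * vnorm2 r (2 * n) y)\<^sup>2"
          by (simp add: power_mult_distrib vnorm2_double a1_def a2_def b1_def b2_def)
      qed simp
      finally show "cmod (sform r (2*n) \<phi> a y x - sform r (2*n) \<psi> a y x) \<le> 1 / c * vnorm2 r (2*n) x * vnorm2 r (2*n) y"
        unfolding diff using st(3) by (simp add: norm_divide divide_right_mono)
    qed (use st in simp)
    then show "ereal (cnorm (r*(2*n)) (r*(2*n)) (msub (ampl (2*n) \<phi> a r) (ampl (2*n) \<psi> a r))) \<le> ereal (1 / c)" by simp
  qed
  define X where "X = cnorm (n*(2*n)) (n*(2*n)) (msub (ampl (2*n) \<phi> b n) (ampl (2*n) \<psi> b n))"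
  \<comment> \<open>Placing \<open>x\<close> in the lower and \<open>y\<close> in the upper half
    picks out the corner that contains \<open>g\<close>, where the value
    \<open>G b \<ge> 1 + \<eta>\<close> is seen.\<close>
  have X: "(1 + \<eta>) / c \<le> X * (1 + n * \<epsilon>)"
  proof -
    define x' y' where "x' i p = (if p < n then 0 else x i (p - n))" and "y' i p = (if p < n then y i p else 0)" for i p
    have x': "(\<lambda>i p. x' i (n + p)) = x" and y': "(\<lambda>i p. y' i (n + p)) = (\<lambda>i p. 0)"
      by (auto simp: x'_def y'_def fun_eq_iff)
    have "sform n (2*n) (dil n g) b y' x' = sform n n g b y x"
      unfolding sform_dil x' y' by (simp add: sform_def y'_def)
    moreover have "1 + \<eta> \<le> cmod (sform n n g b y x)"
      using g(7)[OF b] G(5) complex_Re_le_cmod[of "sform n n g b y x"] by simp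
    ultimately have "(1 + \<eta>) / c \<le> cmod (sform n (2*n) \<phi> b y' x' - sform n (2*n) \<psi> b y' x')"
      unfolding diff using st(3) by (simp add: norm_divide divide_right_mono)
    also have "\<dots> \<le> X * vnorm2 n (2*n) x' * vnorm2 n (2*n) y'"
      unfolding X_def by (rule sform_diff_le)
    also have "\<dots> \<le> X * sqrt (1 + n * \<epsilon>) * sqrt (1 + n * \<epsilon>)"
    proof -
      have "(vnorm2 n (2*n) x')\<^sup>2 \<le> 1 + n * \<epsilon>"
        unfolding vnorm2_double x' using g(5) by (simp add: vnorm2_squared[of n n x'] x'_def)
      moreover have "(vnorm2 n (2*n) y')\<^sup>2 \<le> 1 + n * \<epsilon>"
        unfolding vnorm2_double y' using g(6) by (simp add: vnorm2_squared y'_def)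
      ultimately show ?thesis
        by (intro mult_mono mult_left_mono real_le_rsqrt mult_nonneg_nonneg) (use \<epsilon>(1) in \<open>auto simp: X_def\<close>)
    qed
    also have "\<dots> = X * (1 + n * \<epsilon>)" using \<epsilon> by (simp add: mult.assoc)
    finally show ?thesis .
  qed
  have X0: "X > 0"
  proof (rule ccontr)
    assume "\<not> X > 0"
    then have "X = 0" using cnorm_nonneg by (simp add: X_def order.antisym not_less)
    then show False using X st(3) pos by (simp add: divide_le_0_iff)
  qed
  have "\<phi> \<noteq> \<psi>"
  proof
    assume "\<phi> = \<psi>"
    then have "X \<le> 0" unfolding X_def by (intro cnorm_ampl_leI) auto
    then show False using X0 by simp
  qed
  \<comment> \<open>\<open>LD\<close> takes states of every size, so the doubled size
    \<open>2 * n\<close> is admissible for \<open>b\<close> of size \<open>n\<close>.\<close>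
  then have "ereal X / Dist L (2*n) \<phi> \<psi> \<le> LD V L n b"
    unfolding LD_def X_def using st n
    by (intro Sup_upper CollectI exI[of _ "2*n"] exI[of _ \<phi>] exI[of _ \<psi>]) auto
  then have ratio: "ereal X / Dist L (2*n) \<phi> \<psi> \<le> 1" using LD by simp
  have "X \<le> 1 / c"
  proof (cases "Dist L (2*n) \<phi> \<psi>")
    case (real d)
    show ?thesis
    proof (cases "d = 0")
      \<comment> \<open>Since \<open>X > 0\<close>, the extended quotient by zero is infinite, which
        contradicts \<open>ratio\<close>.\<close>
      case True
      then show ?thesis using ratio X0 real by (simp add: divide_ereal_def)
    next
      case False
      then have "d > 0" using Dist_nonneg[of "2*n" \<phi> \<psi>] real by simp
      then have "X \<le> d" using ratio real by (simp add: field_simps one_ereal_def)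
      then show ?thesis using Dist_le real by simp
    qed
  qed (use Dist_le Dist_nonneg[of "2*n" \<phi> \<psi>] in auto)
  then have "X * (1 + n * \<epsilon>) \<le> 1 / c * (1 + n * \<epsilon>)" using \<epsilon> by (intro mult_right_mono) auto
  then have "(1 + \<eta>) / c \<le> (1 + n * \<epsilon>) / c" using X by simp
  then show False using st(3) \<epsilon> by (simp add: divide_le_cancel)
qed

text \<open>Each numerator in \<open>LD\<close> is one of the values whose supremum is
  \<open>Dist\<close>. If the distance is zero, so is the numerator, and \<open>0 / 0 = 0\<close>
  for extended reals; an infinite distance also gives quotient 0.\<close>

lemma LD_le:
  assumes "n \<ge> 1" "a \<in> mats n n" "L n a \<le> 1"
  shows "LD V L n a \<le> 1"
  unfolding LD_def
proof (rule Sup_least, clarify)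
  fix r \<phi> \<psi> assume "r \<ge> (1::nat)"
  have q: "x / y \<le> 1" if "0 \<le> x" "x \<le> y" for x y :: real
    using that by (cases "y = 0") (auto simp: divide_le_eq_1)
  have "ereal (cnorm (n*r) (n*r) (msub (ampl r \<phi> a n) (ampl r \<psi> a n))) \<le> Dist L r \<phi> \<psi>"
    using assms by (rule Dist_upper)
  then show "ereal (cnorm (n*r) (n*r) (msub (ampl r \<phi> a n) (ampl r \<psi> a n))) / Dist L r \<phi> \<psi> \<le> 1"
    using cnorm_nonneg[of "n*r" "n*r" "msub (ampl r \<phi> a n) (ampl r \<psi> a n)"] q
    by (cases "Dist L r \<phi> \<psi>") (auto simp: divide_ereal_def zero_ereal_def one_ereal_def field_simps)
qed

end

section \<open>Comparison of radius and norm; compactness of the state space\<close>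

text \<open>Tychonoff's theorem for total functions; applied once for each argument of a map into
  matrices.\<close>

lemma compact_Pi_UNIV:
  fixes K :: "'i \<Rightarrow> 'b::topological_space set"
  assumes "\<And>i. compact (K i)"
  shows "compact {f. \<forall>i. f i \<in> K i}"
proof -
  have "compactin (product_topology (\<lambda>i. euclidean) UNIV) (PiE UNIV K)"
    unfolding compactin_PiE using assms by simp
  moreover have "PiE UNIV K = {f. \<forall>i. f i \<in> K i}" by (auto simp: PiE_iff)
  ultimately show ?thesis by (simp add: euclidean_product_topology)
qed

lemma continuous_on_eval3: "continuous_on S (\<lambda>\<phi> :: 'a \<Rightarrow> 'i \<Rightarrow> 'j \<Rightarrow> 'b::topological_space. \<phi> x i j)"
  by (rule continuous_on_product_then_coordinatewise[OF continuous_on_product_then_coordinatewise[OF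
        continuous_on_product_then_coordinatewise[OF continuous_on_id]]])

context mou
begin

lemma sum_delta2:
  fixes n :: nat
  assumes "i < n" "j < n"
  shows "(\<Sum>k<n. \<Sum>l<n. sm (cnj (if k = i then c else 0) * (if l = j then d else 0)) (X k l)) = sm (cnj c * d) (X i j)"
proof -
  have "(\<Sum>k<n. \<Sum>l<n. sm (cnj (if k = i then c else 0) * (if l = j then d else 0)) (X k l))
    = (\<Sum>k<n. if k = i then (\<Sum>l<n. if l = j then sm (cnj c * d) (X i j) else 0) else 0)"
  proof (rule sum.cong[OF refl])
    fix k
    show "(\<Sum>l<n. sm (cnj (if k = i then c else 0) * (if l = j then d else 0)) (X k l))
      = (if k = i then (\<Sum>l<n. if l = j then sm (cnj c * d) (X i j) else 0) else 0)"
      by (cases "k = i") (auto intro!: sum.neutral sum.cong simp del: sum.delta sum.delta')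
  qed
  then show ?thesis using assms by simp
qed

text \<open>Compress the block matrix by the column with blocks \<open>1\<close> and
  \<open>u\<close>.\<close>

lemma blk_cone_imp_nrad:
  assumes A: "A \<in> mats n n" and B: "blk n (idm n t) A (vadj V A) (idm n t) \<in> mcone V (2 * n)"
  shows "nrad V n t A"
  unfolding nrad_def
proof (intro allI impI)
  fix u assume u: "cmod u = 1"
  have uu: "cnj u * u = 1" using u by (metis complex_norm_square mult.commute of_real_1 one_power2)
  let ?B = "blk n (idm n t) A (vadj V A) (idm n t)"
  define g where "g k i = (if i < n then (if k < n then (if k = i then 1 else 0) else (if k - n = i then u else 0)) else 0)" for k i
  have "mconj V (2 * n) g ?B \<in> mcone V n" by (rule cone_conj[OF B]) (simp add: g_def)
  also have "mconj V (2 * n) g ?B = idm n (2 * t) + mm u A + mm (cnj u) (vadj V A)"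
  proof (intro ext)
    fix i j
    show "mconj V (2 * n) g ?B i j = (idm n (2 * t) + mm u A + mm (cnj u) (vadj V A)) i j"
    proof (cases "i < n \<and> j < n")
      case True
      have "mconj V (2 * n) g ?B i j
         = (\<Sum>k<n. \<Sum>l<n. sm (cnj (if k = i then 1 else 0) * (if l = j then 1 else 0)) (idm n t k l))
         + (\<Sum>k<n. \<Sum>l<n. sm (cnj (if k = i then 1 else 0) * (if l = j then u else 0)) (A k l))
         + ((\<Sum>k<n. \<Sum>l<n. sm (cnj (if k = i then u else 0) * (if l = j then 1 else 0)) (vadj V A k l))
         + (\<Sum>k<n. \<Sum>l<n. sm (cnj (if k = i then u else 0) * (if l = j then u else 0)) (idm n t k l)))"
        unfolding mconj_def sum_lessThan_double sum.distrib[symmetric]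
        using True by (intro arg_cong2[where f = "(+)"] sum.cong refl) (simp_all add: g_def blk_def)
      also have "\<dots> = sm 1 (idm n t i j) + sm u (A i j) + (sm (cnj u) (vadj V A i j) + sm (cnj u * u) (idm n t i j))"
        using True by (simp only: sum_delta2) simp
      also have "\<dots> = (idm n (2 * t) + mm u A + mm (cnj u) (vadj V A)) i j"
      proof -
        have "idm n (2 * t) i j = idm n t i j + idm n t i j"
          using fun_cong[OF fun_cong[OF idm_add[of n t t]], of i j] by simp
        then show ?thesis by (simp add: uu mmap_def add_ac)
      qed
      finally show ?thesis .
    next
      case False
      have "mconj V (2 * n) g ?B i j = 0"
        using False by (auto simp: mconj_def g_def intro!: sum.neutral)
      moreover have "idm n (2 * t) + mm u A + mm (cnj u) (vadj V A) \<in> mats n n"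
        using A by (intro mats_add smat_mats mm_mats vadj_mats)
      ultimately show ?thesis using False by (auto simp: mats_def not_less)
    qed
  qed
  finally show "idm n (2 * t) + mm u A + mm (cnj u) (vadj V A) \<in> mcone V n" .
qed

text \<open>The converse costs a factor 2, as the norm can be twice the numerical radius. The block
  matrix is the average, over the unit scalars 1, -1, i, -i, of the radius conditions conjugated by
  the row with blocks \<open>1\<close> and \<open>cnj u\<close>.\<close>

lemma nrad_imp_blk:
  assumes A: "A \<in> mats n n" "nrad V n t A"
  shows "blk n (idm n (2 * t)) A (vadj V A) (idm n (2 * t)) \<in> mcone V (2 * n)"
proof -
  define X where "X u = idm n (2 * t) + mm u A + mm (cnj u) (vadj V A)" for u
  define g where "g u k c = (if c < n then (if k = c then 1 else 0) else if c < 2 * n then (if k = c - n then cnj u else 0) else 0)" for u :: complex and k c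
  have C: "mconj V n (g u) (X u) \<in> mcone V (2 * n)" if "cmod u = 1" for u
    using nradD[OF A(2) that] by (intro cone_conj) (auto simp: X_def g_def)
  define S where "S = mconj V n (g 1) (X 1) + mconj V n (g (-1)) (X (-1)) + mconj V n (g \<i>) (X \<i>) + mconj V n (g (-\<i>)) (X (-\<i>))"
  have "S \<in> mcone V (2 * n)" unfolding S_def by (intro cone_add C) auto
  then have "mm (complex_of_real (1/4)) S \<in> mcone V (2 * n)" by (rule cone_scale) simp
  also have "mm (complex_of_real (1/4)) S = blk n (idm n (2 * t)) A (vadj V A) (idm n (2 * t))"
  proof (intro ext)
    fix c d
    define c' d' where "c' = (if c < n then c else c - n)" and "d' = (if d < n then d else d - n)"
    show "mm (complex_of_real (1/4)) S c d = blk n (idm n (2 * t)) A (vadj V A) (idm n (2 * t)) c d"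
    proof (cases "c < 2 * n \<and> d < 2 * n")
      case True
      then have lt: "c' < n" "d' < n" by (auto simp: c'_def d'_def)
      have m: "mconj V n (g u) (X u) c d = sm (cnj (if c < n then 1 else cnj u) * (if d < n then 1 else cnj u)) (X u c' d')" for u
      proof -
        have "mconj V n (g u) (X u) c d = (\<Sum>k<n. \<Sum>l<n. sm (cnj (if k = c' then (if c < n then 1 else cnj u) else 0)
            * (if l = d' then (if d < n then 1 else cnj u) else 0)) (X u k l))"
          unfolding mconj_def using True by (intro sum.cong refl) (auto simp: g_def c'_def d'_def)
        then show ?thesis using lt by (simp only: sum_delta2)
      qed
      have X: "X 1 c' d' = idm n (2*t) c' d' + A c' d' + vadj V A c' d'"
        "X (-1) c' d' = idm n (2*t) c' d' - A c' d' - vadj V A c' d'"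
        "X \<i> c' d' = idm n (2*t) c' d' + sm \<i> (A c' d') - sm \<i> (vadj V A c' d')"
        "X (-\<i>) c' d' = idm n (2*t) c' d' - sm \<i> (A c' d') + sm \<i> (vadj V A c' d')"
        by (simp_all add: X_def mmap_def)
      have S: "S c d = sm (cnj (if c < n then 1 else 1) * (if d < n then 1 else 1)) (X 1 c' d')
         + sm (cnj (if c < n then 1 else -1) * (if d < n then 1 else -1)) (X (-1) c' d')
         + sm (cnj (if c < n then 1 else -\<i>) * (if d < n then 1 else -\<i>)) (X \<i> c' d')
         + sm (cnj (if c < n then 1 else \<i>) * (if d < n then 1 else \<i>)) (X (-\<i>) c' d')"
        by (simp add: S_def m)
      show ?thesis
      proof (cases "c < n"; cases "d < n")
        assume "c < n" "d < n"
        then show ?thesis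
          unfolding mmap_def S X polarization by (simp add: blk_def c'_def d'_def)
      next
        assume "c < n" "\<not> d < n"
        then show ?thesis using True
          unfolding mmap_def S X polarization by (simp add: blk_def c'_def d'_def)
      next
        assume "\<not> c < n" "d < n"
        then show ?thesis using True
          unfolding mmap_def S X polarization by (simp add: blk_def c'_def d'_def)
      next
        assume "\<not> c < n" "\<not> d < n"
        then show ?thesis using True
          unfolding mmap_def S X polarization by (simp add: blk_def c'_def d'_def)
      qed
    next
      case False
      have z: "mconj V n (g u) (X u) c d = 0" for u
        using False unfolding mconj_def by (intro sum.neutral ballI) (auto simp: g_def)
      show ?thesis using False by (auto simp: mmap_def S_def z blk_def)
    qed
  qed
  finally show ?thesis .
qed

lemma mnorm_less_nrad:
  assumes A: "A \<in> mats n n" and "mnorm V n A < t"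
  shows "nrad V n t A"
proof -
  let ?S = "{t. blk n (idm n t) A (vadj V A) (idm n t) \<in> mcone V (2 * n)}"
  obtain s where "nrad V n s A" using nrad_exists[OF A] by blast
  then have "2 * s \<in> ?S" using nrad_imp_blk[OF A] by simp
  then have ne: "?S \<noteq> {}" by (metis empty_iff)
  from cInf_lessD[OF ne assms(2)[unfolded mnorm_def]] obtain s where s: "s \<in> ?S" "s < t"
    by (elim bexE) (rule that)
  from s(1) have "nrad V n s A" by (intro blk_cone_imp_nrad[OF A]) (rule CollectD)
  then show ?thesis using s(2) by (intro nrad_mono[of n s A t]) auto
qed

text \<open>The nonzero unit bounds the set in \<open>mnorm\<close> from below, so that its infimum
  is meaningful.\<close>

lemma nrad_mnorm_le:
  assumes "munit V \<noteq> 0" "n \<ge> 1" and A: "A \<in> mats n n" "nrad V n t A"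
  shows "mnorm V n A \<le> 2 * t"
  unfolding mnorm_def
proof (rule cInf_lower)
  show "2 * t \<in> {t. blk n (idm n t) A (vadj V A) (idm n t) \<in> mcone V (2 * n)}"
    using nrad_imp_blk[OF A] by simp
  show "bdd_below {t. blk n (idm n t) A (vadj V A) (idm n t) \<in> mcone V (2 * n)}"
    using nrad_nonneg[OF assms(1,2) blk_cone_imp_nrad[OF A(1)]] by (auto simp: bdd_below_def)
qed

lemma sform_1_1: "sform 1 1 \<phi> (one_one v) y x = cnj (y 0 0) * \<phi> v 0 0 * x 0 0"
  by (simp add: sform_def one_one_def)

lemma state_bound:
  assumes "\<phi> \<in> CS V 1" "nrad V 1 t (one_one v)"
  shows "cmod (\<phi> v 0 0) \<le> t"
  using nrad_sform_le[OF assms, of "\<lambda>_ _. 1"] sform_1_1[of \<phi> v "\<lambda>_ _. 1" "\<lambda>_ _. 1"]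
  by (simp add: vnorm2_def)

text \<open>A failure of the radius condition would be witnessed by a scalar state, and the value of
  that state would violate the bound.\<close>

lemma nrad_of_states:
  assumes "\<And>\<phi>. \<phi> \<in> CS V 1 \<Longrightarrow> cmod (\<phi> v 0 0) \<le> t"
  shows "nrad V 1 t (one_one v)"
  unfolding nrad_def
proof (intro allI impI)
  fix u assume u: "cmod u = 1"
  let ?M = "idm 1 (2 * t) + mm u (one_one v) + mm (cnj u) (vadj V (one_one v))"
  show "?M \<in> mcone V 1"
  proof (rule ccontr)
    assume "?M \<notin> mcone V 1"
    moreover have "?M \<in> mats 1 1"
      by (intro mats_add smat_mats mm_mats vadj_mats one_one_mats)
    moreover have "vadj V ?M = ?M" by (simp only: vadj_add vadj_idm vadj_mm vadj_vadj complex_cnj_cnj add_ac)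
    ultimately obtain \<psi> x where \<psi>: "\<psi> \<in> CS V 1" "Re (sform 1 1 \<psi> ?M x x) < 0"
      using matrix_state_separation[of ?M 1] by auto
    define z where "z = sform 1 1 \<psi> (one_one v) x x"
    have "sform 1 1 \<psi> ?M x x = complex_of_real (2 * t * (vnorm2 1 1 x)\<^sup>2) + u * z + cnj (u * z)"
      by (simp only: sform_add[OF CS_CPM[OF \<psi>(1)]] sform_mm[OF CS_CPM[OF \<psi>(1)]]
        sform_vadj[OF CS_CPM[OF \<psi>(1)]] sform_idm[OF \<psi>(1)] z_def complex_cnj_mult)
    then have "2 * t * (vnorm2 1 1 x)\<^sup>2 + 2 * Re (u * z) < 0" using \<psi>(2) by simp
    moreover have "\<bar>Re (u * z)\<bar> \<le> t * (vnorm2 1 1 x)\<^sup>2"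
    proof -
      have "\<bar>Re (u * z)\<bar> \<le> cmod z" using abs_Re_le_cmod[of "u * z"] u by (simp add: norm_mult)
      also have "cmod z = cmod (\<psi> v 0 0) * (vnorm2 1 1 x)\<^sup>2"
        unfolding z_def sform_1_1 vnorm2_squared by (simp add: norm_mult power2_eq_square)
      also have "\<dots> \<le> t * (vnorm2 1 1 x)\<^sup>2" using assms[OF \<psi>(1)] by (intro mult_right_mono) auto
      finally show ?thesis .
    qed
    ultimately show False by linarith
  qed
qed

lemma closed_CS: "closed (CS V n)"
proof -
  have "CS V n = {\<phi>. (((\<forall>x y i j. \<phi> (x + y) i j = \<phi> x i j + \<phi> y i j) \<and>
     (\<forall>c x i j. \<phi> (sm c x) i j = c * \<phi> x i j)) \<and>
     ((\<forall>x i j. n \<le> i \<or> n \<le> j \<longrightarrow> \<phi> x i j = 0) \<and> (\<forall>i j. \<phi> (munit V) i j = smat n 1 i j))) \<and>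
     (\<forall>r a x. a \<in> mcone V r \<longrightarrow> Im (sform r n \<phi> a x x) = 0 \<and> 0 \<le> Re (sform r n \<phi> a x x))}"
    unfolding CS_iff[abs_def] by (auto simp: CS_iff CPM_def mats_def fun_eq_iff)
  also have "closed \<dots>"
    unfolding sform_def
    by (intro closed_Collect_conj closed_Collect_all closed_Collect_imp closed_Collect_eq closed_Collect_le
        open_Collect_const continuous_on_Im continuous_on_Re continuous_on_sum continuous_on_mult
        continuous_on_add continuous_on_const continuous_on_eval3)
  finally show ?thesis .
qed

text \<open>Banach-Alaoglu: the values of a state at \<open>v\<close> lie in a ball given by the
  radius of \<open>v\<close>, and the defining conditions are closed in the pointwise
  topology.\<close>

lemma compact_CS1: "compact (CS V 1)"
proof -
  define b where "b v = (SOME t. t \<ge> 0 \<and> nrad V 1 t (one_one v))" for v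
  have b: "b v \<ge> 0 \<and> nrad V 1 (b v) (one_one v)" for v
    unfolding b_def using nrad_exists1 by (rule someI_ex)
  define K where "K = {\<phi> :: 'v \<Rightarrow> complex mtx. \<forall>v. \<phi> v \<in> {f. \<forall>i. f i \<in> {h. \<forall>j. h j \<in> cball 0 (b v)}}}"
  have "compact K"
    unfolding K_def by (intro compact_Pi_UNIV compact_cball)
  then have "compact (K \<inter> CS V 1)" by (rule compact_Int_closed[OF _ closed_CS])
  also have "K \<inter> CS V 1 = CS V 1"
  proof -
    have "cmod (\<phi> v i j) \<le> b v" if \<phi>: "\<phi> \<in> CS V 1" for \<phi> v i j
    proof (cases "i = 0 \<and> j = 0")
      case True
      then show ?thesis using state_bound[OF \<phi>] b by blast
    next
      case False
      then have "\<phi> v i j = 0" using CPM_mats[OF CS_CPM[OF \<phi>], of v] by (auto simp: mats_def)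
      then show ?thesis using b by simp
    qed
    then show ?thesis by (auto simp: K_def)
  qed
  finally show ?thesis .
qed

end

locale quantized_metric = lip_space V L for V :: "('v::ab_group_add) mous" and L +
  assumes lip_norm: "mlip_norm V L"
begin

lemma Dist_triangle: "Dist L n \<phi> \<theta> \<le> Dist L n \<phi> \<psi> + Dist L n \<psi> \<theta>"
  unfolding Dist_def[of L n \<phi> \<theta>]
proof (rule Sup_least, clarify)
  fix r a assume r: "r \<ge> 1" "a \<in> mats r r" "L r a \<le> 1"
  let ?c = "\<lambda>\<phi> \<psi>. cnorm (r*n) (r*n) (msub (ampl n \<phi> a r) (ampl n \<psi> a r))"
  have "?c \<phi> \<theta> \<le> ?c \<phi> \<psi> + ?c \<psi> \<theta>"
  proof (rule cnorm_ampl_leI)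
    fix x y
    have "cmod (sform r n \<phi> a y x - sform r n \<theta> a y x)
       \<le> cmod (sform r n \<phi> a y x - sform r n \<psi> a y x) + cmod (sform r n \<psi> a y x - sform r n \<theta> a y x)"
      using norm_triangle_ineq[of "sform r n \<phi> a y x - sform r n \<psi> a y x" "sform r n \<psi> a y x - sform r n \<theta> a y x"] by simp
    also have "\<dots> \<le> ?c \<phi> \<psi> * vnorm2 r n x * vnorm2 r n y + ?c \<psi> \<theta> * vnorm2 r n x * vnorm2 r n y"
      by (intro add_mono sform_diff_le)
    finally show "cmod (sform r n \<phi> a y x - sform r n \<theta> a y x) \<le> (?c \<phi> \<psi> + ?c \<psi> \<theta>) * vnorm2 r n x * vnorm2 r n y"
      by (simp add: ring_distribs)
  qed simp
  then have "ereal (?c \<phi> \<theta>) \<le> ereal (?c \<phi> \<psi>) + ereal (?c \<psi> \<theta>)" by simp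
  also have "\<dots> \<le> Dist L n \<phi> \<psi> + Dist L n \<psi> \<theta>" by (intro add_mono Dist_upper r)
  finally show "ereal (?c \<phi> \<theta>) \<le> Dist L n \<phi> \<psi> + Dist L n \<psi> \<theta>" .
qed

lemma Dist_self: "Dist L n \<phi> \<phi> \<le> 0"
  unfolding Dist_def
proof (rule Sup_least, clarify)
  fix r a
  have "cnorm (r*n) (r*n) (msub (ampl n \<phi> a r) (ampl n \<phi> a r)) \<le> 0" by (rule cnorm_ampl_leI) auto
  then show "ereal (cnorm (r*n) (r*n) (msub (ampl n \<phi> a r) (ampl n \<phi> a r))) \<le> 0" by simp
qed

text \<open>The Lip-norm axiom makes \<open>Dist\<close> balls open in the pointwise topology, for
  which the state space is compact.\<close>

lemma finite_net:
  assumes "\<epsilon> > 0"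
  obtains T where "finite T" "T \<subseteq> CS V 1" "\<And>\<phi>. \<phi> \<in> CS V 1 \<Longrightarrow> \<exists>\<psi>\<in>T. Dist L 1 \<psi> \<phi> < ereal \<epsilon>"
proof -
  define B where "B \<psi> = {\<phi> \<in> CS V 1. Dist L 1 \<psi> \<phi> < ereal \<epsilon>}" for \<psi>
  have "openin (top_of_set (CS V 1)) (B \<psi>)" for \<psi>
  proof -
    have *: "openin (top_of_set (CS V 1)) U \<longleftrightarrow> (U \<subseteq> CS V 1 \<and> (\<forall>\<phi>\<in>U. \<exists>e>0.
            (\<forall>\<theta>\<in>CS V 1. Dist L 1 \<phi> \<theta> < ereal e \<longrightarrow> \<theta> \<in> U)))" for U
      using lip_norm unfolding mlip_norm_def by simp
    have "\<exists>e>0. \<forall>\<theta>\<in>CS V 1. Dist L 1 \<phi> \<theta> < ereal e \<longrightarrow> \<theta> \<in> B \<psi>" if \<phi>: "\<phi> \<in> B \<psi>" for \<phi>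
    proof -
      obtain d where d: "Dist L 1 \<psi> \<phi> = ereal d" "d < \<epsilon>"
        using \<phi> Dist_nonneg[of 1 \<psi> \<phi>] by (cases "Dist L 1 \<psi> \<phi>") (auto simp: B_def)
      have "\<theta> \<in> B \<psi>" if \<theta>: "\<theta> \<in> CS V 1" "Dist L 1 \<phi> \<theta> < ereal (\<epsilon> - d)" for \<theta>
      proof -
        have "Dist L 1 \<psi> \<theta> \<le> Dist L 1 \<psi> \<phi> + Dist L 1 \<phi> \<theta>" by (rule Dist_triangle)
        also have "\<dots> < ereal \<epsilon>"
          using d \<theta>(2) by (cases "Dist L 1 \<phi> \<theta>") auto
        finally show ?thesis using \<theta> by (simp add: B_def)
      qed
      then show ?thesis using d by (intro exI[of _ "\<epsilon> - d"]) auto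
    qed
    then show ?thesis unfolding * by (auto simp: B_def)
  qed
  then have "\<exists>O'. open O' \<and> B \<psi> = CS V 1 \<inter> O'" for \<psi> by (simp add: openin_open)
  then obtain O' where O': "\<And>\<psi>. open (O' \<psi>)" "\<And>\<psi>. B \<psi> = CS V 1 \<inter> O' \<psi>" by metis
  have "CS V 1 \<subseteq> (\<Union>\<psi>\<in>CS V 1. O' \<psi>)"
  proof
    fix \<psi> assume \<psi>: "\<psi> \<in> CS V 1"
    have "Dist L 1 \<psi> \<psi> < ereal \<epsilon>"
      using Dist_self[of 1 \<psi>] assms by (simp add: order_le_less_trans)
    then have "\<psi> \<in> B \<psi>" using \<psi> by (simp add: B_def)
    then show "\<psi> \<in> (\<Union>\<psi>\<in>CS V 1. O' \<psi>)" using O'(2) \<psi> by blast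
  qed
  then obtain T where T: "T \<subseteq> CS V 1" "finite T" "CS V 1 \<subseteq> (\<Union>\<psi>\<in>T. O' \<psi>)"
    using compactE_image[OF compact_CS1, of "CS V 1" O'] O'(1) by metis
  have "\<exists>\<psi>\<in>T. Dist L 1 \<psi> \<phi> < ereal \<epsilon>" if \<phi>: "\<phi> \<in> CS V 1" for \<phi>
  proof -
    obtain \<psi> where "\<psi> \<in> T" "\<phi> \<in> O' \<psi>" using T(3) \<phi> by blast
    then have "\<phi> \<in> B \<psi>" using O'(2) \<phi> by blast
    then show ?thesis using \<open>\<psi> \<in> T\<close> by (auto simp: B_def)
  qed
  then show thesis using that T by blast
qed

lemma state_diff_le:
  assumes "L 1 (one_one v) \<le> C" "C > 0" "Dist L 1 \<psi> \<phi> < ereal d" "\<phi> \<in> CS V 1" "\<psi> \<in> CS V 1"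
  shows "cmod (\<psi> v 0 0 - \<phi> v 0 0) \<le> C * d"
proof -
  define w where "w = sm (complex_of_real (1 / C)) v"
  have "L 1 (one_one w) = 1 / C * L 1 (one_one v)"
    using L_mm[OF order_refl one_one_mats[of v], of "complex_of_real (1 / C)"] assms(2)
    by (simp add: w_def mm_one_one norm_divide)
  then have "L 1 (one_one w) \<le> 1" using assms(1,2) by simp
  then have "ereal (cnorm (1*1) (1*1) (msub (ampl 1 \<psi> (one_one w) 1) (ampl 1 \<phi> (one_one w) 1))) \<le> Dist L 1 \<psi> \<phi>"
    by (intro Dist_upper one_one_mats) auto
  then have "ereal (cnorm (1*1) (1*1) (msub (ampl 1 \<psi> (one_one w) 1) (ampl 1 \<phi> (one_one w) 1))) < ereal d"
    using assms(3) by (rule order_le_less_trans)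
  then have le: "cnorm (1*1) (1*1) (msub (ampl 1 \<psi> (one_one w) 1) (ampl 1 \<phi> (one_one w) 1)) \<le> d" by simp
  have "cmod (\<psi> w 0 0 - \<phi> w 0 0) \<le> cnorm (1*1) (1*1) (msub (ampl 1 \<psi> (one_one w) 1) (ampl 1 \<phi> (one_one w) 1))"
    using sform_diff_le[of 1 1 \<psi> "one_one w" "\<lambda>_ _. 1" "\<lambda>_ _. 1" \<phi>]
    unfolding sform_1_1 by (simp add: vnorm2_def)
  then have "cmod (\<psi> w 0 0 - \<phi> w 0 0) \<le> d" using le by linarith
  moreover have "\<psi> w 0 0 - \<phi> w 0 0 = (\<psi> v 0 0 - \<phi> v 0 0) / complex_of_real C"
    using CPM_sm[OF CS_CPM[OF assms(4)]] CPM_sm[OF CS_CPM[OF assms(5)]] by (simp add: w_def diff_divide_distrib)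
  ultimately show ?thesis using assms(2) by (simp add: norm_divide field_simps)
qed

text \<open>Elements with a common bound on \<open>L\<close> are equi-Lipschitz functions on a
  totally bounded state space. Along the ultrafilter their values converge at the points of a finite
  net; these values control all states, and the states compute the radius.\<close>

lemma ultra_Cauchy:
  fixes b :: "'i \<Rightarrow> 'v"
  assumes U: "ultra U" and C: "\<And>k. L 1 (one_one (b k)) \<le> C" "C > 0"
    and M: "\<And>\<psi>. \<psi> \<in> CS V 1 \<Longrightarrow> \<exists>M. eventually (\<lambda>k. cmod (\<psi> (b k) 0 0) \<le> M) U" and \<epsilon>: "\<epsilon> > 0"
  obtains S where "eventually (\<lambda>k. k \<in> S) U" "\<And>k l. k \<in> S \<Longrightarrow> l \<in> S \<Longrightarrow> nrad V 1 \<epsilon> (one_one (b k - b l))"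
proof -
  \<comment> \<open>With this mesh, moving from a state to the net costs
    \<open>\<epsilon> / 4\<close> for each of the two elements; the remaining half is spent on the
    limit at the net point.\<close>
  have "\<epsilon> / (4 * C) > 0" using \<epsilon> C by simp
  then obtain T where T: "finite T" "T \<subseteq> CS V 1" "\<And>\<phi>. \<phi> \<in> CS V 1 \<Longrightarrow> \<exists>\<psi>\<in>T. Dist L 1 \<psi> \<phi> < ereal (\<epsilon> / (4 * C))"
    using finite_net by metis
  have "\<exists>l. ((\<lambda>k. \<psi> (b k) 0 0) \<longlongrightarrow> l) U" if \<psi>: "\<psi> \<in> T" for \<psi>
  proof -
    have "\<psi> \<in> CS V 1" using \<psi> T(2) by blast
    from M[OF this] obtain M where M: "eventually (\<lambda>k. cmod (\<psi> (b k) 0 0) \<le> M) U" by blast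
    then have "eventually (\<lambda>k. \<psi> (b k) 0 0 \<in> cball 0 M) U" by simp
    then show ?thesis using ultra_bounded_tendsto[OF U bounded_cball] by metis
  qed
  then obtain l where l: "\<And>\<psi>. \<psi> \<in> T \<Longrightarrow> ((\<lambda>k. \<psi> (b k) 0 0) \<longlongrightarrow> l \<psi>) U" by metis
  define S where "S = {k. \<forall>\<psi>\<in>T. dist (\<psi> (b k) 0 0) (l \<psi>) < \<epsilon> / 4}"
  have "eventually (\<lambda>k. \<forall>\<psi>\<in>T. dist (\<psi> (b k) 0 0) (l \<psi>) < \<epsilon> / 4) U"
    using \<epsilon> by (intro eventually_ball_finite[OF T(1)] ballI tendstoD[OF l]) simp_all
  then have S: "eventually (\<lambda>k. k \<in> S) U" by (simp add: S_def)
  have "nrad V 1 \<epsilon> (one_one (b k - b k'))" if k: "k \<in> S" "k' \<in> S" for k k'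
  proof (rule nrad_of_states)
    fix \<phi> assume \<phi>: "\<phi> \<in> CS V 1"
    obtain \<psi> where \<psi>: "\<psi> \<in> T" "Dist L 1 \<psi> \<phi> < ereal (\<epsilon> / (4 * C))" using T(3)[OF \<phi>] by blast
    have q: "cmod (\<psi> (b k) 0 0 - \<phi> (b k) 0 0) \<le> \<epsilon> / 4" for k
      using state_diff_le[OF C(1,2) \<psi>(2) \<phi>] \<psi>(1) T(2) C(2) by (auto simp: field_simps)
    have "dist (\<psi> (b k) 0 0) (\<psi> (b k') 0 0) < \<epsilon> / 4 + \<epsilon> / 4"
      using k \<psi>(1) by (intro dist_triangle_less_add[of _ "l \<psi>"]) (auto simp: S_def dist_commute)
    then have m: "cmod (\<psi> (b k) 0 0 - \<psi> (b k') 0 0) < \<epsilon> / 4 + \<epsilon> / 4" by (simp add: dist_norm)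
    have eq: "\<phi> (b k - b k') 0 0 = - (\<psi> (b k) 0 0 - \<phi> (b k) 0 0) + (\<psi> (b k) 0 0 - \<psi> (b k') 0 0) + (\<psi> (b k') 0 0 - \<phi> (b k') 0 0)"
      by (simp add: CPM_diff[OF CS_CPM[OF \<phi>]])
    have "cmod (\<phi> (b k - b k') 0 0) \<le> cmod (\<psi> (b k) 0 0 - \<phi> (b k) 0 0) + cmod (\<psi> (b k) 0 0 - \<psi> (b k') 0 0) + cmod (\<psi> (b k') 0 0 - \<phi> (b k') 0 0)"
    proof -
      have "cmod (- x + y + z) \<le> cmod x + cmod y + cmod z" for x y z
        using norm_triangle_ineq[of "- x + y" z] norm_triangle_ineq[of "- x" y] by simp
      then show ?thesis unfolding eq .
    qed
    also have "\<dots> \<le> \<epsilon> / 4 + (\<epsilon> / 4 + \<epsilon> / 4) + \<epsilon> / 4"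
      by (rule add_mono[OF add_mono[OF q less_imp_le[OF m]] q])
    finally show "cmod (\<phi> (b k - b k') 0 0) \<le> \<epsilon>" by simp
  qed
  then show thesis using S that by blast
qed

end

section \<open>Convergence in the completion and the closed Lipschitz seminorm\<close>

locale completion = V: quantized_metric V L + W: mou W
  for V :: "('v::ab_group_add) mous" and L and W :: "('w::ab_group_add) mous" +
  fixes \<iota> :: "'v \<Rightarrow> 'w"
  assumes completion: "mou_completion V W \<iota>" and nontrivial: "munit V \<noteq> 0"
begin

lemma \<iota>_add: "\<iota> (x + y) = \<iota> x + \<iota> y"
  and \<iota>_sm: "\<iota> (msmul V c x) = msmul W c (\<iota> x)"
  and \<iota>_unit: "\<iota> (munit V) = munit W"
  and \<iota>_star: "\<iota> (mstar V x) = mstar W (\<iota> x)"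
  and \<iota>_inj: "inj \<iota>"
  and \<iota>_cone: "A \<in> mats n n \<Longrightarrow> mmap \<iota> A \<in> mcone W n \<longleftrightarrow> A \<in> mcone V n"
  using completion by (simp_all add: mou_completion_def)

lemma \<iota>_complete:
  fixes f :: "nat \<Rightarrow> 'w"
  assumes "\<And>e. e > 0 \<Longrightarrow> \<exists>N. \<forall>k\<ge>N. \<forall>l\<ge>N. mnorm W 1 (one_one (f k - f l)) < e"
  obtains w where "\<And>e. e > 0 \<Longrightarrow> \<exists>N. \<forall>k\<ge>N. mnorm W 1 (one_one (f k - w)) < e"
proof -
  have "\<forall>f::nat \<Rightarrow> 'w. (\<forall>e>0. \<exists>N. \<forall>k\<ge>N. \<forall>l\<ge>N. mnorm W 1 (one_one (f k - f l)) < e) \<longrightarrow>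
        (\<exists>w. \<forall>e>0. \<exists>N. \<forall>k\<ge>N. mnorm W 1 (one_one (f k - w)) < e)"
    using completion by (simp add: mou_completion_def)
  from spec[OF this, of f] have "\<exists>w. \<forall>e>0. \<exists>N. \<forall>k\<ge>N. mnorm W 1 (one_one (f k - w)) < e"
    by (rule mp) (intro allI impI assms)
  then show thesis using that by auto
qed

lemma \<iota>_0: "\<iota> 0 = 0"
  using \<iota>_add[of 0 0] by simp

lemma \<iota>_diff: "\<iota> (x - y) = \<iota> x - \<iota> y"
  using \<iota>_add[of "x - y" y] by simp

lemma W_nontrivial: "munit W \<noteq> 0"
proof
  assume "munit W = 0"
  then have "\<iota> (munit V) = \<iota> 0" by (simp add: \<iota>_unit \<iota>_0)
  then show False using \<iota>_inj nontrivial by (simp add: inj_eq)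
qed

lemma mmap_\<iota>_add: "mmap \<iota> (A + B) = mmap \<iota> A + mmap \<iota> B"
  and mmap_\<iota>_diff: "mmap \<iota> (A - B) = mmap \<iota> A - mmap \<iota> B"
  and mmap_\<iota>_mm: "mmap \<iota> (mmap (msmul V c) A) = mmap (msmul W c) (mmap \<iota> A)"
  and mmap_\<iota>_vadj: "mmap \<iota> (vadj V A) = vadj W (mmap \<iota> A)"
  by (simp_all add: mmap_def vadj_def fun_eq_iff \<iota>_add \<iota>_diff \<iota>_sm \<iota>_star)

lemma mmap_\<iota>_idm: "mmap \<iota> (V.idm n t) = W.idm n t"
  by (intro ext) (simp add: mmap_def smat_def \<iota>_0 \<iota>_sm \<iota>_unit)

lemma mmap_\<iota>_one_one: "mmap \<iota> (one_one x) = one_one (\<iota> x)"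
  by (intro ext) (simp add: mmap_def one_one_def \<iota>_0)

lemma mmap_\<iota>_mats: "A \<in> mats n m \<Longrightarrow> mmap \<iota> A \<in> mats n m"
  by (auto simp: mmap_def mats_def \<iota>_0)

lemma nrad_\<iota>:
  assumes "A \<in> mats n n"
  shows "nrad W n t (mmap \<iota> A) \<longleftrightarrow> nrad V n t A"
proof -
  have "W.idm n (2 * t) + W.mm u (mmap \<iota> A) + W.mm (cnj u) (vadj W (mmap \<iota> A)) \<in> mcone W n
     \<longleftrightarrow> V.idm n (2 * t) + V.mm u A + V.mm (cnj u) (vadj V A) \<in> mcone V n" for u
  proof -
    have "W.idm n (2 * t) + W.mm u (mmap \<iota> A) + W.mm (cnj u) (vadj W (mmap \<iota> A))
       = mmap \<iota> (V.idm n (2 * t) + V.mm u A + V.mm (cnj u) (vadj V A))"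
      by (simp only: mmap_\<iota>_add mmap_\<iota>_mm mmap_\<iota>_vadj mmap_\<iota>_idm)
    moreover have "V.idm n (2 * t) + V.mm u A + V.mm (cnj u) (vadj V A) \<in> mats n n"
      using assms by (intro mats_add smat_mats V.mm_mats V.vadj_mats)
    ultimately show ?thesis using \<iota>_cone by simp
  qed
  then show ?thesis by (simp only: nrad_def)
qed

lemma nrad_\<iota>_1: "nrad W 1 t (one_one (\<iota> x)) \<longleftrightarrow> nrad V 1 t (one_one x)"
  using nrad_\<iota>[OF one_one_mats] by (simp only: mmap_\<iota>_one_one)

lemma sform_comp: "sform r n (\<lambda>v. \<psi> (\<iota> v)) a y x = sform r n \<psi> (mmap \<iota> a) y x"
  by (simp add: sform_def mmap_def)

lemma CS_pullback:
  assumes \<psi>: "\<psi> \<in> CS W n"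
  shows "(\<lambda>v. \<psi> (\<iota> v)) \<in> CS V n"
  unfolding CS_iff
proof
  have \<psi>': "\<psi> \<in> CPM W n" by (rule W.CS_CPM[OF \<psi>])
  show "(\<lambda>v. \<psi> (\<iota> v)) \<in> CPM V n"
    unfolding CPM_def
  proof (intro CollectI conjI allI impI)
    fix r a x assume "a \<in> mcone V r"
    then have "mmap \<iota> a \<in> mcone W r" using \<iota>_cone[OF V.cone_mats] by blast
    then show "Im (sform r n (\<lambda>v. \<psi> (\<iota> v)) a x x) = 0" "0 \<le> Re (sform r n (\<lambda>v. \<psi> (\<iota> v)) a x x)"
      unfolding sform_comp by (rule W.CPM_real[OF \<psi>'], rule W.CPM_pos[OF \<psi>'])
  qed (simp_all add: \<iota>_add \<iota>_sm W.CPM_add[OF \<psi>'] W.CPM_sm[OF \<psi>'] W.CPM_mats[OF \<psi>'])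
  show "\<psi> (\<iota> (munit V)) = smat n 1" using \<psi> by (simp add: \<iota>_unit CS_iff)
qed

definition conv :: "'i filter \<Rightarrow> ('i \<Rightarrow> 'v) \<Rightarrow> 'w \<Rightarrow> bool" where
  "conv U f w \<longleftrightarrow> (\<forall>e>0. eventually (\<lambda>k. nrad W 1 e (one_one (\<iota> (f k) - w))) U)"

lemma conv_add:
  assumes "conv U f w" "conv U g z"
  shows "conv U (\<lambda>k. f k + g k) (w + z)"
  unfolding conv_def
proof (intro allI impI)
  fix e :: real assume "e > 0"
  then have "eventually (\<lambda>k. nrad W 1 (e/2) (one_one (\<iota> (f k) - w))) U" "eventually (\<lambda>k. nrad W 1 (e/2) (one_one (\<iota> (g k) - z))) U"
    using assms unfolding conv_def by (auto dest: spec[of _ "e/2"])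
  then show "eventually (\<lambda>k. nrad W 1 e (one_one (\<iota> (f k + g k) - (w + z)))) U"
  proof eventually_elim
    case (elim k)
    have "one_one (\<iota> (f k + g k) - (w + z)) = one_one (\<iota> (f k) - w) + one_one (\<iota> (g k) - z)"
      by (simp add: \<iota>_add algebra_simps flip: one_one_add)
    then show ?case using W.nrad_add[OF elim] by simp
  qed
qed

lemma conv_sm:
  assumes "conv U f w"
  shows "conv U (\<lambda>k. msmul V c (f k)) (msmul W c w)"
  unfolding conv_def
proof (intro allI impI)
  fix e :: real assume e: "e > 0"
  define d where "d = e / (cmod c + 1)"
  have c: "cmod c + 1 > 0" by (simp add: add_nonneg_pos)
  then have "d > 0" using e by (simp add: d_def)
  then have "eventually (\<lambda>k. nrad W 1 d (one_one (\<iota> (f k) - w))) U"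
    using assms unfolding conv_def by blast
  then show "eventually (\<lambda>k. nrad W 1 e (one_one (\<iota> (msmul V c (f k)) - msmul W c w))) U"
  proof eventually_elim
    case (elim k)
    have "nrad W 1 (cmod c * d) (one_one (msmul W c (\<iota> (f k) - w)))"
      using W.nrad_mm[OF elim, of c] by (simp only: W.mm_one_one)
    moreover have "cmod c * d \<le> e" using c e by (simp add: d_def field_simps)
    ultimately show ?case
      using W.nrad_mono by (simp add: \<iota>_sm W.sm.scale_right_diff_distrib)
  qed
qed

lemma conv_star:
  assumes "conv U f w"
  shows "conv U (\<lambda>k. mstar V (f k)) (mstar W w)"
proof -
  have "nrad W 1 e (one_one (\<iota> (mstar V x) - mstar W w))" if "nrad W 1 e (one_one (\<iota> x - w))" for x e
  proof -
    have "mstar W (\<iota> x - w) = \<iota> (mstar V x) - mstar W w"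
      using W.star_add[of "\<iota> x" "- w"] by (simp add: \<iota>_star W.star_minus)
    then show ?thesis using W.nrad_vadj[OF that] by (simp add: W.vadj_one_one)
  qed
  then show ?thesis using assms unfolding conv_def by (auto elim!: eventually_mono)
qed

lemma conv_const: "conv U (\<lambda>k. x) (\<iota> x)"
  unfolding conv_def by (simp add: one_one_def W.nrad_0 flip: zero_fun_def)

lemma conv_mats:
  assumes "\<And>k. a k \<in> mats n n" "X \<in> mats n n" "\<And>i j. i < n \<Longrightarrow> j < n \<Longrightarrow> conv U (\<lambda>k. a k i j) (X i j)" "e > 0"
  shows "eventually (\<lambda>k. nrad W n e (mmap \<iota> (a k) - X)) U"
proof -
  \<comment> \<open>This compensates the factor \<open>2 * n^2\<close> in
    \<open>nrad_entriesI\<close>; the summand 1 covers \<open>n = 0\<close>.\<close>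
  define d where "d = e / (2 * (real n)\<^sup>2 + 1)"
  have n: "2 * (real n)\<^sup>2 + 1 > 0" by (simp add: add_nonneg_pos)
  then have d: "d > 0" using assms(4) by (simp add: d_def)
  have "eventually (\<lambda>k. \<forall>i\<in>{..<n}. \<forall>j\<in>{..<n}. nrad W 1 d (one_one (\<iota> (a k i j) - X i j))) U"
    using assms(3) d unfolding conv_def by (intro eventually_ball_finite ballI) auto
  then show ?thesis
  proof eventually_elim
    case (elim k)
    have "nrad W n (2 * (real n)\<^sup>2 * d) (mmap \<iota> (a k) - X)"
      using elim d assms(1)[of k] assms(2)
      by (intro W.nrad_entriesI mats_diff mmap_\<iota>_mats) (auto simp: mmap_def)
    moreover have "2 * (real n)\<^sup>2 * d \<le> e" using n assms(4) by (simp add: d_def field_simps)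
    ultimately show ?case by (rule W.nrad_mono)
  qed
qed

text \<open>Completeness is given for sequences, so points \<open>m j\<close> are chosen in the
  intersection of the first sets \<open>S i\<close>. They form a Cauchy sequence, and the whole
  filter converges to its limit.\<close>

lemma conv_exists:
  assumes U: "U \<noteq> bot" and C: "\<And>e. e > 0 \<Longrightarrow> \<exists>S. eventually (\<lambda>k. k \<in> S) U \<and> (\<forall>k\<in>S. \<forall>l\<in>S. nrad V 1 e (one_one (b k - b l)))"
  obtains w where "conv U b w"
proof -
  define e where "e j = inverse (real (Suc j))" for j
  have e: "e j > 0" for j by (simp add: e_def)
  have "\<forall>j. \<exists>S. eventually (\<lambda>k. k \<in> S) U \<and> (\<forall>k\<in>S. \<forall>l\<in>S. nrad V 1 (e j) (one_one (b k - b l)))"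
    using C e by blast
  then obtain S where S: "\<And>j. eventually (\<lambda>k. k \<in> S j) U" "\<And>j k l. k \<in> S j \<Longrightarrow> l \<in> S j \<Longrightarrow> nrad V 1 (e j) (one_one (b k - b l))"
    by metis
  have "\<exists>k. \<forall>i\<in>{..j}. k \<in> S i" for j
  proof -
    have "eventually (\<lambda>k. \<forall>i\<in>{..j}. k \<in> S i) U" using S(1) by (intro eventually_ball_finite) auto
    then show ?thesis using eventually_happens'[OF U] by blast
  qed
  then obtain m where m: "\<And>j i. i \<le> j \<Longrightarrow> m j \<in> S i" by (metis atMost_iff)
  have small: "\<exists>N. e N < r" if "r > 0" for r
    using reals_Archimedean[OF that] by (simp add: e_def)
  have \<iota>S: "nrad W 1 (e j) (one_one (\<iota> (b k) - \<iota> (b l)))" if "k \<in> S j" "l \<in> S j" for j k l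
    using S(2)[OF that] by (simp only: nrad_\<iota>_1 flip: \<iota>_diff)
  have "\<exists>N. \<forall>k\<ge>N. \<forall>l\<ge>N. mnorm W 1 (one_one (\<iota> (b (m k)) - \<iota> (b (m l)))) < r" if r: "r > 0" for r
  proof -
    obtain N where N: "e N < r / 2" using small[of "r / 2"] r by auto
    have "mnorm W 1 (one_one (\<iota> (b (m k)) - \<iota> (b (m l)))) < r" if "k \<ge> N" "l \<ge> N" for k l
      using W.nrad_mnorm_le[OF W_nontrivial order_refl one_one_mats \<iota>S[OF m[OF that(1)] m[OF that(2)]]] N by simp
    then show ?thesis by blast
  qed
  then obtain w where w: "\<And>r. r > 0 \<Longrightarrow> \<exists>N. \<forall>k\<ge>N. mnorm W 1 (one_one (\<iota> (b (m k)) - w)) < r"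
    using \<iota>_complete[of "\<lambda>k. \<iota> (b (m k))"] by blast
  have "eventually (\<lambda>k. nrad W 1 r (one_one (\<iota> (b k) - w))) U" if r: "r > 0" for r
  proof -
    obtain N where N: "e N < r / 2" using small[of "r / 2"] r by auto
    obtain M where M: "\<And>k. k \<ge> M \<Longrightarrow> mnorm W 1 (one_one (\<iota> (b (m k)) - w)) < r / 2"
      using w[of "r / 2"] r by auto
    define k0 where "k0 = max N M"
    have "nrad W 1 (r / 2) (one_one (\<iota> (b (m k0)) - w))"
      by (rule W.mnorm_less_nrad[OF one_one_mats M]) (simp add: k0_def)
    moreover have "nrad W 1 (e N) (one_one (\<iota> (b k) - \<iota> (b (m k0))))" if "k \<in> S N" for k
      by (rule \<iota>S[OF that m]) (simp add: k0_def)
    ultimately have "nrad W 1 (e N + r / 2) (one_one (\<iota> (b k) - w))" if "k \<in> S N" for k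
      using W.nrad_add[of 1 "e N" "one_one (\<iota> (b k) - \<iota> (b (m k0)))" "r / 2" "one_one (\<iota> (b (m k0)) - w)"] that
      by (simp flip: one_one_add)
    note * = this
    have "nrad W 1 r (one_one (\<iota> (b k) - w))" if "k \<in> S N" for k
    proof (rule W.nrad_mono)
      show "nrad W 1 (e N + r / 2) (one_one (\<iota> (b k) - w))" by (rule *[OF that])
    qed (use N in simp)
    then show ?thesis using S(1)[of N] by (auto elim: eventually_mono)
  qed
  then have "conv U b w" unfolding conv_def by blast
  then show thesis by (rule that)
qed

text \<open>Membership in the closure of a ball of \<open>L\<close> instead of \<open>LD\<close>. By
  \<open>Lc_lessD\<close> and \<open>Lc_leI\<close> the values of \<open>Lc\<close> can be read off
  from it.\<close>

definition approximable :: "nat \<Rightarrow> real \<Rightarrow> 'w mtx \<Rightarrow> bool" where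
  "approximable n s A \<longleftrightarrow> (\<forall>e>0. \<exists>y\<in>mats n n. L n y \<le> s \<and> nrad W n e (A - mmap \<iota> y))"

text \<open>The direction that rests on \<open>bipolar\<close>: an approximant in the unit ball of
  \<open>LD\<close> is replaced by a nearby one in a slightly larger ball of
  \<open>L\<close>.\<close>

lemma Lc_lessD:
  assumes n: "n \<ge> 1" and "Lc V L W \<iota> n A < ereal s"
  shows "approximable n s A"
proof -
  obtain t c where t: "t > 0" "t < s" and c: "c \<in> Bbar V L W \<iota> n" "A = W.mm (complex_of_real t) c"
    using assms(2) unfolding Lc_def Inf_less_iff by auto
  show ?thesis unfolding approximable_def
  proof (intro allI impI)
    fix e :: real assume e: "e > 0"
    \<comment> \<open>Two approximations, one by \<open>a\<close> and one by \<open>y\<close>, are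
      added and then scaled by \<open>t\<close>.\<close>
    define e' where "e' = e / (2 * t)"
    have e': "e' > 0" using e t by (simp add: e'_def)
    obtain a where a: "a \<in> mats n n" "LD V L n a \<le> 1" "mnorm W n (msub c (mmap \<iota> a)) < e'"
      using c(1) e' unfolding Bbar_def by blast
    have cm: "c \<in> mats n n" using c(1) by (simp add: Bbar_def)
    have 1: "nrad W n e' (c - mmap \<iota> a)"
      using a cm by (intro W.mnorm_less_nrad mats_diff mmap_\<iota>_mats) (simp_all add: msub_eq)
    \<comment> \<open>Chosen so that \<open>t * (1 + \<eta>) = s\<close>; the gap between
      \<open>t\<close> and \<open>s\<close> absorbs the loss in \<open>bipolar\<close>.\<close>
    define \<eta> where "\<eta> = (s - t) / t"
    have "\<eta> > 0" using t by (simp add: \<eta>_def)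
    then obtain y where y: "y \<in> mats n n" "L n y \<le> 1 + \<eta>" "nrad V n e' (a - y)"
      using V.bipolar[OF nontrivial n a(1,2) e'] by blast
    have 2: "nrad W n e' (mmap \<iota> a - mmap \<iota> y)"
      using y a nrad_\<iota>[of "a - y" n e'] by (simp add: mmap_\<iota>_diff mats_diff)
    have "nrad W n (t * (e' + e')) (W.mm (complex_of_real t) (c - mmap \<iota> y))"
      using W.nrad_mm[OF W.nrad_add[OF 1 2], of "complex_of_real t"] t by simp
    also have "t * (e' + e') = e" using t by (simp add: e'_def)
    also have "W.mm (complex_of_real t) (c - mmap \<iota> y) = A - mmap \<iota> (V.mm (complex_of_real t) y)"
      by (simp add: c(2) mmap_\<iota>_mm W.mm.scale_right_diff_distrib)
    finally have "nrad W n e (A - mmap \<iota> (V.mm (complex_of_real t) y))" .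
    moreover have "L n (V.mm (complex_of_real t) y) \<le> s"
    proof -
      have "t * L n y \<le> t * (1 + \<eta>)" using y(2) t by (intro mult_left_mono) auto
      also have "\<dots> = s" using t by (simp add: \<eta>_def field_simps)
      finally show ?thesis using V.L_mm[OF n y(1)] t by simp
    qed
    ultimately show "\<exists>y\<in>mats n n. L n y \<le> s \<and> nrad W n e (A - mmap \<iota> y)"
      using V.mm_mats[OF y(1)] by blast
  qed
qed

lemma Lc_leI:
  assumes n: "n \<ge> 1" and A: "A \<in> mats n n" and s: "s > 0" and ap: "approximable n s A"
  shows "Lc V L W \<iota> n A \<le> ereal s"
proof -
  define c where "c = W.mm (complex_of_real (1 / s)) A"
  have cm: "c \<in> mats n n" unfolding c_def by (rule W.mm_mats[OF A])
  have "\<exists>a\<in>mats n n. LD V L n a \<le> 1 \<and> mnorm W n (msub c (mmap \<iota> a)) < e" if e: "e > 0" for e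
  proof -
    \<comment> \<open>The norm is at most twice the radius, so a third of \<open>e\<close> leaves a
      strict inequality after division by \<open>s\<close>.\<close>
    have "s * e / 3 > 0" using e s by simp
    with ap obtain y where y: "y \<in> mats n n" "L n y \<le> s" "nrad W n (s * e / 3) (A - mmap \<iota> y)"
      unfolding approximable_def by blast
    define a where "a = V.mm (complex_of_real (1 / s)) y"
    have a: "a \<in> mats n n" unfolding a_def by (rule V.mm_mats[OF y(1)])
    have "L n a \<le> 1" using V.L_mm[OF n y(1), of "complex_of_real (1 / s)"] y(2) s by (simp add: a_def norm_divide)
    then have "LD V L n a \<le> 1" by (rule V.LD_le[OF n a])
    moreover have "nrad W n (1 / s * (s * e / 3)) (W.mm (complex_of_real (1 / s)) (A - mmap \<iota> y))"
      using W.nrad_mm[OF y(3), of "complex_of_real (1 / s)"] s by (simp add: norm_divide)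
    then have "nrad W n (e / 3) (c - mmap \<iota> a)"
      using s by (simp add: c_def a_def mmap_\<iota>_mm W.mm.scale_right_diff_distrib)
    then have "mnorm W n (c - mmap \<iota> a) \<le> 2 * (e / 3)"
      by (intro W.nrad_mnorm_le[OF W_nontrivial n] mats_diff cm mmap_\<iota>_mats a)
    then have "mnorm W n (msub c (mmap \<iota> a)) < e" using e by (simp add: msub_eq)
    ultimately show ?thesis using a by blast
  qed
  then have "c \<in> Bbar V L W \<iota> n" using cm by (simp add: Bbar_def)
  moreover have "A = W.mm (complex_of_real s) c" using s unfolding c_def by simp
  ultimately show ?thesis unfolding Lc_def using s
    by (intro Inf_lower CollectI exI[of _ s] conjI refl bexI[of _ c])
qed

lemma Vc_iff: "w \<in> Vc V L W \<iota> \<longleftrightarrow> (\<exists>s>0. approximable 1 s (one_one w))"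
proof
  assume "w \<in> Vc V L W \<iota>"
  then obtain s where s: "Lc V L W \<iota> 1 (one_one w) < ereal s"
    unfolding Vc_def using less_PInf_Ex_of_nat by auto
  then have "Lc V L W \<iota> 1 (one_one w) < ereal (max s 1)" by (rule order_less_le_trans) simp
  then have "approximable 1 (max s 1) (one_one w)" by (rule Lc_lessD[OF order_refl])
  then show "\<exists>s>0. approximable 1 s (one_one w)" by (intro exI[of _ "max s 1"]) auto
next
  assume "\<exists>s>0. approximable 1 s (one_one w)"
  then obtain s where "s > 0" "approximable 1 s (one_one w)" by blast
  then have "Lc V L W \<iota> 1 (one_one w) \<le> ereal s" by (intro Lc_leI one_one_mats) auto
  then show "w \<in> Vc V L W \<iota>" by (auto simp: Vc_def)
qed

end

section \<open>The relation between the two completions\<close>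

text \<open>\<open>N k\<close> plays the role of a sequence of matrix Lip-norms on the direct sum for which the
  matrix state spaces of the two summands get arbitrarily close. An element of one completion is
  related to an element of the other one if they are limits, along a fixed ultrafilter, of
  components of an \<open>N\<close>-bounded sequence; this relation is the graph of the isometry. Its axioms are
  symmetric in the two spaces.\<close>

locale bridge = A: completion V1 L1 W1 \<iota>1 + B: completion V2 L2 W2 \<iota>2
  for V1 :: "('a::ab_group_add) mous" and L1 and W1 :: "('c::ab_group_add) mous" and \<iota>1
    and V2 :: "('b::ab_group_add) mous" and L2 and W2 :: "('d::ab_group_add) mous" and \<iota>2 +
  fixes N :: "nat \<Rightarrow> nat \<Rightarrow> 'a mtx \<Rightarrow> 'b mtx \<Rightarrow> real" and U :: "nat filter"
  assumes U: "ultra U" "U \<le> sequentially"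
    and N_add: "\<And>k n a a' b b'. n \<ge> 1 \<Longrightarrow> a \<in> mats n n \<Longrightarrow> a' \<in> mats n n \<Longrightarrow> b \<in> mats n n \<Longrightarrow> b' \<in> mats n n \<Longrightarrow>
      N k n (a + a') (b + b') \<le> N k n a b + N k n a' b'"
    and N_mm: "\<And>k n a b c. n \<ge> 1 \<Longrightarrow> a \<in> mats n n \<Longrightarrow> b \<in> mats n n \<Longrightarrow>
      N k n (mmap (msmul V1 c) a) (mmap (msmul V2 c) b) = cmod c * N k n a b"
    and N_vadj: "\<And>k n a b. n \<ge> 1 \<Longrightarrow> a \<in> mats n n \<Longrightarrow> b \<in> mats n n \<Longrightarrow> N k n (vadj V1 a) (vadj V2 b) = N k n a b"
    and N_elm: "\<And>k n i j x y. i < n \<Longrightarrow> j < n \<Longrightarrow> N k n (elm i j x) (elm i j y) \<le> N k 1 (one_one x) (one_one y)"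
    and N_entry: "\<And>k n a b i j. a \<in> mats n n \<Longrightarrow> b \<in> mats n n \<Longrightarrow> i < n \<Longrightarrow> j < n \<Longrightarrow>
      N k 1 (one_one (a i j)) (one_one (b i j)) \<le> N k n a b"
    and N_unit: "\<And>k. N k 1 (one_one (munit V1)) (one_one (munit V2)) \<le> 0"
    and N_L1: "\<And>k n a b. n \<ge> 1 \<Longrightarrow> a \<in> mats n n \<Longrightarrow> b \<in> mats n n \<Longrightarrow> L1 n a \<le> N k n a b"
    and N_L2: "\<And>k n a b. n \<ge> 1 \<Longrightarrow> a \<in> mats n n \<Longrightarrow> b \<in> mats n n \<Longrightarrow> L2 n b \<le> N k n a b"
    and lift1: "\<And>k n a \<eta>. n \<ge> 1 \<Longrightarrow> a \<in> mats n n \<Longrightarrow> \<eta> > 0 \<Longrightarrow> \<exists>b\<in>mats n n. N k n a b \<le> L1 n a + \<eta>"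
    and lift2: "\<And>k n b \<eta>. n \<ge> 1 \<Longrightarrow> b \<in> mats n n \<Longrightarrow> \<eta> > 0 \<Longrightarrow> \<exists>a\<in>mats n n. N k n a b \<le> L2 n b + \<eta>"
    and close1: "\<And>n \<eta>. n \<ge> 1 \<Longrightarrow> \<eta> > 0 \<Longrightarrow> eventually (\<lambda>k. \<forall>\<psi>\<in>CS V2 n. \<exists>\<phi>\<in>CS V1 n. \<forall>r a b x. r \<ge> 1 \<longrightarrow>
      a \<in> mats r r \<longrightarrow> b \<in> mats r r \<longrightarrow> N k r a b \<le> 1 \<longrightarrow>
      cmod (sform r n \<phi> a x x - sform r n \<psi> b x x) \<le> \<eta> * (vnorm2 r n x)\<^sup>2) U"
    and close2: "\<And>n \<eta>. n \<ge> 1 \<Longrightarrow> \<eta> > 0 \<Longrightarrow> eventually (\<lambda>k. \<forall>\<phi>\<in>CS V1 n. \<exists>\<psi>\<in>CS V2 n. \<forall>r a b x. r \<ge> 1 \<longrightarrow>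
      a \<in> mats r r \<longrightarrow> b \<in> mats r r \<longrightarrow> N k r a b \<le> 1 \<longrightarrow>
      cmod (sform r n \<psi> b x x - sform r n \<phi> a x x) \<le> \<eta> * (vnorm2 r n x)\<^sup>2) U"
begin

lemma U_nontrivial: "U \<noteq> bot" using U(1) by (simp add: ultra_def)

definition rel :: "'c \<Rightarrow> 'd \<Rightarrow> bool" where
  "rel w z \<longleftrightarrow> (\<exists>a b C. (\<forall>k. N k 1 (one_one (a k)) (one_one (b k)) \<le> C) \<and> A.conv U a w \<and> B.conv U b z)"

lemma relI:
  assumes "A.conv U a w" "B.conv U b z" "\<And>k. N k 1 (one_one (a k)) (one_one (b k)) \<le> C"
  shows "rel w z"
  unfolding rel_def using assms by (intro exI[of _ a] exI[of _ b] exI[of _ C] conjI allI)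

text \<open>The bound \<open>C\<close> may be zero or negative, so the rescaling divides by one more
  than its modulus.\<close>

lemma close1_scaled:
  assumes n: "n \<ge> 1" and \<eta>: "\<eta> > 0"
  shows "eventually (\<lambda>k. \<forall>\<psi>\<in>CS V2 n. \<exists>\<phi>\<in>CS V1 n. \<forall>r a b x. r \<ge> 1 \<longrightarrow>
      a \<in> mats r r \<longrightarrow> b \<in> mats r r \<longrightarrow> N k r a b \<le> C \<longrightarrow>
      cmod (sform r n \<phi> a x x - sform r n \<psi> b x x) \<le> \<eta> * (vnorm2 r n x)\<^sup>2) U"
proof -
  define C' where "C' = \<bar>C\<bar> + 1"
  have C': "C' > 0" "C \<le> C'" by (auto simp: C'_def)
  have "\<eta> / C' > 0" using C' \<eta> by simp
  from close1[OF n this] show ?thesis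
  proof eventually_elim
    case (elim k)
    show ?case
    proof
      fix \<psi> assume \<psi>: "\<psi> \<in> CS V2 n"
      then obtain \<phi> where \<phi>: "\<phi> \<in> CS V1 n" and le: "\<And>r a b x. r \<ge> 1 \<Longrightarrow>
        a \<in> mats r r \<Longrightarrow> b \<in> mats r r \<Longrightarrow> N k r a b \<le> 1 \<Longrightarrow>
        cmod (sform r n \<phi> a x x - sform r n \<psi> b x x) \<le> \<eta> / C' * (vnorm2 r n x)\<^sup>2"
        using elim by blast
      have "cmod (sform r n \<phi> a x x - sform r n \<psi> b x x) \<le> \<eta> * (vnorm2 r n x)\<^sup>2"
        if r: "r \<ge> 1" "a \<in> mats r r" "b \<in> mats r r" "N k r a b \<le> C" for r a b x
      proof -
        define c where "c = complex_of_real (1 / C')"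
        have "N k r (A.V.mm c a) (B.V.mm c b) \<le> 1"
          using N_mm[OF r(1,2,3), of k c] r(4) C' by (simp add: c_def norm_divide)
        then have "cmod (sform r n \<phi> (A.V.mm c a) x x - sform r n \<psi> (B.V.mm c b) x x) \<le> \<eta> / C' * (vnorm2 r n x)\<^sup>2"
          by (intro le r A.V.mm_mats B.V.mm_mats)
        also have "sform r n \<phi> (A.V.mm c a) x x - sform r n \<psi> (B.V.mm c b) x x = c * (sform r n \<phi> a x x - sform r n \<psi> b x x)"
          by (simp add: A.V.sform_mm[OF A.V.CS_CPM[OF \<phi>]] B.V.sform_mm[OF B.V.CS_CPM[OF \<psi>]] algebra_simps)
        finally show ?thesis using C' by (simp add: c_def norm_mult norm_divide field_simps)
      qed
      then show "\<exists>\<phi>\<in>CS V1 n. \<forall>r a b x. r \<ge> 1 \<longrightarrow> a \<in> mats r r \<longrightarrow> b \<in> mats r r \<longrightarrow> N k r a b \<le> C \<longrightarrow>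
         cmod (sform r n \<phi> a x x - sform r n \<psi> b x x) \<le> \<eta> * (vnorm2 r n x)\<^sup>2"
        using \<phi> by (intro bexI[of _ \<phi>] allI impI)
    qed
  qed
qed

text \<open>A matrix state \<psi> that detects a failure of positivity is pulled back to
  \<open>V2\<close>. A nearby state \<phi> of \<open>V1\<close> takes almost the same value at
  \<open>a k\<close>, which is almost positive. The conclusion is about twice the real part of
  \<open>Z\<close>, since self-adjointness of \<open>Z\<close> becomes available only through
  uniqueness.\<close>

lemma positivity_transfer:
  assumes n: "n \<ge> 1" and ab: "\<And>k. a k \<in> mats n n" "\<And>k. b k \<in> mats n n" "\<And>k. N k n (a k) (b k) \<le> C"
    and X: "X \<in> mcone W1 n" "\<And>i j. i < n \<Longrightarrow> j < n \<Longrightarrow> A.conv U (\<lambda>k. a k i j) (X i j)"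
    and Z: "Z \<in> mats n n" "\<And>i j. i < n \<Longrightarrow> j < n \<Longrightarrow> B.conv U (\<lambda>k. b k i j) (Z i j)"
  shows "Z + vadj W2 Z \<in> mcone W2 n"
proof (rule ccontr)
  assume "Z + vadj W2 Z \<notin> mcone W2 n"
  moreover have "Z + vadj W2 Z \<in> mats n n" using Z by (intro mats_add B.W.vadj_mats)
  moreover have "vadj W2 (Z + vadj W2 Z) = Z + vadj W2 Z" by (simp add: B.W.vadj_add add.commute)
  ultimately obtain \<psi> x where \<psi>: "\<psi> \<in> CS W2 n" "Re (sform n n \<psi> (Z + vadj W2 Z) x x) < 0"
    using B.W.matrix_state_separation[OF _ _ _ n] by blast
  define v where "v = (vnorm2 n n x)\<^sup>2"
  define d where "d = - Re (sform n n \<psi> Z x x)"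
  have \<psi>': "\<psi> \<in> CPM W2 n" by (rule B.W.CS_CPM[OF \<psi>(1)])
  have d: "d > 0" using \<psi>(2) by (simp add: d_def B.W.sform_add[OF \<psi>'] B.W.sform_vadj[OF \<psi>'])
  have v: "v \<ge> 0" by (simp add: v_def)
  \<comment> \<open>Three errors of size \<open>e * v\<close> occur: approximation of
    \<open>Z\<close>, closeness of the states, approximation of \<open>X\<close>. Each is at most a
    quarter of \<open>d\<close>.\<close>
  define e where "e = d / (4 * (v + 1))"
  have e: "e > 0" using d v by (simp add: e_def)
  have ev: "e * v \<le> d / 4" using d v by (simp add: e_def field_simps)
  have "eventually (\<lambda>k. nrad W1 n e (mmap \<iota>1 (a k) - X)) U"
    by (rule A.conv_mats[OF ab(1) A.W.cone_mats[OF X(1)] X(2) e])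
  moreover have "eventually (\<lambda>k. nrad W2 n e (mmap \<iota>2 (b k) - Z)) U"
    by (rule B.conv_mats[OF ab(2) Z(1) Z(2) e])
  moreover note close1_scaled[OF n e, of C]
  ultimately have "eventually (\<lambda>k. False) U"
  proof eventually_elim
    case (elim k)
    define \<psi>2 where "\<psi>2 = (\<lambda>v. \<psi> (\<iota>2 v))"
    have "\<psi>2 \<in> CS V2 n" unfolding \<psi>2_def by (rule B.CS_pullback[OF \<psi>(1)])
    then obtain \<phi> where \<phi>: "\<phi> \<in> CS V1 n" "cmod (sform n n \<phi> (a k) x x - sform n n \<psi>2 (b k) x x) \<le> e * v"
      using elim(3) n ab unfolding v_def by blast
    have \<phi>': "\<phi> \<in> CPM V1 n" by (rule A.V.CS_CPM[OF \<phi>(1)])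
    have near: "cmod (sform n n \<psi> (mmap \<iota>2 (b k) - Z) x x) \<le> e * v"
      unfolding v_def by (rule B.W.nrad_sform_le[OF \<psi>(1) elim(2)])
    have "sform n n \<psi> (mmap \<iota>2 (b k) - Z) x x + sform n n \<psi> Z x x = sform n n \<psi>2 (b k) x x"
      by (simp add: \<psi>2_def B.sform_comp flip: B.W.sform_add[OF \<psi>'])
    from arg_cong[OF this, of Re]
    have "Re (sform n n \<psi>2 (b k) x x) = Re (sform n n \<psi> (mmap \<iota>2 (b k) - Z) x x) - d"
      by (simp add: d_def)
    then have 1: "Re (sform n n \<psi>2 (b k) x x) \<le> - d + e * v"
      using order_trans[OF complex_Re_le_cmod near] by simp
    have 2: "Re (sform n n \<phi> (a k) x x) \<le> Re (sform n n \<psi>2 (b k) x x) + e * v"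
      using \<phi>(2) complex_Re_le_cmod[of "sform n n \<phi> (a k) x x - sform n n \<psi>2 (b k) x x"] by simp
    \<comment> \<open>Twice the real part of \<open>a k\<close>, raised by the approximation error,
      which makes it positive.\<close>
    define h where "h = a k + vadj V1 (a k) + A.V.idm n (2 * e)"
    have hm: "h \<in> mats n n" unfolding h_def using ab(1) by (intro mats_add A.V.vadj_mats smat_mats)
    have "(X + X) + (A.W.idm n (2 * e) + A.W.mm 1 (mmap \<iota>1 (a k) - X) + A.W.mm (cnj 1) (vadj W1 (mmap \<iota>1 (a k) - X))) \<in> mcone W1 n"
      by (intro A.W.cone_add X(1) A.W.nradD[OF elim(1)]) simp
    also have "(X + X) + (A.W.idm n (2 * e) + A.W.mm 1 (mmap \<iota>1 (a k) - X) + A.W.mm (cnj 1) (vadj W1 (mmap \<iota>1 (a k) - X))) = mmap \<iota>1 h"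
      unfolding h_def A.mmap_\<iota>_add A.mmap_\<iota>_vadj A.mmap_\<iota>_idm
      by (simp add: A.W.vadj_diff A.W.cone_sa[OF X(1)])
    finally have "h \<in> mcone V1 n" using A.\<iota>_cone[OF hm] by simp
    then have "0 \<le> Re (sform n n \<phi> h x x)" by (rule A.V.CPM_pos[OF \<phi>'])
    also have "sform n n \<phi> h x x = sform n n \<phi> (a k) x x + cnj (sform n n \<phi> (a k) x x) + complex_of_real (2 * e * v)"
      unfolding h_def v_def by (simp only: A.V.sform_add[OF \<phi>'] A.V.sform_vadj[OF \<phi>'] A.V.sform_idm[OF \<phi>(1)])
    finally have "0 \<le> 2 * Re (sform n n \<phi> (a k) x x) + 2 * e * v" by simp
    then have "0 \<le> Re (sform n n \<phi> (a k) x x) + e * v" by simp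
    with 1 2 ev d show False by linarith
  qed
  then show False using U_nontrivial by (simp add: trivial_limit_def)
qed

lemma rel_sm: "rel w z \<Longrightarrow> rel (msmul W1 c w) (msmul W2 c z)"
proof -
  assume "rel w z"
  then obtain a b C where ab: "\<And>k. N k 1 (one_one (a k)) (one_one (b k)) \<le> C" "A.conv U a w" "B.conv U b z"
    unfolding rel_def by blast
  have "N k 1 (one_one (msmul V1 c (a k))) (one_one (msmul V2 c (b k))) \<le> cmod c * C" for k
    using N_mm[OF order_refl one_one_mats one_one_mats, of k c "a k" "b k"] mult_left_mono[OF ab(1)[of k], of "cmod c"]
    by (simp add: A.V.mm_one_one B.V.mm_one_one)
  then show ?thesis by (rule relI[OF A.conv_sm[OF ab(2)] B.conv_sm[OF ab(3)]])
qed

lemma rel_add: "rel w z \<Longrightarrow> rel w' z' \<Longrightarrow> rel (w + w') (z + z')"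
proof -
  assume "rel w z" "rel w' z'"
  then obtain a b C a' b' C' where ab: "\<And>k. N k 1 (one_one (a k)) (one_one (b k)) \<le> C" "A.conv U a w" "B.conv U b z"
    "\<And>k. N k 1 (one_one (a' k)) (one_one (b' k)) \<le> C'" "A.conv U a' w'" "B.conv U b' z'"
    unfolding rel_def by blast
  have "N k 1 (one_one (a k + a' k)) (one_one (b k + b' k)) \<le> C + C'" for k
    using N_add[OF order_refl one_one_mats[of "a k"] one_one_mats[of "a' k"] one_one_mats[of "b k"] one_one_mats[of "b' k"], of k]
      ab(1)[of k] ab(4)[of k] by (simp add: one_one_add)
  then show ?thesis by (rule relI[OF A.conv_add[OF ab(2,5)] B.conv_add[OF ab(3,6)]])
qed

lemma rel_star: "rel w z \<Longrightarrow> rel (mstar W1 w) (mstar W2 z)"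
proof -
  assume "rel w z"
  then obtain a b C where ab: "\<And>k. N k 1 (one_one (a k)) (one_one (b k)) \<le> C" "A.conv U a w" "B.conv U b z"
    unfolding rel_def by blast
  have "N k 1 (one_one (mstar V1 (a k))) (one_one (mstar V2 (b k))) \<le> C" for k
    using N_vadj[OF order_refl one_one_mats one_one_mats, of k "a k" "b k"] ab(1)[of k]
    by (simp add: A.V.vadj_one_one B.V.vadj_one_one)
  then show ?thesis by (rule relI[OF A.conv_star[OF ab(2)] B.conv_star[OF ab(3)]])
qed

lemma rel_diff: "rel w z \<Longrightarrow> rel w' z' \<Longrightarrow> rel (w - w') (z - z')"
  using rel_add[of w z "msmul W1 (-1) w'" "msmul W2 (-1) z'"] rel_sm[of w' z' "-1"] by simp

lemma rel_unit: "rel (munit W1) (munit W2)"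
  using relI[OF A.conv_const[of U "munit V1"] B.conv_const[of U "munit V2"] N_unit]
  by (simp only: A.\<iota>_unit B.\<iota>_unit)

text \<open>The entries come with separate sequences and bounds. Assembled into one matrix they
  remain \<open>N\<close>-bounded, because \<open>N_elm\<close> controls a matrix with a single
  entry.\<close>

lemma rel_pos2:
  assumes n: "n \<ge> 1" and X: "X \<in> mcone W1 n" and Z: "Z \<in> mats n n"
    and r: "\<And>i j. i < n \<Longrightarrow> j < n \<Longrightarrow> rel (X i j) (Z i j)"
  shows "Z + vadj W2 Z \<in> mcone W2 n"
proof -
  have "\<forall>i j. \<exists>a b C. i < n \<and> j < n \<longrightarrow> (\<forall>k. N k 1 (one_one (a k)) (one_one (b k)) \<le> C)
      \<and> A.conv U a (X i j) \<and> B.conv U b (Z i j)"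
    using r unfolding rel_def by blast
  then obtain a b C where ab: "\<And>i j k. i < n \<Longrightarrow> j < n \<Longrightarrow> N k 1 (one_one (a i j k)) (one_one (b i j k)) \<le> C i j"
    "\<And>i j. i < n \<Longrightarrow> j < n \<Longrightarrow> A.conv U (a i j) (X i j)" "\<And>i j. i < n \<Longrightarrow> j < n \<Longrightarrow> B.conv U (b i j) (Z i j)"
    by metis
  define a' where "a' k = (\<lambda>i j. if i < n \<and> j < n then a i j k else 0)" for k
  define b' where "b' k = (\<lambda>i j. if i < n \<and> j < n then b i j k else 0)" for k
  have m: "a' k \<in> mats n n" "b' k \<in> mats n n" for k by (auto simp: a'_def b'_def mats_def)
  have N0: "N k n 0 0 = 0" for k
    using N_mm[OF n mats_0 mats_0, of k 0] by simp
  have N_sum: "N k n (\<Sum>i\<in>S. f i) (\<Sum>i\<in>S. g i) \<le> (\<Sum>i\<in>S. N k n (f i) (g i)) \<and> (\<Sum>i\<in>S. f i) \<in> mats n n \<and> (\<Sum>i\<in>S. g i) \<in> mats n n"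
    if "finite S" "\<And>i. i \<in> S \<Longrightarrow> f i \<in> mats n n \<and> g i \<in> mats n n" for k S and f :: "nat \<Rightarrow> 'a mtx" and g :: "nat \<Rightarrow> 'b mtx"
    using that
  proof (induction S rule: finite_induct)
    case (insert i S)
    have IH: "N k n (\<Sum>i\<in>S. f i) (\<Sum>i\<in>S. g i) \<le> (\<Sum>i\<in>S. N k n (f i) (g i))" "(\<Sum>i\<in>S. f i) \<in> mats n n" "(\<Sum>i\<in>S. g i) \<in> mats n n"
      "f i \<in> mats n n" "g i \<in> mats n n" using insert by auto
    have "N k n (f i + (\<Sum>i\<in>S. f i)) (g i + (\<Sum>i\<in>S. g i)) \<le> N k n (f i) (g i) + N k n (\<Sum>i\<in>S. f i) (\<Sum>i\<in>S. g i)"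
      by (intro N_add n IH)
    with IH(1) have "N k n (f i + (\<Sum>i\<in>S. f i)) (g i + (\<Sum>i\<in>S. g i)) \<le> N k n (f i) (g i) + (\<Sum>i\<in>S. N k n (f i) (g i))"
      by simp
    then show ?case unfolding sum.insert[OF insert.hyps] by (intro conjI mats_add IH)
  qed (simp add: N0 mats_0)
  have bound: "N k n (a' k) (b' k) \<le> (\<Sum>i<n. \<Sum>j<n. C i j)" for k
  proof -
    let ?f = "\<lambda>i. \<Sum>j<n. elm i j (a' k i j)" and ?g = "\<lambda>i. \<Sum>j<n. elm i j (b' k i j)"
    have inner: "N k n (?f i) (?g i) \<le> (\<Sum>j<n. C i j) \<and> ?f i \<in> mats n n \<and> ?g i \<in> mats n n" if i: "i < n" for i
    proof -
      have s: "N k n (?f i) (?g i) \<le> (\<Sum>j<n. N k n (elm i j (a' k i j)) (elm i j (b' k i j))) \<and> ?f i \<in> mats n n \<and> ?g i \<in> mats n n"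
        using i by (intro N_sum) (auto intro: elm_mats)
      have "(\<Sum>j<n. N k n (elm i j (a' k i j)) (elm i j (b' k i j))) \<le> (\<Sum>j<n. C i j)"
      proof (rule sum_mono)
        fix j assume "j \<in> {..<n}"
        then have j: "j < n" by simp
        show "N k n (elm i j (a' k i j)) (elm i j (b' k i j)) \<le> C i j"
          using order_trans[OF N_elm[OF i j] ab(1)[OF i j]] i j by (simp add: a'_def b'_def)
      qed
      with s show ?thesis by auto
    qed
    have "N k n (\<Sum>i<n. ?f i) (\<Sum>i<n. ?g i) \<le> (\<Sum>i<n. N k n (?f i) (?g i))"
      using N_sum[of "{..<n}" ?f ?g k] inner by auto
    also have "\<dots> \<le> (\<Sum>i<n. \<Sum>j<n. C i j)" using inner by (intro sum_mono) auto
    finally show ?thesis using A.V.mtx_elm_sum[OF m(1)[of k]] B.V.mtx_elm_sum[OF m(2)[of k]] by simp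
  qed
  have cA: "A.conv U (\<lambda>k. a' k i j) (X i j)" and cB: "B.conv U (\<lambda>k. b' k i j) (Z i j)" if "i < n" "j < n" for i j
    using ab(2,3)[OF that] that by (simp_all add: a'_def b'_def)
  show ?thesis by (rule positivity_transfer[OF n m bound X cA Z cB])
qed

text \<open>Positivity of 0 transfers to every rotation of \<open>z\<close>, so all these rotations
  have positive real part and the numerical radius of \<open>z\<close> is zero.\<close>

lemma rel_0_eq:
  assumes "rel 0 z" shows "z = 0"
proof -
  have "nrad W2 1 t (one_one z)" if "t > 0" for t
    unfolding nrad_def
  proof (intro allI impI)
    fix u
    have "rel 0 (msmul W2 u z)" using rel_sm[OF assms, of u] by simp
    moreover have "one_one (msmul W2 u z) i j = msmul W2 u z" if "i < 1" "j < 1" for i j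
      using that by (simp add: one_one_def)
    ultimately have "one_one (msmul W2 u z) + vadj W2 (one_one (msmul W2 u z)) \<in> mcone W2 1"
      by (intro rel_pos2[of 1 0] A.W.cone_0 one_one_mats) auto
    then have "B.W.idm 1 (2 * t) + (one_one (msmul W2 u z) + vadj W2 (one_one (msmul W2 u z))) \<in> mcone W2 1"
      using \<open>t > 0\<close> by (intro B.W.cone_add[OF B.W.idm_cone]) auto
    then show "B.W.idm 1 (2 * t) + B.W.mm u (one_one z) + B.W.mm (cnj u) (vadj W2 (one_one z)) \<in> mcone W2 1"
      by (simp only: B.W.mm_one_one B.W.vadj_one_one B.W.star_sm add.assoc)
  qed
  then have "one_one z = 0" by (intro B.W.nrad_arch[of _ 1] one_one_mats)
  then have "one_one z 0 0 = 0" by simp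
  then show ?thesis by (simp add: one_one_def)
qed

lemma rel_unique: "rel w z \<Longrightarrow> rel w z' \<Longrightarrow> z = z'"
  using rel_diff[of w z w z'] rel_0_eq[of "z - z'"] by simp

text \<open>\<open>rel_star\<close> together with uniqueness makes \<open>Z\<close> self-adjoint,
  which removes the symmetrisation from \<open>rel_pos2\<close>.\<close>

lemma rel_pos:
  assumes n: "n \<ge> 1" and X: "X \<in> mcone W1 n" and Z: "Z \<in> mats n n"
    and r: "\<And>i j. i < n \<Longrightarrow> j < n \<Longrightarrow> rel (X i j) (Z i j)"
  shows "Z \<in> mcone W2 n"
proof -
  have "vadj W2 Z = Z"
  proof (intro ext)
    fix i j
    show "vadj W2 Z i j = Z i j"
    proof (cases "i < n \<and> j < n")
      case True
      have "vadj W1 X i j = X i j" using A.W.cone_sa[OF X] by simp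
      then have "rel (X i j) (vadj W2 Z i j)"
        using rel_star[OF r[of j i]] True by (simp add: vadj_def)
      then show ?thesis using rel_unique r True by blast
    next
      case False
      then show ?thesis using Z B.W.vadj_mats[OF Z] by (auto simp: mats_def not_less)
    qed
  qed
  then have "Z + Z \<in> mcone W2 n" using rel_pos2[OF n X Z r] by simp
  then have "B.W.mm (complex_of_real (1/2)) (Z + Z) \<in> mcone W2 n" by (rule B.W.cone_scale) simp
  also have "B.W.mm (complex_of_real (1/2)) (Z + Z) = B.W.mm (1/2 + 1/2) Z"
    by (simp only: B.W.mm.scale_right_distrib B.W.mm.scale_left_distrib) simp
  finally show ?thesis by simp
qed

text \<open>The components in \<open>V1\<close> of the defining sequence approximate
  \<open>w\<close>, and \<open>N\<close> bounds their seminorm \<open>L1\<close>.\<close>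

lemma rel_Vc:
  assumes "rel w z" shows "w \<in> Vc V1 L1 W1 \<iota>1"
proof -
  obtain a b C where ab: "\<And>k. N k 1 (one_one (a k)) (one_one (b k)) \<le> C" "A.conv U a w"
    using assms unfolding rel_def by blast
  have "A.approximable 1 (max C 1) (one_one w)"
    unfolding A.approximable_def
  proof (intro allI impI)
    fix e :: real assume "e > 0"
    then obtain k where k: "nrad W1 1 e (one_one (\<iota>1 (a k) - w))"
      using ab(2) eventually_happens'[OF U_nontrivial] unfolding A.conv_def by blast
    have "L1 1 (one_one (a k)) \<le> max C 1"
      using N_L1[OF order_refl one_one_mats one_one_mats, of "a k" k "b k"] ab(1)[of k] by simp
    moreover have "nrad W1 1 e (one_one w - mmap \<iota>1 (one_one (a k)))"
      using A.W.nrad_minus[OF k] by (simp add: A.mmap_\<iota>_one_one one_one_diff)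
    ultimately show "\<exists>y\<in>mats 1 1. L1 1 y \<le> max C 1 \<and> nrad W1 1 e (one_one w - mmap \<iota>1 y)"
      using one_one_mats by blast
  qed
  then show ?thesis unfolding A.Vc_iff by (intro exI[of _ "max C 1"]) auto
qed

text \<open>Approximants \<open>a k\<close> of \<open>X\<close> have partners \<open>b k\<close>
  with \<open>N k n (a k) (b k) \<le> s + \<epsilon> k\<close>. Nothing relates the partners for
  different \<open>k\<close>, but their states are bounded, and \<open>ultra_Cauchy\<close> makes
  them converge. The vanishing slack \<open>\<epsilon> k\<close> is the reason for
  \<open>s' > s\<close> in the conclusion.\<close>

lemma lift:
  assumes n: "n \<ge> 1" and X: "X \<in> mats n n" "A.approximable n s X" and s: "s > 0"
  obtains Z where "Z \<in> mats n n" "\<And>i j. i < n \<Longrightarrow> j < n \<Longrightarrow> rel (X i j) (Z i j)"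
    "\<And>s'. s' > s \<Longrightarrow> B.approximable n s' Z"
proof -
  define \<epsilon> where "\<epsilon> k = inverse (real (Suc k))" for k
  have \<epsilon>: "\<epsilon> k > 0" "\<epsilon> k \<le> 1" for k by (auto simp: \<epsilon>_def field_simps)
  have "\<forall>k. \<exists>y\<in>mats n n. L1 n y \<le> s \<and> nrad W1 n (\<epsilon> k) (X - mmap \<iota>1 y)"
    using X(2) \<epsilon> unfolding A.approximable_def by blast
  then obtain a where a: "\<And>k. a k \<in> mats n n" "\<And>k. L1 n (a k) \<le> s" "\<And>k. nrad W1 n (\<epsilon> k) (X - mmap \<iota>1 (a k))"
    by metis
  have "\<forall>k. \<exists>b\<in>mats n n. N k n (a k) b \<le> L1 n (a k) + \<epsilon> k" using lift1[OF n a(1) \<epsilon>(1)] by blast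
  then obtain b where b: "\<And>k. b k \<in> mats n n" "\<And>k. N k n (a k) (b k) \<le> L1 n (a k) + \<epsilon> k" by metis
  have bs: "N k n (a k) (b k) \<le> s + \<epsilon> k" for k using b(2)[of k] a(2)[of k] by simp
  have ent: "N k 1 (one_one (a k i j)) (one_one (b k i j)) \<le> s + 1" if "i < n" "j < n" for k i j
    using N_entry[OF a(1)[of k] b(1)[of k] that, of k] bs[of k] \<epsilon>(2)[of k] by linarith
  have lim: "eventually (\<lambda>k. \<epsilon> k < r) U" if "r > 0" for r
  proof -
    have "\<epsilon> \<longlonglongrightarrow> 0" unfolding \<epsilon>_def by (rule LIMSEQ_inverse_real_of_nat)
    then have "eventually (\<lambda>k. \<epsilon> k < r) sequentially" using that by (rule order_tendstoD)
    then show ?thesis by (rule filter_leD[OF U(2)])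
  qed
  have ca: "A.conv U (\<lambda>k. a k i j) (X i j)" if ij: "i < n" "j < n" for i j
    unfolding A.conv_def
  proof (intro allI impI)
    fix e :: real assume "e > 0"
    \<comment> \<open>Passing from the matrix to its entry costs the factor 4 of
      \<open>nrad_entry\<close>.\<close>
    then have "eventually (\<lambda>k. \<epsilon> k < e / 4) U" by (intro lim) simp
    then show "eventually (\<lambda>k. nrad W1 1 e (one_one (\<iota>1 (a k i j) - X i j))) U"
    proof eventually_elim
      case (elim k)
      have "nrad W1 n (\<epsilon> k) (mmap \<iota>1 (a k) - X)"
        using A.W.nrad_minus[OF a(3)[of k]] by simp
      then have "nrad W1 1 (4 * \<epsilon> k) (one_one ((mmap \<iota>1 (a k) - X) i j))"
        by (rule A.W.nrad_entry[OF _ less_imp_le[OF \<epsilon>(1)] ij])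
      then have "nrad W1 1 (4 * \<epsilon> k) (one_one (\<iota>1 (a k i j) - X i j))" by (simp add: mmap_def)
      then show ?case by (rule A.W.nrad_mono) (use elim in simp)
    qed
  qed
  \<comment> \<open>Seminorms do not see the scalar part of \<open>b k\<close>. It is controlled
    here: a state of \<open>V2\<close> at \<open>b k\<close> is within 1 of a state of
    \<open>V1\<close> at \<open>a k\<close>, and the latter is bounded because \<open>a k\<close>
    converges.\<close>
  have bounded: "\<exists>M. eventually (\<lambda>k. cmod (\<psi> (b k i j) 0 0) \<le> M) U" if ij: "i < n" "j < n" and \<psi>: "\<psi> \<in> CS V2 1" for \<psi> i j
  proof -
    obtain t where t: "t \<ge> 0" "nrad W1 1 t (one_one (X i j))" using A.W.nrad_exists1 by blast
    have "eventually (\<lambda>k. nrad W1 1 1 (one_one (\<iota>1 (a k i j) - X i j))) U"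
      using ca[OF ij] unfolding A.conv_def by simp
    moreover note close1_scaled[OF order_refl zero_less_one, of "s + 1"]
    ultimately have "eventually (\<lambda>k. cmod (\<psi> (b k i j) 0 0) \<le> 1 + t + 1) U"
    proof eventually_elim
      case (elim k)
      obtain \<phi> where \<phi>: "\<phi> \<in> CS V1 1" "cmod (sform 1 1 \<phi> (one_one (a k i j)) (\<lambda>_ _. 1) (\<lambda>_ _. 1)
          - sform 1 1 \<psi> (one_one (b k i j)) (\<lambda>_ _. 1) (\<lambda>_ _. 1)) \<le> 1 * (vnorm2 1 1 (\<lambda>_ _. 1))\<^sup>2"
        using elim(2) \<psi> ent[OF ij, of k] one_one_mats[of "a k i j"] one_one_mats[of "b k i j"] order_refl[of "1::nat"] by blast
      have "nrad W1 1 (1 + t) (one_one (\<iota>1 (a k i j)))"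
        using A.W.nrad_add[OF elim(1) t(2)] by (simp flip: one_one_add)
      then have "cmod (\<phi> (a k i j) 0 0) \<le> 1 + t"
        unfolding A.nrad_\<iota>_1 by (rule A.V.state_bound[OF \<phi>(1)])
      moreover have "cmod (\<phi> (a k i j) 0 0 - \<psi> (b k i j) 0 0) \<le> 1"
        using \<phi>(2) unfolding A.V.sform_1_1 B.V.sform_1_1 by (simp add: vnorm2_def)
      moreover have "cmod (\<psi> (b k i j) 0 0) \<le> cmod (\<phi> (a k i j) 0 0) + cmod (\<phi> (a k i j) 0 0 - \<psi> (b k i j) 0 0)"
        by (metis norm_minus_commute norm_triangle_sub)
      ultimately show ?case by simp
    qed
    then show ?thesis by blast
  qed
  have "\<exists>z. B.conv U (\<lambda>k. b k i j) z" if ij: "i < n" "j < n" for i j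
  proof -
    have "L2 1 (one_one (b k i j)) \<le> s + 1" for k
      using order_trans[OF N_L2[OF order_refl one_one_mats one_one_mats] ent[OF ij]] .
    then have "\<exists>S. eventually (\<lambda>k. k \<in> S) U \<and> (\<forall>k\<in>S. \<forall>l\<in>S. nrad V2 1 e (one_one (b k i j - b l i j)))" if "e > 0" for e
      using B.V.ultra_Cauchy[OF U(1), of "\<lambda>k. b k i j" "s + 1" e] s bounded[OF ij] that by (metis add_pos_pos zero_less_one)
    then show ?thesis using B.conv_exists[OF U_nontrivial, of "\<lambda>k. b k i j"] by blast
  qed
  then obtain Z0 where Z0: "\<And>i j. i < n \<Longrightarrow> j < n \<Longrightarrow> B.conv U (\<lambda>k. b k i j) (Z0 i j)" by metis
  define Z where "Z = trunc n Z0"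
  have Zm: "Z \<in> mats n n" unfolding Z_def by (rule trunc_mats)
  have cb: "B.conv U (\<lambda>k. b k i j) (Z i j)" if "i < n" "j < n" for i j
    using Z0[OF that] that by (simp add: Z_def trunc_def)
  show thesis
  proof (rule that[OF Zm])
    show "rel (X i j) (Z i j)" if "i < n" "j < n" for i j
      by (rule relI[OF ca[OF that] cb[OF that] ent[OF that]])
    show "B.approximable n s' Z" if s': "s' > s" for s'
      unfolding B.approximable_def
    proof (intro allI impI)
      fix e :: real assume e: "e > 0"
      have "eventually (\<lambda>k. nrad W2 n e (mmap \<iota>2 (b k) - Z) \<and> \<epsilon> k < s' - s) U"
        using s' by (intro eventually_conj B.conv_mats[OF b(1) Zm cb e] lim) auto
      then obtain k where k: "nrad W2 n e (mmap \<iota>2 (b k) - Z)" "\<epsilon> k < s' - s"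
        using eventually_happens'[OF U_nontrivial] by blast
      have "L2 n (b k) \<le> s'" using N_L2[OF n a(1) b(1), of k k k] bs[of k] k(2) by linarith
      moreover have "nrad W2 n e (Z - mmap \<iota>2 (b k))" using B.W.nrad_minus[OF k(1)] by simp
      ultimately show "\<exists>y\<in>mats n n. L2 n y \<le> s' \<and> nrad W2 n e (Z - mmap \<iota>2 y)" using b(1) by blast
    qed
  qed
qed

lemma rel_total:
  assumes "w \<in> Vc V1 L1 W1 \<iota>1" shows "\<exists>z. rel w z"
proof -
  obtain s where s: "s > 0" "A.approximable 1 s (one_one w)" using assms unfolding A.Vc_iff by blast
  obtain Z where "\<And>i j. i < 1 \<Longrightarrow> j < 1 \<Longrightarrow> rel (one_one w i j) (Z i j)"
    using lift[OF order_refl one_one_mats s(2,1)] by metis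
  from this[of 0 0] have "rel w (Z 0 0)" by (simp add: one_one_def)
  then show ?thesis by blast
qed

text \<open>Lifting \<open>X\<close> produces some related matrix with almost the same bound, and
  uniqueness identifies it with \<open>Z\<close>.\<close>

lemma Lc_transfer:
  assumes n: "n \<ge> 1" and X: "X \<in> mats n n" and Z: "Z \<in> mats n n"
    and r: "\<And>i j. i < n \<Longrightarrow> j < n \<Longrightarrow> rel (X i j) (Z i j)"
  shows "Lc V2 L2 W2 \<iota>2 n Z \<le> Lc V1 L1 W1 \<iota>1 n X"
proof (rule ccontr)
  assume "\<not> ?thesis"
  then have "Lc V1 L1 W1 \<iota>1 n X < Lc V2 L2 W2 \<iota>2 n Z" by simp
  then obtain s0 where s0: "Lc V1 L1 W1 \<iota>1 n X < ereal s0" "ereal s0 < Lc V2 L2 W2 \<iota>2 n Z"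
    using ereal_dense2 by blast
  \<comment> \<open>A second intermediate value, because \<open>lift\<close> gives approximability
    only strictly above \<open>s0\<close>.\<close>
  then obtain s' where s': "ereal s0 < ereal s'" "ereal s' < Lc V2 L2 W2 \<iota>2 n Z"
    using ereal_dense2 by blast
  have s0pos: "s0 > 0"
  proof -
    obtain t where "t > 0" "t < s0" using s0(1) unfolding Lc_def Inf_less_iff by auto
    then show ?thesis by simp
  qed
  obtain Z' where Z': "Z' \<in> mats n n" "\<And>i j. i < n \<Longrightarrow> j < n \<Longrightarrow> rel (X i j) (Z' i j)"
    "\<And>s'. s' > s0 \<Longrightarrow> B.approximable n s' Z'"
    by (rule lift[OF n X A.Lc_lessD[OF n s0(1)] s0pos]) (rule that)
  have "Z' i j = Z i j" for i j
  proof (cases "i < n \<and> j < n")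
    case True
    then show ?thesis using rel_unique Z'(2) r by blast
  next
    case False
    then show ?thesis using Z Z'(1) by (auto simp: mats_def not_less)
  qed
  then have "Z' = Z" by (intro ext)
  then have "Lc V2 L2 W2 \<iota>2 n Z \<le> ereal s'"
    using Z'(3)[of s'] s'(1) s0pos by (intro B.Lc_leI[OF n Z]) auto
  then show False using s'(2) by simp
qed

end

text \<open>The axioms are exchanged in pairs. Each one-sided result about the relation thereby
  holds in the other direction as well.\<close>

lemma bridge_swap:
  assumes "bridge V1 L1 W1 \<iota>1 V2 L2 W2 \<iota>2 N U"
  shows "bridge V2 L2 W2 \<iota>2 V1 L1 W1 \<iota>1 (\<lambda>k n b a. N k n a b) U"
proof -
  interpret bridge V1 L1 W1 \<iota>1 V2 L2 W2 \<iota>2 N U by fact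
  show ?thesis
    by (rule bridge.intro[OF B.completion_axioms A.completion_axioms], rule bridge_axioms.intro)
      (assumption | rule U N_add N_mm N_vadj N_elm N_entry N_unit N_L1 N_L2 lift1 lift2
      | (rule eventually_mono[OF close2], assumption, assumption, blast)
      | (rule eventually_mono[OF close1], assumption, assumption, blast))+
qed

section \<open>Seminorms on the direct sum and the final assembly\<close>

lemma completionI:
  assumes "qms V L" "mou_completion V W \<iota>" "munit V \<noteq> 0"
  shows "completion V L W \<iota>"
proof (intro completion.intro quantized_metric.intro lip_space.intro mou.intro lip_space_axioms.intro
    quantized_metric_axioms.intro completion_axioms.intro)
  show "mou_space V" "mlip_norm V L" using assms(1) by (simp_all add: qms_def)
  then show "mlip_seminorm V L" by (simp add: mlip_norm_def)
  show "mou_space W" using assms(2) unfolding mou_completion_def by (rule conjunct1)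
qed fact+

text \<open>Lets a seminorm on matrices of pairs be read as a function of two matrices, the form in
  which the bridge is symmetric.\<close>

definition mpair :: "'a mtx \<Rightarrow> 'b mtx \<Rightarrow> ('a \<times> 'b) mtx" where
  "mpair a b = (\<lambda>i j. (a i j, b i j))"

lemma mpair_mats: "a \<in> mats n m \<Longrightarrow> b \<in> mats n m \<Longrightarrow> mpair a b \<in> mats n m"
  by (auto simp: mpair_def mats_def zero_prod_def)

lemma mpair_fst_snd: "mpair (mmap fst c) (mmap snd c) = c"
  by (simp add: mpair_def mmap_def)

lemma mmap_mpair: "mmap fst (mpair a b) = a" "mmap snd (mpair a b) = b"
  by (simp_all add: mpair_def mmap_def)

lemma mpair_elm: "elm i j (x, y) = mpair (elm i j x) (elm i j y)"
  and mpair_one_one: "one_one (x, y) = mpair (one_one x) (one_one y)"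
  by (auto simp: mpair_def elm_def one_one_def fun_eq_iff zero_prod_def)

lemma cnorm_elm: "cnorm n m (elm i j 1) \<le> 1"
proof (rule cnorm_leI)
  fix x y :: "nat \<Rightarrow> complex"
  have e: "(\<Sum>a<n. \<Sum>b<m. y a * elm i j 1 a b * x b) = (\<Sum>a<n. if a = i then (\<Sum>b<m. if b = j then y i * x j else 0) else 0)"
  proof (rule sum.cong[OF refl])
    fix a
    have "(\<Sum>b<m. y a * elm i j 1 a b * x b) = (\<Sum>b<m. if a = i then (if b = j then y i * x j else 0) else 0)"
      by (intro sum.cong refl) (auto simp: elm_def)
    then show "(\<Sum>b<m. y a * elm i j 1 a b * x b) = (if a = i then (\<Sum>b<m. if b = j then y i * x j else 0) else 0)"
      by (cases "a = i") auto
  qed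
  have le: "cmod (x j) \<le> vnorm m x" if "j < m" for m and x :: "nat \<Rightarrow> complex" and j
    unfolding vnorm_def using that by (intro member_le_L2_set[of _ j "\<lambda>i. cmod (x i)", simplified]) auto
  show "cmod (\<Sum>a<n. \<Sum>b<m. y a * elm i j 1 a b * x b) \<le> 1 * vnorm m x * vnorm n y"
  proof (cases "i < n \<and> j < m")
    case True
    then have "cmod (\<Sum>a<n. \<Sum>b<m. y a * elm i j 1 a b * x b) = cmod (x j) * cmod (y i)"
      unfolding e by (simp add: norm_mult)
    also have "\<dots> \<le> vnorm m x * vnorm n y" using True by (intro mult_mono le) auto
    finally show ?thesis by simp
  next
    case False
    then show ?thesis unfolding e by auto
  qed
qed simp

lemma hausdorffD1:
  assumes "hausdorff d A B < c" "x \<in> A" obtains y where "y \<in> B" "d x y < c"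
proof -
  have "(INF y\<in>B. d x y) \<le> (SUP x\<in>A. INF y\<in>B. d x y)" by (rule SUP_upper[OF assms(2)])
  also have "\<dots> < c" using assms(1) by (simp add: hausdorff_def)
  finally show thesis using that by (auto simp: INF_less_iff)
qed

lemma hausdorffD2:
  assumes "hausdorff d A B < c" "y \<in> B" obtains x where "x \<in> A" "d x y < c"
proof -
  have "(INF x\<in>A. d x y) \<le> (SUP y\<in>B. INF x\<in>A. d x y)" by (rule SUP_upper[OF assms(2)])
  also have "\<dots> < c" using assms(1) by (simp add: hausdorff_def)
  finally show thesis using that by (auto simp: INF_less_iff)
qed

lemma CS_nontrivial: "n \<ge> 1 \<Longrightarrow> \<phi> \<in> CS V n \<Longrightarrow> munit V \<noteq> 0"
proof
  assume n: "n \<ge> 1" and \<phi>: "\<phi> \<in> CS V n" and "munit V = 0"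
  have "\<phi> (munit V) = smat n 1" "\<And>x y i j. \<phi> (x + y) i j = \<phi> x i j + \<phi> y i j"
    using \<phi> unfolding CS_def by simp_all
  then have "\<phi> 0 0 0 = smat n 1 0 0" "\<phi> 0 0 0 = \<phi> 0 0 0 + \<phi> 0 0 0"
    using \<open>munit V = 0\<close> by (metis, metis add_0)
  then show False using n by (simp add: smat_def)
qed

locale dsum_seminorm = A: mou V1 + B: mou V2
  for V1 :: "('a::ab_group_add) mous" and V2 :: "('b::ab_group_add) mous" +
  fixes L :: "nat \<Rightarrow> ('a \<times> 'b) mtx \<Rightarrow> real"
  assumes seminorm: "mlip_seminorm (dsum_mous V1 V2) L"
begin

abbreviation "D \<equiv> dsum_mous V1 V2"

lemma D_simps: "msmul D c p = (msmul V1 c (fst p), msmul V2 c (snd p))"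
  "mstar D p = (mstar V1 (fst p), mstar V2 (snd p))" "munit D = (munit V1, munit V2)"
  by (simp_all add: dsum_mous_def case_prod_unfold)

lemma mpair_add: "mpair (a + a') (b + b') = madd (mpair a b) (mpair a' b')"
  and mpair_mm: "mpair (mmap (msmul V1 c) a) (mmap (msmul V2 c) b) = mmap (msmul D c) (mpair a b)"
  and mpair_vadj: "mpair (vadj V1 a) (vadj V2 b) = vadj D (mpair a b)"
  by (simp_all add: mpair_def madd_def mmap_def vadj_def D_simps fun_eq_iff)

lemma seminorm_add: "n \<ge> 1 \<Longrightarrow> X \<in> mats n n \<Longrightarrow> Y \<in> mats n n \<Longrightarrow> L n (madd X Y) \<le> L n X + L n Y"
  and seminorm_mm: "n \<ge> 1 \<Longrightarrow> X \<in> mats n n \<Longrightarrow> L n (mmap (msmul D c) X) = cmod c * L n X"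
  and seminorm_vadj: "n \<ge> 1 \<Longrightarrow> X \<in> mats n n \<Longrightarrow> L n (vadj D X) = L n X"
  and seminorm_mult: "m \<ge> 1 \<Longrightarrow> n \<ge> 1 \<Longrightarrow> X \<in> mats m m \<Longrightarrow> \<alpha> \<in> mats n m \<Longrightarrow> \<beta> \<in> mats m n \<Longrightarrow>
    L n (rmul D m (lmul D m \<alpha> X) \<beta>) \<le> cnorm n m \<alpha> * L m X * cnorm m n \<beta>"
  using seminorm unfolding mlip_seminorm_def by simp_all

lemma seminorm_nonneg:
  assumes "n \<ge> 1" "X \<in> mats n n" shows "0 \<le> L n X"
proof -
  have m: "mmap (msmul D (-1)) X \<in> mats n n"
    using assms(2) by (auto simp: mats_def mmap_def D_simps zero_prod_def)
  have "madd X (mmap (msmul D (-1)) X) = mmap (msmul D 0) X"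
    by (intro ext) (simp add: madd_def mmap_def D_simps prod_eq_iff)
  then have "L n (madd X (mmap (msmul D (-1)) X)) = 0" using seminorm_mm[OF assms, of 0] by simp
  then show ?thesis using seminorm_add[OF assms m] seminorm_mm[OF assms, of "-1"] by simp
qed

text \<open>Multiplication by matrix units, of norm at most 1, moves one entry to another place and
  possibly to another matrix size. It yields both \<open>N_elm\<close> and
  \<open>N_entry\<close>.\<close>

lemma seminorm_corner:
  assumes "m \<ge> 1" "n \<ge> 1" "X \<in> mats m m" "i < n" "j < n" "k < m" "l < m"
  shows "L n (elm i j (X k l)) \<le> L m X"
proof -
  have e: "rmul D m (lmul D m (elm i k 1) X) (elm l j 1) = elm i j (X k l)"
  proof (intro ext)
    fix a b
    have "lmul D m (elm i k 1) X a c = (if a = i then X k c else 0)" for c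
    proof -
      have "lmul D m (elm i k 1) X a c = (\<Sum>p<m. if p = k then (if a = i then X k c else 0) else 0)"
        unfolding lmul_def by (intro sum.cong refl) (auto simp: elm_def D_simps zero_prod_def)
      then show ?thesis using assms(6) by simp
    qed
    then have "rmul D m (lmul D m (elm i k 1) X) (elm l j 1) a b
      = (\<Sum>p<m. if p = l then (if a = i \<and> b = j then X k l else 0) else 0)"
      unfolding rmul_def by (intro sum.cong refl) (auto simp: elm_def D_simps zero_prod_def)
    then show "rmul D m (lmul D m (elm i k 1) X) (elm l j 1) a b = elm i j (X k l) a b"
      using assms(7) by (simp add: elm_def)
  qed
  have "L n (elm i j (X k l)) \<le> cnorm n m (elm i k 1) * L m X * cnorm m n (elm l j 1)"
    unfolding e[symmetric] using assms by (intro seminorm_mult elm_mats) auto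
  also have "\<dots> \<le> 1 * L m X * 1"
    using seminorm_nonneg[OF assms(1,3)] by (intro mult_mono cnorm_elm mult_nonneg_nonneg) auto
  finally show ?thesis by simp
qed

lemma induced_le:
  assumes "induces L fst L1" "n \<ge> 1" "a \<in> mats n n" "b \<in> mats n n"
  shows "L1 n a \<le> L n (mpair a b)"
proof -
  have "L1 n a = Inf {L n c | c. c \<in> mats n n \<and> mmap fst c = a}"
    using assms unfolding induces_def by blast
  also have "\<dots> \<le> L n (mpair a b)"
    
  proof (rule cInf_lower)
    show "L n (mpair a b) \<in> {L n c | c. c \<in> mats n n \<and> mmap fst c = a}"
      by (intro CollectI exI[of _ "mpair a b"]) (simp add: mpair_mats[OF assms(3,4)] mmap_mpair)
    show "bdd_below {L n c | c. c \<in> mats n n \<and> mmap fst c = a}"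
      using seminorm_nonneg[OF assms(2)] by (intro bdd_belowI[of _ 0]) auto
  qed
  finally show ?thesis .
qed

lemma induced_le2:
  assumes "induces L snd L2" "n \<ge> 1" "a \<in> mats n n" "b \<in> mats n n"
  shows "L2 n b \<le> L n (mpair a b)"
proof -
  have "L2 n b = Inf {L n c | c. c \<in> mats n n \<and> mmap snd c = b}"
    using assms unfolding induces_def by blast
  also have "\<dots> \<le> L n (mpair a b)"
    
  proof (rule cInf_lower)
    show "L n (mpair a b) \<in> {L n c | c. c \<in> mats n n \<and> mmap snd c = b}"
      by (intro CollectI exI[of _ "mpair a b"]) (simp add: mpair_mats[OF assms(3,4)] mmap_mpair)
    show "bdd_below {L n c | c. c \<in> mats n n \<and> mmap snd c = b}"
      using seminorm_nonneg[OF assms(2)] by (intro bdd_belowI[of _ 0]) auto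
  qed
  finally show ?thesis .
qed

lemma mmap_proj_mats: "c \<in> mats n n \<Longrightarrow> mmap fst c \<in> mats n n" "c \<in> mats n n \<Longrightarrow> mmap snd c \<in> mats n n" for c :: "('a \<times> 'b) mtx"
  by (auto simp: mats_def mmap_def)

lemma induced_lift:
  assumes "induces L fst L1" "n \<ge> 1" "a \<in> mats n n" "\<eta> > 0"
  shows "\<exists>b\<in>mats n n. L n (mpair a b) \<le> L1 n a + \<eta>"
proof -
  have eq: "L1 n a = Inf {L n c | c. c \<in> mats n n \<and> mmap fst c = a}"
    using assms unfolding induces_def by blast
  have ne: "{L n c | c. c \<in> mats n n \<and> mmap fst c = a} \<noteq> {}"
    using mpair_mats[OF assms(3) mats_0] mmap_mpair(1) by blast
  have "Inf {L n c | c. c \<in> mats n n \<and> mmap fst c = a} < L1 n a + \<eta>" using eq assms(4) by simp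
  from cInf_lessD[OF ne this] obtain c where c: "c \<in> mats n n" "mmap fst c = a" "L n c < L1 n a + \<eta>" by blast
  then show ?thesis using mmap_proj_mats(2)[OF c(1)] mpair_fst_snd[of c] by (intro bexI[of _ "mmap snd c"]) auto
qed

lemma induced_lift2:
  assumes "induces L snd L2" "n \<ge> 1" "b \<in> mats n n" "\<eta> > 0"
  shows "\<exists>a\<in>mats n n. L n (mpair a b) \<le> L2 n b + \<eta>"
proof -
  have eq: "L2 n b = Inf {L n c | c. c \<in> mats n n \<and> mmap snd c = b}"
    using assms unfolding induces_def by blast
  have ne: "{L n c | c. c \<in> mats n n \<and> mmap snd c = b} \<noteq> {}"
    using mpair_mats[OF mats_0 assms(3)] mmap_mpair(2) by blast
  have "Inf {L n c | c. c \<in> mats n n \<and> mmap snd c = b} < L2 n b + \<eta>" using eq assms(4) by simp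
  from cInf_lessD[OF ne this] obtain c where c: "c \<in> mats n n" "mmap snd c = b" "L n c < L2 n b + \<eta>" by blast
  then show ?thesis using mmap_proj_mats(1)[OF c(1)] mpair_fst_snd[of c] by (intro bexI[of _ "mmap fst c"]) auto
qed

lemma Dist_sform:
  assumes "Dist L n (\<phi> \<circ> fst) (\<psi> \<circ> snd) < ereal \<eta>" "r \<ge> 1" "a \<in> mats r r" "b \<in> mats r r" "L r (mpair a b) \<le> 1"
  shows "cmod (sform r n \<phi> a x x - sform r n \<psi> b x x) \<le> \<eta> * (vnorm2 r n x)\<^sup>2"
proof -
  let ?c = "cnorm (r*n) (r*n) (msub (ampl n (\<phi> \<circ> fst) (mpair a b) r) (ampl n (\<psi> \<circ> snd) (mpair a b) r))"
  have "ereal ?c \<le> Dist L n (\<phi> \<circ> fst) (\<psi> \<circ> snd)"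
    unfolding Dist_def using assms mpair_mats by (intro Sup_upper) blast
  then have "ereal ?c < ereal \<eta>" using assms(1) by (rule order_le_less_trans)
  then have c: "?c \<le> \<eta>" by simp
  have eq: "sform r n \<phi> a x x - sform r n \<psi> b x x = sform r n (\<phi> \<circ> fst) (mpair a b) x x - sform r n (\<psi> \<circ> snd) (mpair a b) x x"
    by (simp add: sform_def mpair_def)
  have "cmod (sform r n \<phi> a x x - sform r n \<psi> b x x) \<le> ?c * vnorm2 r n x * vnorm2 r n x"
    unfolding eq by (rule sform_diff_le)
  also have "\<dots> \<le> \<eta> * vnorm2 r n x * vnorm2 r n x" using c by (intro mult_right_mono) auto
  finally show ?thesis by (simp add: power2_eq_square mult.assoc)
qed

end

text \<open>For fixed \<open>n\<close> the bound on the Hausdorff distance tends to 0 in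
  \<open>k\<close>, and the bridge asks for closeness level by level. The remaining axioms restate
  the seminorm axioms and the two induced seminorms.\<close>

lemma bridge_of_distance:
  fixes V1 :: "('a::ab_group_add) mous" and V2 :: "('b::ab_group_add) mous"
    and W1 :: "('c::ab_group_add) mous" and W2 :: "('d::ab_group_add) mous"
  assumes A: "completion V1 L1 W1 \<iota>1" and B: "completion V2 L2 W2 \<iota>2" and U: "ultra U" "U \<le> sequentially"
    and M: "\<And>k. LL k \<in> Mset V1 L1 V2 L2"
    and H: "\<And>k n. n \<ge> 1 \<Longrightarrow> hausdorff (Dist (LL k) n) ((\<lambda>\<phi>. \<phi> \<circ> fst) ` CS V1 n) ((\<lambda>\<psi>. \<psi> \<circ> snd) ` CS V2 n)
      < ereal ((real n)\<^sup>2 / real (Suc k))"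
  shows "bridge V1 L1 W1 \<iota>1 V2 L2 W2 \<iota>2 (\<lambda>k n a b. LL k n (mpair a b)) U"
proof -
  interpret A: completion V1 L1 W1 \<iota>1 by fact
  interpret B: completion V2 L2 W2 \<iota>2 by fact
  have D: "dsum_seminorm V1 V2 (LL k)" for k
    using M[of k] A.V.mou_axioms B.V.mou_axioms
    by (simp add: dsum_seminorm_def dsum_seminorm_axioms_def Mset_def mlip_norm_def)
  have ind: "induces (LL k) fst L1" "induces (LL k) snd L2" for k using M[of k] by (simp_all add: Mset_def)
  have small: "eventually (\<lambda>k. (real n)\<^sup>2 / real (Suc k) \<le> \<eta>) U" if "\<eta> > 0" for n :: nat and \<eta>
  proof -
    have "(\<lambda>k. (real n)\<^sup>2 * inverse (real (Suc k))) \<longlonglongrightarrow> (real n)\<^sup>2 * 0"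
      by (intro tendsto_mult tendsto_const LIMSEQ_inverse_real_of_nat)
    then have "eventually (\<lambda>k. (real n)\<^sup>2 * inverse (real (Suc k)) < \<eta>) sequentially"
      using that by (intro order_tendstoD(2)) auto
    then have "eventually (\<lambda>k. (real n)\<^sup>2 * inverse (real (Suc k)) < \<eta>) U" by (rule filter_leD[OF U(2)])
    then show ?thesis by eventually_elim (simp add: divide_inverse)
  qed
  show ?thesis
  proof (rule bridge.intro[OF A B], rule bridge_axioms.intro)
    fix k n i j and x :: 'a and y :: 'b assume ij: "i < n" "j < (n::nat)"
    show "LL k n (mpair (elm i j x) (elm i j y)) \<le> LL k 1 (mpair (one_one x) (one_one y))"
    proof -
      have "LL k n (elm i j (one_one (x, y) 0 0)) \<le> LL k 1 (one_one (x, y))"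
        by (rule dsum_seminorm.seminorm_corner[OF D _ _ one_one_mats]) (use ij in auto)
      moreover have "one_one (x, y) 0 0 = (x, y)" by (simp add: one_one_def)
      ultimately show ?thesis by (simp only: mpair_elm mpair_one_one)
    qed
  next
    fix k n i j and a :: "'a mtx" and b :: "'b mtx" assume "a \<in> mats n n" "b \<in> mats n n" and ij: "i < n" "j < (n::nat)"
    then have "LL k 1 (elm 0 0 (mpair a b i j)) \<le> LL k n (mpair a b)"
      by (intro dsum_seminorm.seminorm_corner[OF D[of k]] mpair_mats) auto
    moreover have "elm 0 0 (mpair a b i j) = mpair (one_one (a i j)) (one_one (b i j))"
      by (simp add: mpair_def elm_def one_one_def fun_eq_iff zero_prod_def)
    ultimately show "LL k 1 (mpair (one_one (a i j)) (one_one (b i j))) \<le> LL k n (mpair a b)" by simp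
  next
    fix k
    have "\<exists>c\<in>mats 1 1. one_one (munit V1, munit V2) = (\<lambda>i j. msmul (dsum_mous V1 V2) (c i j) (munit (dsum_mous V1 V2)))"
      using one_one_mats[of "1::complex"]
      by (intro bexI[of _ "one_one 1"] ext) (auto simp: dsum_mous_def one_one_def zero_prod_def)
    moreover have "\<forall>n\<ge>1. \<forall>A\<in>mats n n. LL k n A = 0 \<longleftrightarrow>
        (\<exists>c\<in>mats n n. A = (\<lambda>i j. msmul (dsum_mous V1 V2) (c i j) (munit (dsum_mous V1 V2))))"
      using dsum_seminorm.seminorm[OF D[of k]] unfolding mlip_seminorm_def by (elim conjE)
    ultimately have "LL k 1 (one_one (munit V1, munit V2)) = 0" using one_one_mats by blast
    then show "LL k 1 (mpair (one_one (munit V1)) (one_one (munit V2))) \<le> 0" by (simp only: mpair_one_one) 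
  next
    fix n and \<eta> :: real assume n: "n \<ge> (1::nat)" and "\<eta> > 0"
    from small[OF this(2), of n]
    show "eventually (\<lambda>k. \<forall>\<psi>\<in>CS V2 n. \<exists>\<phi>\<in>CS V1 n. \<forall>r a b x. r \<ge> 1 \<longrightarrow>
      a \<in> mats r r \<longrightarrow> b \<in> mats r r \<longrightarrow> LL k r (mpair a b) \<le> 1 \<longrightarrow>
      cmod (sform r n \<phi> a x x - sform r n \<psi> b x x) \<le> \<eta> * (vnorm2 r n x)\<^sup>2) U"
    proof eventually_elim
      case (elim k)
      have "hausdorff (Dist (LL k) n) ((\<lambda>\<phi>. \<phi> \<circ> fst) ` CS V1 n) ((\<lambda>\<psi>. \<psi> \<circ> snd) ` CS V2 n) < ereal \<eta>"
        by (rule order_less_le_trans[OF H[OF n]]) (use elim in simp)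
      note h = hausdorffD2[OF this]
      show ?case
      proof
        fix \<psi> assume "\<psi> \<in> CS V2 n"
        then obtain f where "f \<in> (\<lambda>\<phi>. \<phi> \<circ> fst) ` CS V1 n" and f: "Dist (LL k) n f (\<psi> \<circ> snd) < ereal \<eta>"
          by (rule h[OF imageI])
        then obtain \<phi> where \<phi>: "\<phi> \<in> CS V1 n" "f = \<phi> \<circ> fst" by (elim imageE)
        from f[unfolded \<phi>(2)] show "\<exists>\<phi>\<in>CS V1 n. \<forall>r a b x. r \<ge> 1 \<longrightarrow>
            a \<in> mats r r \<longrightarrow> b \<in> mats r r \<longrightarrow> LL k r (mpair a b) \<le> 1 \<longrightarrow>
            cmod (sform r n \<phi> a x x - sform r n \<psi> b x x) \<le> \<eta> * (vnorm2 r n x)\<^sup>2"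
          by (intro bexI[OF _ \<phi>(1)] allI impI) (rule dsum_seminorm.Dist_sform[OF D])
      qed
    qed
    from small[OF \<open>\<eta> > 0\<close>, of n]
    show "eventually (\<lambda>k. \<forall>\<phi>\<in>CS V1 n. \<exists>\<psi>\<in>CS V2 n. \<forall>r a b x. r \<ge> 1 \<longrightarrow>
      a \<in> mats r r \<longrightarrow> b \<in> mats r r \<longrightarrow> LL k r (mpair a b) \<le> 1 \<longrightarrow>
      cmod (sform r n \<psi> b x x - sform r n \<phi> a x x) \<le> \<eta> * (vnorm2 r n x)\<^sup>2) U"
    proof eventually_elim
      case (elim k)
      have "hausdorff (Dist (LL k) n) ((\<lambda>\<phi>. \<phi> \<circ> fst) ` CS V1 n) ((\<lambda>\<psi>. \<psi> \<circ> snd) ` CS V2 n) < ereal \<eta>"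
        by (rule order_less_le_trans[OF H[OF n]]) (use elim in simp)
      note h = hausdorffD1[OF this]
      show ?case
      proof
        fix \<phi> assume "\<phi> \<in> CS V1 n"
        then obtain f where "f \<in> (\<lambda>\<psi>. \<psi> \<circ> snd) ` CS V2 n" and f: "Dist (LL k) n (\<phi> \<circ> fst) f < ereal \<eta>"
          by (rule h[OF imageI])
        then obtain \<psi> where \<psi>: "\<psi> \<in> CS V2 n" "f = \<psi> \<circ> snd" by (elim imageE)
        from f[unfolded \<psi>(2)] show "\<exists>\<psi>\<in>CS V2 n. \<forall>r a b x. r \<ge> 1 \<longrightarrow>
            a \<in> mats r r \<longrightarrow> b \<in> mats r r \<longrightarrow> LL k r (mpair a b) \<le> 1 \<longrightarrow>
            cmod (sform r n \<psi> b x x - sform r n \<phi> a x x) \<le> \<eta> * (vnorm2 r n x)\<^sup>2"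
          by (intro bexI[OF _ \<psi>(1)] allI impI, subst norm_minus_commute) (rule dsum_seminorm.Dist_sform[OF D])
      qed
    qed
  qed (use U ind in \<open>simp_all add: dsum_seminorm.mpair_add[OF D] dsum_seminorm.mpair_mm[OF D] dsum_seminorm.mpair_vadj[OF D]
      dsum_seminorm.seminorm_add[OF D] dsum_seminorm.seminorm_mm[OF D] dsum_seminorm.seminorm_vadj[OF D] mpair_mats
      dsum_seminorm.induced_le[OF D] dsum_seminorm.induced_le2[OF D] dsum_seminorm.induced_lift[OF D] dsum_seminorm.induced_lift2[OF D]\<close>)
qed

text \<open>The relation is single-valued and total in both directions, the second one by the
  swapped bridge, which also turns preservation of cones into an equivalence and the estimate for
  \<open>Lc\<close> into an equality.\<close>

lemma bridge_isometry:
  assumes "bridge V1 L1 W1 \<iota>1 V2 L2 W2 \<iota>2 N U"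
  shows "\<exists>\<Phi>. complete_isometry V1 L1 W1 \<iota>1 V2 L2 W2 \<iota>2 \<Phi>"
proof -
  interpret F: bridge V1 L1 W1 \<iota>1 V2 L2 W2 \<iota>2 N U by fact
  interpret S: bridge V2 L2 W2 \<iota>2 V1 L1 W1 \<iota>1 "\<lambda>k n b a. N k n a b" U by (rule bridge_swap[OF assms])
  have swap: "S.rel z w \<longleftrightarrow> F.rel w z" for w z unfolding S.rel_def F.rel_def by blast
  define \<Phi> where "\<Phi> w = (THE z. F.rel w z)" for w
  have \<Phi>_eq: "\<Phi> w = z" if "F.rel w z" for w z
    unfolding \<Phi>_def using that F.rel_unique by (intro the_equality) auto
  have \<Phi>_rel: "F.rel w (\<Phi> w)" if w: "w \<in> Vc V1 L1 W1 \<iota>1" for w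
  proof -
    obtain z where z: "F.rel w z" using F.rel_total[OF w] by blast
    then show ?thesis by (simp only: \<Phi>_eq[OF z])
  qed
  have rel0: "F.rel 0 0" using F.rel_sm[OF F.rel_unit, of 0] by simp
  have ent: "F.rel (A i j) (mmap \<Phi> A i j)" if "\<forall>i j. A i j \<in> Vc V1 L1 W1 \<iota>1" for A i j
    using \<Phi>_rel that by (simp add: mmap_def)
  \<comment> \<open>Since 0 is related to 0, the map sends 0 to 0 and keeps the padding outside the
    n-by-n corner.\<close>
  have m: "mmap \<Phi> A \<in> mats n n" if "A \<in> mats n n" for A n
    using that \<Phi>_eq[OF rel0] by (auto simp: mats_def mmap_def)
  have "complete_isometry V1 L1 W1 \<iota>1 V2 L2 W2 \<iota>2 \<Phi>"
    unfolding complete_isometry_def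
  proof (intro conjI ballI allI impI)
    show "bij_betw \<Phi> (Vc V1 L1 W1 \<iota>1) (Vc V2 L2 W2 \<iota>2)"
      unfolding bij_betw_def
    proof
      show "inj_on \<Phi> (Vc V1 L1 W1 \<iota>1)"
      proof (rule inj_onI)
        fix x y assume xy: "x \<in> Vc V1 L1 W1 \<iota>1" "y \<in> Vc V1 L1 W1 \<iota>1" "\<Phi> x = \<Phi> y"
        have "S.rel (\<Phi> x) x" "S.rel (\<Phi> x) y"
          using \<Phi>_rel[OF xy(1)] \<Phi>_rel[OF xy(2)] xy(3) by (simp_all add: swap)
        then show "x = y" by (rule S.rel_unique)
      qed
      show "\<Phi> ` Vc V1 L1 W1 \<iota>1 = Vc V2 L2 W2 \<iota>2"
      proof (intro equalityI subsetI)
        fix z assume "z \<in> \<Phi> ` Vc V1 L1 W1 \<iota>1"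
        then obtain w where w: "w \<in> Vc V1 L1 W1 \<iota>1" "z = \<Phi> w" by blast
        then have "S.rel z w" using \<Phi>_rel by (simp add: swap)
        then show "z \<in> Vc V2 L2 W2 \<iota>2" by (rule S.rel_Vc)
      next
        fix z assume "z \<in> Vc V2 L2 W2 \<iota>2"
        then obtain w where "S.rel z w" using S.rel_total by blast
        then have w: "F.rel w z" by (simp add: swap)
        then show "z \<in> \<Phi> ` Vc V1 L1 W1 \<iota>1" using F.rel_Vc[OF w] \<Phi>_eq[OF w] by blast
      qed
    qed
    show "\<Phi> (x + y) = \<Phi> x + \<Phi> y" if "x \<in> Vc V1 L1 W1 \<iota>1" "y \<in> Vc V1 L1 W1 \<iota>1" for x y
      by (intro \<Phi>_eq F.rel_add \<Phi>_rel that)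
    show "\<Phi> (msmul W1 c x) = msmul W2 c (\<Phi> x)" if "x \<in> Vc V1 L1 W1 \<iota>1" for c x
      by (intro \<Phi>_eq F.rel_sm \<Phi>_rel that)
    show "\<Phi> (munit W1) = munit W2" by (rule \<Phi>_eq[OF F.rel_unit])
  next
    fix n :: nat and A assume n: "1 \<le> n" and A: "A \<in> mats n n" "\<forall>i j. A i j \<in> Vc V1 L1 W1 \<iota>1"
    show "A \<in> mcone W1 n \<longleftrightarrow> mmap \<Phi> A \<in> mcone W2 n"
    proof
      assume "A \<in> mcone W1 n"
      then show "mmap \<Phi> A \<in> mcone W2 n" by (rule F.rel_pos[OF n _ m[OF A(1)]]) (rule ent[OF A(2)])
    next
      assume "mmap \<Phi> A \<in> mcone W2 n"
      then show "A \<in> mcone W1 n" by (rule S.rel_pos[OF n _ A(1)]) (simp only: swap ent[OF A(2)])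
    qed
    show "Lc V1 L1 W1 \<iota>1 n A = Lc V2 L2 W2 \<iota>2 n (mmap \<Phi> A)"
    proof (rule antisym)
      show "Lc V1 L1 W1 \<iota>1 n A \<le> Lc V2 L2 W2 \<iota>2 n (mmap \<Phi> A)"
        by (rule S.Lc_transfer[OF n m[OF A(1)] A(1)]) (simp only: swap ent[OF A(2)])
      show "Lc V2 L2 W2 \<iota>2 n (mmap \<Phi> A) \<le> Lc V1 L1 W1 \<iota>1 n A"
        by (rule F.Lc_transfer[OF n A(1) m[OF A(1)]]) (rule ent[OF A(2)])
    qed
  qed
  then show ?thesis by blast
qed

text \<open>If the order unit is zero, the space is trivial and has no matrix states, and \<open>mnorm\<close> is the
  unspecified value \<open>Inf UNIV\<close>, which the density axiom for the completion forces to be at most zero.\<close>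

lemma Lc_trivial:
  fixes V :: "('v::ab_group_add) mous" and W :: "('w::ab_group_add) mous"
  assumes V: "mou_space V" and W: "mou_completion V W \<iota>" and e: "munit V = 0"
  shows "munit W = 0" "n \<ge> 1 \<Longrightarrow> Lc V L W \<iota> n A = Inf {ereal t | t. t > 0}"
proof -
  note W' = W[unfolded mou_completion_def]
  have mW: "mou_space W" by (rule W'[THEN conjunct1])
  have add: "\<forall>x y. \<iota> (x + y) = \<iota> x + \<iota> y" by (rule W'[THEN conjunct2, THEN conjunct1])
  have "\<iota> (munit V) = munit W" by (rule W'[THEN conjunct2, THEN conjunct2, THEN conjunct2, THEN conjunct1])
  then have unit: "\<iota> 0 = munit W" by (simp only: e)
  have "\<iota> (0 + 0) = \<iota> 0 + \<iota> 0" by (rule add[rule_format])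
  then show eW: "munit W = 0" using unit by simp
  note mW = mou.intro[OF mW]
  have z: "w = 0" for w :: 'w by (rule cone_trivial[OF mW eW])
  have Z: "X = 0" for X :: "nat \<Rightarrow> nat \<Rightarrow> 'w" by (intro ext) (simp add: z)
  have cone: "X \<in> mcone W k" for X k by (subst Z[of X]) (rule mou.cone_0[OF mW])
  have mnorm: "mnorm W n X = Inf UNIV" for n X
    unfolding mnorm_def by (intro arg_cong[where f = Inf] equalityI subsetI CollectI UNIV_I cone)
  have dense: "\<forall>w e. e > 0 \<longrightarrow> (\<exists>v. mnorm W 1 (one_one (w - \<iota> v)) < e)"
    using W' by (elim conjE)
  have small: "Inf (UNIV :: real set) < r" if "r > 0" for r
    using dense that unfolding mnorm by simp
  show "Lc V L W \<iota> n A = Inf {ereal t | t. t > 0}" if n: "n \<ge> 1"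
  proof -
    have CS: "CS V r = {}" if "r \<ge> 1" for r using CS_nontrivial[OF that] e by blast
    have "LD V L n a \<le> 1" for a unfolding LD_def by (intro Sup_least) (auto simp: CS)
    then have "0 \<in> Bbar V L W \<iota> n"
      unfolding Bbar_def mnorm by (intro CollectI conjI allI impI bexI[of _ 0] small mats_0)
    then have "\<exists>c\<in>Bbar V L W \<iota> n. A = mmap (msmul W (complex_of_real t)) c" for t
      by (rule bexI[rotated]) (rule trans[OF Z Z[symmetric]])
    then show ?thesis unfolding Lc_def by (simp only: HOL.simp_thms)
  qed
qed

text \<open>Both completions are singletons and both seminorms equal the same infimum over all
  positive reals. The case is separate because \<open>completion\<close> assumes a nonzero
  unit.\<close>

lemma trivial_isometry:
  fixes V1 :: "('a::ab_group_add) mous" and V2 :: "('b::ab_group_add) mous"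
    and W1 :: "('c::ab_group_add) mous" and W2 :: "('d::ab_group_add) mous"
  assumes V: "mou_space V1" "mou_space V2" and W: "mou_completion V1 W1 \<iota>1" "mou_completion V2 W2 \<iota>2"
    and e: "munit V1 = 0" "munit V2 = 0"
  shows "complete_isometry V1 L1 W1 \<iota>1 V2 L2 W2 \<iota>2 (\<lambda>_. 0)"
proof -
  note L = Lc_trivial(2)[OF V(1) W(1) e(1)] Lc_trivial(2)[OF V(2) W(2) e(2)]
  have m: "mou W1" "mou W2" by (rule mou.intro[OF W(1)[unfolded mou_completion_def, THEN conjunct1]])
      (rule mou.intro[OF W(2)[unfolded mou_completion_def, THEN conjunct1]])
  have z1: "x = 0" for x :: 'c by (rule cone_trivial[OF m(1) Lc_trivial(1)[OF V(1) W(1) e(1)]])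
  have z2: "y = 0" for y :: 'd by (rule cone_trivial[OF m(2) Lc_trivial(1)[OF V(2) W(2) e(2)]])
  have Z1: "X = 0" for X :: "nat \<Rightarrow> nat \<Rightarrow> 'c" by (intro ext) (simp add: z1)
  have Z2: "Y = 0" for Y :: "nat \<Rightarrow> nat \<Rightarrow> 'd" by (intro ext) (simp add: z2)
  have "Inf {ereal t | t. t > 0} \<le> ereal 1" by (intro Inf_lower) auto
  then have fin: "Inf {ereal t | t. t > 0} < \<infinity>" by auto
  have Vc: "Vc V1 L1 W1 \<iota>1 = UNIV" "Vc V2 L2 W2 \<iota>2 = UNIV"
    unfolding Vc_def L[OF order_refl] using fin by simp_all
  have c: "A \<in> mcone W1 n" "B \<in> mcone W2 n" for A B n
    by (subst Z1[of A], rule mou.cone_0[OF m(1)]) (subst Z2[of B], rule mou.cone_0[OF m(2)])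
  have bij: "bij_betw (\<lambda>_. 0) (UNIV :: 'c set) (UNIV :: 'd set)"
    by (rule bij_betw_byWitness[where f' = "\<lambda>_. 0"]) (intro ballI z1[symmetric] z2[symmetric] subset_UNIV)+
  show ?thesis
    unfolding complete_isometry_def Vc
  proof (intro conjI ballI allI impI)
    show "Lc V1 L1 W1 \<iota>1 n A = Lc V2 L2 W2 \<iota>2 n (mmap (\<lambda>_. 0) A)" if "1 \<le> n" for n A
      unfolding L(1)[OF that] L(2)[OF that] ..
  qed (simp_all add: c bij trans[OF z2 z2[symmetric]])
qed

theorem theorem5p6:
  fixes V1 :: "('a::ab_group_add) mous" and L1 :: "nat \<Rightarrow> 'a mtx \<Rightarrow> real"
    and V2 :: "('b::ab_group_add) mous" and L2 :: "nat \<Rightarrow> 'b mtx \<Rightarrow> real"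
    and W1 :: "('c::ab_group_add) mous" and \<iota>1 :: "'a \<Rightarrow> 'c"
    and W2 :: "('d::ab_group_add) mous" and \<iota>2 :: "'b \<Rightarrow> 'd"
  assumes "qms V1 L1" and "qms V2 L2"
    and "mou_completion V1 W1 \<iota>1" and "mou_completion V2 W2 \<iota>2"
    and "distNC V1 L1 V2 L2 = 0"
  shows "\<exists>\<Phi>. complete_isometry V1 L1 W1 \<iota>1 V2 L2 W2 \<iota>2 \<Phi>"
proof -
  have ex: "\<exists>L. L \<in> Mset V1 L1 V2 L2 \<and> (\<forall>n\<ge>1. hausdorff (Dist L n) ((\<lambda>\<phi>. \<phi> \<circ> fst) ` CS V1 n) ((\<lambda>\<psi>. \<psi> \<circ> snd) ` CS V2 n)
      < ereal ((real n)\<^sup>2 / real (Suc k)))" for k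
  proof -
    have "distNC V1 L1 V2 L2 < ereal (1 / real (Suc k))" using assms(5) by simp
    then obtain L where L: "L \<in> Mset V1 L1 V2 L2" and S: "(SUP n\<in>{1::nat..}. ereal (1 / (real n)^2) *
      hausdorff (Dist L n) ((\<lambda>phi. phi \<circ> fst) ` CS V1 n) ((\<lambda>psi. psi \<circ> snd) ` CS V2 n)) < ereal (1 / real (Suc k))"
      unfolding distNC_def INF_less_iff by blast
    have "hausdorff (Dist L n) ((\<lambda>\<phi>. \<phi> \<circ> fst) ` CS V1 n) ((\<lambda>\<psi>. \<psi> \<circ> snd) ` CS V2 n) < ereal ((real n)\<^sup>2 / real (Suc k))"
      (is "?h < _") if n: "n \<ge> 1" for n
    proof -
      have "ereal (1 / (real n)^2) * ?h \<le> (SUP n\<in>{1::nat..}. ereal (1 / (real n)^2) *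
        hausdorff (Dist L n) ((\<lambda>phi. phi \<circ> fst) ` CS V1 n) ((\<lambda>psi. psi \<circ> snd) ` CS V2 n))"
        using n by (intro SUP_upper2[of n]) auto
      then have *: "ereal (1 / (real n)^2) * ?h < ereal (1 / real (Suc k))" using S by (rule order_le_less_trans)
      show ?thesis
      proof (cases ?h)
        case (real h)
        then have "1 / (real n)^2 * h < 1 / real (Suc k)" using * by simp
        then have "h < (real n)\<^sup>2 / real (Suc k)" using n by (simp add: field_simps)
        then show ?thesis using real by simp
      next
        \<comment> \<open>An infinite distance would stay infinite after multiplication with the
          positive weight.\<close>
        case PInf
        then show ?thesis using * n by simp
      next
        case MInf
        then show ?thesis by simp
      qed
    qed
    then show ?thesis using L by blast
  qed
  have "\<forall>k. \<exists>L. L \<in> Mset V1 L1 V2 L2 \<and> (\<forall>n\<ge>1. hausdorff (Dist (L) n) ((\<lambda>\<phi>. \<phi> \<circ> fst) ` CS V1 n) ((\<lambda>\<psi>. \<psi> \<circ> snd) ` CS V2 n)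
      < ereal ((real n)\<^sup>2 / real (Suc k)))"
    by (intro allI ex)
  from choice[OF this] obtain LL where LL: "\<forall>k. LL k \<in> Mset V1 L1 V2 L2 \<and> (\<forall>n\<ge>1. hausdorff (Dist (LL k) n) ((\<lambda>\<phi>. \<phi> \<circ> fst) ` CS V1 n) ((\<lambda>\<psi>. \<psi> \<circ> snd) ` CS V2 n)
      < ereal ((real n)\<^sup>2 / real (Suc k)))"
    by (elim exE)
  have M: "LL k \<in> Mset V1 L1 V2 L2" for k by (rule LL[THEN spec, THEN conjunct1])
  have H: "hausdorff (Dist (LL k) n) ((\<lambda>\<phi>. \<phi> \<circ> fst) ` CS V1 n) ((\<lambda>\<psi>. \<psi> \<circ> snd) ` CS V2 n)
      < ereal ((real n)\<^sup>2 / real (Suc k))" if "n \<ge> 1" for k n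
    by (rule LL[THEN spec, THEN conjunct2, THEN spec, THEN mp, OF that])
  have V: "mou_space V1" "mou_space V2" using assms(1,2) by (simp_all add: qms_def)
  \<comment> \<open>A nonzero unit provides states and a zero unit excludes them. The finite bound
    on the Hausdorff distance gives every state on one side a partner on the other, so either both
    units vanish or neither does.\<close>
  have iff: "munit V1 = 0 \<longleftrightarrow> munit V2 = 0"
  proof (rule iffI; rule ccontr)
    assume "munit V1 = 0" "munit V2 \<noteq> 0"
    then obtain \<psi> where "\<psi> \<in> CS V2 1" using mou.state_exists[OF mou.intro[OF V(2)]] by blast
    then obtain \<phi> where "\<phi> \<in> (\<lambda>\<phi>. \<phi> \<circ> fst) ` CS V1 1" using hausdorffD2[OF H[of 1 0]] by blast
    then obtain \<phi>' where "\<phi>' \<in> CS V1 1" by blast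
    then show False using CS_nontrivial[OF order_refl] \<open>munit V1 = 0\<close> by blast
  next
    assume "munit V2 = 0" "munit V1 \<noteq> 0"
    then obtain \<phi> where "\<phi> \<in> CS V1 1" using mou.state_exists[OF mou.intro[OF V(1)]] by blast
    then obtain \<psi> where "\<psi> \<in> (\<lambda>\<psi>. \<psi> \<circ> snd) ` CS V2 1" using hausdorffD1[OF H[of 1 0]] by blast
    then obtain \<psi>' where "\<psi>' \<in> CS V2 1" by blast
    then show False using CS_nontrivial[OF order_refl] \<open>munit V2 = 0\<close> by blast
  qed
  show ?thesis
  proof (cases "munit V1 = 0")
    case True
    then show ?thesis using trivial_isometry[OF V assms(3,4)] iff by blast
  next
    case False
    obtain U :: "nat filter" where U: "U \<le> sequentially" "ultra U"
      using ultrafilter_below[OF sequentially_bot] by blast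
    have "bridge V1 L1 W1 \<iota>1 V2 L2 W2 \<iota>2 (\<lambda>k n a b. LL k n (mpair a b)) U"
      using False iff by (intro bridge_of_distance[OF completionI completionI U(2,1) M H] assms) auto
    then show ?thesis by (rule bridge_isometry)
  qed
qed

end
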